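(* Let $n\ge 4$ and let $\Omega$ be the open unit ball of $\mathbb{R}^n$. Set $l=n/2$ and $p^*(n)=2\frac{n+2}{n-2}$ if $n$ is even, and $l=[n/2]+1$ and $p^*(n)=2\frac{[n/2]+2}{[n/2]}$ if $n$ is odd. Let $f:\mathbb{R}\to\mathbb{R}$ satisfy: (f1) $f$ is locally Hölder continuous, $f(z)\ge 0$ for all $z>0$, $f(z)=o(z)$ as $z\to 0$, $\lim_{z\to+\infty} f(z)/z=+\infty$, and $f(z)=0$ for all $z\le 0$; (f2) there are $C>0$ and $p$ with $2<p<p^*(n)$ such that $|f(z)|\le C(1+|z|)^{p-1}$ for all $z\in\mathbb{R}$; (f3) there exists $q>2$ such that $qF(t)\le t f(t)$ for all $t\in\mathbb{R}$, where $F(t)=\int_0^t f(s)\,ds$; (f4) there exist $\mu_1,\mu_2>2$ such that $f(tv)\ge t^{\mu_1-1}f(v)$ for all $t\in[0,1]$ and $v\ge 0$, and $f(tv)\ge t^{\mu_2-1}g(v)$ for all $t\ge 1$ and $v\ge 0$, where $g$ is a non-negative continuous function on $\mathbb{R}$ with $g(0)=0$, and $$4\,\frac{\mu_1-\mu_2}{(\mu_1-2)(\mu_2-2)}<n-l.$$ Then for all sufficiently large $\alpha>0$ the problem $$-\Delta u=|x|^{\alpha}f(u)\ \text{ in }\Omega,\qquad u=0\ \text{ on }\partial\Omega$$ admits a non-radial solution $u$, which is also non-negative.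
   Context: $[s]$ denotes the integer part of $s$. A solution is understood in the variational (weak) sense: $u\in H_0^1(\Omega)$ with $\int_\Omega \nabla u\cdot\nabla\varphi\,dx=\int_\Omega |x|^\alpha f(u)\varphi\,dx$ for all $\varphi\in C_0^\infty(\Omega)$. A function $u$ is radial if $u(x)=u(|x|)$, i.e. it depends (a.e.) only on $|x|$; otherwise it is non-radial. *)

theory Defs
  imports "HOL-Analysis.Analysis" "HOL-Library.Landau_Symbols"
begin

text \<open>
  All Lebesgue integrals over \<open>\<Omega>\<close> are taken with respect to \<^term>\<open>lebesgue_on \<Omega>\<close>. Elements of
  Lebesgue and Sobolev spaces are represented by functions on the whole space whose values outside
  \<open>\<Omega>\<close> are irrelevant. No quotient by a.e. equality is formed; instead, the Sobolev-space
  notions, weak solutions and radiality are invariant under a.e. changes on \<open>\<Omega>\<close>.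
\<close>

subsection \<open>Test functions\<close>

definition partial_deriv :: "'a \<Rightarrow> ('a::euclidean_space \<Rightarrow> real) \<Rightarrow> 'a \<Rightarrow> real" where
  "partial_deriv b \<phi> x = frechet_derivative \<phi> (at x) b"

definition gradient :: "('a::euclidean_space \<Rightarrow> real) \<Rightarrow> 'a \<Rightarrow> 'a" where
  "gradient \<phi> x = (\<Sum>b\<in>Basis. partial_deriv b \<phi> x *\<^sub>R b)"

primrec C_k :: "nat \<Rightarrow> ('a::euclidean_space \<Rightarrow> real) \<Rightarrow> bool" where
  "C_k 0 \<phi> \<longleftrightarrow> continuous_on UNIV \<phi>"
| "C_k (Suc k) \<phi> \<longleftrightarrow> \<phi> differentiable_on UNIV \<and> (\<forall>b\<in>Basis. C_k k (partial_deriv b \<phi>))"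

text \<open>\<open>C\<^sub>0\<^sup>\<infinity>(\<Omega>)\<close>, each element being extended by zero to the whole space.\<close>

definition test_functions :: "'a::euclidean_space set \<Rightarrow> ('a \<Rightarrow> real) set" where
  "test_functions \<Omega> =
     {\<phi>. (\<forall>k. C_k k \<phi>) \<and> compact (closure {x. \<phi> x \<noteq> 0}) \<and> closure {x. \<phi> x \<noteq> 0} \<subseteq> \<Omega>}"


subsection \<open>Sobolev spaces\<close>

definition L2 :: "'a::euclidean_space set \<Rightarrow> ('a \<Rightarrow> 'b::euclidean_space) set" where
  "L2 \<Omega> = {v. v \<in> borel_measurable (lebesgue_on \<Omega>) \<and>
              integrable (lebesgue_on \<Omega>) (\<lambda>x. (norm (v x))\<^sup>2)}"

definition L1_loc :: "'a::euclidean_space set \<Rightarrow> ('a \<Rightarrow> 'b::euclidean_space) set" where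
  "L1_loc \<Omega> = {v. \<forall>K. compact K \<and> K \<subseteq> \<Omega> \<longrightarrow> integrable (lebesgue_on K) v}"

definition has_weak_gradient ::
    "'a::euclidean_space set \<Rightarrow> ('a \<Rightarrow> real) \<Rightarrow> ('a \<Rightarrow> 'a) \<Rightarrow> bool" where
  "has_weak_gradient \<Omega> u G \<longleftrightarrow> u \<in> L1_loc \<Omega> \<and> G \<in> L1_loc \<Omega> \<and>
     (\<forall>\<phi>\<in>test_functions \<Omega>. \<forall>b\<in>Basis.
        (\<integral>x. u x * partial_deriv b \<phi> x \<partial>lebesgue_on \<Omega>) =
        - (\<integral>x. (G x \<bullet> b) * \<phi> x \<partial>lebesgue_on \<Omega>))"

text \<open>
  On an open set a weak gradient is unique up to null sets, so the choice is harmless: only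
  measurability and integrals over \<open>\<Omega>\<close> of the value below are ever considered.
\<close>

definition weak_gradient :: "'a::euclidean_space set \<Rightarrow> ('a \<Rightarrow> real) \<Rightarrow> 'a \<Rightarrow> 'a" where
  "weak_gradient \<Omega> u = (SOME G. has_weak_gradient \<Omega> u G)"

definition H1 :: "'a::euclidean_space set \<Rightarrow> ('a \<Rightarrow> real) set" where
  "H1 \<Omega> = {u \<in> L2 \<Omega>. (\<exists>G. has_weak_gradient \<Omega> u G) \<and> weak_gradient \<Omega> u \<in> L2 \<Omega>}"

text \<open>\<open>H\<^sub>0\<^sup>1(\<Omega>)\<close> is the closure of \<open>C\<^sub>0\<^sup>\<infinity>(\<Omega>)\<close> in the norm of \<open>H\<^sup>1(\<Omega>)\<close>.\<close>

definition H1_0 :: "'a::euclidean_space set \<Rightarrow> ('a \<Rightarrow> real) set" where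
  "H1_0 \<Omega> = {u \<in> H1 \<Omega>. \<exists>\<phi>. (\<forall>k::nat. \<phi> k \<in> test_functions \<Omega>) \<and>
     (\<lambda>k. (\<integral>x. (\<phi> k x - u x)\<^sup>2 \<partial>lebesgue_on \<Omega>) +
          (\<integral>x. (norm (gradient (\<phi> k) x - weak_gradient \<Omega> u x))\<^sup>2 \<partial>lebesgue_on \<Omega>))
       \<longlonglongrightarrow> 0}"


subsection \<open>The boundary value problem\<close>

text \<open>
  Weak solutions of \<open>-\<Delta>u = |x|\<^sup>\<alpha> f(u)\<close> in \<open>\<Omega>\<close>, \<open>u = 0\<close> on \<open>\<partial>\<Omega>\<close>. For supercritical \<open>f\<close> membership in
  \<open>H\<^sub>0\<^sup>1(\<Omega>)\<close> does not make the right-hand integrand integrable, and the Bochner integral of a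
  non-integrable function is 0; integrability is therefore required explicitly.
\<close>

definition weak_solution ::
    "'a::euclidean_space set \<Rightarrow> real \<Rightarrow> (real \<Rightarrow> real) \<Rightarrow> ('a \<Rightarrow> real) \<Rightarrow> bool" where
  "weak_solution \<Omega> \<alpha> f u \<longleftrightarrow> u \<in> H1_0 \<Omega> \<and>
     (\<forall>\<phi>\<in>test_functions \<Omega>.
        integrable (lebesgue_on \<Omega>) (\<lambda>x. norm x powr \<alpha> * f (u x) * \<phi> x) \<and>
        (\<integral>x. weak_gradient \<Omega> u x \<bullet> gradient \<phi> x \<partial>lebesgue_on \<Omega>) =
        (\<integral>x. norm x powr \<alpha> * f (u x) * \<phi> x \<partial>lebesgue_on \<Omega>))"

definition radial_on :: "'a::euclidean_space set \<Rightarrow> ('a \<Rightarrow> real) \<Rightarrow> bool" where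
  "radial_on \<Omega> u \<longleftrightarrow> (\<exists>h. AE x in lebesgue_on \<Omega>. u x = h (norm x))"


subsection \<open>The nonlinearity and the exponents\<close>

definition locally_Hoelder :: "(real \<Rightarrow> real) \<Rightarrow> bool" where
  "locally_Hoelder f \<longleftrightarrow>
     (\<forall>z. \<exists>\<delta>>0. \<exists>\<gamma>. 0 < \<gamma> \<and> \<gamma> \<le> 1 \<and>
        (\<exists>C. \<forall>x\<in>ball z \<delta>. \<forall>y\<in>ball z \<delta>. \<bar>f x - f y\<bar> \<le> C * \<bar>x - y\<bar> powr \<gamma>))"

text \<open>The interval integral is signed, so that \<open>F(t) = -\<integral>\<^sub>t\<^sup>0 f\<close> for \<open>t < 0\<close>.\<close>

definition primitive :: "(real \<Rightarrow> real) \<Rightarrow> real \<Rightarrow> real" where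
  "primitive f t = (LBINT s=ereal 0..ereal t. f s)"

definition l_of :: "nat \<Rightarrow> nat" where
  "l_of n = (if even n then n div 2 else n div 2 + 1)"

definition p_star :: "nat \<Rightarrow> real" where
  "p_star n = (if even n then 2 * ((real n + 2) / (real n - 2))
               else 2 * ((real (n div 2) + 2) / real (n div 2)))"

end

(* Split R^n into coordinate blocks of dimensions l and n - l, and look for a mountain pass among the
 functions u(|x_1|, |x_2|) that are radial in each block. On such functions the Dirichlet energy lives
 on the unit square with the weight r^(l-1) s^(n-l-1). For large alpha the factor |x|^alpha tames the
 corner, and what remains is a weighted Sobolev inequality that is compact for p < p^*(n).
 Palais-Smale sequences of smooth block-radial test functions therefore converge strongly. The limit u
 solves the equation against block-radial test functions, and hence against all of them: the functional
 is invariant under rotations of the blocks, and every test function has, in the C^1 closure of the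
 convex hull of its rotations, a block-radial one.
 Let Theta be the Dirichlet energy of u, k = n - l, and c the mountain pass level, so that c is
 comparable with Theta. If u were radial, its pointwise decay would give F(A) >= const alpha Theta for
 A^2 = Theta / alpha. Bumps supported in a tube of radius 1 / alpha around a sphere S^(l-1) close to
 the boundary then show c <= const Theta / alpha^k, which is absurd for large alpha. *)
theory Submission
 imports Defs "HOL-Library.Function_Algebras" "HOL-Library.Diagonal_Subsequence"
begin

text \<open>The exponent \<open>p\<close> may exceed the critical exponent of H_0^1 in dimension n,
  so the functional need not be finite on H_0^1. The variational argument therefore stays on smooth
  functions with the Dirichlet norm, an incomplete space, and a limit is formed only once a
  Palais-Smale sequence is at hand. The bound p^*(n) = 2 + 4 / (l - 1) is the Sobolev exponent of
  dimension l + 1: near a point where one block vanishes and the other does not, a block-radial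
  function sees at most the l variables of the vanishing block and one radius of the other. Since f
  is not homogeneous, the radial energy and the bump level cannot be compared by scaling; both are
  measured against the single number F(A), and the two growth exponents of F carry this number to
  other arguments. The powers of \<alpha> originate in the boundary condition: the weight lives
  within distance of order 1 / \<alpha> of the boundary, where a radial function of given energy
  must be small, while a bump that is concentrated in the second block as well costs little
  energy.\<close>

notation (input) LIMSEQ ("(_)/ ----> (_)" [60, 60] 60)

section \<open>Calculus of functions of class C^k\<close>

lemma partial_deriv_eqI:
 assumes "(\<phi> has_derivative \<phi>') (at x)"
 shows "partial_deriv b \<phi> x = \<phi>' b"
 unfolding partial_deriv_def using frechet_derivative_at[OF assms] by simp

lemma differentiable_on_UNIV_D: "\<phi> differentiable_on UNIV ==> \<phi> differentiable (at x)"
 by (simp add: differentiable_on_def)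

lemma frechet_works: "\<phi> differentiable_on UNIV ==> (\<phi> has_derivative frechet_derivative \<phi> (at x)) (at x)"
 using differentiable_on_UNIV_D frechet_derivative_works by blast

lemma C_k_Suc_D: "C_k (Suc k) \<phi> ==> C_k k \<phi>"
proof (induction k arbitrary: \<phi>)
 case 0
 then show ?case by (simp add: differentiable_imp_continuous_on)
next
 case (Suc k)
 have "\<phi> differentiable_on UNIV" "ALL b:Basis. C_k (Suc k) (partial_deriv b \<phi>)"
  using Suc.prems C_k.simps(2)[of "Suc k" \<phi>] by blast+
 then show ?case using Suc.IH C_k.simps(2)[of k \<phi>] by blast
qed

lemma C_k_const: "C_k k (%x. c)"
proof (induction k arbitrary: c)
 case (Suc k)
 have "partial_deriv b (%x::'a. c) = (%x. 0)" for b
  by (rule ext, rule partial_deriv_eqI[where \<phi>'="%h. 0", simplified]) simp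
 then show ?case using Suc by (simp add: differentiable_on_def)
qed simp

lemma C_k_inner: "C_k k (%x. x \<bullet> a)"
proof (cases k)
 case (Suc j)
 have "partial_deriv b (%x. x \<bullet> a) = (%x. b \<bullet> a)" for b
  by (rule ext, rule partial_deriv_eqI) (auto intro!: derivative_eq_intros)
 then show ?thesis using Suc by (simp add: C_k_const differentiable_on_def)
qed (simp add: continuous_intros)

lemma C_k_add:
 "C_k k \<phi> ==> C_k k \<psi> ==> C_k k (%x. \<phi> x + \<psi> x)"
proof (induction k arbitrary: \<phi> \<psi>)
 case (Suc k)
 have "partial_deriv b (%x. \<phi> x + \<psi> x) = (%x. partial_deriv b \<phi> x + partial_deriv b \<psi> x)" for b
  using Suc.prems
  by (intro ext, subst partial_deriv_eqI[OF has_derivative_add[OF frechet_works frechet_works]])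
   (auto simp: partial_deriv_def)
 then show ?case using Suc by simp
qed (simp add: continuous_on_add)

lemma C_k_mult:
 "C_k k \<phi> ==> C_k k \<psi> ==> C_k k (%x. \<phi> x * \<psi> x)"
proof (induction k arbitrary: \<phi> \<psi>)
 case (Suc k)
 have "partial_deriv b (%x. \<phi> x * \<psi> x) = (%x. \<phi> x * partial_deriv b \<psi> x + partial_deriv b \<phi> x * \<psi> x)" for b
  using Suc.prems
  by (intro ext, subst partial_deriv_eqI[OF has_derivative_mult[OF frechet_works frechet_works]])
   (auto simp: partial_deriv_def)
 moreover have "C_k k (%x. \<phi> x * partial_deriv b \<psi> x + partial_deriv b \<phi> x * \<psi> x)" if "b : Basis" for b
  using Suc.prems that C_k_Suc_D[OF Suc.prems(1)] C_k_Suc_D[OF Suc.prems(2)]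
  by (intro C_k_add Suc.IH) auto
 ultimately show ?case using Suc.prems by (simp add: differentiable_on_mult)
qed (simp add: continuous_on_mult)

lemma C_k_cmult: "C_k k \<phi> ==> C_k k (%x. c * \<phi> x)"
 by (intro C_k_mult C_k_const)

lemma C_k_sum: "finite S ==> (!!i. i : S ==> C_k k (\<phi> i)) ==> C_k k (%x. SUM i:S. \<phi> i x)"
 by (induction rule: finite_induct) (auto intro: C_k_const C_k_add)

lemma C_k_prod: "finite S ==> (!!i. i : S ==> C_k k (\<phi> i)) ==> C_k k (%x. PROD i:S. \<phi> i x)"
 by (induction rule: finite_induct) (auto intro: C_k_const C_k_mult)

lemma C_k_power: "C_k k \<phi> ==> C_k k (%x. \<phi> x ^ j)"
 by (induction j) (auto intro: C_k_const C_k_mult)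

text \<open>Differentiating a composition with \<open>h j\<close> brings in
  \<open>h (Suc j)\<close>, so the induction must vary \<open>j\<close> together with
  \<open>\<phi>\<close>.\<close>

lemma C_k_compose_real:
 fixes h :: "nat => real => real"
 assumes "!!j t. (h j has_real_derivative h (Suc j) t) (at t)"
 shows "C_k k \<phi> ==> C_k k (%x. h j (\<phi> x))"
proof (induction k arbitrary: \<phi> j)
 case 0
 have "isCont (h j) t" for t using assms DERIV_isCont by blast
 then have "continuous_on UNIV (h j)" by (simp add: continuous_at_imp_continuous_on)
 then show ?case using 0 continuous_on_compose2[of UNIV "h j" UNIV \<phi>] by simp
next
 case (Suc k)
 have d: "((%x. h j (\<phi> x)) has_derivative (%v. h (Suc j) (\<phi> x) * frechet_derivative \<phi> (at x) v)) (at x)" for x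
  using has_derivative_compose[OF frechet_works[of \<phi> x] assms[unfolded has_field_derivative_def, of j "\<phi> x"]]
   Suc.prems by simp
 have "partial_deriv b (%x. h j (\<phi> x)) = (%x. h (Suc j) (\<phi> x) * partial_deriv b \<phi> x)" for b
  by (intro ext, subst partial_deriv_eqI[OF d]) (simp add: partial_deriv_def)
 moreover have "C_k k (%x. h (Suc j) (\<phi> x) * partial_deriv b \<phi> x)" if "b : Basis" for b
  using Suc.prems that C_k_Suc_D[OF Suc.prems(1)]
  by (intro C_k_mult Suc.IH) auto
 moreover have "(%x. h j (\<phi> x)) differentiable_on UNIV"
  using d unfolding differentiable_on_def differentiable_def by blast
 ultimately show ?case by simp
qed

lemma partial_deriv_linear_compose:
 assumes "linear g" "\<phi> differentiable_on UNIV"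
 shows "partial_deriv b (%x. \<phi> (g x)) = (%x. SUM c:Basis. (g b \<bullet> c) * partial_deriv c \<phi> (g x))"
proof
 fix x
 have d: "((%x. \<phi> (g x)) has_derivative (%v. frechet_derivative \<phi> (at (g x)) (g v))) (at x)"
  using has_derivative_compose[OF linear_imp_has_derivative[OF assms(1)] frechet_works[OF assms(2)], of x] by simp
 have l: "linear (frechet_derivative \<phi> (at (g x)))"
  using frechet_works[OF assms(2)] has_derivative_linear by blast
 have "partial_deriv b (%x. \<phi> (g x)) x = frechet_derivative \<phi> (at (g x)) (SUM c:Basis. (g b \<bullet> c) *\<^sub>R c)"
  by (simp add: partial_deriv_eqI[OF d] euclidean_representation)
 also have "... = (SUM c:Basis. (g b \<bullet> c) * partial_deriv c \<phi> (g x))"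
  by (simp add: linear_sum[OF l] linear_scale[OF l] partial_deriv_def)
 finally show "partial_deriv b (%x. \<phi> (g x)) x = (SUM c:Basis. (g b \<bullet> c) * partial_deriv c \<phi> (g x))" .
qed

lemma C_k_linear_compose:
 assumes "linear g"
 shows "C_k k \<phi> ==> C_k k (%x. \<phi> (g x))"
proof (induction k arbitrary: \<phi>)
 case 0
 have "continuous_on UNIV g" using assms linear_continuous_on linear_conv_bounded_linear by blast
 then show ?case using 0 continuous_on_compose2[of UNIV \<phi> UNIV g] by simp
next
 case (Suc k)
 have "((%x. \<phi> (g x)) has_derivative (%v. frechet_derivative \<phi> (at (g x)) (g v))) (at x)" for x
  using has_derivative_compose[OF linear_imp_has_derivative[OF assms(1)] frechet_works, of \<phi>] Suc.prems by simp
 then have "(%x. \<phi> (g x)) differentiable_on UNIV"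
  unfolding differentiable_on_def differentiable_def by blast
 then show ?case
  using Suc.prems by (auto simp: partial_deriv_linear_compose[OF assms] intro!: C_k_sum C_k_cmult Suc.IH)
qed

subsection \<open>Smooth bump functions\<close>

text \<open>A family that contains the flat function exp (-1/t) and is closed under differentiation;
  the polynomial records the prefactor, so no formula for higher derivatives is ever needed.\<close>

definition ebump :: "real poly => real => real" where
 "ebump p t = (if t > 0 then poly p (1 / t) * exp (- (1 / t)) else 0)"

lemma poly_exp_tendsto_0: "((%y. poly p y * exp (- y)) \<longlongrightarrow> 0) at_top" for p :: "real poly"
proof -
 have "((%y. SUM i<=degree p. coeff p i * (y ^ i / exp y)) \<longlongrightarrow> (SUM i<=degree p. coeff p i * 0)) at_top"
  by (intro tendsto_sum tendsto_mult tendsto_const tendsto_power_div_exp_0)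
 then show ?thesis by (simp add: poly_altdef sum_divide_distrib exp_minus field_simps)
qed

lemma ebump_tendsto_0: "((%t. ebump p t) \<longlongrightarrow> 0) (at 0)"
proof -
 have "((%t. poly p (1 / t) * exp (- (1 / t))) \<longlongrightarrow> 0) (at_right 0)"
  using filterlim_compose[OF poly_exp_tendsto_0 filterlim_inverse_at_top_right] by (simp add: inverse_eq_divide)
 moreover have "eventually (%t. ebump p t = poly p (1 / t) * exp (- (1 / t))) (at_right 0)"
  using eventually_at_right_less[of 0] by eventually_elim (simp add: ebump_def)
 ultimately have "((%t. ebump p t) \<longlongrightarrow> 0) (at_right 0)" by (simp add: tendsto_cong)
 moreover have "eventually (%t. ebump p t = 0) (at_left 0)"
  unfolding eventually_at_filter by (auto simp: ebump_def)
 then have "((%t. ebump p t) \<longlongrightarrow> 0) (at_left 0)" using tendsto_cong by fastforce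
 ultimately show ?thesis by (simp add: filterlim_at_split)
qed

text \<open>The derivative of P(1/t) exp(-1/t) is (P - P')(1/t) exp(-1/t) / t^2, and
  \<open>[:0, 0, 1:]\<close> is the factor 1/t^2 as a polynomial in 1/t.\<close>

definition ebump_step :: "real poly => real poly" where
 "ebump_step p = [:0, 0, 1:] * (p - pderiv p)"

lemma ebump_deriv: "(ebump p has_real_derivative ebump (ebump_step p) t) (at t)"
proof -
 consider "t > 0" | "t < 0" | "t = 0" by linarith
 then show ?thesis
 proof cases
  case 1
  have "((%t. poly p (1 / t) * exp (- (1 / t))) has_real_derivative ebump (ebump_step p) t) (at t)"
   using 1 by (auto intro!: derivative_eq_intros DERIV_chain2[OF poly_DERIV]
     simp: ebump_def ebump_step_def field_simps power2_eq_square)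
  moreover have "eventually (%s. s : {0<..}) (nhds t)" using 1 by (intro eventually_nhds_in_open) auto
  then have "eventually (%s. ebump p s = poly p (1 / s) * exp (- (1 / s))) (nhds t)"
   by eventually_elim (simp add: ebump_def)
  ultimately show ?thesis by (simp add: DERIV_cong_ev)
 next
  case 2
  have "eventually (%s. s : {..<0}) (nhds t)" using 2 by (intro eventually_nhds_in_open) auto
  then have "eventually (%s. ebump p s = 0) (nhds t)" by eventually_elim (simp add: ebump_def)
  then have "(ebump p has_real_derivative 0) (at t)" by (subst DERIV_cong_ev) auto
  then show ?thesis using 2 by (simp add: ebump_def)
 next
  case 3
  \<comment> \<open>At the origin the difference quotient of a member of the family is again a
    member, with one more factor 1/t, and its limit is already known.\<close>
  have "(ebump p s - ebump p 0) / (s - 0) = ebump ([:0, 1:] * p) s" for s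
   by (simp add: ebump_def)
  then show ?thesis
   unfolding 3 has_field_derivative_iff using ebump_tendsto_0[of "[:0, 1:] * p"]
   by (simp add: ebump_def)
 qed
qed

text \<open>A family \<open>h\<close> with \<open>h\<^sub>j' = h\<^sub>j\<^sub>+\<^sub>1\<close> encodes a smooth function \<open>h\<^sub>0\<close> together with its derivatives.\<close>

definition smooth_seq :: "(nat => real => real) => bool" where
 "smooth_seq h \<longleftrightarrow> (ALL j t. (h j has_real_derivative h (Suc j) t) (at t))"

definition smooth :: "('a::euclidean_space => real) => bool" where
 "smooth \<phi> \<longleftrightarrow> (ALL k. C_k k \<phi>)"

lemma smooth_compose_real: "smooth_seq h ==> smooth \<phi> ==> smooth (%x. h 0 (\<phi> x))"
 unfolding smooth_def smooth_seq_def using C_k_compose_real[of h] by blast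

lemma smooth_add: "smooth \<phi> ==> smooth \<psi> ==> smooth (%x. \<phi> x + \<psi> x)"
 and smooth_mult: "smooth \<phi> ==> smooth \<psi> ==> smooth (%x. \<phi> x * \<psi> x)"
 and smooth_cmult: "smooth \<phi> ==> smooth (%x. c * \<phi> x)"
 and smooth_const: "smooth (%x. c)"
 and smooth_inner: "smooth (%x. x \<bullet> a)"
 and smooth_power: "smooth \<phi> ==> smooth (%x. \<phi> x ^ j)"
 and smooth_linear_compose: "linear g ==> smooth \<phi> ==> smooth (%x. \<phi> (g x))"
 and smooth_sum: "finite S ==> (!!i. i : S ==> smooth (\<xi> i)) ==> smooth (%x. SUM i:S. \<xi> i x)"
 and smooth_prod: "finite S ==> (!!i. i : S ==> smooth (\<xi> i)) ==> smooth (%x. PROD i:S. \<xi> i x)"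
 by (auto simp: smooth_def intro: C_k_add C_k_mult C_k_cmult C_k_const C_k_inner C_k_power C_k_linear_compose C_k_sum C_k_prod)

lemma smooth_differentiable: "smooth \<phi> ==> \<phi> differentiable_on UNIV"
 unfolding smooth_def using C_k.simps(2)[of 0 \<phi>] by blast

lemma smooth_partial: "smooth \<phi> ==> b : Basis ==> smooth (partial_deriv b \<phi>)"
 unfolding smooth_def using C_k.simps(2) by blast

lemma smooth_continuous: "smooth \<phi> ==> continuous_on S \<phi>"
 unfolding smooth_def using C_k.simps(1)[of \<phi>] continuous_on_subset by blast

lemma smooth_diff: "smooth \<phi> ==> smooth \<psi> ==> smooth (%x. \<phi> x - \<psi> x)"
 using smooth_add[of \<phi> "%x. (-1) * \<psi> x"] smooth_cmult[of \<psi> "-1"] by simp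

lemma smooth_has_derivative:
 assumes "smooth \<phi>"
 shows "(\<phi> has_derivative (%v. gradient \<phi> x \<bullet> v)) (at x)"
proof -
 note f = frechet_works[OF smooth_differentiable[OF assms], of x]
 have l: "linear (frechet_derivative \<phi> (at x))" using f has_derivative_linear by blast
 have "frechet_derivative \<phi> (at x) v = gradient \<phi> x \<bullet> v" for v
 proof -
  have "frechet_derivative \<phi> (at x) v = frechet_derivative \<phi> (at x) (SUM b:Basis. (v \<bullet> b) *\<^sub>R b)"
   by (simp add: euclidean_representation)
  also have "... = gradient \<phi> x \<bullet> v"
   by (simp add: linear_sum[OF l] linear_scale[OF l] gradient_def inner_sum_left partial_deriv_def)
    (simp add: inner_commute mult.commute)
  finally show ?thesis .
 qed
 then have "frechet_derivative \<phi> (at x) = (%v. gradient \<phi> x \<bullet> v)" by blast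
 then show ?thesis using f by simp
qed

lemma directional_derivative:
 assumes "smooth u"
 shows "((%r. u (y + r *\<^sub>R a)) has_real_derivative gradient u (y + r *\<^sub>R a) \<bullet> a) (at r)"
 unfolding has_field_derivative_def
 by (rule has_derivative_eq_rhs[OF has_derivative_compose[OF _ smooth_has_derivative[OF assms]]])
  (auto intro!: derivative_eq_intros simp: mult.commute)

lemma gradient_inner_Basis: "b : Basis ==> gradient \<phi> x \<bullet> b = partial_deriv b \<phi> x"
 by (simp add: gradient_def inner_sum_left inner_Basis if_distrib cong: if_cong)

lemma gradient_eqI:
 assumes "(\<phi> has_derivative (%v. G \<bullet> v)) (at x)"
 shows "gradient \<phi> x = G"
proof (rule euclidean_eqI)
 fix b :: 'a assume "b : Basis"
 then show "gradient \<phi> x \<bullet> b = G \<bullet> b" using partial_deriv_eqI[OF assms, of b] by (simp add: gradient_inner_Basis)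
qed

lemma smooth_gradient_continuous:
 assumes "smooth \<phi>" shows "continuous_on S (gradient \<phi>)"
 unfolding gradient_def[abs_def]
 by (intro continuous_on_sum continuous_on_scaleR continuous_on_const smooth_continuous smooth_partial assms)

lemma smooth_seq_ebump: "smooth_seq (%j. ebump ((ebump_step ^^ j) 1))"
 unfolding smooth_seq_def using ebump_deriv by simp

definition E :: "real => real" where "E t = (if t > 0 then exp (- (1 / t)) else 0)"

lemma smooth_E: "smooth \<phi> ==> smooth (%x. E (\<phi> x))"
 using smooth_compose_real[OF smooth_seq_ebump, of \<phi>] by (simp add: ebump_def[abs_def] E_def cong: if_cong)

lemma E_bounds: "0 <= E t" "E t < 1" "E t > 0 \<longleftrightarrow> t > 0"
 by (auto simp: E_def)

lemma E_deriv: "(E has_real_derivative (if t > 0 then exp (- (1 / t)) / t^2 else 0)) (at t)"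
proof -
 have "E = ebump 1" by (auto simp: E_def ebump_def)
 then show ?thesis using ebump_deriv[of 1 t]
  by (auto simp: ebump_def ebump_step_def power2_eq_square field_simps cong: if_cong)
qed

text \<open>A slope between 0 and 1 means that composition with \<open>E\<close> does not enlarge
  gradients. This serves both the cut-offs of the bump and the smooth truncation that proves
  nonnegativity.\<close>

lemma E_deriv_bounds:
 fixes t :: real
 assumes "t > 0" shows "0 <= exp (- (1 / t)) / t^2" "exp (- (1 / t)) / t^2 <= 1"
proof -
 have "(1 / t)^2 <= exp (1 / t)"
 proof -
  define y where "y = 1 / t"
  have y: "y > 0" using assms by (simp add: y_def)
  \<comment> \<open>The function y^2 exp(-y) is largest at y = 2. The tangent inequality 1 + x <=
    exp x is therefore used at x = y / 2 - 1 and then squared, which gives the bound 4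
    exp(-2).\<close>
  have "y / 2 <= exp (y / 2 - 1)" using exp_ge_add_one_self[of "y / 2 - 1"] by simp
  then have "(y / 2)^2 <= (exp (y / 2 - 1))^2" using y by (intro power_mono) auto
  also have "... = exp (y - 2)" by (simp add: power2_eq_square exp_add[symmetric] flip: exp_add)
  also have "... = exp y * exp (- 2)" by (simp add: exp_diff exp_minus divide_inverse)
  finally have 1: "y^2 <= 4 * exp (- 2) * exp y" by (simp add: power_divide mult_ac)
  have "(2::real) <= exp 1" using exp_ge_add_one_self[of 1] by simp
  then have "(2::real) * 2 <= exp 1 * exp 1" by (intro mult_mono) auto
  then have "4 * exp (-2::real) <= 1" by (simp add: exp_minus exp_add[symmetric] field_simps)
  then have "4 * exp (-2) * exp y <= 1 * exp y" by (intro mult_right_mono) auto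
  from order_trans[OF 1 this] show ?thesis by (simp add: y_def)
 qed
 then show "exp (- (1 / t)) / t^2 <= 1" using assms by (simp add: exp_minus field_simps)
qed simp

subsection \<open>The fundamental lemma of the calculus of variations\<close>

lemma tendsto_one_minus_power:
 fixes s :: real
 assumes "0 <= s" "s < 1"
 shows "(%j. 1 - (1 - s) ^ j) ----> (if s > 0 then 1 else 0)"
proof (cases "s > 0")
 case True
 then have "(%j. (1 - s) ^ j) ----> 0" using assms by (intro LIMSEQ_power_zero) auto
 from tendsto_diff[OF tendsto_const[of 1] this] show ?thesis using True by simp
qed (use assms in simp)

text \<open>One smooth \<open>\<psi>\<close> with values in [0, 1), positive exactly on the open
  box, is enough: the functions 1 - (1 - \<psi>)^j are smooth, vanish where \<open>\<psi>\<close>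
  does, and tend to the indicator of the box.\<close>

lemma box_test_functions:
 fixes a b :: "'a::euclidean_space"
 assumes "cbox a b \<subseteq> \<Omega>"
 obtains \<phi> :: "nat => 'a => real"
 where "!!j. \<phi> j : test_functions \<Omega>" "!!j x. 0 <= \<phi> j x" "!!j x. \<phi> j x <= 1"
  "!!x. (%j. \<phi> j x) ----> indicator (box a b) x" "!!j x. x ~: box a b ==> \<phi> j x = 0"
proof -
 define \<psi> where "\<psi> x = (PROD i:Basis. E (x \<bullet> i - a \<bullet> i) * E (b \<bullet> i - x \<bullet> i))" for x
 have sm: "smooth \<psi>"
  unfolding \<psi>_def[abs_def]
  by (intro smooth_prod finite_Basis smooth_mult smooth_E smooth_diff smooth_inner smooth_const)
 have nn: "0 <= \<psi> x" for x unfolding \<psi>_def by (intro prod_nonneg) (auto simp: E_bounds)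
 have le: "\<psi> x < 1" for x
 proof -
  obtain i :: 'a where i: "i : Basis" using nonempty_Basis by blast
  have le1: "E (x \<bullet> i - a \<bullet> i) * E (b \<bullet> i - x \<bullet> i) < 1" for i
   using mult_strict_mono'[OF E_bounds(2) E_bounds(2) E_bounds(1) E_bounds(1)] by simp
  have "\<psi> x = (E (x \<bullet> i - a \<bullet> i) * E (b \<bullet> i - x \<bullet> i)) * (PROD i:Basis - {i}. E (x \<bullet> i - a \<bullet> i) * E (b \<bullet> i - x \<bullet> i))"
   unfolding \<psi>_def using prod.remove[OF finite_Basis i] by blast
  also have "... <= (E (x \<bullet> i - a \<bullet> i) * E (b \<bullet> i - x \<bullet> i)) * 1"
   using less_imp_le[OF le1] by (intro mult_left_mono prod_le_1) (auto simp: E_bounds(1))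
  finally show ?thesis using le1[of i] by linarith
 qed
 have pos: "\<psi> x > 0 \<longleftrightarrow> x : box a b" for x
 proof -
  have "\<psi> x ~= 0 \<longleftrightarrow> (ALL i:Basis. E (x \<bullet> i - a \<bullet> i) ~= 0 & E (b \<bullet> i - x \<bullet> i) ~= 0)"
   unfolding \<psi>_def by (simp add: prod_zero_iff)
  also have "... \<longleftrightarrow> x : box a b"
  proof -
   have "E t ~= 0 \<longleftrightarrow> t > 0" for t by (simp add: E_def)
   then show ?thesis by (simp add: mem_box)
  qed
  finally show ?thesis using nn[of x] by linarith
 qed
 define \<phi> where "\<phi> j x = 1 - (1 - \<psi> x) ^ j" for j :: nat and x
 have z: "\<phi> j x = 0" if "x ~: box a b" for j x
 proof -
  have "\<psi> x = 0" using pos[of x] that nn[of x] by linarith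
  then show ?thesis by (simp add: \<phi>_def)
 qed
 show thesis
 proof
  fix j x
  show "0 <= \<phi> j x" "\<phi> j x <= 1" using nn[of x] le[of x] by (auto simp: \<phi>_def power_le_one)
  show "(%j. \<phi> j x) ----> indicator (box a b) x"
   using tendsto_one_minus_power[OF nn le, of x] pos[of x] by (cases "x : box a b") (simp_all add: \<phi>_def)
  have "smooth (\<phi> j)" unfolding \<phi>_def[abs_def] by (intro smooth_diff smooth_const smooth_power sm)
  moreover have cl: "closure {x. \<phi> j x ~= 0} \<subseteq> cbox a b"
   using z box_subset_cbox[of a b] by (intro closure_minimal) auto
  moreover have "compact (closure {x. \<phi> j x ~= 0})"
   using cl bounded_subset[OF bounded_cbox] by (simp add: compact_eq_bounded_closed)
  ultimately show "\<phi> j : test_functions \<Omega>" using assms unfolding test_functions_def smooth_def by auto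
 qed (use z in auto)
qed

text \<open>Open boxes form an intersection-stable generator, so vanishing integrals spread from
  boxes to all Borel sets by a Dynkin argument. The complement step needs the integral over the
  whole space, hence the hypothesis \<open>tot\<close>.\<close>

lemma AE_zero_if_box_integrals_zero:
 fixes g :: "'a::euclidean_space => real"
 assumes g: "integrable lborel g" and z: "!!a b. (LBINT x. indicator (box a b) x * g x) = 0"
  and tot: "(LBINT x. g x) = 0"
 shows "AE x in lborel. g x = 0"
proof (rule sigma_finite_measure.density_zero[OF lborel.sigma_finite_measure_axioms g])
 fix A :: "'a set" assume "A : sets lborel"
 then have A: "A : sigma_sets UNIV (range (%(a, b). box a b))"
  by (simp add: borel_eq_box sets_measure_of)
 have gA: "set_integrable lborel A g" if "A : sets borel" for A
  using integrable_mult_indicator[of A lborel g] g that by (simp add: set_integrable_def)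
 have bs: "A : sets borel" if "A : sigma_sets UNIV (range (%(a, b). box a b))" for A :: "'a set"
  using that by (simp add: borel_eq_box sets_measure_of)
 have "(LINT x:A|lborel. g x) = 0"
 proof (rule sigma_sets_induct_disjoint[OF _ _ A])
  show "Int_stable (range (%(a, b). box a b :: 'a set))"
   by (auto simp: Int_stable_def box_Int_box)
  show "(LINT x:X|lborel. g x) = 0" if "X : range (%(a, b). box a b)" for X
   using that z by (auto simp: set_lebesgue_integral_def)
  show "(LINT x:UNIV - X|lborel. g x) = 0"
   if X: "X : sigma_sets UNIV (range (%(a, b). box a b))" and 0: "(LINT x:X|lborel. g x) = 0" for X :: "'a set"
  proof -
   have "(LINT x:UNIV|lborel. g x) = (LINT x:X|lborel. g x) + (LINT x:UNIV - X|lborel. g x)"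
    using set_integral_Un[of X "UNIV - X" lborel g] gA bs[OF X] by auto
   then show ?thesis using 0 tot by (simp add: set_lebesgue_integral_def)
  qed
  show "(LINT x:(UN i. X i)|lborel. g x) = 0"
   if "disjoint_family X" and "range X \<subseteq> sigma_sets UNIV (range (%(a, b). box a b))"
    and "!!i. (LINT x:X i|lborel. g x) = 0" for X :: "nat => 'a set"
  proof -
   have m: "X i : sets borel" for i using that bs by blast
   have "(LINT x:(UN i. X i)|lborel. g x) = (\<Sum>i. (LINT x:X i|lborel. g x))"
    using m that(1) by (intro lebesgue_integral_countable_add gA) (auto simp: disjoint_family_on_def)
   then show ?thesis using that by simp
  qed
 qed (auto simp: set_lebesgue_integral_def)
 then show "(LINT x:A|lborel. g x) = 0" .
qed

lemma open_countable_Union_box_cbox: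
 fixes \<Omega> :: "'a::euclidean_space set"
 assumes "open \<Omega>"
 obtains \<D> where "countable \<D>" "!!a b. (a, b) : \<D> ==> cbox a b \<subseteq> \<Omega>" "\<Omega> \<subseteq> (\<Union>(a, b)\<in>\<D>. box a b)"
proof -
 define \<C> where "\<C> = {(a, b). cbox a b \<subseteq> \<Omega>}"
 define \<F> where "\<F> = (%(a, b). box a b) ` \<C>"
 have sub: "\<Omega> \<subseteq> \<Union>\<F>"
 proof
  fix x assume "x : \<Omega>"
  with assms obtain a b where "cbox a b \<subseteq> \<Omega>" "x : box a b" by (rule open_contains_cbox)
  then show "x : \<Union>\<F>" by (auto simp: \<F>_def \<C>_def)
 qed
 have "!!S. S : \<F> ==> open S" by (auto simp: \<F>_def)
 then obtain \<F>' where F': "\<F>' \<subseteq> \<F>" "countable \<F>'" "\<Union>\<F>' = \<Union>\<F>"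
  by (rule Lindelof) simp_all
 then have "EX \<D>. countable \<D> & \<D> \<subseteq> \<C> & \<F>' = (%(a, b). box a b) ` \<D>"
  unfolding \<F>_def countable_subset_image[symmetric] by simp
 then obtain \<D> where D: "countable \<D>" "\<D> \<subseteq> \<C>" "\<F>' = (%(a, b). box a b) ` \<D>" by auto
 show thesis
 proof
  show "countable \<D>" by (fact D)
  show "cbox a b \<subseteq> \<Omega>" if "(a, b) : \<D>" for a b using that D(2) by (auto simp: \<C>_def)
  show "\<Omega> \<subseteq> (\<Union>(a, b)\<in>\<D>. box a b)" using sub F'(3) D(3) by simp
 qed
qed

text \<open>Testing with smooth approximations of a box indicator kills the integral of
  \<open>g\<close> over every open box whose closure lies in \<Omega>. Each such box is then treated
  by the Dynkin argument, and countably many of them cover \<Omega>.\<close>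

lemma du_Bois_Reymond:
 fixes g :: "'a::euclidean_space => real"
 assumes \<Omega>: "open \<Omega>" and g: "g : L1_loc \<Omega>"
  and z: "!!\<phi>. \<phi> : test_functions \<Omega> ==> (\<integral>x. g x * \<phi> x \<partial>lebesgue_on \<Omega>) = 0"
 shows "AE x in lebesgue_on \<Omega>. g x = 0"
proof -
 have [measurable]: "\<Omega> : sets lebesgue" using \<Omega> by simp
 have int_box: "integrable lebesgue (%x. indicator (box a b) x * g x)" if "cbox a b \<subseteq> \<Omega>" for a b
 proof -
  have "integrable (lebesgue_on (cbox a b)) g" using g that by (auto simp: L1_loc_def)
  then have "integrable lebesgue (%x. indicator (cbox a b) x *\<^sub>R g x)"
   by (subst (asm) integrable_restrict_space) auto
  then have "integrable lebesgue (%x. indicator (box a b) x *\<^sub>R (indicator (cbox a b) x *\<^sub>R g x))"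
   by (rule integrable_mult_indicator[rotated]) simp
  moreover have "(%x. indicator (box a b) x *\<^sub>R (indicator (cbox a b) x *\<^sub>R g x)) = (%x. indicator (box a b) x * g x)"
   using box_subset_cbox[of a b] by (auto simp: indicator_def fun_eq_iff)
  ultimately show ?thesis by (simp only:)
 qed
 have box0: "(LINT x|lebesgue. indicator (box a b) x * g x) = 0" if ab: "cbox a b \<subseteq> \<Omega>" for a b
 proof -
  obtain \<phi> where \<phi>: "!!j. \<phi> j : test_functions \<Omega>" "!!j x. 0 <= \<phi> j x" "!!j x. \<phi> j x <= (1::real)"
   "!!x. (%j. \<phi> j x) ----> indicator (box a b) x" "!!j x. x ~: box a b ==> \<phi> j x = 0"
   using box_test_functions[OF ab] by metis
  have "\<phi> j : borel_measurable lborel" for j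
   using \<phi>(1)[of j] smooth_continuous[of "\<phi> j" UNIV]
   by (auto simp: test_functions_def smooth_def intro: borel_measurable_continuous_onI)
  then have [measurable]: "\<phi> j : borel_measurable lebesgue" for j by (rule measurable_completion)
  have [measurable]: "box a b : sets lebesgue" by simp
  have [measurable]: "(%x. indicator (box a b) x * g x) : borel_measurable lebesgue" using int_box[OF ab] by auto
  have eq: "(LINT x|lebesgue. \<phi> j x * (indicator (box a b) x * g x)) = 0" for j
  proof -
   have "(\<integral>x. g x * \<phi> j x \<partial>lebesgue_on \<Omega>) = (LINT x|lebesgue. indicator \<Omega> x *\<^sub>R (g x * \<phi> j x))"
    by (subst integral_restrict_space) auto
   also have "... = (LINT x|lebesgue. \<phi> j x * (indicator (box a b) x * g x))"
    using \<phi>(5)[of _ j] ab box_subset_cbox[of a b]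
    by (intro Bochner_Integration.integral_cong) (auto simp: indicator_def)
   finally show ?thesis using z \<phi>(1) by simp
  qed
  have "(%j. \<integral>x. \<phi> j x * (indicator (box a b) x * g x) \<partial>lebesgue) ---->
   (LINT x|lebesgue. indicator (box a b) x * (indicator (box a b) x * g x))"
  proof (rule integral_dominated_convergence[where w="%x. norm (indicator (box a b) x * g x)"])
   show "AE x in lebesgue. (%j. \<phi> j x * (indicator (box a b) x * g x)) ----> indicator (box a b) x * (indicator (box a b) x * g x)"
    by (intro AE_I2 tendsto_mult tendsto_const \<phi>(4))
   show "AE x in lebesgue. norm (\<phi> j x * (indicator (box a b) x * g x)) <= norm (indicator (box a b) x * g x)" for j
    using \<phi>(2,3)[of j] by (intro AE_I2) (auto simp: abs_mult intro: mult_left_le_one_le)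
  qed (use int_box[OF ab] in auto)
  then have "(LINT x|lebesgue. indicator (box a b) x * (indicator (box a b) x * g x)) = 0"
   by (simp add: eq LIMSEQ_const_iff)
  moreover have "indicator (box a b) x * (indicator (box a b) x * g x) = indicator (box a b) x * g x" for x
   by (auto simp: indicator_def)
  ultimately show ?thesis by simp
 qed
 have zero: "AE x in lebesgue. x : box a b --> g x = 0" if ab: "cbox a b \<subseteq> \<Omega>" for a b
 proof -
  let ?h = "%x. indicator (box a b) x * g x"
  have "?h : borel_measurable lebesgue" using int_box[OF ab] by blast
  \<comment> \<open>The Dynkin argument lives on Borel sets, so the Lebesgue measurable function is
    replaced by a Borel function that equals it almost everywhere.\<close>
  then obtain h' where h'[measurable]: "h' : borel_measurable lborel" and eq: "AE x in lborel. ?h x = h' x"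
   using completion_ex_borel_measurable_real by blast
  have eq': "AE x in lebesgue. ?h x = h' x" using eq by (simp add: AE_completion)
  have h'm[measurable]: "h' : borel_measurable lebesgue" using h' by (rule measurable_completion)
  have hm[measurable]: "?h : borel_measurable lebesgue" using int_box[OF ab] by blast
  have "integrable lebesgue h'"
   using integrable_cong_AE[OF hm h'm eq'] int_box[OF ab] by blast
  then have ih': "integrable lborel h'" by (simp add: integrable_completion)
  have "(LBINT x. indicator (box c d) x * h' x) = 0" for c d
  proof -
   have "(LBINT x. indicator (box c d) x * h' x) = (LINT x|lebesgue. indicator (box c d) x * h' x)"
    by (subst integral_completion) auto
   also have "... = (LINT x|lebesgue. indicator (box c d) x * ?h x)"
   proof (rule integral_cong_AE)
    have [measurable]: "box c d : sets lebesgue" by simp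
    show "(%x. indicator (box c d) x * h' x) : borel_measurable lebesgue"
     and "(%x. indicator (box c d) x * ?h x) : borel_measurable lebesgue"
     by (intro borel_measurable_times hm h'm borel_measurable_indicator; simp)+
    show "AE x in lebesgue. indicator (box c d) x * h' x = indicator (box c d) x * ?h x"
     using eq' by eventually_elim simp
   qed
   also have "... = (LINT x|lebesgue. indicator (box c d \<inter> box a b) x * g x)"
    by (intro Bochner_Integration.integral_cong) (auto simp: indicator_def)
   also have "... = 0"
   proof -
    define p q where "p = (SUM i:Basis. max (c \<bullet> i) (a \<bullet> i) *\<^sub>R i)"
     and "q = (SUM i:Basis. min (d \<bullet> i) (b \<bullet> i) *\<^sub>R i)"
    then have pq: "box c d \<inter> box a b = box p q" by (simp add: box_Int_box)
    have "cbox p q \<subseteq> cbox a b" by (auto simp: mem_box p_def q_def)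
    then have "cbox p q \<subseteq> \<Omega>" using ab by simp
    then show ?thesis using box0 pq by simp
   qed
   finally show ?thesis .
  qed
  moreover have "(LBINT x. h' x) = 0"
   using integral_cong_AE[OF hm h'm eq'] box0[OF ab] integral_completion[OF h'] by simp
  ultimately have "AE x in lborel. h' x = 0" using AE_zero_if_box_integrals_zero[OF ih'] by blast
  with eq have "AE x in lborel. ?h x = 0" by eventually_elim simp
  then have "AE x in lebesgue. ?h x = 0" by (simp add: AE_completion)
  then show ?thesis by eventually_elim (auto simp: indicator_def split: if_splits)
 qed
 obtain \<D> where D: "countable \<D>" "!!a b. (a, b) : \<D> ==> cbox a b \<subseteq> \<Omega>" "\<Omega> \<subseteq> (\<Union>(a, b)\<in>\<D>. box a b)"
  using open_countable_Union_box_cbox[OF \<Omega>] by metis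
 have zero': "AE x in lebesgue. x : box (fst p) (snd p) --> g x = 0" if "p : \<D>" for p
  using that by (intro zero D(2)) simp
 have "AE x in lebesgue. ALL p:\<D>. x : box (fst p) (snd p) --> g x = 0"
  unfolding AE_ball_countable[OF D(1)] using zero' by blast
 then have "AE x in lebesgue. x : \<Omega> --> g x = 0"
 proof eventually_elim
  fix x assume *: "ALL p:\<D>. x : box (fst p) (snd p) --> g x = 0"
  show "x : \<Omega> --> g x = 0"
  proof
   assume "x : \<Omega>"
   then have "x : (\<Union>(a, b)\<in>\<D>. box a b)" using D(3) by (rule set_rev_mp)
   then obtain p where "p : \<D>" "x : box (fst p) (snd p)" by (auto simp: case_prod_beta)
   then show "g x = 0" using * by blast
  qed
 qed
 then show ?thesis by (simp add: AE_restrict_space_iff)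
qed

subsection \<open>Test functions on the unit ball\<close>

abbreviation TF :: "('a::euclidean_space => real) set" where
 "TF \<equiv> test_functions (ball 0 1)"

text \<open>The support condition is turned into a radius strictly below 1, a form that passes
  easily to sums, products, derivatives and compositions with isometries.\<close>

lemma TF_iff: "u : TF \<longleftrightarrow> smooth u & (EX r<1. ALL x. r < norm x --> u x = 0)"
proof
 assume u: "u : TF"
 define K where "K = closure {x. u x ~= 0}"
 have K: "compact K" "K \<subseteq> ball 0 1" using u by (auto simp: test_functions_def K_def)
 have "EX r<1. ALL x:K. norm x <= r"
 proof (cases "K = {}")
  case False
  then obtain x where "x : K" "ALL y:K. norm y <= norm x"
   using continuous_attains_sup[OF K(1), of norm] by (auto intro: continuous_on_norm_id)
  then show ?thesis using K(2) by (intro exI[of _ "norm x"]) auto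
 qed (auto intro: exI[of _ 0])
 then obtain r where "r < 1" "ALL x:K. norm x <= r" by blast
 then have "ALL x. r < norm x --> u x = 0" using closure_subset[of "{x. u x ~= 0}"] unfolding K_def by fastforce
 then show "smooth u & (EX r<1. ALL x. r < norm x --> u x = 0)"
  using u \<open>r < 1\<close> by (auto simp: test_functions_def smooth_def)
next
 assume "smooth u & (EX r<1. ALL x. r < norm x --> u x = 0)"
 then obtain r where r: "smooth u" "r < 1" "!!x. r < norm x ==> u x = 0" by blast
 have cl: "closure {x. u x ~= 0} \<subseteq> cball 0 r"
  using r(3) by (intro closure_minimal) (auto simp: not_less[symmetric])
 then have "compact (closure {x. u x ~= 0})"
  using bounded_subset[OF bounded_cball] by (simp add: compact_eq_bounded_closed)
 then show "u : TF" using cl r by (auto simp: test_functions_def smooth_def)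
qed

lemma TF_smooth: "u : TF ==> smooth u" by (simp add: TF_iff)

lemma TF_zero_outside: "u : TF ==> 1 <= norm x ==> u x = 0"
 by (force simp: TF_iff)

lemma TF_add: "u : TF ==> v : TF ==> (%x. u x + v x) : TF"
proof -
 assume "u : TF" "v : TF"
 then obtain r s where "r < 1" "s < 1" "ALL x. r < norm x --> u x = 0" "ALL x. s < norm x --> v x = 0" "smooth u" "smooth v"
  unfolding TF_iff by blast
 then show ?thesis unfolding TF_iff by (intro conjI smooth_add exI[of _ "max r s"]) auto
qed

lemma TF_cmult: "u : TF ==> (%x. c * u x) : TF"
 by (auto simp: TF_iff intro: smooth_cmult)

lemma TF_zero: "(%x. 0) : TF"
 by (auto simp: TF_iff intro: smooth_const exI[of _ 0])

lemma TF_mult: "u : TF ==> smooth v ==> (%x. u x * v x) : TF"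
 by (auto simp: TF_iff intro!: smooth_mult)

lemma TF_diff: "u : TF ==> v : TF ==> (%x. u x - v x) : TF"
 using TF_add[of u "%x. (-1) * v x"] TF_cmult[of v "-1"] by simp

lemma gradient_add: "smooth u ==> smooth v ==> gradient (%x. u x + v x) x = gradient u x + gradient v x"
 by (rule gradient_eqI) (auto intro!: derivative_eq_intros smooth_has_derivative simp: inner_add_left)

lemma gradient_cmult: "smooth u ==> gradient (%x. c * u x) x = c *\<^sub>R gradient u x"
 by (rule gradient_eqI) (auto intro!: derivative_eq_intros smooth_has_derivative)

lemma gradient_diff: "smooth u ==> smooth v ==> gradient (%x. u x - v x) x = gradient u x - gradient v x"
 by (rule gradient_eqI) (auto intro!: derivative_eq_intros smooth_has_derivative simp: inner_diff_left)

lemma gradient_mult: "smooth u ==> smooth v ==> gradient (%x. u x * v x) x = u x *\<^sub>R gradient v x + v x *\<^sub>R gradient u x"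
 by (rule gradient_eqI) (auto intro!: derivative_eq_intros smooth_has_derivative simp: inner_add_left mult.commute)

lemma gradient_const: "gradient (%x. c) x = 0"
 by (rule gradient_eqI) simp

lemma gradient_sum:
 "finite S ==> (!!i. i : S ==> smooth (u i)) ==> gradient (%x. SUM i:S. u i x) x = (SUM i:S. gradient (u i) x)"
 by (induction rule: finite_induct) (auto simp: gradient_const gradient_add smooth_sum)

lemma TF_partial: "u : TF ==> b : Basis ==> partial_deriv b u : TF"
proof -
 assume u: "u : TF" and b: "b : Basis"
 then obtain r where r: "r < 1" "!!x. r < norm x ==> u x = 0" unfolding TF_iff by blast
 have "partial_deriv b u x = 0" if "r < norm x" for x
 proof -
  have "open {x::'a. r < norm x}" by (intro open_Collect_less continuous_intros)
  then have "(u has_derivative (%h. 0)) (at x)"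
   by (rule has_derivative_transform_within_open[OF has_derivative_const[of 0]]) (use that r in auto)
  then show ?thesis by (rule partial_deriv_eqI)
 qed
 then show ?thesis using r(1) smooth_partial[OF TF_smooth[OF u] b] unfolding TF_iff by blast
qed

lemma TF_gradient_zero: "u : TF ==> 1 <= norm x ==> gradient u x = 0"
 unfolding gradient_def by (intro sum.neutral ballI) (simp add: TF_zero_outside[OF TF_partial])

lemma continuous_ball_support_bounded:
 fixes g :: "'a::euclidean_space => 'b::real_normed_vector"
 assumes "continuous_on UNIV g" "!!x. 1 <= norm x ==> g x = 0"
 obtains M where "M > 0" "!!x. norm (g x) <= M"
proof -
 have "compact (g ` cball 0 1)"
  using assms(1) by (intro compact_continuous_image) (auto intro: continuous_on_subset)
 then obtain M where M: "M > 0" "!!y. y : g ` cball 0 1 ==> norm y <= M"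
  using compact_imp_bounded bounded_pos by metis
 have "norm (g x) <= M" for x
  using M assms(2)[of x] by (cases "norm x <= 1") auto
 then show thesis using M that by blast
qed

lemma continuous_ball_support_integrable:
 fixes g :: "'a::euclidean_space => 'b::{banach, second_countable_topology}"
 assumes "continuous_on UNIV g" "!!x. 1 <= norm x ==> g x = 0"
 shows "integrable lborel g"
proof -
 have "integrable lborel (%x. indicator (cball 0 1) x *\<^sub>R g x)"
  using assms(1) by (intro borel_integrable_compact) (auto intro: continuous_on_subset)
 moreover have "(%x. indicator (cball 0 1) x *\<^sub>R g x) = g"
  using assms(2) by (auto simp: fun_eq_iff indicator_def)
 ultimately show ?thesis by simp
qed

lemma TF_continuous: "u : TF ==> continuous_on S u"
 by (intro smooth_continuous TF_smooth)

lemma TF_gradient_continuous: "u : TF ==> continuous_on S (gradient u)"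
 by (intro smooth_gradient_continuous TF_smooth)

lemma TF_bounded:
 assumes "u : TF" obtains M where "M > 0" "!!x. abs (u x) <= M"
 using continuous_ball_support_bounded[OF TF_continuous[OF assms] TF_zero_outside[OF assms]] by (metis real_norm_def)

lemma TF_gradient_bounded:
 assumes "u : TF" obtains M where "M > 0" "!!x. norm (gradient u x) <= M"
 using continuous_ball_support_bounded[OF TF_gradient_continuous[OF assms] TF_gradient_zero[OF assms]] by metis

lemma TF_integrable: "u : TF ==> integrable lborel u"
 by (rule continuous_ball_support_integrable[OF TF_continuous TF_zero_outside])

text \<open>Difference quotients have integral zero by translation invariance of Lebesgue measure;
  they converge to the partial derivative under a common bound.\<close>

lemma TF_integral_partial_zero:
 fixes u :: "'a::euclidean_space => real"
 assumes u: "u : TF" and b: "b : Basis"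
 shows "(LBINT x. partial_deriv b u x) = 0"
proof -
 define t :: "nat => real" where "t k = 1 / real (Suc k)" for k
 have t: "0 < t k" "t k <= 1" for k by (auto simp: t_def)
 define q where "q k x = (u (t k *\<^sub>R b + x) - u x) / t k" for k x
 obtain M where M: "M > 0" "!!x. norm (gradient u x) <= M" using TF_gradient_bounded[OF u] by metis
 have um[measurable]: "u : borel_measurable borel"
  using TF_continuous[OF u] by (auto intro: borel_measurable_continuous_onI)
 have qz: "(LBINT x. q k x) = 0" for k
 proof -
  have iu: "integrable lborel u" using continuous_ball_support_integrable[OF TF_continuous[OF u] TF_zero_outside[OF u]] .
  then have iu': "integrable lborel (%x. u (t k *\<^sub>R b + x))"
   using integrable_distr_eq[of "%x. t k *\<^sub>R b + x" lborel borel u] lborel_distr_plus[of "t k *\<^sub>R b"] by simp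
  have "(LBINT x. u (t k *\<^sub>R b + x)) = (LBINT x. u x)"
   using integral_distr[of "%x. t k *\<^sub>R b + x" lborel borel u] lborel_distr_plus[of "t k *\<^sub>R b"] by simp
  then show ?thesis using iu iu' by (simp add: q_def)
 qed
 note der = directional_derivative[OF TF_smooth[OF u]]
 have lim: "(%k. q k x) ----> partial_deriv b u x" for x
 proof -
  have "((%h. (u (x + h *\<^sub>R b) - u x) / h) \<longlongrightarrow> partial_deriv b u x) (at 0)"
   using der[of x b 0] b by (simp add: has_field_derivative_iff gradient_inner_Basis)
  moreover have "filterlim t (at 0) sequentially"
   unfolding t_def filterlim_at using LIMSEQ_inverse_real_of_nat by (auto simp: inverse_eq_divide)
  ultimately show ?thesis
   using filterlim_compose[of "%h. (u (x + h *\<^sub>R b) - u x) / h"] unfolding q_def by (simp add: add.commute)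
 qed
 \<comment> \<open>The radius 2 suffices because a shift of length at most 1 cannot carry a point
   outside this ball into the open unit ball.\<close>
 have bound: "norm (q k x) <= M * indicator (cball 0 2) x" for k x
 proof (cases "x : cball 0 2")
  case True
  obtain s where s: "u (x + t k *\<^sub>R b) - u (x + 0 *\<^sub>R b) = (t k - 0) * (gradient u (x + s *\<^sub>R b) \<bullet> b)"
   using MVT2[of 0 "t k" "%s. u (x + s *\<^sub>R b)" "%s. gradient u (x + s *\<^sub>R b) \<bullet> b"] t[of k] der by blast
  have "abs (gradient u (x + s *\<^sub>R b) \<bullet> b) <= M"
   using Cauchy_Schwarz_ineq2[of "gradient u (x + s *\<^sub>R b)" b] M(2)[of "x + s *\<^sub>R b"] b by simp
  moreover have "q k x = gradient u (x + s *\<^sub>R b) \<bullet> b"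
   using s t[of k] by (simp add: q_def add.commute field_simps)
  ultimately show ?thesis using True by simp
 next
  case False
  have "norm (t k *\<^sub>R b + x) >= norm x - norm (t k *\<^sub>R b)" using norm_diff_ineq[of x "t k *\<^sub>R b"] by (simp add: add.commute)
  then have "1 <= norm (t k *\<^sub>R b + x)" using False t[of k] b by simp
  then show ?thesis using False TF_zero_outside[OF u] by (simp add: q_def)
 qed
 have "(%k. \<integral>x. q k x \<partial>lborel) ----> (LBINT x. partial_deriv b u x)"
 proof (rule integral_dominated_convergence[where w="%x. M * indicator (cball 0 2) x"])
  show "partial_deriv b u : borel_measurable lborel"
   using TF_continuous[OF TF_partial[OF u b]] by (auto intro: borel_measurable_continuous_onI)
  show "integrable lborel (%x::'a. M * indicator (cball 0 2) x)"
   using emeasure_bounded_finite[OF bounded_cball[of "0::'a" 2]] by (intro integrable_mult_right) (simp add: less_top)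
 qed (use lim bound in \<open>auto simp: q_def\<close>)
 then show ?thesis by (simp add: qz LIMSEQ_const_iff)
qed

lemma TF_integration_by_parts:
 fixes u :: "'a::euclidean_space => real"
 assumes u: "u : TF" and v: "v : TF" and b: "b : Basis"
 shows "(LBINT x. u x * partial_deriv b v x) = - (LBINT x. partial_deriv b u x * v x)"
proof -
 have uv: "(%x. u x * v x) : TF" using TF_mult u TF_smooth v by blast
 have "partial_deriv b (%x. u x * v x) x = u x * partial_deriv b v x + partial_deriv b u x * v x" for x
  using gradient_mult[OF TF_smooth[OF u] TF_smooth[OF v], of x] b
  by (simp flip: gradient_inner_Basis add: inner_add_left)
 moreover have "integrable lborel (%x. u x * partial_deriv b v x)" "integrable lborel (%x. partial_deriv b u x * v x)"
  using TF_partial[OF u b] TF_partial[OF v b] u v by (auto intro: TF_integrable TF_mult TF_smooth)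
 ultimately show ?thesis using TF_integral_partial_zero[OF uv b] by simp
qed

subsection \<open>Invariance of Lebesgue measure under isometries\<close>

lemma nn_integral_lborel_shift:
 assumes [measurable]: "f : borel_measurable borel"
 shows "(\<integral>\<^sup>+x. f (c + x) \<partial>lborel) = (\<integral>\<^sup>+x. f x \<partial>(lborel :: 'a::euclidean_space measure))"
 using nn_integral_distr[of "%x. c + x" lborel borel f] by (simp add: lborel_distr_plus)

lemma orthogonal_transformation_measurable:
 fixes g :: "'a::euclidean_space => 'a"
 assumes "orthogonal_transformation g" shows "g : borel_measurable borel"
 using assms linear_continuous_on[of g UNIV] linear_conv_bounded_linear[of g]
 by (auto simp: orthogonal_transformation_def intro: borel_measurable_continuous_onI)

text \<open>Uniqueness of Haar measure: the double integral of \<open>1\<^sub>A(x) 1\<^sub>B(y - x)\<close> against the image measure and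
 Lebesgue measure is computed in both orders, with \<open>B\<close> the unit ball.\<close>

lemma distr_lborel_orthogonal:
 fixes g :: "'a::euclidean_space => 'a"
 assumes g: "orthogonal_transformation g"
 shows "distr lborel borel g = lborel"
proof (rule measure_eqI)
 have lin: "linear g" using g by (simp add: orthogonal_transformation_def)
 have [measurable]: "g : borel_measurable borel" using orthogonal_transformation_measurable[OF g] .
 define \<mu> where "\<mu> = distr lborel borel g"
 have [measurable_cong]: "sets \<mu> = sets borel" by (simp add: \<mu>_def)
 \<comment> \<open>The image measure inherits translation invariance: a shift by \<open>c\<close> of
   the image is a shift of the argument by a preimage \<open>d\<close> of \<open>c\<close>.\<close>
 have shift: "(\<integral>\<^sup>+x. f (c + x) \<partial>\<mu>) = (\<integral>\<^sup>+x. f x \<partial>\<mu>)" if [measurable]: "f : borel_measurable borel" for f c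
 proof -
  obtain d where d: "g d = c" using orthogonal_transformation_surj[OF g] by (metis surjD)
  have "(\<integral>\<^sup>+x. f (c + x) \<partial>\<mu>) = (\<integral>\<^sup>+x. f (g (d + x)) \<partial>lborel)"
   unfolding \<mu>_def by (subst nn_integral_distr) (auto simp: linear_add[OF lin] d)
  also have "... = (\<integral>\<^sup>+x. f (g x) \<partial>lborel)" by (rule nn_integral_lborel_shift[of "%x. f (g x)"]) measurable
  also have "... = (\<integral>\<^sup>+x. f x \<partial>\<mu>)" unfolding \<mu>_def by (subst nn_integral_distr) auto
  finally show ?thesis .
 qed
 have ball: "emeasure \<mu> (ball 0 1) = emeasure lborel (ball (0::'a) 1)"
 proof -
  have "g -` ball 0 1 = ball 0 1" using orthogonal_transformation_norm[OF g] by auto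
  then show ?thesis unfolding \<mu>_def by (subst emeasure_distr) auto
 qed
 have fin: "emeasure \<mu> (ball 0 r) ~= \<infinity>" for r
 proof -
  have "g -` ball 0 r = ball 0 r" using orthogonal_transformation_norm[OF g] by auto
  then show ?thesis using emeasure_lborel_ball_finite[of "0::'a" r] unfolding \<mu>_def by (subst emeasure_distr) auto
 qed
 interpret \<mu>: sigma_finite_measure \<mu>
 proof
  show "EX A. countable A & A \<subseteq> sets \<mu> & \<Union>A = space \<mu> & (ALL a:A. emeasure \<mu> a ~= \<infinity>)"
  proof (intro exI conjI)
   show "countable (range (%n::nat. ball (0::'a) (real n)))" by simp
   show "\<Union>(range (%n::nat. ball (0::'a) (real n))) = space \<mu>"
    using reals_Archimedean2 by (auto simp: \<mu>_def)
  qed (use fin in \<open>auto simp: \<mu>_def\<close>)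
 qed
 interpret pair_sigma_finite \<mu> "lborel :: 'a measure" by unfold_locales
 fix A assume "A : sets (distr lborel borel g)"
 then have [measurable]: "A : sets borel" by simp
 define B where "B = ball (0::'a) 1"
 have [measurable]: "B : sets borel" by (simp add: B_def)
 have "emeasure \<mu> A * emeasure lborel B = (\<integral>\<^sup>+x. indicator A x * (\<integral>\<^sup>+y. indicator B y \<partial>lborel) \<partial>\<mu>)"
  by (subst nn_integral_multc) (auto simp: \<mu>_def)
 also have "... = (\<integral>\<^sup>+x. indicator A x * (\<integral>\<^sup>+y. indicator B (- x + y) \<partial>lborel) \<partial>\<mu>)"
  by (subst nn_integral_lborel_shift) auto
 also have "... = (\<integral>\<^sup>+x. (\<integral>\<^sup>+y. indicator A x * indicator B (- x + y) \<partial>lborel) \<partial>\<mu>)"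
  by (subst nn_integral_cmult) auto
 also have "... = (\<integral>\<^sup>+y. (\<integral>\<^sup>+x. indicator A x * indicator B (- x + y) \<partial>\<mu>) \<partial>lborel)"
  by (rule Fubini'[symmetric]) measurable
 also have "... = (\<integral>\<^sup>+y. (\<integral>\<^sup>+x. indicator A (y + x) * indicator B (- (y + x) + y) \<partial>\<mu>) \<partial>lborel)"
  by (intro nn_integral_cong shift[symmetric]) measurable
 \<comment> \<open>The argument of the indicator of \<open>B\<close> is now - x, and the ball is
   symmetric.\<close>
 also have "... = (\<integral>\<^sup>+y. (\<integral>\<^sup>+x. indicator B x * indicator A (x + y) \<partial>\<mu>) \<partial>lborel)"
  by (intro nn_integral_cong) (auto simp: B_def indicator_def add.commute)
 also have "... = (\<integral>\<^sup>+x. (\<integral>\<^sup>+y. indicator B x * indicator A (x + y) \<partial>lborel) \<partial>\<mu>)"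
  by (rule Fubini') measurable
 also have "... = (\<integral>\<^sup>+x. indicator B x * (\<integral>\<^sup>+y. indicator A (x + y) \<partial>lborel) \<partial>\<mu>)"
  by (subst nn_integral_cmult) auto
 also have "... = (\<integral>\<^sup>+x. indicator B x * emeasure lborel A \<partial>\<mu>)"
  by (subst nn_integral_lborel_shift) auto
 also have "... = emeasure \<mu> B * emeasure lborel A"
  by (subst nn_integral_multc) (auto simp: \<mu>_def)
 finally have "emeasure \<mu> A * emeasure lborel B = emeasure lborel A * emeasure lborel B"
  using ball by (simp add: B_def mult.commute)
 moreover have "emeasure lborel B = ennreal (unit_ball_vol (real DIM('a)))"
  by (simp add: B_def emeasure_ball)
 moreover have "unit_ball_vol (real DIM('a)) > 0" by simp
 ultimately show "emeasure (distr lborel borel g) A = emeasure lborel A"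
  unfolding \<mu>_def[symmetric] by (simp add: mult_right_ennreal_cancel)
qed simp

lemma integral_orthogonal:
 fixes g :: "'a::euclidean_space => 'a" and h :: "'a => 'b::{banach, second_countable_topology}"
 assumes "orthogonal_transformation g" "h : borel_measurable borel"
 shows "(LBINT x. h (g x)) = (LBINT x. h x)"
 using integral_distr[of g lborel borel h] orthogonal_transformation_measurable[OF assms(1)] assms(2)
 by (simp add: distr_lborel_orthogonal[OF assms(1)])

subsection \<open>Averaging over a group of isometries\<close>

text \<open>The C^k supremum norm is at most \<open>M\<close>, as a predicate with the same
  recursion as \<open>C_k\<close>.\<close>

primrec ubd :: "nat => real => ('a::euclidean_space => real) => bool" where
 "ubd 0 M \<phi> \<longleftrightarrow> (ALL x. abs (\<phi> x) <= M)"
| "ubd (Suc k) M \<phi> \<longleftrightarrow> (ALL x. abs (\<phi> x) <= M) & (ALL b:Basis. ubd k M (partial_deriv b \<phi>))"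

lemma ubd_abs: "ubd k M \<phi> ==> abs (\<phi> x) <= M"
 by (cases k) auto

lemma ubd_mono: "ubd k M \<phi> ==> M <= M' ==> ubd k M' \<phi>"
 by (induction k arbitrary: \<phi>) (auto intro: order_trans)

lemma ubd_TF: "\<phi> : TF ==> EX M>0. ubd k M \<phi>"
proof (induction k arbitrary: \<phi>)
 case 0
 then show ?case using TF_bounded[of \<phi>] by (metis ubd.simps(1))
next
 case (Suc k)
 then have "ALL b:Basis. EX M>0. ubd k M (partial_deriv b \<phi>)" using TF_partial by blast
 then obtain m where m: "!!b. b : Basis ==> 0 < m b & ubd k (m b) (partial_deriv b \<phi>)" by metis
 obtain M0 where M0: "M0 > 0" "!!x. abs (\<phi> x) <= M0" using TF_bounded[OF Suc.prems] by blast
 have s0: "0 <= sum m Basis" by (intro sum_nonneg less_imp_le) (use m in blast)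
 have "ubd k (M0 + sum m Basis) (partial_deriv b \<phi>)" if b: "b : Basis" for b
 proof -
  have "m b <= sum m Basis" using b m by (intro member_le_sum less_imp_le) auto
  then show ?thesis using m[OF b] M0(1) by (elim conjE ubd_mono) linarith
 qed
 moreover have "abs (\<phi> x) <= M0 + sum m Basis" for x using M0(2)[of x] s0 by linarith
 ultimately have "ubd (Suc k) (M0 + sum m Basis) \<phi>" by simp
 moreover have "M0 + sum m Basis > 0" using M0(1) s0 by linarith
 ultimately show ?case by blast
qed

lemma partial_deriv_sum_cmult:
 assumes "finite S" "!!i. i : S ==> smooth (\<phi> i)" "b : Basis"
 shows "partial_deriv b (%x. SUM i:S. c i * \<phi> i x) = (%x. SUM i:S. c i * partial_deriv b (\<phi> i) x)"
proof
 fix x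
 have "gradient (%x. SUM i:S. c i * \<phi> i x) x = (SUM i:S. c i *\<^sub>R gradient (\<phi> i) x)"
  using assms by (subst gradient_sum) (auto simp: gradient_cmult intro: smooth_cmult)
 then show "partial_deriv b (%x. SUM i:S. c i * \<phi> i x) x = (SUM i:S. c i * partial_deriv b (\<phi> i) x)"
  using assms(3) by (simp flip: gradient_inner_Basis add: inner_sum_left)
qed

lemma ubd_sum:
 assumes S: "finite S" and "!!i. i : S ==> smooth (\<phi> i)" and "!!i. i : S ==> ubd k (M i) (\<phi> i)"
 shows "ubd k (SUM i:S. abs (c i) * M i) (%x. SUM i:S. c i * \<phi> i x)"
 using assms(2,3)
proof (induction k arbitrary: \<phi>)
 case 0
 then show ?case by (auto simp: abs_mult intro!: order_trans[OF sum_abs] sum_mono mult_left_mono)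
next
 case (Suc k)
 have "abs (SUM i:S. c i * \<phi> i x) <= (SUM i:S. abs (c i) * M i)" for x
  using Suc.prems by (auto simp: abs_mult intro!: order_trans[OF sum_abs] sum_mono mult_left_mono)
 moreover have "ubd k (SUM i:S. abs (c i) * M i) (partial_deriv b (%x. SUM i:S. c i * \<phi> i x))" if "b : Basis" for b
 proof -
  have "ubd k (SUM i:S. abs (c i) * M i) (%x. SUM i:S. c i * partial_deriv b (\<phi> i) x)"
   using Suc.prems that by (intro Suc.IH) (auto intro: smooth_partial)
  then show ?thesis using Suc.prems(1) that by (simp add: partial_deriv_sum_cmult[OF S])
 qed
 ultimately show ?case by simp
qed

text \<open>Each differentiation produces a sum over the basis with coefficients of modulus at most
  1, hence a factor of at most the dimension. The factor is the same for all isometries, so the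
  bounds hold uniformly on an orbit.\<close>

lemma ubd_orthogonal:
 fixes \<phi> :: "'a::euclidean_space => real"
 assumes g: "orthogonal_transformation g" and "smooth \<phi>" "ubd k M \<phi>" "M >= 0"
 shows "ubd k (real DIM('a) ^ k * M) (%x. \<phi> (g x))"
 using assms(2-)
proof (induction k arbitrary: \<phi> M)
 case (Suc k)
 let ?n = "real DIM('a)"
 have n: "?n ^ Suc k >= 1" by (intro one_le_power) simp
 have lin: "linear g" using g by (simp add: orthogonal_transformation_def)
 have "abs (\<phi> (g x)) <= ?n ^ Suc k * M" for x
  using ubd_abs[OF Suc.prems(2), of "g x"] mult_right_mono[OF n Suc.prems(3)] by linarith
 moreover have "ubd k (?n ^ Suc k * M) (partial_deriv b (%x. \<phi> (g x)))" if b: "b : Basis" for b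
 proof -
  have "ubd k (SUM c:Basis. abs (g b \<bullet> c) * (?n ^ k * M)) (%x. SUM c:Basis. (g b \<bullet> c) * partial_deriv c \<phi> (g x))"
   using Suc by (intro ubd_sum Suc.IH) (auto intro: smooth_partial smooth_linear_compose lin)
  then have "ubd k (SUM c:Basis. abs (g b \<bullet> c) * (?n ^ k * M)) (partial_deriv b (%x. \<phi> (g x)))"
   using partial_deriv_linear_compose[OF lin smooth_differentiable[OF Suc.prems(1)]] by simp
  moreover have "(SUM c:Basis. abs (g b \<bullet> c) * (?n ^ k * M)) <= (SUM c:(Basis::'a set). 1 * (?n ^ k * M))"
  proof (intro sum_mono mult_right_mono)
   fix c :: 'a assume "c : Basis"
   then show "abs (g b \<bullet> c) <= 1"
    using Cauchy_Schwarz_ineq2[of "g b" c] b orthogonal_transformation_norm[OF g, of b] by simp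
  qed (use Suc.prems in simp)
  ultimately show ?thesis by (auto elim!: ubd_mono)
 qed
 ultimately show ?case by simp
qed simp

text \<open>Interpolation of Landau-Kolmogorov type: a function that is uniformly small and has
  bounded second derivatives has small first derivatives.\<close>

lemma uniformly_Cauchy_partial_deriv:
 fixes \<xi> :: "nat => 'a::euclidean_space => real"
 assumes sm: "!!j. smooth (\<xi> j)" and bd: "!!j. ubd 2 M (\<xi> j)"
  and cau: "uniformly_Cauchy_on UNIV \<xi>" and b: "b : Basis"
 shows "uniformly_Cauchy_on UNIV (%j. partial_deriv b (\<xi> j))"
proof (rule uniformly_Cauchy_onI)
 fix e :: real assume e: "e > 0"
 have M: "M >= 0" using ubd_abs[OF bd, of 0 0] by linarith
 \<comment> \<open>The step is so short that the bound 2 M on the second derivative of a difference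
   changes the first derivative by less than e / 2 along it. The tolerance e t / 8 then keeps the
   mean slope over the step below e / 4.\<close>
 define t where "t = e / (4 * M + 4)"
 have t: "t > 0" "2 * M * t < e / 2" using e M by (auto simp: t_def field_simps)
 have "e * t / 8 > 0" using e t by simp
 then obtain N where N: "!!x i j. i >= N ==> j >= N ==> dist (\<xi> i x) (\<xi> j x) < e * t / 8"
  using cau unfolding uniformly_Cauchy_on_def by (metis UNIV_I)
 show "EX N. ALL x:UNIV. ALL i>=N. ALL j>=N. dist (partial_deriv b (\<xi> i) x) (partial_deriv b (\<xi> j) x) < e"
 proof (intro exI ballI allI impI)
  fix x i j assume ij: "N <= i" "N <= j"
  define f where "f y = \<xi> i y - \<xi> j y" for y
  have smf: "smooth f" unfolding f_def[abs_def] by (intro smooth_diff sm)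
  have pf: "partial_deriv b f y = partial_deriv b (\<xi> i) y - partial_deriv b (\<xi> j) y" for y
   using b by (simp flip: gradient_inner_Basis add: f_def[abs_def] gradient_diff sm inner_diff_left)
  have smp: "smooth (partial_deriv b f)" by (intro smooth_partial smf b)
  have ppf: "abs (gradient (partial_deriv b f) y \<bullet> b) <= 2 * M" for y
  proof -
   have "partial_deriv b f = (%y. partial_deriv b (\<xi> i) y - partial_deriv b (\<xi> j) y)" using pf by blast
   then have "gradient (partial_deriv b f) y \<bullet> b = partial_deriv b (partial_deriv b (\<xi> i)) y - partial_deriv b (partial_deriv b (\<xi> j)) y"
    using b by (simp add: gradient_diff smooth_partial sm inner_diff_left gradient_inner_Basis)
   moreover
   have "abs (partial_deriv b (partial_deriv b (\<xi> i)) y) <= M" for i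
    using bd[of i] b by (simp add: numeral_2_eq_2)
   from this[of i] this[of j] have "abs (partial_deriv b (partial_deriv b (\<xi> i)) y - partial_deriv b (partial_deriv b (\<xi> j)) y) <= 2 * M"
    by linarith
   ultimately show ?thesis by simp
  qed
  note der = directional_derivative
  obtain s where s: "0 < s" "s < t" "f (x + t *\<^sub>R b) - f (x + 0 *\<^sub>R b) = (t - 0) * (gradient f (x + s *\<^sub>R b) \<bullet> b)"
   using MVT2[of 0 t "%s. f (x + s *\<^sub>R b)" "%s. gradient f (x + s *\<^sub>R b) \<bullet> b"] t(1) der[OF smf] by blast
  obtain r where r: "0 < r" "r < s" "partial_deriv b f (x + s *\<^sub>R b) - partial_deriv b f (x + 0 *\<^sub>R b) = (s - 0) * (gradient (partial_deriv b f) (x + r *\<^sub>R b) \<bullet> b)"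
   using MVT2[of 0 s "%s. partial_deriv b f (x + s *\<^sub>R b)" "%s. gradient (partial_deriv b f) (x + s *\<^sub>R b) \<bullet> b"] s(1) der[OF smp] by blast
  have "abs (partial_deriv b f (x + s *\<^sub>R b) - partial_deriv b f x) <= s * (2 * M)"
   using r ppf[of "x + r *\<^sub>R b"] s(1) by (simp add: abs_mult)
  also have "... <= t * (2 * M)" using s M by (intro mult_right_mono) auto
  finally have 1: "abs (partial_deriv b f (x + s *\<^sub>R b) - partial_deriv b f x) < e / 2" using t(2) by (simp add: mult_ac)
  have "abs (f y) < e * t / 8" for y using N[OF ij, of y] by (simp add: f_def dist_real_def)
  from this[of "x + t *\<^sub>R b"] this[of x] have "abs (f (x + t *\<^sub>R b) - f x) < e * t / 4" by linarith
  then have "t * abs (partial_deriv b f (x + s *\<^sub>R b)) < t * (e / 4)"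
   using s(3) t(1) b by (simp add: gradient_inner_Basis abs_mult mult_ac)
  then have "abs (partial_deriv b f (x + s *\<^sub>R b)) < e / 4" using t(1) by simp
  then have "abs (partial_deriv b f x) < e" using 1 e by linarith
  then show "dist (partial_deriv b (\<xi> i) x) (partial_deriv b (\<xi> j) x) < e" by (simp add: pf dist_real_def)
 qed
qed

text \<open>Bounds at all orders upgrade uniform convergence of the functions to uniform convergence
  of the first derivatives, by interpolation. The partial derivatives then satisfy the same
  hypotheses, which drives the induction on \<open>k\<close>.\<close>

lemma C_k_uniform_limit:
 fixes \<xi> :: "nat => 'a::euclidean_space => real"
 assumes sm: "!!j. smooth (\<xi> j)" and bd: "!!k. EX M. ALL j. ubd k M (\<xi> j)"
  and cau: "uniformly_Cauchy_on UNIV \<xi>"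
 shows "C_k k (%x. lim (%j. \<xi> j x))"
  and "b : Basis ==> partial_deriv b (%x. lim (%j. \<xi> j x)) = (%x. lim (%j. partial_deriv b (\<xi> j) x))"
proof -
 have *: "uniform_limit UNIV \<xi> (%x. lim (%j. \<xi> j x)) sequentially" if "uniformly_Cauchy_on UNIV \<xi>" for \<xi> :: "nat => 'a => real"
  using Cauchy_uniformly_convergent[OF that] by (simp add: uniformly_convergent_uniform_limit_iff)
 have der: "((%x. lim (%j. \<xi> j x)) has_derivative (%h. SUM b:Basis. (h \<bullet> b) * lim (%j. partial_deriv b (\<xi> j) x))) (at x)"
  if sm: "!!j. smooth (\<xi> j)" and bd: "!!k. EX M. ALL j. ubd k M (\<xi> j)" and cau: "uniformly_Cauchy_on UNIV \<xi>"
  for \<xi> :: "nat => 'a => real" and x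
 proof -
  obtain M where M: "!!j. ubd 2 M (\<xi> j)" using bd by blast
  have ul: "uniform_limit UNIV (%j. partial_deriv b (\<xi> j)) (%x. lim (%j. partial_deriv b (\<xi> j) x)) sequentially" if "b : Basis" for b
   by (rule *[OF uniformly_Cauchy_partial_deriv[OF sm M cau that]])
  have pt: "(%j. \<xi> j x) ----> lim (%j. \<xi> j x)" for x
   using tendsto_uniform_limitI[OF *[OF cau]] by blast
  have "EX g. ALL x:UNIV. (%n. \<xi> n x) ----> g x &
    (g has_derivative (%h. SUM b:Basis. (h \<bullet> b) * lim (%j. partial_deriv b (\<xi> j) x))) (at x)"
  proof (rule has_derivative_sequence[where f'="%n x h. gradient (\<xi> n) x \<bullet> h" and S=UNIV and f=\<xi>])
   show "(\<xi> n has_derivative (\<bullet>) (gradient (\<xi> n) x)) (at x)" for n x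
    using smooth_has_derivative[OF sm] by simp
   fix e :: real assume e: "e > 0"
   define d where "d = e / real DIM('a)"
   have d: "d > 0" using e by (simp add: d_def)
   have "\<forall>\<^sub>F n in sequentially. ALL b:(Basis::'a set). ALL x:UNIV. dist (partial_deriv b (\<xi> n) x) (lim (%j. partial_deriv b (\<xi> j) x)) < d"
    using uniform_limitD[OF ul d] by (intro eventually_ball_finite) auto
   then show "\<forall>\<^sub>F n in sequentially. ALL x:UNIV. ALL h. norm (gradient (\<xi> n) x \<bullet> h - (SUM b:Basis. (h \<bullet> b) * lim (%j. partial_deriv b (\<xi> j) x))) <= e * norm h"
   proof eventually_elim
    case (elim n)
    show ?case
    proof (intro ballI allI)
     fix x h :: 'a
     have "gradient (\<xi> n) x \<bullet> h - (SUM b:Basis. (h \<bullet> b) * lim (%j. partial_deriv b (\<xi> j) x)) =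
      (SUM b:Basis. (h \<bullet> b) * (partial_deriv b (\<xi> n) x - lim (%j. partial_deriv b (\<xi> j) x)))"
      by (simp add: gradient_def inner_sum_left inner_sum_right right_diff_distrib sum_subtractf inner_commute[of _ h] mult.commute)
     also have "norm ... <= (SUM b:(Basis::'a set). norm h * d)"
      using elim by (intro order_trans[OF norm_sum] sum_mono)
       (auto simp: abs_mult dist_real_def intro!: mult_mono Basis_le_norm intro: less_imp_le)
     also have "... = e * norm h" by (simp add: d_def)
     finally show "norm (gradient (\<xi> n) x \<bullet> h - (SUM b:Basis. (h \<bullet> b) * lim (%j. partial_deriv b (\<xi> j) x))) <= e * norm h" .
    qed
   qed
  qed (use pt in auto)
  then obtain g where g: "!!x. (%n. \<xi> n x) ----> g x"
   "(g has_derivative (%h. SUM b:Basis. (h \<bullet> b) * lim (%j. partial_deriv b (\<xi> j) x))) (at x)" by blast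
  have "g = (%x. lim (%j. \<xi> j x))" by (rule ext) (rule limI[OF g(1), symmetric])
  then show ?thesis using g(2) by simp
 qed
 have part: "partial_deriv b (%x. lim (%j. \<xi> j x)) = (%x. lim (%j. partial_deriv b (\<xi> j) x))"
  if sm: "!!j. smooth (\<xi> j)" and bd: "!!k. EX M. ALL j. ubd k M (\<xi> j)" and cau: "uniformly_Cauchy_on UNIV \<xi>"
   and b: "b : Basis" for \<xi> :: "nat => 'a => real" and b
  using b by (intro ext, subst partial_deriv_eqI[OF der[OF sm bd cau]])
   (simp add: inner_Basis if_distrib[of "%c. c * _"] cong: if_cong)
 show "b : Basis ==> partial_deriv b (%x. lim (%j. \<xi> j x)) = (%x. lim (%j. partial_deriv b (\<xi> j) x))"
  by (rule part[OF sm bd cau])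
 show "C_k k (%x. lim (%j. \<xi> j x))"
  using assms
 proof (induction k arbitrary: \<xi>)
  case 0
  show ?case using uniform_limit_theorem[OF _ *[OF 0(3)]] smooth_continuous[OF 0(1)] by simp
 next
  case (Suc k)
  obtain M where M: "!!j. ubd 2 M (\<xi> j)" using Suc.prems(2) by blast
  have "C_k k (partial_deriv b (%x. lim (%j. \<xi> j x)))" if b: "b : Basis" for b
   unfolding part[OF Suc.prems b]
  proof (rule Suc.IH)
   show "smooth (partial_deriv b (\<xi> j))" for j by (intro smooth_partial Suc.prems b)
   show "EX M. ALL j. ubd k M (partial_deriv b (\<xi> j))" for k
    using Suc.prems(2)[of "Suc k"] b by auto
   show "uniformly_Cauchy_on UNIV (%j. partial_deriv b (\<xi> j))"
    by (rule uniformly_Cauchy_partial_deriv[OF Suc.prems(1) M Suc.prems(3) b])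
  qed
  then show ?case using der[OF Suc.prems] unfolding C_k.simps differentiable_on_def differentiable_def by auto
 qed
qed

text \<open>Dyadic convex combinations suffice, since the parallelogram identity only involves midpoints.\<close>

inductive_set orbit_hull :: "('a => 'a) set => ('a::euclidean_space => real) => ('a => real) set"
 for G \<phi> where
  orbit: "g : G ==> (%x. \<phi> (g x)) : orbit_hull G \<phi>"
 | midpoint: "u : orbit_hull G \<phi> ==> v : orbit_hull G \<phi> ==> (%x. (u x + v x) / 2) : orbit_hull G \<phi>"

definition isometry_monoid :: "('a::euclidean_space => 'a) set => bool" where
 "isometry_monoid G \<longleftrightarrow> (%x. x) : G & (ALL g:G. orthogonal_transformation g) & (ALL g:G. ALL h:G. (%x. g (h x)) : G)"

lemma TF_orthogonal:
 assumes "orthogonal_transformation g" "u : TF" shows "(%x. u (g x)) : TF"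
 using assms by (auto simp: TF_iff orthogonal_transformation_norm orthogonal_transformation_def intro: smooth_linear_compose)

lemma orbit_hull_TF:
 assumes "isometry_monoid G" "\<phi> : TF" shows "u : orbit_hull G \<phi> ==> u : TF"
proof (induction rule: orbit_hull.induct)
 case (midpoint u v)
 then show ?case using TF_cmult[OF TF_add[of u v], of "1/2"] by simp
qed (use assms in \<open>auto simp: isometry_monoid_def intro: TF_orthogonal\<close>)

lemma orbit_hull_compose:
 assumes "isometry_monoid G" "h : G" shows "u : orbit_hull G \<phi> ==> (%x. u (h x)) : orbit_hull G \<phi>"
proof (induction rule: orbit_hull.induct)
 case (orbit g)
 then show ?case using assms orbit_hull.orbit[of "%x. g (h x)" G \<phi>] by (auto simp: isometry_monoid_def)
qed (auto intro: orbit_hull.midpoint)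

lemma orbit_hull_vanish:
 assumes "isometry_monoid G" "!!x. r < norm x ==> \<phi> x = 0"
 shows "u : orbit_hull G \<phi> ==> r < norm x ==> u x = 0"
 by (induction rule: orbit_hull.induct) (use assms in \<open>auto simp: isometry_monoid_def orthogonal_transformation_norm\<close>)

lemma orbit_hull_ubd:
 fixes \<phi> :: "'a::euclidean_space => real"
 assumes G: "isometry_monoid G" and \<phi>: "\<phi> : TF"
 shows "EX M>0. ALL u:orbit_hull G \<phi>. ubd k M u"
proof -
 obtain M where M: "M > 0" "ubd k M \<phi>" using ubd_TF[OF \<phi>] by blast
 have "ubd k (real DIM('a) ^ k * M) u" if "u : orbit_hull G \<phi>" for u
  using that
 proof (induction rule: orbit_hull.induct)
  case (orbit g)
  then show ?case using ubd_orthogonal[of g \<phi> k M] G M TF_smooth[OF \<phi>] by (auto simp: isometry_monoid_def)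
 next
  case (midpoint u v)
  let ?f = "%i. if i then u else v"
  have "ubd k (SUM i:(UNIV :: bool set). abs (1 / 2) * (real DIM('a) ^ k * M)) (%x. SUM i:(UNIV :: bool set). (1 / 2) * ?f i x)"
   by (rule ubd_sum) (use midpoint TF_smooth[OF orbit_hull_TF[OF G \<phi>]] in auto)
  then show ?case by (simp add: UNIV_bool add_divide_distrib add.commute)
 qed
 moreover have "real DIM('a) ^ k * M > 0" using M by simp
 ultimately show ?thesis by blast
qed

lemma ubd_1_Lipschitz:
 fixes u :: "'a::euclidean_space => real"
 assumes u: "smooth u" and "ubd 1 M u"
 shows "abs (u x - u y) <= (real DIM('a) * M) * norm (x - y)"
proof -
 have "norm (gradient u z) <= real DIM('a) * M" for z
 proof -
  have "norm (gradient u z) <= (SUM b:(Basis::'a set). M)"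
   unfolding gradient_def using assms(2) by (intro order_trans[OF norm_sum] sum_mono) auto
  then show ?thesis by simp
 qed
 then have "norm (gradient u z \<bullet> v) <= real DIM('a) * M * norm v" for z v
  using Cauchy_Schwarz_ineq2[of "gradient u z" v] by (metis mult_right_mono norm_ge_zero order_trans real_norm_def)
 then have "onorm (%v. gradient u z \<bullet> v) <= real DIM('a) * M" for z by (intro onorm_le)
 then have "norm (u x - u y) <= (real DIM('a) * M) * norm (x - y)"
  by (intro differentiable_bound[of UNIV u "%z v. gradient u z \<bullet> v"]) (auto intro: smooth_has_derivative[OF u])
 then show ?thesis by simp
qed

text \<open>If a Lipschitz function reaches \<open>\<delta>\<close> at one point, it stays above
  \<delta> / 2 on a ball of fixed radius, which costs a fixed amount of L2 norm. On a set with a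
  common Lipschitz bound, L2 convergence thus becomes uniform convergence.\<close>

lemma sup_le_if_L2_small:
 fixes L :: real
 assumes L: "L > 0" and \<delta>: "\<delta> > 0"
 shows "EX \<eta>>0. ALL f :: 'a::euclidean_space => real. (ALL x y. abs (f x - f y) <= L * norm (x - y)) --> f : TF -->
  (LBINT x. (f x)^2) < \<eta> --> (ALL x. abs (f x) < \<delta>)"
proof -
 define r where "r = \<delta> / (2 * L)"
 have r: "r > 0" using L \<delta> by (simp add: r_def)
 define V where "V = unit_ball_vol (real DIM('a)) * r ^ DIM('a)"
 have V: "V > 0" using r by (simp add: V_def)
 show ?thesis
 proof (intro exI[of _ "(\<delta> / 2)^2 * V"] conjI allI impI)
  show "(\<delta> / 2)^2 * V > 0" using \<delta> V by simp
  fix f :: "'a => real" and x0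
  assume lip: "ALL x y. abs (f x - f y) <= L * norm (x - y)" and f: "f : TF" and small: "(LBINT x. (f x)^2) < (\<delta> / 2)^2 * V"
  show "abs (f x0) < \<delta>"
  proof (rule ccontr)
   assume big: "~abs (f x0) < \<delta>"
   have "(\<delta> / 2)^2 * V = (LBINT x. (\<delta> / 2)^2 * indicator (ball x0 r) x)"
    using r emeasure_ball[of r x0] by (simp add: V_def measure_def)
   also have "... <= (LBINT x. (f x)^2)"
   proof (rule integral_mono)
    show "integrable lborel (%x. (\<delta> / 2)^2 * indicator (ball x0 r) x :: real)"
     using emeasure_lborel_ball_finite[of x0 r] by (intro integrable_mult_right) simp
    show "integrable lborel (%x. (f x)^2)"
     using TF_integrable[OF TF_mult[OF f TF_smooth[OF f]]] by (simp add: power2_eq_square)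
    show "(\<delta> / 2)^2 * indicator (ball x0 r) x <= (f x)^2" for x
    proof (cases "x : ball x0 r")
     case True
     have "L * norm (x0 - x) <= L * r" using True L by (intro mult_left_mono) (auto simp: dist_norm)
     then have "abs (f x0 - f x) <= \<delta> / 2" using lip[rule_format, of x0 x] L by (simp add: r_def)
     then have "\<delta> / 2 <= abs (f x)" using big by linarith
     then have "(\<delta> / 2)^2 <= abs (f x)^2" using \<delta> by (intro power_mono) auto
     then show ?thesis using True by simp
    qed simp
   qed
   finally show False using small by simp
  qed
 qed
qed

lemma TF_integrable_power2: "u : TF ==> integrable lborel (%x. (u x)^2)"
 using TF_integrable[OF TF_mult[OF _ TF_smooth]] by (simp add: power2_eq_square)

text \<open>No integration over the group is involved. A minimising sequence for the L2 norm on the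
  orbit hull is Cauchy by the parallelogram identity. Composing it with a member of \<open>G\<close>
  gives another minimising sequence, so the limit is invariant. The derivative bounds on the hull
  turn L2 into C^1 convergence.\<close>

lemma averaging:
 fixes \<phi> :: "'a::euclidean_space => real"
 assumes G: "isometry_monoid G" and \<phi>: "\<phi> : TF"
 obtains \<psi> u where "\<psi> : TF" "!!g x. g : G ==> \<psi> (g x) = \<psi> x" "!!j::nat. u j : orbit_hull G \<phi>"
  "uniform_limit UNIV u \<psi> sequentially"
  "!!b. b : Basis ==> uniform_limit UNIV (%j. partial_deriv b (u j)) (partial_deriv b \<psi>) sequentially"
proof -
 let ?H = "orbit_hull G \<phi>"
 define e where "e u = (LBINT x. (u x)^2)" for u :: "'a => real"
 have e0: "e u >= 0" for u unfolding e_def by (intro integral_nonneg_AE) auto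
 define d where "d = (INF u\<in>?H. e u)"
 have ne: "?H ~= {}" using G orbit_hull.orbit[of "%x. x" G \<phi>] by (auto simp: isometry_monoid_def)
 have bb: "bdd_below (e ` ?H)" using e0 by (intro bdd_belowI[of _ 0]) auto
 have d_le: "d <= e u" if "u : ?H" for u unfolding d_def using that bb by (rule cINF_lower[rotated])
 have "EX u:?H. e u < d + 1 / real (Suc j)" for j
  using cINF_less_iff[OF ne bb, of "d + 1 / real (Suc j)"] by (simp add: d_def)
 then obtain u where u: "!!j. u j : ?H" "!!j. e (u j) < d + 1 / real (Suc j)" by metis
 have para: "e (%x. v x - w x) <= 2 * e v + 2 * e w - 4 * d" if "v : ?H" "w : ?H" for v w
 proof -
  have TF: "v : TF" "w : TF" using that orbit_hull_TF[OF G \<phi>] by auto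
  have i: "integrable lborel (%x. (v x)^2)" "integrable lborel (%x. (w x)^2)" "integrable lborel (%x. ((v x + w x) / 2)^2)"
   using TF_integrable_power2[of v] TF_integrable_power2[of w] TF TF_integrable_power2[OF TF_cmult[OF TF_add[of v w], of "1/2"]] by auto
  have "(v x - w x)^2 = 2 * (v x)^2 + 2 * (w x)^2 - 4 * ((v x + w x) / 2)^2" for x
   by (simp add: power2_eq_square field_simps)
  then have "e (%x. v x - w x) = 2 * e v + 2 * e w - 4 * e (%x. (v x + w x) / 2)"
   using i by (simp add: e_def)
  then show ?thesis using d_le[OF orbit_hull.midpoint[OF that]] by linarith
 qed
 obtain M where M: "M > 0" "!!u. u : ?H ==> ubd 1 M u" using orbit_hull_ubd[OF G \<phi>] by blast
 define L where "L = 2 * (real DIM('a) * M)"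
 have L: "L > 0" using M by (simp add: L_def)
 \<comment> \<open>Any two near-minimisers are uniformly close. This one fact yields both the Cauchy
   property of \<open>u\<close> and the invariance of its limit.\<close>
 have close: "EX \<eta>>0. ALL v:?H. ALL w:?H. e v < d + \<eta> --> e w < d + \<eta> --> (ALL x. abs (v x - w x) < \<delta>)" if \<delta>: "\<delta> > 0" for \<delta>
 proof -
  obtain \<eta> where \<eta>: "\<eta> > 0" "ALL f :: 'a => real. (ALL x y. abs (f x - f y) <= L * norm (x - y)) --> f : TF -->
    (LBINT x. (f x)^2) < \<eta> --> (ALL x. abs (f x) < \<delta>)"
   using sup_le_if_L2_small[OF L \<delta>] by auto
  show ?thesis
  \<comment> \<open>With both excesses over \<open>d\<close> below \<eta> / 4, the parallelogram
    bound \<open>2 * e v + 2 * e w - 4 * d\<close> is below \<eta>.\<close>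
  proof (intro exI[of _ "\<eta> / 4"] conjI ballI impI allI)
   show "0 < \<eta> / 4" using \<eta>(1) by simp
   fix v w x assume vw: "v : ?H" "w : ?H" "e v < d + \<eta> / 4" "e w < d + \<eta> / 4"
   have TF: "v : TF" "w : TF" using vw orbit_hull_TF[OF G \<phi>] by auto
   show "abs (v x - w x) < \<delta>"
   proof (rule \<eta>(2)[rule_format, of "%x. v x - w x"])
    show "(%x. v x - w x) : TF" by (intro TF_diff TF)
    show "(LBINT x. (v x - w x)^2) < \<eta>" using para[OF vw(1,2)] vw(3,4) by (simp add: e_def)
    fix x y
    have "abs (v x - v y) <= (real DIM('a) * M) * norm (x - y)" "abs (w x - w y) <= (real DIM('a) * M) * norm (x - y)"
     using ubd_1_Lipschitz[OF TF_smooth] TF M(2) vw by blast+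
    moreover have "L * norm (x - y) = (real DIM('a) * M) * norm (x - y) + (real DIM('a) * M) * norm (x - y)"
     by (simp add: L_def algebra_simps)
    ultimately show "abs ((v x - w x) - (v y - w y)) <= L * norm (x - y)" by linarith
   qed
  qed
 qed
 have ev: "EX N. ALL j>=N. e (u j) < d + \<eta>" if "\<eta> > 0" for \<eta>
 proof -
  obtain N where N: "1 / real (Suc N) < \<eta>" using nat_approx_posE[OF \<open>\<eta> > 0\<close>] by auto
  have "1 / real (Suc j) <= 1 / real (Suc N)" if "j >= N" for j using that by (simp add: field_simps)
  then show ?thesis using u(2) N by (meson add_strict_left_mono dual_order.strict_trans order_le_less_trans)
 qed
 have cau: "uniformly_Cauchy_on UNIV u"
 proof (rule uniformly_Cauchy_onI)
  fix \<delta> :: real assume "\<delta> > 0"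
  then obtain \<eta> where \<eta>: "\<eta> > 0" "ALL v:?H. ALL w:?H. e v < d + \<eta> --> e w < d + \<eta> --> (ALL x. abs (v x - w x) < \<delta>)" using close by blast
  obtain N where "ALL j>=N. e (u j) < d + \<eta>" using ev[OF \<eta>(1)] by blast
  then show "EX N. ALL x:UNIV. ALL i>=N. ALL j>=N. dist (u i x) (u j x) < \<delta>" using \<eta>(2) u(1) unfolding dist_real_def by blast
 qed
 define \<psi> where "\<psi> x = lim (%j. u j x)" for x
 have TFu: "u j : TF" for j using u(1) orbit_hull_TF[OF G \<phi>] by blast
 have sm: "smooth (u j)" for j using TFu TF_smooth by blast
 have bd: "EX M. ALL j. ubd k M (u j)" for k using orbit_hull_ubd[OF G \<phi>, of k] u(1) by blast
 obtain M2 where M2: "!!j. ubd 2 M2 (u j)" using bd by blast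
 have ul: "uniform_limit UNIV u \<psi> sequentially"
  using Cauchy_uniformly_convergent[OF cau] by (simp add: uniformly_convergent_uniform_limit_iff \<psi>_def[abs_def])
 have pt: "(%j. u j x) ----> \<psi> x" for x using tendsto_uniform_limitI[OF ul] by blast
 have "smooth \<psi>" unfolding smooth_def \<psi>_def[abs_def] using C_k_uniform_limit(1)[OF sm bd cau] by blast
 moreover obtain r where r: "r < 1" "!!x. r < norm x ==> \<phi> x = 0" using \<phi> unfolding TF_iff by blast
 have "\<psi> x = 0" if "r < norm x" for x
  using pt[of x] orbit_hull_vanish[OF G r(2) u(1) that] by (simp add: LIMSEQ_const_iff)
 ultimately have 1: "\<psi> : TF" using r(1) unfolding TF_iff by blast
 have 2: "\<psi> (g x) = \<psi> x" if g: "g : G" for g x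
 proof -
  have og: "orthogonal_transformation g" using g G by (auto simp: isometry_monoid_def)
  have eg: "e (%x. u j (g x)) = e (u j)" for j
   unfolding e_def using TF_continuous[OF TFu[of j]]
   by (intro integral_orthogonal[OF og, of "%x. (u j x)^2"] borel_measurable_continuous_onI continuous_intros)
  have "(%j. u j (g x) - u j x) ----> 0"
  proof (rule LIMSEQ_I)
   fix \<delta> :: real assume "\<delta> > 0"
   then obtain \<eta> where \<eta>: "\<eta> > 0" "ALL v:?H. ALL w:?H. e v < d + \<eta> --> e w < d + \<eta> --> (ALL x. abs (v x - w x) < \<delta>)" using close by blast
   obtain N where "ALL j>=N. e (u j) < d + \<eta>" using ev[OF \<eta>(1)] by blast
   then have "norm (u j (g x) - u j x - 0) < \<delta>" if "j >= N" for j
    using \<eta>(2)[rule_format, OF orbit_hull_compose[OF G g u(1)] u(1), of j j x] eg[of j] that by simp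
   then show "EX N. ALL j>=N. norm (u j (g x) - u j x - 0) < \<delta>" by blast
  qed
  moreover have "(%j. u j (g x) - u j x) ----> \<psi> (g x) - \<psi> x" by (intro tendsto_diff pt)
  ultimately show ?thesis using LIMSEQ_unique by fastforce
 qed
 have 3: "uniform_limit UNIV (%j. partial_deriv b (u j)) (partial_deriv b \<psi>) sequentially" if b: "b : Basis" for b
  unfolding \<psi>_def[abs_def] C_k_uniform_limit(2)[OF sm bd cau b]
  using Cauchy_uniformly_convergent[OF uniformly_Cauchy_partial_deriv[OF sm M2 cau b]]
  by (simp add: uniformly_convergent_uniform_limit_iff)
 show thesis by (rule that[of \<psi> u]) (use 1 2 u(1) ul 3 in auto)
qed

subsection \<open>A mountain pass theorem on a seminormed space\<close>

text \<open>The paths are polygons, so no completeness and no topology on the space are needed. A polygon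
 is deformed by one Euler step at each vertex, along a direction of descent; this lowers \<open>I\<close> on whole
 edges because \<open>dI\<close> is uniformly continuous on bounded sets. The ray condition moves the end point back
 to the sphere of radius \<open>R\<close>.\<close>

locale mountain_pass =
 fixes V :: "'v::real_vector set" and nm I :: "'v => real" and dI :: "'v => 'v => real"
  and R M r0 \<rho>0 :: real and e :: 'v
 assumes V: "subspace V"
  and nm_nonneg: "!!u. u : V ==> nm u >= 0"
  and nm_triangle: "!!u v. u : V ==> v : V ==> nm (u + v) <= nm u + nm v"
  and nm_scale: "!!u c. u : V ==> nm (c *\<^sub>R u) = abs c * nm u"
  and dI_add: "!!u \<phi> \<psi>. u : V ==> \<phi> : V ==> \<psi> : V ==> dI u (\<phi> + \<psi>) = dI u \<phi> + dI u \<psi>"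
  and dI_scale: "!!u \<phi> c. u : V ==> \<phi> : V ==> dI u (c *\<^sub>R \<phi>) = c * dI u \<phi>"
  and deriv: "!!u \<phi> t. u : V ==> \<phi> : V ==>
   ((%t. I (u + t *\<^sub>R \<phi>)) has_real_derivative dI (u + t *\<^sub>R \<phi>) \<phi>) (at t)"
  and uc: "!!r \<delta>. \<delta> > 0 ==> EX \<eta>>0. ALL u:V. ALL v:V. nm u <= r --> nm v <= r --> nm (u - v) <= \<eta> -->
   (ALL \<phi>:V. nm \<phi> <= 1 --> abs (dI u \<phi> - dI v \<phi>) <= \<delta>)"
  and bnd: "!!r. EX C. ALL u:V. nm u <= r --> (ALL \<phi>:V. nm \<phi> <= 1 --> abs (dI u \<phi>) <= C)"
  and I0: "I 0 = 0"
  and r0: "0 < r0" "r0 < R" "1 < R" and \<rho>0: "0 < \<rho>0"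
  and sphere: "!!u. u : V ==> nm u = r0 ==> \<rho>0 <= I u"
  and ray: "!!v t. v : V ==> R - 1 <= nm v ==> I v <= M + 1 ==> 1 <= t ==> I (t *\<^sub>R v) <= I v"
  and e: "e : V" "R <= nm e" "!!t. 0 <= t ==> t <= 1 ==> I (t *\<^sub>R e) <= M"
begin

definition seg :: "'v => 'v => real => 'v" where "seg u v t = u + t *\<^sub>R (v - u)"

lemma VI: "u : V ==> v : V ==> u + v : V" "u : V ==> c *\<^sub>R u : V" "u : V ==> v : V ==> u - v : V" "0 : V"
 using V by (auto simp: subspace_add subspace_scale subspace_diff subspace_0)

lemma seg_V: "u : V ==> v : V ==> seg u v t : V"
 by (simp add: seg_def VI)

lemma nm_diff_le: "u : V ==> v : V ==> nm (u - v) <= nm u + nm v"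
 using nm_triangle[of u "(-1) *\<^sub>R v"] nm_scale[of v "-1"] VI(2)[of v "-1"] by simp

lemma nm_diff_ge: "u : V ==> v : V ==> abs (nm u - nm v) <= nm (u - v)"
 using nm_triangle[of "u - v" v] nm_triangle[of "v - u" u] nm_scale[of "v - u" "-1"] VI by auto

lemma nm_zero: "nm 0 = 0" using nm_scale[of 0 0] VI by simp

lemma nm_seg: "u : V ==> v : V ==> 0 <= t ==> t <= 1 ==> nm (seg u v t) <= (1 - t) * nm u + t * nm v"
proof -
 assume uv: "u : V" "v : V" "0 <= t" "t <= 1"
 have "seg u v t = (1 - t) *\<^sub>R u + t *\<^sub>R v" by (simp add: seg_def algebra_simps)
 then show ?thesis using nm_triangle[of "(1 - t) *\<^sub>R u" "t *\<^sub>R v"] uv by (simp add: VI nm_scale)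
qed

lemma nm_seg_le: "u : V ==> v : V ==> nm u <= r ==> nm v <= r ==> 0 <= t ==> t <= 1 ==> nm (seg u v t) <= r"
 by (rule order_trans[OF nm_seg]) (auto intro: convex_bound_le)

lemma seg_diff: "seg u v t - seg u v s = (t - s) *\<^sub>R (v - u)"
 by (simp add: seg_def algebra_simps)

lemma nm_seg_continuous:
 assumes uv: "u : V" "v : V" shows "continuous_on S (%t. nm (seg u v t))"
proof (rule continuous_on_subset[of UNIV])
 have "abs (nm (seg u v t) - nm (seg u v s)) <= nm (v - u) * abs (t - s)" for t s
 proof -
  show ?thesis using nm_diff_ge[of "seg u v t" "seg u v s"] seg_V[OF uv] uv by (simp add: seg_diff nm_scale VI mult.commute)
 qed
 note lip = this
 show "continuous_on UNIV (%t. nm (seg u v t))"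
  unfolding continuous_on_iff
 proof (intro ballI allI impI)
  fix t \<epsilon> :: real assume "\<epsilon> > 0"
  moreover have n: "nm (v - u) >= 0" using uv by (simp add: nm_nonneg VI)
  ultimately show "EX d>0. ALL s:UNIV. dist s t < d --> dist (nm (seg u v s)) (nm (seg u v t)) < \<epsilon>"
  proof (intro exI[of _ "\<epsilon> / (nm (v - u) + 1)"] conjI ballI impI)
   fix s assume "dist s t < \<epsilon> / (nm (v - u) + 1)"
   then have "(nm (v - u) + 1) * abs (s - t) < \<epsilon>" using n by (simp add: dist_real_def field_simps)
   moreover have "nm (v - u) * abs (s - t) <= (nm (v - u) + 1) * abs (s - t)" by (intro mult_right_mono) auto
   ultimately show "dist (nm (seg u v s)) (nm (seg u v t)) < \<epsilon>" using lip[of s t] by (simp add: dist_real_def)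
  qed (use n in auto)
 qed
qed simp

text \<open>Paths are chains of such segments, so a path becomes an element of a reflexive
  transitive closure and needs no parametrisation.\<close>

definition edge :: "real => 'v => 'v => bool" where
 "edge \<kappa> u v \<longleftrightarrow> u : V & v : V & (ALL t. 0 <= t & t <= 1 --> I (seg u v t) <= \<kappa>)"

text \<open>Balls are convex, so the condition at the two end points controls the whole
  segment.\<close>

definition edgeR :: "real => 'v => 'v => bool" where
 "edgeR \<kappa> u v \<longleftrightarrow> edge \<kappa> u v & nm u <= R & nm v <= R"

abbreviation reach where "reach \<kappa> \<equiv> (edge \<kappa>)\<^sup>*\<^sup>* 0"

lemma edge_sub:
 assumes e: "edge \<kappa> u v" and s: "0 <= s" "s <= s'" "s' <= 1" shows "edge \<kappa> (seg u v s) (seg u v s')"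
 unfolding edge_def
proof (intro conjI allI impI)
 fix t :: real assume t: "0 <= t & t <= 1"
 have "seg (seg u v s) (seg u v s') t = seg u v (s + t * (s' - s))" by (simp add: seg_def algebra_simps)
 moreover have "t * (s' - s) <= 1 * (s' - s)" using t s by (intro mult_right_mono) auto
 ultimately show "I (seg (seg u v s) (seg u v s') t) <= \<kappa>" using e s t by (simp add: edge_def)
qed (use e in \<open>auto simp: edge_def seg_V\<close>)

lemma reach_V: "reach \<kappa> v ==> v : V"
 by (induction rule: rtranclp_induct) (auto simp: edge_def VI)

lemma reach_le: "reach \<kappa> v ==> 0 <= \<kappa> ==> I v <= \<kappa>"
proof (induction rule: rtranclp_induct)
 case (step u v)
 then have "I (seg u v 1) <= \<kappa>" by (auto simp: edge_def)
 then show ?case by (simp add: seg_def)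
qed (simp add: I0)

text \<open>A segment that leaves the ball is cut where it meets the sphere, by the intermediate
  value theorem. So a path to the outside can be exchanged for one that stays in the ball and ends
  exactly on the sphere.\<close>

lemma reach_inside: "reach \<kappa> v ==> ((edgeR \<kappa>)\<^sup>*\<^sup>* 0 v & nm v <= R) | (EX w. (edgeR \<kappa>)\<^sup>*\<^sup>* 0 w & nm w = R)"
proof (induction rule: rtranclp_induct)
 case base
 then show ?case using nm_zero r0 by simp
next
 case (step u v)
 show ?case
 proof (cases "EX w. (edgeR \<kappa>)\<^sup>*\<^sup>* 0 w & nm w = R")
  case False
  then have u: "(edgeR \<kappa>)\<^sup>*\<^sup>* 0 u" "nm u <= R" using step.IH by auto
  have V: "u : V" "v : V" using step(2) by (auto simp: edge_def)
  show ?thesis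
  proof (cases "nm v <= R")
   case True
   then show ?thesis using u step(2) by (meson edgeR_def rtranclp.rtrancl_into_rtrancl)
  next
   case False
   have "EX s>=0. s <= 1 & nm (seg u v s) = R"
    using u(2) False by (intro IVT' nm_seg_continuous V) (auto simp: seg_def)
   then obtain s where s: "0 <= s" "s <= 1" "nm (seg u v s) = R" by blast
   have "edgeR \<kappa> u (seg u v s)" using edge_sub[OF step(2) order.refl s(1,2)] u(2) s(3) by (simp add: edgeR_def seg_def)
   with u(1) have "(edgeR \<kappa>)\<^sup>*\<^sup>* 0 (seg u v s)" by (rule rtranclp.rtrancl_into_rtrancl)
   then show ?thesis using s(3) by blast
  qed
 qed simp
qed

text \<open>A path that left the small ball would cross the sphere of radius \<open>r0\<close>,
  where \<open>I\<close> is at least \<open>\<rho>0\<close>. This bounds the mountain pass level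
  from below.\<close>

lemma reach_below: "reach \<kappa> v ==> \<kappa> < \<rho>0 ==> nm v < r0"
proof (induction rule: rtranclp_induct)
 case base
 then show ?case using nm_zero r0 by simp
next
 case (step u v)
 have V: "u : V" "v : V" using step(2) by (auto simp: edge_def)
 show ?case
 proof (rule ccontr)
  assume "~nm v < r0"
  then have "EX s>=0. s <= 1 & nm (seg u v s) = r0"
   using step by (intro IVT' nm_seg_continuous V) (auto simp: seg_def)
  then obtain s where s: "0 <= s" "s <= 1" "nm (seg u v s) = r0" by blast
  then have "\<rho>0 <= I (seg u v s)" by (intro sphere seg_V V)
  moreover have "I (seg u v s) <= \<kappa>" using step(2) s by (auto simp: edge_def)
  ultimately show False using step.prems by linarith
 qed
qed

lemma dI_bound:
 assumes C: "ALL u:V. nm u <= r --> (ALL \<phi>:V. nm \<phi> <= 1 --> abs (dI u \<phi>) <= C)"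
  and u: "u : V" "nm u <= r" and \<phi>: "\<phi> : V"
 shows "abs (dI u \<phi>) <= C * nm \<phi>"
proof -
 have C0: "C >= 0" using C u VI(4) nm_zero by force
 show ?thesis
 proof (rule field_le_epsilon)
  fix x :: real assume x: "x > 0"
  \<comment> \<open>Since \<open>nm\<close> is only a seminorm, \<open>\<phi>\<close> is normalised
    by a number slightly larger than \<open>nm \<phi>\<close>, which may be zero.\<close>
  define s where "s = nm \<phi> + x / (C + 1)"
  have s: "s > 0" "nm \<phi> <= s" using x C0 nm_nonneg[OF \<phi>] by (auto simp: s_def add_nonneg_pos)
  have "nm ((1 / s) *\<^sub>R \<phi>) <= 1" using s nm_nonneg[OF \<phi>] by (simp add: nm_scale[OF \<phi>])
  then have "abs (dI u ((1 / s) *\<^sub>R \<phi>)) <= C" using C u \<phi> by (simp add: VI)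
  then have "abs (dI u \<phi>) <= C * s" using s by (simp add: dI_scale[OF u(1) \<phi>] abs_mult field_simps)
  also have "C * s = C * nm \<phi> + C * (x / (C + 1))" by (simp add: s_def algebra_simps)
  also have "C * (x / (C + 1)) <= x" using C0 x by (simp add: field_simps)
  finally show "abs (dI u \<phi>) <= C * nm \<phi> + x" by simp
 qed
qed

lemma mvt:
 assumes "u : V" "\<phi> : V" "s > 0"
 obtains \<theta> where "0 < \<theta>" "\<theta> < s" "I (u + s *\<^sub>R \<phi>) - I u = s * dI (u + \<theta> *\<^sub>R \<phi>) \<phi>"
 using MVT2[of 0 s "%t. I (u + t *\<^sub>R \<phi>)" "%t. dI (u + t *\<^sub>R \<phi>) \<phi>"] deriv[OF assms(1,2)] assms(3) by auto

lemma I_Lipschitz: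
 assumes C: "ALL u:V. nm u <= r --> (ALL \<phi>:V. nm \<phi> <= 1 --> abs (dI u \<phi>) <= C)"
  and u: "u : V" "nm u <= r" and v: "v : V" "nm v <= r"
 shows "abs (I v - I u) <= C * nm (v - u)"
proof -
 obtain t where t: "0 < t" "t < 1" "I (u + 1 *\<^sub>R (v - u)) - I u = 1 * dI (u + t *\<^sub>R (v - u)) (v - u)"
  using mvt[of u "v - u" 1] u v VI by auto
 have "nm (seg u v t) <= r" using t u v by (intro nm_seg_le) auto
 then have "nm (u + t *\<^sub>R (v - u)) <= r" by (simp add: seg_def)
 then show ?thesis using t(3) dI_bound[OF C, of "u + t *\<^sub>R (v - u)" "v - u"] u v VI by simp
qed

theorem critical_sequence:
 shows "EX c. \<rho>0 <= c & c <= M & (ALL \<epsilon>>0. EX u:V. nm u <= R & abs (I u - c) <= \<epsilon> & (ALL \<phi>:V. nm \<phi> <= 1 --> abs (dI u \<phi>) <= \<epsilon>))"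
proof -
 \<comment> \<open>The levels at which the outside of the ball of radius \<open>R\<close> can be
   reached from 0; the mountain pass level is their infimum.\<close>
 define L where "L = {\<kappa>. EX v. reach \<kappa> v & R <= nm v}"
 have MinL: "M : L"
 proof -
  have "edge M 0 e" using e by (auto simp: edge_def seg_def VI)
  then show ?thesis using e(2) unfolding L_def by blast
 qed
 have Lge: "\<rho>0 <= \<kappa>" if "\<kappa> : L" for \<kappa>
  using that reach_below[of \<kappa>] r0 unfolding L_def by force
 define c where "c = Inf L"
 have bb: "bdd_below L" using Lge by (intro bdd_belowI)
 have c1: "\<rho>0 <= c" unfolding c_def using MinL Lge by (intro cInf_greatest) auto
 have c2: "c <= M" unfolding c_def using MinL bb by (rule cInf_lower)
 have "EX u:V. nm u <= R & abs (I u - c) <= \<epsilon>1 & (ALL \<phi>:V. nm \<phi> <= 1 --> abs (dI u \<phi>) <= \<epsilon>1)" if \<epsilon>1: "\<epsilon>1 > 0" for \<epsilon>1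
 proof (rule ccontr)
  assume none: "~?thesis"
  \<comment> \<open>The choice below \<open>\<rho>0\<close> keeps the starting point 0 out of the
    zone, because \<open>I 0 = 0\<close> while \<open>c\<close> is at least \<open>\<rho>0\<close>.
    The deformation therefore fixes the start of every path.\<close>
  define \<epsilon> where "\<epsilon> = min \<epsilon>1 (min 1 (\<rho>0 / 2))"
  have \<epsilon>: "0 < \<epsilon>" "\<epsilon> <= 1" "\<epsilon> < \<rho>0" "\<epsilon> <= \<epsilon>1" using \<epsilon>1 \<rho>0 by (auto simp: \<epsilon>_def)
  define zone where "zone u \<longleftrightarrow> u : V & nm u <= R & abs (I u - c) <= \<epsilon>" for u
  have desc: "EX \<phi>:V. nm \<phi> <= 1 & dI u \<phi> < - \<epsilon>" if "zone u" for u
  proof -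
   have "u : V" "nm u <= R" "abs (I u - c) <= \<epsilon>1" using that \<epsilon>(4) by (auto simp: zone_def)
   then have "~(ALL \<phi>:V. nm \<phi> <= 1 --> abs (dI u \<phi>) <= \<epsilon>1)" using none by blast
   then obtain \<phi> where \<phi>: "\<phi> : V" "nm \<phi> <= 1" "~abs (dI u \<phi>) <= \<epsilon>1" by blast
   then have \<phi>3: "abs (dI u \<phi>) > \<epsilon>" using \<epsilon>(4) by linarith
   show ?thesis
   proof (cases "dI u \<phi> < 0")
    case False
    then show ?thesis using \<phi> \<phi>3 dI_scale[of u \<phi> "-1"] nm_scale[of \<phi> "-1"] VI(2)[of \<phi> "-1"] that
     by (intro bexI[of _ "- \<phi>"]) (auto simp: zone_def)
   next
    case True
    then show ?thesis using \<phi> \<phi>3 by (intro bexI[of _ \<phi>]) auto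
   qed
  qed
  \<comment> \<open>A descent direction is chosen at each point of the zone without any continuity.
    Only its values at the vertices matter; along an edge they are interpolated linearly.\<close>
  define \<Phi> where "\<Phi> u = (if zone u then SOME \<phi>. \<phi> : V & nm \<phi> <= 1 & dI u \<phi> < - \<epsilon> else 0)" for u
  have \<Phi>z: "\<Phi> u : V & nm (\<Phi> u) <= 1 & dI u (\<Phi> u) < - \<epsilon>" if "zone u" for u
   unfolding \<Phi>_def using that someI_ex[of "%\<phi>. \<phi> : V & nm \<phi> <= 1 & dI u \<phi> < - \<epsilon>"] desc[OF that] by auto
  have \<Phi>n: "\<Phi> u = 0" if "~zone u" for u using that by (simp add: \<Phi>_def)
  have \<Phi>V: "\<Phi> u : V" "nm (\<Phi> u) <= 1" for u
   by (cases "zone u"; use \<Phi>z[of u] \<Phi>n[of u] nm_zero VI(4) in force)+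
  obtain \<eta> where \<eta>: "\<eta> > 0" "!!u v \<phi>. u : V ==> v : V ==> nm u <= R + 1 ==> nm v <= R + 1 ==> nm (u - v) <= \<eta> ==>
   \<phi> : V ==> nm \<phi> <= 1 ==> abs (dI u \<phi> - dI v \<phi>) <= \<epsilon> / 4"
   using uc[of "\<epsilon> / 4" "R + 1"] \<epsilon> by auto
  obtain C0 where C0: "ALL u:V. nm u <= R --> (ALL \<phi>:V. nm \<phi> <= 1 --> abs (dI u \<phi>) <= C0)" using bnd by blast
  define C where "C = max C0 1"
  have C: "ALL u:V. nm u <= R --> (ALL \<phi>:V. nm \<phi> <= 1 --> abs (dI u \<phi>) <= C)" "C > 0"
   using C0 by (force simp: C_def)+
  \<comment> \<open>\<open>s\<close> is the length of the Euler step and \<open>h\<close> the mesh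
    of the subdivision. Together they displace a point by at most \<open>\<eta>\<close>, and over
    the distance \<open>h\<close> the functional changes by at most \<epsilon> / 4.\<close>
  define s where "s = min 1 (\<eta> / 2)"
  have s: "0 < s" "s <= 1" "s <= \<eta> / 2" using \<eta> by (auto simp: s_def)
  define h where "h = min (\<eta> / 2) (\<epsilon> / (4 * C))"
  have h: "0 < h" "h <= \<eta> / 2" "C * h <= \<epsilon> / 4"
  proof -
   have "h <= \<epsilon> / (4 * C)" by (simp add: h_def)
   then show "C * h <= \<epsilon> / 4" using C(2) by (simp add: field_simps)
  qed (use \<eta> \<epsilon> C in \<open>auto simp: h_def\<close>)
  obtain \<kappa>1 where \<kappa>1: "\<kappa>1 : L" "\<kappa>1 < c + s * \<epsilon> / 4"
  proof -
   have "Inf L < c + s * \<epsilon> / 4" using s \<epsilon> by (simp add: c_def)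
   then show thesis using cInf_lessD[of L] MinL that by blast
  qed
  have se: "s * \<epsilon> <= \<epsilon>" using s \<epsilon> by (simp add: mult_left_le_one_le)
  define \<kappa>2 where "\<kappa>2 = c - s * \<epsilon> / 2"
  have step: "edge \<kappa>2 (a + s *\<^sub>R \<Phi> a) (b + s *\<^sub>R \<Phi> b)"
   if ab: "edge \<kappa>1 a b" "nm a <= R" "nm b <= R" "nm (b - a) <= h" for a b
  proof -
   have V: "a : V" "b : V" using ab by (auto simp: edge_def)
   have "I (seg (a + s *\<^sub>R \<Phi> a) (b + s *\<^sub>R \<Phi> b) t) <= \<kappa>2" if t: "0 <= t" "t <= 1" for t
   proof -
    define p where "p = seg a b t"
    define \<Psi> where "\<Psi> = (1 - t) *\<^sub>R \<Phi> a + t *\<^sub>R \<Phi> b"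
    have pV: "p : V" "\<Psi> : V" by (auto simp: p_def \<Psi>_def VI \<Phi>V seg_V V)
    have eq: "seg (a + s *\<^sub>R \<Phi> a) (b + s *\<^sub>R \<Phi> b) t = p + s *\<^sub>R \<Psi>"
     by (simp add: p_def \<Psi>_def seg_def algebra_simps)
    have np: "nm p <= R" unfolding p_def using t ab V by (intro nm_seg_le) auto
   have n\<Psi>: "nm \<Psi> <= 1"
    proof -
     have "nm \<Psi> <= (1 - t) * nm (\<Phi> a) + t * nm (\<Phi> b)"
      using nm_triangle[of "(1 - t) *\<^sub>R \<Phi> a" "t *\<^sub>R \<Phi> b"] t by (simp add: \<Psi>_def VI \<Phi>V nm_scale)
     also have "... <= (1 - t) * 1 + t * 1" using t \<Phi>V by (intro add_mono mult_left_mono) auto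
     finally show ?thesis by simp
    qed
    have Ip: "I p <= \<kappa>1" using ab(1) t by (simp add: edge_def p_def)
    have pa: "nm (p - a) <= h" "nm (p - b) <= h"
    proof -
     have "p - a = t *\<^sub>R (b - a)" "p - b = (t - 1) *\<^sub>R (b - a)" by (simp_all add: p_def seg_def algebra_simps)
     then have "nm (p - a) = t * nm (b - a)" "nm (p - b) = (1 - t) * nm (b - a)"
      using t V by (simp_all add: nm_scale VI)
     moreover have "t * nm (b - a) <= 1 * nm (b - a)" "(1 - t) * nm (b - a) <= 1 * nm (b - a)"
      using t nm_nonneg[of "b - a"] V by (intro mult_right_mono; simp add: VI)+
     ultimately show "nm (p - a) <= h" "nm (p - b) <= h" using ab(4) by linarith+
    qed
    obtain \<theta> where \<theta>: "0 < \<theta>" "\<theta> < s" "I (p + s *\<^sub>R \<Psi>) - I p = s * dI (p + \<theta> *\<^sub>R \<Psi>) \<Psi>"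
     using mvt[OF pV s(1)] by blast
    define z where "z = p + \<theta> *\<^sub>R \<Psi>"
    have zV: "z : V" using pV by (simp add: z_def VI)
    have nt: "nm (\<theta> *\<^sub>R \<Psi>) <= s"
    proof -
     have "nm (\<theta> *\<^sub>R \<Psi>) <= \<theta> * 1" using \<theta> n\<Psi> pV by (simp add: nm_scale)
     then show ?thesis using \<theta> by simp
    qed
    have nz: "nm z <= R + 1" using nm_triangle[of p "\<theta> *\<^sub>R \<Psi>"] nt np s pV by (simp add: z_def VI)
    have zx: "nm (z - x) <= \<eta>" if "x : V" "nm (p - x) <= h" for x
    proof -
     have "z - x = (p - x) + \<theta> *\<^sub>R \<Psi>" by (simp add: z_def)
     then have "nm (z - x) <= nm (p - x) + nm (\<theta> *\<^sub>R \<Psi>)"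
      using nm_triangle[of "p - x" "\<theta> *\<^sub>R \<Psi>"] that(1) pV by (simp only: VI)
     then show ?thesis using nt that(2) h(2) s(3) by linarith
    qed
    have dz: "dI z (\<Phi> x) <= (if zone x then - (3 * \<epsilon> / 4) else 0)" if x: "x : V" "nm (p - x) <= h" "nm x <= R" for x
    proof (cases "zone x")
     case True
     have "abs (dI z (\<Phi> x) - dI x (\<Phi> x)) <= \<epsilon> / 4" using \<eta>(2)[OF zV x(1) nz _ zx[OF x(1,2)] \<Phi>V] x(3) by simp
     moreover have "dI x (\<Phi> x) < - \<epsilon>" using \<Phi>z[OF True] by blast
     ultimately have "dI z (\<Phi> x) <= - (3 * \<epsilon> / 4)" by linarith
     then show ?thesis using True by simp
    next
     case False
     then show ?thesis using \<Phi>n[OF False] dI_scale[OF zV VI(4), of 0] by simp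
    qed
    have d\<Psi>: "dI z \<Psi> = (1 - t) * dI z (\<Phi> a) + t * dI z (\<Phi> b)"
     unfolding \<Psi>_def using zV by (simp add: dI_add dI_scale VI \<Phi>V)
    show ?thesis
    \<comment> \<open>If \<open>p\<close> is near the critical level, both vertices lie in the zone
      and the step gains at least 3 s \<epsilon> / 4, which outweighs the excess s \<epsilon> / 4 of
      \<open>\<kappa>1\<close>. If \<open>p\<close> is already low, the step only must not raise
      \<open>I\<close>, and a vertex outside the zone contributes nothing.\<close>
    proof (cases "I p >= c - \<epsilon> / 2")
     case True
     have zn: "zone x" if x: "x : V" "nm (p - x) <= h" "nm x <= R" "I x <= \<kappa>1" for x
     proof -
      have "abs (I p - I x) <= C * nm (p - x)" by (rule I_Lipschitz[OF C(1) x(1,3) pV(1) np])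
      also have "... <= C * h" using x(2) C(2) by (intro mult_left_mono) auto
      finally have "abs (I p - I x) <= \<epsilon> / 4" using h by linarith
      then have "abs (I x - c) <= \<epsilon>" using True x(4) \<kappa>1(2) se \<epsilon> by linarith
      then show ?thesis using x by (simp add: zone_def)
     qed
     have "I (seg a b 0) <= \<kappa>1" "I (seg a b 1) <= \<kappa>1" using ab(1) by (auto simp: edge_def)
     then have "I a <= \<kappa>1" "I b <= \<kappa>1" by (simp_all add: seg_def)
     then have "zone a" "zone b" using zn V pa ab by blast+
     then have "dI z (\<Phi> a) <= - (3 * \<epsilon> / 4)" "dI z (\<Phi> b) <= - (3 * \<epsilon> / 4)"
      using dz[OF V(1) pa(1) ab(2)] dz[OF V(2) pa(2) ab(3)] by auto
     then have "dI z \<Psi> <= (1 - t) * - (3 * \<epsilon> / 4) + t * - (3 * \<epsilon> / 4)"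
      unfolding d\<Psi> using t by (intro add_mono mult_left_mono) auto
     also have "(1 - t) * - (3 * \<epsilon> / 4) + t * - (3 * \<epsilon> / 4) = - (3 * \<epsilon> / 4)"
      by (simp only: left_diff_distrib)
     finally have "dI z \<Psi> <= - (3 * \<epsilon> / 4)" .
     then have "s * dI z \<Psi> <= s * - (3 * \<epsilon> / 4)" using s by (intro mult_left_mono) auto
     then show ?thesis unfolding eq using \<theta>(3) Ip \<kappa>1(2) by (simp add: z_def[symmetric] \<kappa>2_def)
    next
     case False
     have "dI z (\<Phi> a) <= 0" "dI z (\<Phi> b) <= 0"
      using dz[OF V(1) pa(1) ab(2)] dz[OF V(2) pa(2) ab(3)] \<epsilon> by (auto split: if_splits)
     then have "dI z \<Psi> <= (1 - t) * 0 + t * 0"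
      unfolding d\<Psi> using t by (intro add_mono mult_left_mono) auto
     then have "s * dI z \<Psi> <= 0" using s by (simp add: mult_nonneg_nonpos)
     then show ?thesis unfolding eq using \<theta>(3) False se by (simp add: z_def[symmetric] \<kappa>2_def)
    qed
   qed
   then show ?thesis by (auto simp: edge_def VI V \<Phi>V)
  qed
  have long: "reach \<kappa>2 (b + s *\<^sub>R \<Phi> b)" if ab: "edgeR \<kappa>1 a b" "reach \<kappa>2 (a + s *\<^sub>R \<Phi> a)" for a b
  proof -
   have V: "a : V" "b : V" and nab: "nm a <= R" "nm b <= R" and ed: "edge \<kappa>1 a b" using ab by (auto simp: edge_def edgeR_def)
   obtain N :: nat where N: "nm (b - a) / h < real N" using reals_Archimedean2 by blast
   have N0: "N > 0" using N h nm_nonneg[of "b - a"] V by (cases "N = 0") (auto simp: VI divide_less_0_iff)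
   define x where "x i = seg a b (real i / real N)" for i
   have xx: "x (Suc i) - x i = (1 / real N) *\<^sub>R (b - a)" for i
   by (simp add: x_def seg_diff flip: diff_divide_distrib)
  have nx: "nm (x i) <= R" if "i <= N" for i
   unfolding x_def using that N0 by (intro nm_seg_le V nab) auto
  have "reach \<kappa>2 (x i + s *\<^sub>R \<Phi> (x i))" if "i <= N" for i
    using that
   proof (induction i)
    case 0
    then show ?case using ab(2) by (simp add: x_def seg_def)
   next
    case (Suc i)
    have ed2: "edge \<kappa>1 (x i) (x (Suc i))"
    unfolding x_def using Suc.prems N0 by (intro edge_sub[OF ed] divide_right_mono) auto
   have "nm (x (Suc i) - x i) <= h"
    proof -
     have "nm ((1 / real N) *\<^sub>R (b - a)) = (1 / real N) * nm (b - a)" using V by (subst nm_scale) (auto simp: VI)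
     also have "... <= h" using N N0 h by (simp add: field_simps)
     finally show ?thesis unfolding xx .
    qed
    then have "edge \<kappa>2 (x i + s *\<^sub>R \<Phi> (x i)) (x (Suc i) + s *\<^sub>R \<Phi> (x (Suc i)))"
     using Suc.prems by (intro step ed2 nx) auto
    then show ?case using Suc by (meson Suc_leD rtranclp.rtrancl_into_rtrancl)
   qed
   from this[of N] show ?thesis using N0 by (simp add: x_def seg_def)
  qed
  have all: "reach \<kappa>2 (w + s *\<^sub>R \<Phi> w)" if "(edgeR \<kappa>1)\<^sup>*\<^sup>* 0 w" for w
   using that
  proof (induction rule: rtranclp_induct)
   case base
   have "~zone 0" using I0 c1 \<epsilon> by (simp add: zone_def)
   then show ?case using \<Phi>n by simp
  qed (use long in blast)
  obtain v where "reach \<kappa>1 v" "R <= nm v" using \<kappa>1(1) by (auto simp: L_def)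
  then have "EX w. (edgeR \<kappa>1)\<^sup>*\<^sup>* 0 w & nm w = R" using reach_inside[of \<kappa>1 v] by auto
  then obtain w where w: "(edgeR \<kappa>1)\<^sup>*\<^sup>* 0 w" "nm w = R" by blast
  define v' where "v' = w + s *\<^sub>R \<Phi> w"
  have rv: "reach \<kappa>2 v'" using all[OF w(1)] by (simp add: v'_def)
  have wV: "w : V" using w(1)
   by (induction rule: rtranclp_induct) (auto simp: edgeR_def edge_def VI)
  have vV: "v' : V" using reach_V[OF rv] .
  have nv: "R - 1 <= nm v'"
  proof -
   have "nm (s *\<^sub>R \<Phi> w) <= 1 * 1" using s \<Phi>V nm_nonneg[OF \<Phi>V(1)] by (subst nm_scale[OF \<Phi>V(1)]) (intro mult_mono, auto)
   moreover have "w = v' - s *\<^sub>R \<Phi> w" by (simp add: v'_def)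
   ultimately show ?thesis using nm_diff_le[of v' "s *\<^sub>R \<Phi> w"] vV w(2) \<Phi>V VI by simp
  qed
  have sp: "s * \<epsilon> > 0" using s \<epsilon> by simp
  have k0: "0 <= \<kappa>2" unfolding \<kappa>2_def using c1 se \<epsilon> by linarith
  have Iv: "I v' <= \<kappa>2" using reach_le[OF rv k0] .
  have k2M: "\<kappa>2 <= M + 1" unfolding \<kappa>2_def using c2 sp by linarith
  \<comment> \<open>The Euler step has length at most 1, so the end point still has norm at least R
    - 1, and this factor restores norm \<open>R\<close>.\<close>
  define T where "T = R / (R - 1)"
  have T: "T >= 1" "T * (R - 1) = R" using r0 by (auto simp: T_def field_simps)
  have "edge \<kappa>2 v' (T *\<^sub>R v')"
   unfolding edge_def
  proof (intro conjI allI impI)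
   fix t :: real assume t: "0 <= t & t <= 1"
   have "seg v' (T *\<^sub>R v') t = (1 + t * (T - 1)) *\<^sub>R v'" by (simp add: seg_def algebra_simps)
   moreover have "1 + t * (T - 1) >= 1" using t T by simp
   ultimately have "I (seg v' (T *\<^sub>R v') t) <= I v'" using ray[OF vV nv] Iv k2M by simp
   then show "I (seg v' (T *\<^sub>R v') t) <= \<kappa>2" using Iv by simp
  qed (use vV in \<open>auto simp: VI\<close>)
  then have "reach \<kappa>2 (T *\<^sub>R v')" using rv by (meson rtranclp.rtrancl_into_rtrancl)
  moreover have "R <= nm (T *\<^sub>R v')"
  proof -
   have "T * (R - 1) <= T * nm v'" using nv T by (intro mult_left_mono) auto
   then show ?thesis using T vV by (simp add: nm_scale)
  qed
  ultimately have "\<kappa>2 : L" by (auto simp: L_def)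
  then have "c <= \<kappa>2" unfolding c_def using bb by (rule cInf_lower)
  then show False unfolding \<kappa>2_def using sp by linarith
 qed
 then show ?thesis using c1 c2 by blast
qed

end

subsection \<open>Cauchy--Schwarz and averages\<close>

text \<open>The discriminant criterion, including the degenerate leading coefficient: the forms to
  which it is applied are a priori only semidefinite.\<close>

lemma quadratic_nonneg_imp:
 fixes a b c :: real
 assumes "!!t. 0 <= a - 2 * t * b + t^2 * c" "c >= 0"
 shows "b^2 <= a * c"
proof (cases "c = 0")
 case True
 have "b = 0"
 proof (rule ccontr)
  assume "b ~= 0"
  then have "2 * ((a + 1) / (2 * b)) * b = a + 1" by simp
  then show False using assms(1)[of "(a + 1) / (2 * b)"] True by simp
 qed
 then show ?thesis using True by simp
next
 case False
 then have c: "c > 0" using assms(2) by simp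
 have "0 <= c * (a - 2 * (b / c) * b + (b / c)^2 * c)" using assms(1)[of "b / c"] c by simp
 also have "... = a * c - b^2" using c by (simp add: field_simps power2_eq_square)
 finally show ?thesis by simp
qed

lemma integral_Cauchy_Schwarz:
 fixes f g :: "'a => real"
 assumes f: "integrable M (%x. (f x)^2)" and g: "integrable M (%x. (g x)^2)" and fg: "integrable M (%x. f x * g x)"
 shows "(LINT x|M. f x * g x)^2 <= (LINT x|M. (f x)^2) * (LINT x|M. (g x)^2)"
proof (rule quadratic_nonneg_imp)
 fix t
 have "0 <= (LINT x|M. (f x - t * g x)^2)" by (intro integral_nonneg_AE) auto
 also have "(%x. (f x - t * g x)^2) = (%x. (f x)^2 - 2 * t * (f x * g x) + t^2 * (g x)^2)"
  by (auto simp: power2_eq_square algebra_simps)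
 also have "(LINT x|M. (f x)^2 - 2 * t * (f x * g x) + t^2 * (g x)^2) =
   (LINT x|M. (f x)^2) - 2 * t * (LINT x|M. f x * g x) + t^2 * (LINT x|M. (g x)^2)"
  using f g fg by simp
 finally show "0 <= (LINT x|M. (f x)^2) - 2 * t * (LINT x|M. f x * g x) + t^2 * (LINT x|M. (g x)^2)" .
qed (auto intro: integral_nonneg_AE)

definition avg :: "'a measure => 'a set => ('a => real) => real" where
 "avg M A f = (LINT x|M. indicator A x * f x) / measure M A"

locale averaging_set =
 fixes M :: "'a measure" and A :: "'a set"
 assumes A[measurable]: "A : sets M" and finA: "emeasure M A < \<infinity>" and posA: "measure M A > 0"
begin

text \<open>Boundedness on a set of finite measure gives the integrability of \<open>f\<close> and
  of its square on \<open>A\<close> at once.\<close>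

definition sq :: "('a => real) => bool" where
 "sq f \<longleftrightarrow> f : borel_measurable M & (EX B. ALL x:space M. abs (f x) <= B)"

lemma int_ind: "sq f ==> integrable M (%x. indicator A x * f x)"
proof -
 assume "sq f"
 then obtain B where f[measurable]: "f : borel_measurable M" and B: "!!x. x : space M ==> abs (f x) <= B" by (auto simp: sq_def)
 have "integrable M (%x. B * indicator A x)" using finA by (intro integrable_mult_right) simp
 then show ?thesis
  by (rule Bochner_Integration.integrable_bound) (use B in \<open>auto simp: indicator_def intro!: AE_I2 order_trans[OF B abs_ge_self]\<close>)
qed

lemma sq_const: "sq (%x. c)" by (auto simp: sq_def)

lemma sq_diff: "sq f ==> sq g ==> sq (%x. f x - g x)"
 unfolding sq_def by (auto intro!: borel_measurable_diff) (meson abs_triangle_ineq4 add_mono order_trans)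

lemma sq_power2: "sq f ==> sq (%x. (f x)^2)"
proof -
 assume "sq f"
 then obtain B where f: "f : borel_measurable M" and B: "!!x. x : space M ==> abs (f x) <= B" by (auto simp: sq_def)
 have "abs ((f x)^2) <= B^2" if "x : space M" for x using power_mono[OF B[OF that], of 2] by simp
 then show ?thesis unfolding sq_def using f by (intro conjI exI[of _ "B^2"]) auto
qed

text \<open>The decomposition of a second moment into variance and squared bias. It shows both that
  the mean is the best constant and that the mean is close to any constant that approximates
  \<open>f\<close> in L2.\<close>

lemma variance_eq:
 assumes f: "sq f"
 shows "(LINT x|M. indicator A x * (f x - c)^2) = (LINT x|M. indicator A x * (f x - avg M A f)^2) + (avg M A f - c)^2 * measure M A"
proof -
 have i: "integrable M (%x. indicator A x * f x)" "integrable M (%x. indicator A x * (f x)^2)" "integrable M (indicator A :: 'a => real)"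
  using int_ind[OF f] int_ind[OF sq_power2[OF f]] int_ind[OF sq_const[of 1]] by simp_all
 have *: "(LINT x|M. indicator A x * (f x - d)^2) = (LINT x|M. indicator A x * (f x)^2) - 2 * d * (avg M A f * measure M A) + d^2 * measure M A" for d
 proof -
  have "(LINT x|M. indicator A x * (f x - d)^2) = (LINT x|M. indicator A x * (f x)^2 - 2 * d * (indicator A x * f x) + d^2 * indicator A x)"
   by (intro Bochner_Integration.integral_cong) (auto simp: power2_eq_square algebra_simps)
  also have "... = (LINT x|M. indicator A x * (f x)^2) - 2 * d * (LINT x|M. indicator A x * f x) + d^2 * (LINT x|M. indicator A x)"
   using i by simp
  finally show ?thesis using A posA by (simp add: avg_def)
 qed
 show ?thesis unfolding * by (simp add: power2_eq_square algebra_simps)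
qed

lemma variance_le:
 "sq f ==> (LINT x|M. indicator A x * (f x - avg M A f)^2) <= (LINT x|M. indicator A x * (f x - c)^2)"
 using variance_eq[of f c] by simp

lemma avg_diff_const_le:
 assumes "sq f" shows "(avg M A f - c)^2 <= (LINT x|M. indicator A x * (f x - c)^2) / measure M A"
proof -
 have "0 <= (LINT x|M. indicator A x * (f x - avg M A f)^2)" by (intro integral_nonneg_AE) auto
 then show ?thesis using variance_eq[OF assms, of c] posA by (simp add: pos_le_divide_eq)
qed

lemma avg_diff: "sq f ==> sq g ==> avg M A (%x. f x - g x) = avg M A f - avg M A g"
 using int_ind[of f] int_ind[of g] by (simp add: avg_def right_diff_distrib diff_divide_distrib)

end

subsection \<open>Radial measures on the unit interval\<close>

text \<open>The law of |x| for a uniformly distributed point x of the unit ball of R^k, k > 0.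
  Normalised to total mass 1, it turns block-radial integrals into integrals over a product measure
  with a single constant in front.\<close>

definition rmeas :: "nat => real measure" where
 "rmeas k = density lborel (%r. ennreal (indicator {0..1} r * (real k * r ^ (k - 1))))"

lemma sets_rmeas[measurable_cong, simp]: "sets (rmeas k) = sets borel" by (simp add: rmeas_def)
lemma space_rmeas[simp]: "space (rmeas k) = UNIV" by (simp add: rmeas_def)

lemma rmeas_integral:
 assumes [measurable]: "g : borel_measurable borel"
 shows "(\<integral>r. g r \<partial>rmeas k) = (LBINT r. indicator {0..1} r * (real k * r ^ (k - 1)) * g r)"
 unfolding rmeas_def by (subst integral_density) (auto intro!: AE_I2 simp: indicator_def)

lemma emeasure_rmeas_Icc:
 assumes k: "k > 0" and ab: "0 <= a" "a <= b" "b <= 1"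
 shows "emeasure (rmeas k) {a..b} = ennreal (b ^ k - a ^ k)"
proof -
 have "emeasure (rmeas k) {a..b} = (\<integral>\<^sup>+r. ennreal (real k * r ^ (k - 1)) * indicator {a..b} r \<partial>lborel)"
  unfolding rmeas_def using ab by (subst emeasure_density) (auto intro!: nn_integral_cong simp: indicator_def)
 also have "... = ennreal (b ^ k - a ^ k)"
  using ab by (intro nn_integral_FTC_Icc) (auto intro!: derivative_eq_intros simp: field_simps)
 finally show ?thesis .
qed

lemma rmeas_AE_neq: "AE r in rmeas k. r ~= a"
 unfolding rmeas_def by (subst AE_density) (auto intro: AE_mp[OF AE_lborel_singleton[of a]])

lemma emeasure_rmeas_Ico:
 assumes k: "k > 0" and ab: "0 <= a" "a <= b" "b <= 1"
 shows "emeasure (rmeas k) {a..<b} = ennreal (b ^ k - a ^ k)"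
proof -
 have "emeasure (rmeas k) {a..<b} = emeasure (rmeas k) {a..b}"
  using rmeas_AE_neq[of b k] by (intro emeasure_eq_AE) (auto elim!: eventually_mono)
 then show ?thesis using emeasure_rmeas_Icc[OF assms] by simp
qed

lemma rmeas_prob: "k > 0 ==> emeasure (rmeas k) UNIV = 1"
proof -
 assume k: "k > 0"
 have "AE r in rmeas k. r : {0..1}" unfolding rmeas_def by (subst AE_density) (auto simp: indicator_def)
 then have "emeasure (rmeas k) UNIV = emeasure (rmeas k) {0..1}" by (intro emeasure_eq_AE) (auto elim!: eventually_mono)
 then show ?thesis using emeasure_rmeas_Icc[of k 0 1] k by simp
qed

lemma rmeas_AE_unit: "AE r in rmeas k. 0 <= r & r <= 1"
 unfolding rmeas_def by (subst AE_density) (auto simp: indicator_def)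

lemma finite_measure_rmeas: "k > 0 ==> finite_measure (rmeas k)"
 using rmeas_prob by (intro finite_measureI) auto

text \<open>The derivative is split as sqrt g times w' / sqrt g before Cauchy-Schwarz. The free
  weight is constant in the Poincare inequality and a power in the Hardy inequality.\<close>

lemma FTC_Cauchy_Schwarz:
 fixes w w' g :: "real => real"
 assumes r: "r <= b" and w: "!!r. (w has_real_derivative w' r) (at r)" and w': "continuous_on UNIV w'"
  and g: "continuous_on {r..b} g" "!!t. r <= t ==> t <= b ==> 0 < g t"
 shows "(w r - w b)^2 <= (LBINT t. indicator {r..b} t * g t) * (LBINT t. indicator {r..b} t * ((w' t)^2 / g t))"
proof -
 have ii: "integrable lborel (%t. indicator {r..b} t * f t)" if "continuous_on {r..b} f" for f :: "real => real"
  using borel_integrable_compact[OF compact_Icc that] by simp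
 have w'': "continuous_on {r..b} w'" using w' continuous_on_subset by blast
 have g0: "g t ~= 0" "sqrt (g t) ~= 0" "(sqrt (g t))^2 = g t" if "t : {r..b}" for t using g(2)[of t] that by auto
 have e: "(indicator {r..b} t * sqrt (g t))^2 = indicator {r..b} t * g t"
  "(indicator {r..b} t * (w' t / sqrt (g t)))^2 = indicator {r..b} t * ((w' t)^2 / g t)"
  "(indicator {r..b} t * sqrt (g t)) * (indicator {r..b} t * (w' t / sqrt (g t))) = indicator {r..b} t * w' t" for t
  using g0[of t] by (auto simp: indicator_def power_divide)
 have "(LBINT t. indicator {r..b} t * w' t) = w b - w r"
  using integral_FTC_Icc_real[of r b w w'] r w w' by (auto simp: continuous_on_eq_continuous_at mult.commute)
 moreover have "(LBINT t. indicator {r..b} t * w' t)^2 <= (LBINT t. indicator {r..b} t * g t) * (LBINT t. indicator {r..b} t * ((w' t)^2 / g t))"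
  by (rule integral_Cauchy_Schwarz[of lborel "%t. indicator {r..b} t * sqrt (g t)" "%t. indicator {r..b} t * (w' t / sqrt (g t))", unfolded e]; rule ii)
   (use g0(1) in \<open>auto intro!: continuous_intros g(1) w''\<close>)
 ultimately show ?thesis by (simp add: power2_commute)
qed

text \<open>Since \<open>t\<^sup>m\<close> is increasing, the weight can be moved inside the integral, uniformly in the
 distance of the interval from the origin.\<close>

lemma weighted_FTC_bound:
 fixes w w' :: "real => real"
 assumes r: "0 <= r" "r <= b"
  and w: "!!r. (w has_real_derivative w' r) (at r)" and w': "continuous_on UNIV w'"
 shows "r ^ m * (w r - w b)^2 <= (b - r) * (LBINT t. indicator {r..b} t * ((w' t)^2 * t ^ m))"
proof -
 have ii: "integrable lborel (%t. indicator {r..b} t * f t)" if "continuous_on UNIV f" for f :: "real => real"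
  using borel_integrable_compact[of "{r..b}" f] continuous_on_subset[OF that] by simp
 have "r ^ m * (w r - w b)^2 <= r ^ m * ((b - r) * (LBINT t. indicator {r..b} t * (w' t)^2))"
  using FTC_Cauchy_Schwarz[OF r(2) w w', of "%t. 1"] r by (intro mult_left_mono) auto
 also have "... = (b - r) * (LBINT t. r ^ m * (indicator {r..b} t * (w' t)^2))" by simp
 also have "... <= (b - r) * (LBINT t. indicator {r..b} t * ((w' t)^2 * t ^ m))"
 proof (intro mult_left_mono integral_mono)
  show "r ^ m * (indicator {r..b} t * (w' t)^2) <= indicator {r..b} t * ((w' t)^2 * t ^ m)" for t
   using r power_mono[of r t m] by (auto simp: indicator_def mult.commute intro!: mult_right_mono)
 qed (use r in \<open>auto intro!: integrable_mult_right ii continuous_intros w'\<close>)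
 finally show ?thesis .
qed

text \<open>Below the sharp exponent 2, Hardy's inequality follows from a pointwise bound:
  Cauchy-Schwarz with a power weight bounds \<open>r ^ (k - 1) * (w r)^2\<close> by a multiple of a
  power of r that remains integrable after multiplication by r^(-\<kappa>).\<close>

lemma rmeas_Hardy:
 fixes w w' :: "real => real"
 assumes k: "2 <= k" and \<kappa>: "0 < \<kappa>" "\<kappa> < 2"
  and w: "!!r. (w has_real_derivative w' r) (at r)" and w': "continuous_on UNIV w'" and w1: "w 1 = 0"
 shows "(\<integral>\<^sup>+r. ennreal (r powr - \<kappa> * (w r)^2) \<partial>rmeas k) <= ennreal (4 / (2 - \<kappa>)^2 * (\<integral>r. (w' r)^2 \<partial>rmeas k))"
proof -
 have cw: "continuous_on UNIV w" using w DERIV_isCont by (blast intro: continuous_at_imp_continuous_on)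
 have [measurable]: "w : borel_measurable borel" "w' : borel_measurable borel"
  using cw w' by (auto intro: borel_measurable_continuous_onI)
 \<comment> \<open>Half of the gap 2 - \<kappa>. The exponent left in the end is 1 - \<kappa> -
   \<epsilon> = \<epsilon> - 1, whose integral over the unit interval is 1 / \<epsilon>; the weight
   t^(\<epsilon> - 1) in Cauchy-Schwarz has the same exponent.\<close>
 define \<epsilon> where "\<epsilon> = (2 - \<kappa>) / 2"
 have \<epsilon>: "0 < \<epsilon>" "\<epsilon> < 1" "1 - \<kappa> - \<epsilon> = \<epsilon> - 1" using \<kappa> by (auto simp: \<epsilon>_def field_simps)
 define S where "S = (LBINT t. indicator {0..1} t * ((w' t)^2 * t ^ (k - 1)))"
 have ii: "integrable lborel (%t. indicator {c..d} t * f t)" if "continuous_on {c..d} f" for f :: "real => real" and c d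
  using borel_integrable_compact[OF compact_Icc that] by simp
 have w'': "continuous_on {r..1} w'" for r using w' continuous_on_subset by blast
 have kS: "(\<integral>r. (w' r)^2 \<partial>rmeas k) = real k * S"
  by (subst rmeas_integral) (auto simp: S_def mult_ac simp flip: integral_mult_right_zero)
 have S0: "0 <= S" unfolding S_def by (intro integral_nonneg_AE) (auto simp: indicator_def)
 have pt: "r ^ (k - 1) * (w r)^2 <= r powr (1 - \<epsilon>) * (S / \<epsilon>)" if r: "0 < r" "r <= 1" for r
 proof -
  have "(w r - w 1)^2 <= (LBINT t. indicator {r..1} t * t powr (\<epsilon> - 1)) * (LBINT t. indicator {r..1} t * ((w' t)^2 / t powr (\<epsilon> - 1)))"
   using r by (intro FTC_Cauchy_Schwarz w w' continuous_intros) auto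
  also have "... <= (1 / \<epsilon>) * (r powr (1 - \<epsilon>) / r ^ (k - 1) * S)"
  proof (intro mult_mono)
   have "(LBINT t. indicator {r..1} t * t powr (\<epsilon> - 1)) = 1 powr \<epsilon> / \<epsilon> - r powr \<epsilon> / \<epsilon>"
    using r \<epsilon> integral_FTC_Icc_real[of r 1 "%t. t powr \<epsilon> / \<epsilon>" "%t. t powr (\<epsilon> - 1)"]
    by (force intro!: derivative_eq_intros continuous_intros simp: mult.commute)
   then show "(LBINT t. indicator {r..1} t * t powr (\<epsilon> - 1)) <= 1 / \<epsilon>" using \<epsilon> by simp
   have "(LBINT t. indicator {r..1} t * ((w' t)^2 / t powr (\<epsilon> - 1))) <=
    (LBINT t. r powr (1 - \<epsilon>) / r ^ (k - 1) * (indicator {0..1} t * ((w' t)^2 * t ^ (k - 1))))"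
   proof (intro integral_mono integrable_mult_right ii)
    fix t
    have "1 / t powr (\<epsilon> - 1) <= r powr (1 - \<epsilon>) / r ^ (k - 1) * t ^ (k - 1)" if "r <= t"
    proof -
     \<comment> \<open>The exponent is negative because \<open>2 <= k\<close>, so the power
       decreases in t.\<close>
     have "t powr (1 - \<epsilon> - real (k - 1)) <= r powr (1 - \<epsilon> - real (k - 1))"
      using r that k \<epsilon> by (intro powr_mono2') auto
     then have "t powr (1 - \<epsilon>) <= r powr (1 - \<epsilon>) / r ^ (k - 1) * t ^ (k - 1)"
      using r that by (simp add: powr_diff powr_realpow divide_simps) (simp add: mult_ac)
     then show ?thesis using powr_minus_divide[of t "\<epsilon> - 1"] by simp
    qed
    from mult_left_mono[OF this, of "(w' t)^2"]
    show "indicator {r..1} t * ((w' t)^2 / t powr (\<epsilon> - 1)) <= r powr (1 - \<epsilon>) / r ^ (k - 1) * (indicator {0..1} t * ((w' t)^2 * t ^ (k - 1)))"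
     using r by (auto simp: indicator_def mult_ac)
   qed (use r in \<open>auto intro!: continuous_intros w''\<close>)
   then show "(LBINT t. indicator {r..1} t * ((w' t)^2 / t powr (\<epsilon> - 1))) <= r powr (1 - \<epsilon>) / r ^ (k - 1) * S"
    by (simp add: S_def)
   show "0 <= (LBINT t. indicator {r..1} t * ((w' t)^2 / t powr (\<epsilon> - 1)))" by (intro integral_nonneg_AE) auto
  qed (use \<epsilon> in auto)
  finally show ?thesis using r w1 \<epsilon> by (simp add: divide_simps mult_ac)
 qed
 have "(\<integral>\<^sup>+r. ennreal (r powr - \<kappa> * (w r)^2) \<partial>rmeas k) =
  (\<integral>\<^sup>+r. ennreal (indicator {0..1} r * (real k * r ^ (k - 1))) * ennreal (r powr - \<kappa> * (w r)^2) \<partial>lborel)"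
  unfolding rmeas_def by (subst nn_integral_density) auto
 also have "... <= (\<integral>\<^sup>+r. ennreal (real k * (S / \<epsilon>)) * (ennreal (r powr (\<epsilon> - 1)) * indicator {0..1} r) \<partial>lborel)"
 proof (rule nn_integral_mono)
  fix r :: real
  have "real k * r ^ (k - 1) * (r powr - \<kappa> * (w r)^2) <= real k * (S / \<epsilon>) * r powr (\<epsilon> - 1)" if "0 < r" "r <= 1"
  proof -
   have "real k * r powr - \<kappa> * (r ^ (k - 1) * (w r)^2) <= real k * r powr - \<kappa> * (r powr (1 - \<epsilon>) * (S / \<epsilon>))"
    by (intro mult_left_mono pt that) auto
   also have "... = real k * (S / \<epsilon>) * r powr (\<epsilon> - 1)"
    using powr_add[of r "- \<kappa>" "1 - \<epsilon>"] \<open>0 < r\<close> by (simp add: \<epsilon>(3)[symmetric] algebra_simps)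
   finally show ?thesis by (simp add: mult_ac)
  qed
  then show "ennreal (indicator {0..1} r * (real k * r ^ (k - 1))) * ennreal (r powr - \<kappa> * (w r)^2) <=
   ennreal (real k * (S / \<epsilon>)) * (ennreal (r powr (\<epsilon> - 1)) * indicator {0..1} r)"
   using S0 \<epsilon> by (cases "r = 0") (auto simp: indicator_def simp flip: ennreal_mult)
 qed
 also have "... = ennreal (real k * (S / \<epsilon>)) * ennreal (1 / \<epsilon>)"
  using has_integral_powr_from_0[of "\<epsilon> - 1" 1] \<epsilon>
  by (simp add: nn_integral_cmult nn_integral_has_integral_lebesgue'[where I = "1 / \<epsilon>"])
 also have "... = ennreal (4 / (2 - \<kappa>)^2 * (real k * S))"
  using S0 \<epsilon> by (simp add: \<epsilon>_def power2_eq_square field_simps flip: ennreal_mult)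
 finally show ?thesis unfolding kS .
qed

text \<open>The value at the right end point is subtracted, not the mean: integrating towards the
  right lets the increasing weight be moved inside. So the constant is the squared length, wherever
  the interval lies.\<close>

lemma rmeas_Poincare:
 fixes w w' :: "real => real"
 assumes k: "k > 0" and ab: "0 <= a" "a < b" "b <= 1"
  and w: "!!r. (w has_real_derivative w' r) (at r)" and w': "continuous_on UNIV w'"
 shows "(\<integral>r. indicator {a..<b} r * (w r - w b)^2 \<partial>rmeas k) <= (b - a)^2 * (\<integral>r. indicator {a..<b} r * (w' r)^2 \<partial>rmeas k)"
proof -
 have cw: "continuous_on UNIV w" using w DERIV_isCont by (blast intro: continuous_at_imp_continuous_on)
 have [measurable]: "w : borel_measurable borel" "w' : borel_measurable borel"
  using cw w' by (auto intro: borel_measurable_continuous_onI)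
 have ii: "integrable lborel (%t. indicator {c..d} t * f t)" if "continuous_on UNIV f" for f :: "real => real" and c d
  using borel_integrable_compact[of "{c..d}" f] continuous_on_subset[OF that] by simp
 define S where "S = (LBINT t. indicator {a..b} t * ((w' t)^2 * t ^ (k - 1)))"
 have pt: "r ^ (k - 1) * (w r - w b)^2 <= (b - a) * S" if r: "a <= r" "r < b" for r
 proof -
  have "r ^ (k - 1) * (w r - w b)^2 <= (b - r) * (LBINT t. indicator {r..b} t * ((w' t)^2 * t ^ (k - 1)))"
   using r ab by (intro weighted_FTC_bound w w') auto
  also have "... <= (b - a) * S"
  proof (intro mult_mono)
   show "(LBINT t. indicator {r..b} t * ((w' t)^2 * t ^ (k - 1))) <= S"
    unfolding S_def using r ab by (intro integral_mono ii continuous_intros w') (auto simp: indicator_def)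
   show "0 <= (LBINT t. indicator {r..b} t * ((w' t)^2 * t ^ (k - 1)))"
    using r ab by (intro integral_nonneg_AE) (auto simp: indicator_def)
  qed (use r in auto)
  finally show ?thesis .
 qed
 have "(\<integral>r. indicator {a..<b} r * (w r - w b)^2 \<partial>rmeas k) = (LBINT r. indicator {0..1} r * (real k * r ^ (k - 1)) * (indicator {a..<b} r * (w r - w b)^2))"
  by (rule rmeas_integral) measurable
 also have "... <= (LBINT r. indicator {a..b} r * (real k * ((b - a) * S)))"
 proof (rule integral_mono')
  show "integrable lborel (%r. indicator {a..b} r * (real k * ((b - a) * S)))" by (intro ii) simp
  fix r
  have S0: "0 <= S" unfolding S_def using ab by (intro integral_nonneg_AE) (auto simp: indicator_def)
  show "indicator {0..1} r * (real k * r ^ (k - 1)) * (indicator {a..<b} r * (w r - w b)^2) <= indicator {a..b} r * (real k * ((b - a) * S))"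
   using pt[of r] ab S0 by (auto simp: indicator_def mult.assoc intro!: mult_left_mono mult_nonneg_nonneg)
  show "0 <= indicator {a..b} r * (real k * ((b - a) * S))" using ab S0 by simp
 qed
 also have "... = (b - a)^2 * (real k * S)" using ab by (simp add: power2_eq_square)
 also have "real k * S = (\<integral>r. indicator {a..<b} r * (w' r)^2 \<partial>rmeas k)"
 proof -
  have "(\<integral>r. indicator {a..<b} r * (w' r)^2 \<partial>rmeas k) = (LBINT r. indicator {0..1} r * (real k * r ^ (k - 1)) * (indicator {a..<b} r * (w' r)^2))"
   by (rule rmeas_integral) measurable
  also have "... = (LBINT t. real k * (indicator {a..b} t * ((w' t)^2 * t ^ (k - 1))))"
   using AE_lborel_singleton[of b] ab
   by (intro integral_cong_AE) (auto elim!: eventually_mono simp: indicator_def)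
  finally show ?thesis by (simp add: S_def)
 qed
 finally show ?thesis .
qed

subsection \<open>A weighted Poincare inequality on squares\<close>

text \<open>In the application, \<open>w(|P\<^sub>1 x|, |P\<^sub>2 x|)\<close> is a test function on the unit ball, \<open>P\<^sub>1\<close> and \<open>P\<^sub>2\<close> being
 the projections onto two complementary coordinate blocks.\<close>

definition C1b :: "(real \<times> real => real) => (real \<times> real => real) => (real \<times> real => real) => bool" where
 "C1b w w1 w2 \<longleftrightarrow> continuous_on UNIV w & continuous_on UNIV w1 & continuous_on UNIV w2 &
   (EX B. ALL z. abs (w z) <= B & abs (w1 z) <= B & abs (w2 z) <= B) &
   (ALL r s. ((%r. w (r, s)) has_real_derivative w1 (r, s)) (at r)) &
   (ALL r s. ((%s. w (r, s)) has_real_derivative w2 (r, s)) (at s)) &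
   (ALL t. w (1, t) = 0 & w (t, 1) = 0)"

lemma C1b_diff:
 assumes "C1b v v1 v2" "C1b w w1 w2"
 shows "C1b (%z. v z - w z) (%z. v1 z - w1 z) (%z. v2 z - w2 z)"
proof -
 obtain B where B: "!!z. abs (v z) <= B" "!!z. abs (v1 z) <= B" "!!z. abs (v2 z) <= B" using assms(1) by (auto simp: C1b_def)
 obtain B' where B': "!!z. abs (w z) <= B'" "!!z. abs (w1 z) <= B'" "!!z. abs (w2 z) <= B'" using assms(2) by (auto simp: C1b_def)
 have "abs (v z - w z) <= B + B'" "abs (v1 z - w1 z) <= B + B'" "abs (v2 z - w2 z) <= B + B'" for z
  using B[of z] B'[of z] by linarith+
 then have ex: "EX B. ALL z. abs (v z - w z) <= B & abs (v1 z - w1 z) <= B & abs (v2 z - w2 z) <= B" by blast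
 show ?thesis
  unfolding C1b_def by (intro conjI ex allI continuous_on_diff DERIV_diff) (use assms in \<open>simp_all add: C1b_def\<close>)
qed

text \<open>The unit square with the joint law of the two block radii. The larger dimension
  \<open>k1\<close> decides the admissible exponents of the Sobolev inequality.\<close>

locale weighted_square =
 fixes k1 k2 :: nat
 assumes k2: "2 <= k2" and k1: "k2 <= k1"
begin

abbreviation "N1 \<equiv> rmeas k1"
abbreviation "N2 \<equiv> rmeas k2"
definition "M = N1 \<Otimes>\<^sub>M N2"

sublocale N1: finite_measure N1 using k1 k2 by (intro finite_measure_rmeas) simp
sublocale N2: finite_measure N2 using k2 by (intro finite_measure_rmeas) simp
sublocale NN: pair_sigma_finite N1 N2 by unfold_locales

lemma sets_M[measurable_cong, simp]: "sets M = sets borel"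
 unfolding M_def borel_prod[symmetric] by (intro sets_pair_measure_cong) auto

lemma space_M[simp]: "space M = UNIV" by (simp add: M_def space_pair_measure)

lemma M_times:
 assumes "A : sets borel" "B : sets borel"
 shows "emeasure M (A \<times> B) = emeasure N1 A * emeasure N2 B"
 unfolding M_def using assms by (intro N2.emeasure_pair_measure_Times) auto

sublocale M: finite_measure M
 using M_times[of UNIV UNIV] k1 k2 by (intro finite_measureI) (auto simp: rmeas_prob)

lemma M_UNIV: "measure M UNIV = 1"
 using M_times[of UNIV UNIV] k1 k2 by (simp add: rmeas_prob measure_def)

lemma bounded_integrable:
 assumes "f : borel_measurable borel" "!!z. abs (f z) <= B"
 shows "integrable M (f :: real \<times> real => real)"
 using assms by (intro M.integrable_const_bound[of _ B]) auto

lemma Fubini_M: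
 fixes f :: "real \<times> real => real"
 assumes f: "f : borel_measurable borel" "!!z. abs (f z) <= B"
 shows "(LINT z|M. f z) = (LINT s|N2. (LINT r|N1. f (r, s)))" "(LINT z|M. f z) = (LINT r|N1. (LINT s|N2. f (r, s)))"
  and "integrable N1 (%r. f (r, s))" "integrable N2 (%s. f (r, s))"
  and "integrable N2 (%s. \<integral>r. f (r, s) \<partial>N1)" "integrable N1 (%r. \<integral>s. f (r, s) \<partial>N2)"
proof -
 have i: "integrable (N1 \<Otimes>\<^sub>M N2) (%(r, s). f (r, s))" using bounded_integrable[OF f] by (simp add: M_def case_prod_beta)
 show "(LINT z|M. f z) = (LINT s|N2. (LINT r|N1. f (r, s)))"
  using NN.integral_snd[OF i] by (simp add: M_def case_prod_beta)
 show "(LINT z|M. f z) = (LINT r|N1. (LINT s|N2. f (r, s)))"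
  using NN.integral_fst[OF i] by (simp add: M_def case_prod_beta)
 show "integrable N2 (%s. \<integral>r. f (r, s) \<partial>N1)" using NN.integrable_snd[OF i] by simp
 show "integrable N1 (%r. \<integral>s. f (r, s) \<partial>N2)" using NN.integrable_fst[OF i] by simp
 have [measurable]: "f : borel_measurable (borel \<Otimes>\<^sub>M borel)" using f(1) by (simp add: borel_prod)
 show "integrable N1 (%r. f (r, s))" by (intro N1.integrable_const_bound[of _ B]) (use f(2) in auto)
 show "integrable N2 (%s. f (r, s))" by (intro N2.integrable_const_bound[of _ B]) (use f(2) in auto)
qed

definition energy :: "(real \<times> real => real) => (real \<times> real => real) => real" where
 "energy w1 w2 = (LINT z|M. (w1 z)^2 + (w2 z)^2)"

lemma C1b_borel:
 assumes "C1b w w1 w2"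
 shows "w : borel_measurable borel" "w1 : borel_measurable borel" "w2 : borel_measurable borel"
 using assms by (auto simp: C1b_def intro: borel_measurable_continuous_onI)

lemma C1b_bound:
 assumes "C1b w w1 w2" obtains B where "B >= 0" "!!z. abs (w z) <= B" "!!z. abs (w1 z) <= B" "!!z. abs (w2 z) <= B"
proof -
 obtain B where B: "ALL z. abs (w z) <= B & abs (w1 z) <= B & abs (w2 z) <= B" using assms unfolding C1b_def by blast
 then have "B >= 0" using abs_ge_zero order_trans by blast
 then show thesis using that B by blast
qed

lemma C1b_slices:
 assumes "C1b w w1 w2"
 shows "continuous_on UNIV (%r. w1 (r, s))" "continuous_on UNIV (%s. w2 (r, s))" "w (1, s) = 0" "w (r, 1) = 0"
  "((%r. w (r, s)) has_real_derivative w1 (r, s)) (at r)" "((%s. w (r, s)) has_real_derivative w2 (r, s)) (at s)"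
  "(%r. w (r, s)) : borel_measurable borel" "(%s. w (r, s)) : borel_measurable borel"
proof -
 have c: "continuous_on UNIV w" "continuous_on UNIV w1" "continuous_on UNIV w2" using assms by (auto simp: C1b_def)
 show "continuous_on UNIV (%r. w1 (r, s))" "continuous_on UNIV (%s. w2 (r, s))"
  by (intro continuous_on_compose2[OF c(2)] continuous_on_compose2[OF c(3)] continuous_intros; simp)+
 show "(%r. w (r, s)) : borel_measurable borel" "(%s. w (r, s)) : borel_measurable borel"
  by (intro borel_measurable_continuous_onI continuous_on_compose2[OF c(1)] continuous_intros; simp)+
qed (use assms in \<open>auto simp: C1b_def\<close>)

text \<open>Slices in the first variable suffice, since \<open>w\<close> vanishes at their right end
  point; the slice length 1 gives the constant 1.\<close>

lemma Poincare_M: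
 assumes w: "C1b w w1 w2"
 shows "(LINT z|M. (w z)^2) <= energy w1 w2"
proof -
 obtain B where B: "B >= 0" "!!z. abs (w z) <= B" "!!z. abs (w1 z) <= B" "!!z. abs (w2 z) <= B" using C1b_bound[OF w] by blast
 have sqB: "abs ((w z)^2) <= B^2" "abs ((w1 z)^2) <= B^2" "abs ((w2 z)^2) <= B^2" for z
  using power_mono[OF B(2)[of z], of 2] power_mono[OF B(3)[of z], of 2] power_mono[OF B(4)[of z], of 2] by simp_all
 note [measurable] = C1b_borel[OF w]
 have sl: "(LINT r|N1. (w (r, s))^2) <= (LINT r|N1. (w1 (r, s))^2)" for s
 proof -
  have ae: "AE r in N1. (indicator {0..<1} r :: real) = 1"
   using rmeas_AE_unit[of k1] rmeas_AE_neq[of 1 k1] by eventually_elim simp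
  have "(LINT r|N1. (w (r, s))^2) = (LINT r|N1. indicator {0..<1} r * (w (r, s) - w (1, s))^2)"
   using ae C1b_slices(3)[OF w] C1b_slices(7)[OF w] by (intro integral_cong_AE) (auto elim!: eventually_mono)
  also have "... <= (1 - 0)^2 * (LINT r|N1. indicator {0..<1} r * (w1 (r, s))^2)"
   using k1 k2 C1b_slices[OF w] by (intro rmeas_Poincare) auto
  also have "... = (LINT r|N1. (w1 (r, s))^2)"
   using ae C1b_slices(1)[OF w]
   by (simp, intro integral_cong_AE) (auto elim!: eventually_mono intro: borel_measurable_continuous_onI)
  finally show ?thesis .
 qed
 have f1: "(%z. (w z)^2) : borel_measurable borel" "(%z. (w1 z)^2) : borel_measurable borel" by measurable
 have "(LINT z|M. (w z)^2) = (LINT s|N2. (LINT r|N1. (w (r, s))^2))" by (rule Fubini_M(1)[OF f1(1) sqB(1)])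
 also have "... <= (LINT s|N2. (LINT r|N1. (w1 (r, s))^2))"
  by (intro integral_mono sl Fubini_M(5)[OF f1(1) sqB(1)] Fubini_M(5)[OF f1(2) sqB(2)])
 also have "... = (LINT z|M. (w1 z)^2)" by (rule Fubini_M(1)[OF f1(2) sqB(2), symmetric])
 also have "... <= energy w1 w2"
  unfolding energy_def
 proof (rule integral_mono)
  have "abs ((w1 z)^2 + (w2 z)^2) <= B^2 + B^2" for z using sqB(2,3)[of z] by linarith
  then show "integrable M (%z. (w1 z)^2 + (w2 z)^2)" by (intro bounded_integrable) measurable
  show "integrable M (%z. (w1 z)^2)" by (rule bounded_integrable[OF f1(2) sqB(2)])
 qed simp
 finally show ?thesis .
qed

text \<open>The constant is the mean of \<open>w\<close> over the far edge s = b + \<epsilon> of the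
  cell. On each horizontal slice \<open>w\<close> is compared with its own mean, and this mean with
  that of the far edge through the vertical slices.\<close>

lemma cell_Poincare_const:
 assumes w: "C1b w w1 w2" and a: "0 <= a" "a + \<epsilon> <= 1" "0 <= b" "b + \<epsilon> <= 1" "0 < \<epsilon>"
 defines "A \<equiv> {a..<a + \<epsilon>} \<times> {b..<b + \<epsilon>}"
 shows "EX c. (LINT z|M. indicator A z * (w z - c)^2) <= 2 * \<epsilon>^2 * (LINT z|M. indicator A z * ((w1 z)^2 + (w2 z)^2))"
proof -
 obtain B where B: "B >= 0" "!!z. abs (w z) <= B" "!!z. abs (w1 z) <= B" "!!z. abs (w2 z) <= B" using C1b_bound[OF w] by blast
 have sqB: "abs ((w1 z)^2) <= B^2" "abs ((w2 z)^2) <= B^2" for z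
  using power_mono[OF B(3)[of z], of 2] power_mono[OF B(4)[of z], of 2] by simp_all
 note wm[measurable] = C1b_borel[OF w]
 let ?I = "{a..<a + \<epsilon>}" and ?J = "{b..<b + \<epsilon>}"
 have k: "k1 > 0" "k2 > 0" using k1 k2 by auto
 have Im: "measure N1 ?I = (a + \<epsilon>) ^ k1 - a ^ k1" "emeasure N1 ?I < \<infinity>"
  using emeasure_rmeas_Ico[OF k(1), of a "a + \<epsilon>"] a by (simp_all add: measure_def power_mono)
 have Ip: "measure N1 ?I > 0" using power_strict_mono[of a "a + \<epsilon>" k1] a k Im by simp
 interpret I: averaging_set N1 ?I by unfold_locales (use Im Ip in auto)
 define g where "g s = avg N1 ?I (%r. w (r, s))" for s
 define c where "c = g (b + \<epsilon>)"
 have sqw: "I.sq (%r. w (r, s))" for s unfolding I.sq_def using C1b_slices(7)[OF w] B by auto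
 have gB: "abs c <= B"
 proof -
  have "(c - 0)^2 <= (LINT r|N1. indicator ?I r * (w (r, b + \<epsilon>) - 0)^2) / measure N1 ?I"
   unfolding c_def g_def by (rule I.avg_diff_const_le[OF sqw])
  also have "... <= (LINT r|N1. indicator ?I r * B^2) / measure N1 ?I"
  proof (intro divide_right_mono integral_mono)
   show "indicator ?I r * (w (r, b + \<epsilon>) - 0)^2 <= indicator ?I r * B^2" for r
    using power_mono[OF B(2)[of "(r, b + \<epsilon>)"], of 2] by (auto simp: indicator_def)
   show "integrable N1 (%r. indicator ?I r * (w (r, b + \<epsilon>) - 0)^2)"
    using I.int_ind[OF I.sq_power2[OF sqw[of "b + \<epsilon>"]]] by simp
   show "integrable N1 (%r. indicator ?I r * B^2)" using I.int_ind[OF I.sq_const] by simp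
  qed (use Ip in simp)
  also have "... = B^2" using Ip by simp
  finally show ?thesis using B(1) by (simp add: abs_le_square_iff[symmetric])
 qed
 define f1 where "f1 z = indicator A z * (w z - c)^2" for z
 define f2 where "f2 z = indicator A z * (w1 z)^2" for z
 define f3 where "f3 z = indicator A z * (w z - w (fst z, b + \<epsilon>))^2" for z
 define f4 where "f4 z = indicator A z * (w2 z)^2" for z
 have [measurable]: "A : sets borel" unfolding A_def by (auto intro!: borel_Times)
 have wb[measurable]: "(%z. w (fst z, b + \<epsilon>)) : borel_measurable borel"
 proof (rule borel_measurable_continuous_onI)
  have "continuous_on UNIV w" using w by (simp add: C1b_def)
  then show "continuous_on UNIV (%z. w (fst z, b + \<epsilon>))"
   by (rule continuous_on_compose2[where g=w]) (auto intro!: continuous_intros)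
 qed
 have dB: "abs (w z - c) <= 2 * B" "abs (w z - w (fst z, b + \<epsilon>)) <= 2 * B" for z
  using B(2)[of z] gB B(2)[of "(fst z, b + \<epsilon>)"] by linarith+
 have fm: "f1 : borel_measurable borel" "f2 : borel_measurable borel" "f3 : borel_measurable borel" "f4 : borel_measurable borel"
  unfolding f1_def[abs_def] f2_def[abs_def] f3_def[abs_def] f4_def[abs_def] by measurable
 have fb: "abs (f1 z) <= (2 * B)^2" "abs (f2 z) <= B^2" "abs (f3 z) <= (2 * B)^2" "abs (f4 z) <= B^2" for z
  using power_mono[OF dB(1)[of z], of 2] power_mono[OF dB(2)[of z], of 2] sqB[of z]
  by (auto simp: f1_def f2_def f3_def f4_def indicator_def)
 have indA: "indicator A (r, s) = indicator ?I r * (indicator ?J s :: real)" for r s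
  by (auto simp: A_def indicator_def)
 have inner: "(LINT r|N1. f1 (r, s)) <= 2 * \<epsilon>^2 * (LINT r|N1. f2 (r, s)) + 2 * (LINT r|N1. f3 (r, s))" for s
 proof (cases "s : ?J")
  case True
  have f: "f1 (r, s) = indicator ?I r * (w (r, s) - c)^2" "f2 (r, s) = indicator ?I r * (w1 (r, s))^2"
   "f3 (r, s) = indicator ?I r * (w (r, s) - w (r, b + \<epsilon>))^2" for r
   using True by (simp_all add: f1_def f2_def f3_def indA)
  have 1: "(LINT r|N1. indicator ?I r * (w (r, s) - g s)^2) <= \<epsilon>^2 * (LINT r|N1. f2 (r, s))"
  proof -
   have "(LINT r|N1. indicator ?I r * (w (r, s) - g s)^2) <= (LINT r|N1. indicator ?I r * (w (r, s) - w (a + \<epsilon>, s))^2)"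
    unfolding g_def by (rule I.variance_le[OF sqw])
   also have "... <= (a + \<epsilon> - a)^2 * (LINT r|N1. indicator ?I r * (w1 (r, s))^2)"
    using a k C1b_slices[OF w] by (intro rmeas_Poincare) auto
   finally show ?thesis by (simp add: f)
  qed
  have 2: "(g s - c)^2 * measure N1 ?I <= (LINT r|N1. f3 (r, s))"
  proof -
   have "g s - c = avg N1 ?I (%r. w (r, s) - w (r, b + \<epsilon>))"
    unfolding g_def c_def by (rule I.avg_diff[OF sqw sqw, symmetric])
   then have "(g s - c)^2 <= (LINT r|N1. indicator ?I r * (w (r, s) - w (r, b + \<epsilon>))^2) / measure N1 ?I"
    using I.avg_diff_const_le[OF I.sq_diff[OF sqw[of s] sqw[of "b + \<epsilon>"]], of 0] by simp
   then show ?thesis using Ip by (simp add: f field_simps)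
  qed
  have i: "integrable N1 (%r. indicator ?I r * (w (r, s) - c)^2)" "integrable N1 (%r. indicator ?I r * (w (r, s) - g s)^2)"
   "integrable N1 (%r. indicator ?I r * (g s - c)^2)"
   by (intro I.int_ind I.sq_power2 I.sq_diff sqw I.sq_const)+
  have "(LINT r|N1. f1 (r, s)) <= (LINT r|N1. 2 * (indicator ?I r * (w (r, s) - g s)^2) + 2 * (indicator ?I r * (g s - c)^2))"
   unfolding f
  proof (intro integral_mono)
   show "indicator ?I r * (w (r, s) - c)^2 <= 2 * (indicator ?I r * (w (r, s) - g s)^2) + 2 * (indicator ?I r * (g s - c)^2)" for r
    using sum_squares_bound[of "w (r, s) - g s" "g s - c"] by (auto simp: indicator_def power2_eq_square algebra_simps)
  qed (use i in auto)
  also have "... = 2 * (LINT r|N1. indicator ?I r * (w (r, s) - g s)^2) + 2 * ((g s - c)^2 * measure N1 ?I)"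
   using i by (simp add: mult.commute)
  finally show ?thesis using 1 2 by linarith
 next
  case False
  then show ?thesis by (simp add: f1_def f2_def f3_def indA)
 qed
 have "(LINT z|M. f3 z) <= \<epsilon>^2 * (LINT z|M. f4 z)"
 proof -
  have "(LINT z|M. f3 z) = (LINT r|N1. (LINT s|N2. f3 (r, s)))" by (rule Fubini_M(2)[OF fm(3) fb(3)])
  also have "... <= (LINT r|N1. \<epsilon>^2 * (LINT s|N2. f4 (r, s)))"
  proof (intro integral_mono integrable_mult_right Fubini_M(6)[OF fm(3) fb(3)] Fubini_M(6)[OF fm(4) fb(4)])
   fix r
   have "(LINT s|N2. indicator ?J s * (w (r, s) - w (r, b + \<epsilon>))^2) <= (b + \<epsilon> - b)^2 * (LINT s|N2. indicator ?J s * (w2 (r, s))^2)"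
    using a k C1b_slices[OF w] by (intro rmeas_Poincare) auto
   then show "(LINT s|N2. f3 (r, s)) <= \<epsilon>^2 * (LINT s|N2. f4 (r, s))"
    by (auto simp: f3_def f4_def indA indicator_def[of ?I])
  qed
  also have "... = \<epsilon>^2 * (LINT z|M. f4 z)" by (simp add: Fubini_M(2)[OF fm(4) fb(4)])
  finally show ?thesis .
 qed
 note 3 = this
 have "(LINT z|M. f1 z) = (LINT s|N2. (LINT r|N1. f1 (r, s)))" by (rule Fubini_M(1)[OF fm(1) fb(1)])
 also have "... <= (LINT s|N2. 2 * \<epsilon>^2 * (LINT r|N1. f2 (r, s)) + 2 * (LINT r|N1. f3 (r, s)))"
  by (intro integral_mono inner Bochner_Integration.integrable_add integrable_mult_right
    Fubini_M(5)[OF fm(1) fb(1)] Fubini_M(5)[OF fm(2) fb(2)] Fubini_M(5)[OF fm(3) fb(3)])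
 also have "... = 2 * \<epsilon>^2 * (LINT z|M. f2 z) + 2 * (LINT z|M. f3 z)"
  using Fubini_M(5)[OF fm(2) fb(2)] Fubini_M(5)[OF fm(3) fb(3)]
  by (simp add: Fubini_M(1)[OF fm(2) fb(2)] Fubini_M(1)[OF fm(3) fb(3)])
 also have "... <= 2 * \<epsilon>^2 * (LINT z|M. f2 z) + 2 * \<epsilon>^2 * (LINT z|M. f4 z)" using 3 by simp
 also have "... = 2 * \<epsilon>^2 * (LINT z|M. f2 z + f4 z)"
  using bounded_integrable[OF fm(2) fb(2)] bounded_integrable[OF fm(4) fb(4)] by (simp add: distrib_left)
 also have "(%z. f2 z + f4 z) = (%z. indicator A z * ((w1 z)^2 + (w2 z)^2))"
  by (auto simp: f2_def f4_def distrib_left)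
 finally show ?thesis unfolding f1_def[abs_def] by blast
qed

end

subsection \<open>Compactness\<close>

text \<open>Half-open, so that the cells of every grid tile it exactly.\<close>

definition unit_square :: "(real \<times> real) set" where "unit_square = {0..<1} \<times> {0..<1}"
definition strip :: "nat => nat => real set" where "strip N p = {real p / real N..<real p / real N + 1 / real N}"
definition cell :: "nat => nat \<times> nat => (real \<times> real) set" where "cell N c = strip N (fst c) \<times> strip N (snd c)"
definition grid :: "nat => (nat \<times> nat) set" where "grid N = {..<N} \<times> {..<N}"

lemma sum_indicator_cell:
 assumes "N > 0" shows "(SUM c:grid N. indicator (cell N c) z :: real) = indicator unit_square z"
proof -
 have 1: "(SUM p<N. indicator (strip N p) x :: real) = indicator {0..<1} x" for x
 proof -
  let ?f = "%p. indicator {..<real p / real N} x :: real"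
  have "indicator (strip N p) x = ?f (Suc p) - ?f p" for p
   by (auto simp: strip_def indicator_def add_divide_distrib add.commute intro: add_strict_increasing2)
  then have "(SUM p<N. indicator (strip N p) x) = ?f N - ?f 0" using sum_lessThan_telescope[of ?f N] by simp
  then show ?thesis using assms by (auto simp: indicator_def)
 qed
 show ?thesis
  by (cases z) (simp add: grid_def cell_def unit_square_def indicator_times sum.cartesian_product' 1 flip: sum_product del: sum_mult_indicator sum_indicator_mult)
qed

context weighted_square
begin

lemma cell_borel[measurable]: "cell N c : sets borel" and unit_square_borel[measurable]: "unit_square : sets borel"
 unfolding cell_def strip_def unit_square_def by (auto intro!: borel_Times)

lemma AE_unit_square: "AE z in M. z : unit_square"
proof -
 have "emeasure M unit_square = 1"
  using M_times[of "{0..<1}" "{0..<1}"] emeasure_rmeas_Ico[of k1 0 1] emeasure_rmeas_Ico[of k2 0 1] k1 k2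
  by (simp add: unit_square_def zero_power)
 then have "emeasure M (space M - unit_square) = 0"
  using M_UNIV by (subst emeasure_Diff) (auto simp: M.emeasure_eq_measure)
 then show ?thesis by (intro AE_I[of _ _ "space M - unit_square"]) auto
qed

lemma strip_le: "p < N ==> real p / real N + 1 / real N <= 1"
 by (simp add: divide_simps)

lemma averaging_set_cell:
 assumes c: "c : grid N" shows "averaging_set M (cell N c)"
proof
 have pos: "0 < (real p / real N + 1 / real N) ^ k - (real p / real N) ^ k" if "p < N" "0 < k" for p k
  using that by (simp add: power_strict_mono)
 have "0 < emeasure M (cell N c)"
  using c pos k1 k2 strip_le unfolding cell_def strip_def
  by (subst M_times) (auto simp: grid_def emeasure_rmeas_Ico ennreal_zero_less_mult_iff)
 then show "measure M (cell N c) > 0" by (simp add: M.emeasure_eq_measure)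
qed (auto simp: M.emeasure_eq_measure)

lemma sq_C1b: "C1b w w1 w2 ==> c : grid N ==> averaging_set.sq M w"
 using averaging_set.sq_def[OF averaging_set_cell] C1b_borel(1) C1b_bound by (metis measurable_completion measurable_cong_sets sets_M)

lemma energy_integrable: "C1b w w1 w2 ==> integrable M (%z. (w1 z)^2 + (w2 z)^2)"
 and w2_integrable: "C1b w w1 w2 ==> integrable M (%z. (w z)^2)"
proof -
 assume w: "C1b w w1 w2"
 obtain B where B: "B >= 0" "!!z. abs (w z) <= B" "!!z. abs (w1 z) <= B" "!!z. abs (w2 z) <= B" using C1b_bound[OF w] by blast
 have sqB: "abs ((w z)^2) <= B^2" "abs ((w1 z)^2) <= B^2" "abs ((w2 z)^2) <= B^2" for z
  using power_mono[OF B(2)[of z], of 2] power_mono[OF B(3)[of z], of 2] power_mono[OF B(4)[of z], of 2] by simp_all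
 note [measurable] = C1b_borel[OF w]
 have "abs ((w1 z)^2 + (w2 z)^2) <= B^2 + B^2" for z using sqB(2,3)[of z] by linarith
 then show "integrable M (%z. (w1 z)^2 + (w2 z)^2)" by (intro bounded_integrable) measurable
 show "integrable M (%z. (w z)^2)" by (rule bounded_integrable[OF _ sqB(1)]) measurable
qed

lemma integral_cells:
 fixes f :: "real \<times> real => real"
 assumes f: "integrable M f" and N: "N > 0"
 shows "(LINT z|M. f z) = (SUM c:grid N. \<integral>z. indicator (cell N c) z * f z \<partial>M)"
proof -
 have i: "integrable M (%z. indicator (cell N c) z * f z)" for c
  using integrable_mult_indicator[OF _ f, of "cell N c"] by simp
 have "(LINT z|M. f z) = (LINT z|M. (SUM c:grid N. indicator (cell N c) z * f z))"
  using f i AE_unit_square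
  by (intro integral_cong_AE) (auto elim!: eventually_mono simp: sum_indicator_cell[OF N] simp flip: sum_distrib_right)
 then show ?thesis using i by simp
qed

text \<open>On each cell the variance is controlled by the energy with a factor of order 1 / N^2, so
  up to a small error the L2 norm depends on finitely many cell averages. This is the source of
  compactness. The cell measures, being at most 1, are dropped from the squares of the
  averages.\<close>

lemma L2_cells:
 assumes w: "C1b w w1 w2" and N: "N > 0"
 shows "(LINT z|M. (w z)^2) <= 2 / (real N)^2 * energy w1 w2 + (SUM c:grid N. (avg M (cell N c) w)^2)"
proof -
 let ?e = "%z. (w1 z)^2 + (w2 z)^2"
 have 1: "(LINT z|M. indicator (cell N c) z * (w z)^2) <=
  2 / (real N)^2 * (LINT z|M. indicator (cell N c) z * ?e z) + (avg M (cell N c) w)^2" if c: "c : grid N" for c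
 proof -
  interpret averaging_set M "cell N c" by (rule averaging_set_cell[OF c])
  obtain d where d: "(LINT z|M. indicator (cell N c) z * (w z - d)^2) <= 2 * (1 / real N)^2 * (LINT z|M. indicator (cell N c) z * ?e z)"
   using cell_Poincare_const[OF w, of "real (fst c) / real N" "1 / real N" "real (snd c) / real N"] c strip_le
   unfolding cell_def strip_def by (auto simp: grid_def mem_Times_iff)
  have "measure M (cell N c) <= 1" using M.finite_measure_mono[of "cell N c" UNIV] M_UNIV by simp
  then have "(avg M (cell N c) w)^2 * measure M (cell N c) <= (avg M (cell N c) w)^2" by (intro mult_left_le) auto
  then show ?thesis using order_trans[OF variance_le[OF sq_C1b[OF w c]] d] variance_eq[OF sq_C1b[OF w c], of 0]
   by (simp add: power_divide)
 qed
 then show ?thesis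
  unfolding energy_def integral_cells[OF energy_integrable[OF w] N] integral_cells[OF w2_integrable[OF w] N]
  by (simp add: sum_distrib_left sum_mono flip: sum.distrib)
qed

lemma avg_bound:
 assumes w: "C1b w w1 w2" and c: "c : grid N"
 shows "(avg M (cell N c) w)^2 <= energy w1 w2 / measure M (cell N c)"
proof -
 interpret averaging_set M "cell N c" by (rule averaging_set_cell[OF c])
 have "(LINT y|M. indicator (cell N c) y * (w y)^2) <= (LINT y|M. (w y)^2)"
  using integrable_mult_indicator[OF _ w2_integrable[OF w], of "cell N c"] w2_integrable[OF w]
  by (intro integral_mono) (auto simp: indicator_def)
 then have "(LINT y|M. indicator (cell N c) y * (w y - 0)^2) / measure M (cell N c) <= energy w1 w2 / measure M (cell N c)"
  using Poincare_M[OF w] by (intro divide_right_mono) auto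
 then show ?thesis using avg_diff_const_le[OF sq_C1b[OF w c], of 0] by simp
qed

text \<open>The averages over the cells of all grids form countably many bounded sequences, and a
  diagonal subsequence makes all of them converge. A sufficiently fine grid then controls the L2
  distance.\<close>

lemma Rellich:
 fixes w w1 w2 :: "nat => real \<times> real => real"
 assumes w: "!!i. C1b (w i) (w1 i) (w2 i)" and Q: "!!i. energy (w1 i) (w2 i) <= Q"
 shows "EX s :: nat => nat. strict_mono s & (ALL \<epsilon>>0. EX N. ALL m>=N. ALL n>=N. (LINT z|M. (w (s m) z - w (s n) z)^2) <= \<epsilon>)"
proof -
 \<comment> \<open>The second index is a pair of a grid size and a cell. The value 0 for pairs
   outside the grid keeps every sequence bounded, so the diagonal argument can run over the codes of
   all pairs.\<close>
 define a where "a i jc = (if snd jc : grid (fst jc) then avg M (cell (fst jc) (snd jc)) (w i) else 0)" for i :: nat and jc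
 have bnd: "EX K. ALL i. abs (a i jc) <= K" for jc
 proof (cases "snd jc : grid (fst jc)")
  case True
  have "abs (a i jc) <= sqrt (Q / measure M (cell (fst jc) (snd jc)))" for i
   using order_trans[OF avg_bound[OF w True] divide_right_mono[OF Q]] True
   by (intro real_le_rsqrt) (simp add: a_def)
  then show ?thesis by blast
 qed (auto simp: a_def)
 define P where "P n s \<longleftrightarrow> convergent (%i. a (s i) (from_nat n))" for n and s :: "nat => nat"
 interpret subseqs P
 proof
  fix n and s :: "nat => nat"
  obtain K where K: "!!i. abs (a i (from_nat n)) <= K" using bnd by blast
  then have "bounded (range (%i. a (s i) (from_nat n)))" by (auto simp: bounded_iff intro!: exI[of _ K])
  then obtain l r where "strict_mono r" "((%i. a (s i) (from_nat n)) \<circ> r) ----> l"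
   using bounded_imp_convergent_subsequence by blast
  then show "EX r'. strict_mono r' & P n (s \<circ> r')" by (auto simp: P_def o_def convergent_def)
 qed
 define s where "s = diagseq"
 have s: "strict_mono s" unfolding s_def by (rule subseq_diagseq)
 have conv: "convergent (%i. a (s i) jc)" for jc
 proof -
  have "P (to_nat jc) (diagseq \<circ> ((+) (Suc (to_nat jc))))"
  proof (rule diagseq_holds)
   fix r s' :: "nat => nat" and n assume "strict_mono r" "P n s'"
   then show "P n (s' \<circ> r)" unfolding P_def o_def
    using convergent_subseq_convergent[of "%i. a (s' i) (from_nat n)" r] by (simp add: o_def)
  qed
  then have "convergent (%i. a (s (i + Suc (to_nat jc))) jc)" by (simp add: P_def o_def s_def add.commute)
  then show ?thesis using convergent_ignore_initial_segment[of "%i. a (s i) jc" "Suc (to_nat jc)"] by blast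
 qed
 have "EX N. ALL m>=N. ALL n>=N. (LINT z|M. (w (s m) z - w (s n) z)^2) <= \<epsilon>" if \<epsilon>: "\<epsilon> > 0" for \<epsilon>
 proof -
  \<comment> \<open>The difference of two terms has energy at most 4 Q. The grid is chosen so fine
    that its contribution is at most \<epsilon> / 2.\<close>
  obtain j :: nat where "16 * Q / \<epsilon> < real j" using reals_Archimedean2 by blast
  then have "16 * Q <= \<epsilon> * real j" using \<epsilon> by (simp add: divide_less_eq mult.commute)
  also have "... <= \<epsilon> * (real (Suc j))^2" using \<epsilon> by (intro mult_left_mono) (auto simp: power2_eq_square algebra_simps)
  finally have j: "16 * Q <= \<epsilon> * (real (Suc j))^2" .
  define G where "G = grid (Suc j)"
  have G: "finite G" "real (card G) = (real (Suc j))^2" by (simp_all add: G_def grid_def card_cartesian_product power2_eq_square algebra_simps)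
  define \<delta> where "\<delta> = sqrt (\<epsilon> / 2) / real (Suc j)"
  have \<delta>: "\<delta> > 0" "real (card G) * \<delta>^2 = \<epsilon> / 2" using \<epsilon> by (simp_all add: \<delta>_def G(2) power_divide)
  have "ALL c:G. \<forall>\<^sub>F N in sequentially. ALL m>=N. ALL n>=N. abs (a (s m) (Suc j, c) - a (s n) (Suc j, c)) < \<delta>"
  proof
   fix c
   have "Cauchy (%i. a (s i) (Suc j, c))" using conv convergent_Cauchy by blast
   then obtain N where "ALL m>=N. ALL n>=N. abs (a (s m) (Suc j, c) - a (s n) (Suc j, c)) < \<delta>"
    using \<delta>(1) unfolding Cauchy_def dist_real_def by blast
   then show "\<forall>\<^sub>F N in sequentially. ALL m>=N. ALL n>=N. abs (a (s m) (Suc j, c) - a (s n) (Suc j, c)) < \<delta>"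
    by (intro eventually_sequentiallyI[of N]) auto
  qed
  from eventually_ball_finite[OF G(1) this] obtain N
   where N: "!!c m n. c : G ==> N <= m ==> N <= n ==> abs (a (s m) (Suc j, c) - a (s n) (Suc j, c)) < \<delta>"
   unfolding eventually_sequentially by blast
  have "(LINT z|M. (w (s m) z - w (s n) z)^2) <= \<epsilon>" if mn: "N <= m" "N <= n" for m n
  proof -
   let ?v1 = "%z. w1 (s m) z - w1 (s n) z" and ?v2 = "%z. w2 (s m) z - w2 (s n) z"
   define v where "v z = w (s m) z - w (s n) z" for z
   have v: "C1b v ?v1 ?v2" unfolding v_def[abs_def] by (rule C1b_diff[OF w w])
   define en where "en i z = (w1 i z)^2 + (w2 i z)^2" for i z
   have ien: "integrable M (en i)" for i using energy_integrable[OF w] by (simp add: en_def[abs_def])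
   have "energy ?v1 ?v2 <= (LINT z|M. 2 * en (s m) z + 2 * en (s n) z)"
    unfolding energy_def
   proof (rule integral_mono[OF energy_integrable[OF v]])
    fix z
    have "(x - y)^2 <= 2 * x^2 + 2 * y^2" for x y :: real
     using sum_squares_bound[of x "- y"] by (simp add: power2_eq_square algebra_simps)
    from this[of "w1 (s m) z" "w1 (s n) z"] this[of "w2 (s m) z" "w2 (s n) z"]
    show "(?v1 z)^2 + (?v2 z)^2 <= 2 * en (s m) z + 2 * en (s n) z" unfolding en_def by (simp add: distrib_left)
   qed (use ien in simp)
   also have "... = 2 * energy (w1 (s m)) (w2 (s m)) + 2 * energy (w1 (s n)) (w2 (s n))"
    using ien unfolding energy_def en_def[symmetric] by simp
   finally have ev: "energy ?v1 ?v2 <= 4 * Q" using Q[of "s m"] Q[of "s n"] by linarith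
   have "(avg M (cell (Suc j) c) v)^2 <= \<delta>^2" if c: "c : G" for c
   proof -
    note c' = c[unfolded G_def]
    interpret averaging_set M "cell (Suc j) c" by (rule averaging_set_cell[OF c'])
    have "avg M (cell (Suc j) c) v = a (s m) (Suc j, c) - a (s n) (Suc j, c)"
     unfolding v_def[abs_def] using avg_diff[OF sq_C1b[OF w c'] sq_C1b[OF w c'], of "s m" "s n"] c' by (simp add: a_def)
    then show ?thesis using N[OF c mn] by (simp add: abs_le_square_iff[symmetric])
   qed
   then have "(SUM c:G. (avg M (cell (Suc j) c) v)^2) <= \<epsilon> / 2"
    using sum_bounded_above[of G _ "\<delta>^2"] \<delta>(2) by fastforce
   moreover have "2 / (real (Suc j))^2 * energy ?v1 ?v2 <= 2 / (real (Suc j))^2 * (4 * Q)" by (intro mult_left_mono ev) simp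
   moreover have "2 / (real (Suc j))^2 * (4 * Q) <= \<epsilon> / 2" using j by (simp add: field_simps)
   ultimately show ?thesis using L2_cells[OF v, of "Suc j"] unfolding v_def G_def by linarith
  qed
  then show ?thesis by blast
 qed
 then show ?thesis using s by blast
qed

end

subsection \<open>A weighted Sobolev inequality\<close>

lemma DERIV_abs_powr:
 fixes t \<gamma> :: real
 assumes "\<gamma> > 2"
 shows "((%t. abs t powr \<gamma>) has_real_derivative \<gamma> * (t * abs t powr (\<gamma> - 2))) (at t)"
proof (cases "t = 0")
 case True
 have e: "(abs h powr \<gamma> - abs 0 powr \<gamma>) / h = h * abs h powr (\<gamma> - 2)" for h :: real
  using powr_add[of "abs h" 2 "\<gamma> - 2"] by (simp add: power2_eq_square)
 have "continuous_on UNIV (%h. h * abs h powr (\<gamma> - 2))"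
  using assms by (intro continuous_intros continuous_on_powr') auto
 then have "isCont (%h. h * abs h powr (\<gamma> - 2)) 0" by (simp add: continuous_on_eq_continuous_at)
 then show ?thesis unfolding True DERIV_def add_0_left e by (simp add: isCont_def)
next
 case False
 have e: "(t^2) powr q = abs t powr (2 * q)" for t q :: real using powr_powr[of "abs t" 2 q] by simp
 have "((%t. (t^2) powr (\<gamma> / 2)) has_real_derivative \<gamma> / 2 * (t^2) powr (\<gamma> / 2 - 1) * (2 * t)) (at t)"
  using DERIV_chain2[where f = "%z. z powr (\<gamma> / 2)" and g = "%t. t^2" and x = t and s = UNIV and Db = "2 * t", OF has_real_derivative_powr] False DERIV_pow[of 2 t] by simp
 then show ?thesis unfolding e by (simp add: algebra_simps)
qed

text \<open>The value at r is an integral of the derivative over t >= r, and there both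
  \<open>\<mu>\<close> and t^(k-1) are at least their values at r, so the weights can be moved
  inside.\<close>

lemma rmeas_slice_bound:
 fixes h h' \<mu> :: "real => real"
 assumes h: "!!r. (h has_real_derivative h' r) (at r)" "continuous_on UNIV h'" "h 1 = 0"
  and \<mu>: "\<mu> : borel_measurable borel" "!!r t. 0 <= r ==> r <= t ==> t <= 1 ==> \<mu> r <= \<mu> t" "!!t. 0 <= \<mu> t"
  and k: "k > 0" and r: "0 <= r" "r <= 1"
 shows "r ^ (k - 1) * (\<mu> r * abs (h r)) <= (\<integral>t. \<mu> t * abs (h' t) \<partial>rmeas k)"
proof -
 have [measurable]: "h' : borel_measurable borel" "\<mu> : borel_measurable borel" using h \<mu> by (auto intro: borel_measurable_continuous_onI)
 have ii: "integrable lborel (%t. indicator {c..1} t * f t)" if "continuous_on UNIV f" for f :: "real => real" and c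
  using borel_integrable_compact[of "{c..1}" f] continuous_on_subset[OF that] by simp
 have "(LBINT t. indicator {r..1} t * h' t) = - h r"
  using integral_FTC_Icc_real[of r 1 h h'] r h by (auto simp: continuous_on_eq_continuous_at mult.commute)
 then have "abs (h r) <= (LBINT t. abs (indicator {r..1} t * h' t))"
  using integral_abs_bound[of lborel "%t. indicator {r..1} t * h' t"] by simp
 \<comment> \<open>Enlarging 1 to \<open>k\<close> supplies the factor in the density k t^(k-1) of
   the radial measure.\<close>
 then have "1 * (r ^ (k - 1) * \<mu> r) * abs (h r) <= real k * (r ^ (k - 1) * \<mu> r) * (LBINT t. abs (indicator {r..1} t * h' t))"
  using k r \<mu>(3) by (intro mult_mono) auto
 also have "... = (LBINT t. real k * (r ^ (k - 1) * \<mu> r) * abs (indicator {r..1} t * h' t))" by simp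
 also have "... <= (LBINT t. indicator {0..1} t * (real k * t ^ (k - 1)) * (\<mu> t * abs (h' t)))"
 proof (rule integral_mono')
  have "abs (indicator {0..1} t * (real k * t ^ (k - 1)) * (\<mu> t * abs (h' t))) <= abs (indicator {0..1} t * (real k * t ^ (k - 1) * (\<mu> 1 * abs (h' t))))" for t
   using \<mu>(2)[of t 1] \<mu>(3)[of t] by (auto simp: indicator_def abs_mult intro!: mult_left_mono mult_right_mono)
  then show "integrable lborel (%t. indicator {0..1} t * (real k * t ^ (k - 1)) * (\<mu> t * abs (h' t)))"
   using h(2) by (intro Bochner_Integration.integrable_bound[OF ii[of "%t. real k * t ^ (k - 1) * (\<mu> 1 * abs (h' t))" 0]])
    (auto intro!: continuous_intros)
  fix t
  have "r ^ (k - 1) * \<mu> r <= t ^ (k - 1) * \<mu> t" if "r <= t" "t <= 1" using that r \<mu> by (intro mult_mono power_mono) auto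
  from mult_left_mono[OF this, of "real k * abs (h' t)"]
  show "real k * (r ^ (k - 1) * \<mu> r) * abs (indicator {r..1} t * h' t) <= indicator {0..1} t * (real k * t ^ (k - 1)) * (\<mu> t * abs (h' t))"
   using r \<mu>(3)[of t] by (auto simp: indicator_def abs_mult mult_ac)
  show "0 <= indicator {0..1} t * (real k * t ^ (k - 1)) * (\<mu> t * abs (h' t))" using \<mu>(3)[of t] by (simp add: indicator_def)
 qed
 also have "... = (\<integral>t. \<mu> t * abs (h' t) \<partial>rmeas k)" by (rule rmeas_integral[symmetric]) measurable
 finally show ?thesis by simp
qed

context weighted_square
begin

text \<open>Its power p - 2 is the larger radius to the power (k2 - 1)(p - 2) / 2. Thus, for all
  large \<alpha>, |x|^\<alpha> is bounded in the unit ball by a multiple of that power of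
  \<open>\<tau>\<close>.\<close>

definition \<tau> :: "real \<times> real => real" where "\<tau> z = sqrt (max (fst z) (snd z) ^ (k2 - 1))"

lemma \<tau>_bounds: "z : unit_square ==> 0 <= \<tau> z & \<tau> z <= 1"
 by (auto simp: \<tau>_def unit_square_def mem_Times_iff le_max_iff_disj power_le_one)

lemma \<tau>_borel[measurable]: "\<tau> : borel_measurable borel"
 unfolding \<tau>_def[abs_def] borel_prod[symmetric] by measurable

text \<open>The argument of Ladyzhenskaya: both weights increase in each variable, so
 \<open>r\<^sup>a \<omega> |w|\<^sup>\<gamma>\<close> and \<open>s\<^sup>b \<omega> |w|\<^sup>\<gamma>\<close> are bounded by integrals along the two slices; their product is
 integrated by Fubini and Cauchy--Schwarz, and the rest is absorbed with Hardy's inequality.\<close>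

lemma weighted_Sobolev:
 assumes p: "2 < p" "(real k1 - 1) * (p - 2) < 4"
 shows "EX C>=0. ALL w w1 w2 R. C1b w w1 w2 --> 0 < R --> energy w1 w2 <= R^2 -->
  (LINT z|M. \<tau> z powr (p - 2) * abs (w z) powr p) <= C * R powr p"
proof -
 \<comment> \<open>Two identities fix the exponent: 2 \<gamma> = p + 2 in the product of the two
   slice bounds, and 2 (\<gamma> - 1) = p when Cauchy-Schwarz is applied to the slice integrals.
   With \<open>\<kappa>\<close> below, the hypothesis on \<open>p\<close> becomes \<kappa> < 2, the
   range of Hardy's inequality.\<close>
 define \<gamma> where "\<gamma> = (p + 2) / 2"
 define q where "q = (p - 2) / 2"
 define \<kappa> where "\<kappa> = real (k1 - 1) * q"
 have par: "\<gamma> > 2" "q > 0" "p = 2 + 2 * q" "\<gamma> = 2 + q" using p by (auto simp: \<gamma>_def q_def field_simps)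
 have \<kappa>: "0 < \<kappa>" "\<kappa> < 2" using p k1 k2 par(2) by (auto simp: \<kappa>_def q_def of_nat_diff)
 \<comment> \<open>Each of the two slices carries one factor \<open>om\<close>, so it contains half
   of the exponent p - 2.\<close>
 define om where "om z = indicator ({0..1} \<times> {0..1}) z * \<tau> z powr q" for z
 have [measurable]: "(fst :: real \<times> real => real) : borel_measurable borel" "(snd :: real \<times> real => real) : borel_measurable borel"
  by (intro borel_measurable_continuous_onI continuous_intros)+
 have om0: "0 <= om z" "om z <= 1" for z
  using par by (auto simp: om_def indicator_def \<tau>_def le_max_iff_disj power_le_one intro!: powr_le1)
 have [measurable]: "{0..1} \<times> {0..1} : sets (borel :: (real \<times> real) measure)" by (intro borel_Times) auto
 have om_borel[measurable]: "om : borel_measurable borel" unfolding om_def[abs_def] by measurable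
 have om_mono: "om (r, s) <= om (t, s)" "om (s, r) <= om (s, t)" if "0 <= r" "r <= t" "t <= 1" for r s t
  using that par by (auto simp: om_def indicator_def \<tau>_def le_max_iff_disj intro!: powr_mono2 power_mono max.mono)
 \<comment> \<open>The density r^(k1-1) s^(k2-1) enters with the power - q. The square of
   \<open>om\<close> is a power of the larger radius and cancels the singularity in s when s is the
   larger one; otherwise the surplus is moved from r to s. In both cases a single Hardy weight
   remains.\<close>
 have om_split: "om (r, s) ^ 2 * (r ^ (k1 - 1) * s ^ (k2 - 1)) powr - q <= r powr - \<kappa> + s powr - \<kappa>"
  if rs: "0 < r" "r <= 1" "0 < s" "s <= 1" for r s
 proof -
  let ?m = "max r s" and ?b = "real (k2 - 1) * q"
  have b: "?b <= \<kappa>" unfolding \<kappa>_def using k1 par by (intro mult_right_mono) auto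
  have "om (r, s) = ((?m powr real (k2 - 1)) powr (1 / 2)) powr q"
   using rs by (simp add: om_def \<tau>_def powr_half_sqrt powr_realpow)
  then have "om (r, s) ^ 2 = ?m powr ?b"
   using rs by (simp add: powr_powr powr_add[symmetric] power2_eq_square mult.commute)
  moreover have "(r ^ (k1 - 1) * s ^ (k2 - 1)) powr - q = r powr - \<kappa> * s powr - ?b"
   using rs by (simp add: powr_mult powr_powr \<kappa>_def flip: powr_realpow)
  ultimately have e: "om (r, s) ^ 2 * (r ^ (k1 - 1) * s ^ (k2 - 1)) powr - q = ?m powr ?b * (r powr - \<kappa> * s powr - ?b)" by simp
  show ?thesis
  proof (cases "r <= s")
   case True
   then show ?thesis using rs unfolding e by (simp add: powr_minus field_simps)
  next
   case False
   then have "r powr (?b - \<kappa>) <= s powr (?b - \<kappa>)" using rs b by (intro powr_mono2') auto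
   then have "r powr (?b - \<kappa>) * s powr - ?b <= s powr (?b - \<kappa>) * s powr - ?b" by (intro mult_right_mono) auto
   moreover have "s powr (?b - \<kappa>) * s powr - ?b = s powr - \<kappa>" by (simp flip: powr_add)
   moreover have "?m powr ?b * (r powr - \<kappa> * s powr - ?b) = r powr (?b - \<kappa>) * s powr - ?b"
    using False rs by (simp add: powr_diff powr_minus field_simps)
   ultimately show ?thesis unfolding e using powr_ge_zero[of r "- \<kappa>"] by linarith
  qed
 qed
 define c where "c = 4 / (2 - \<kappa>)^2"
 have c0: "0 <= c" by (simp add: c_def)
 define C where "C = 4 * c * (2 * \<gamma>^2) powr q"
 show ?thesis
 proof (intro exI[of _ C] conjI allI impI)
  show "0 <= C" by (simp add: C_def c_def)
  fix w w1 w2 R assume w: "C1b w w1 w2" and R: "0 < (R :: real)" and D: "energy w1 w2 <= R^2"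
  obtain B where B: "B >= 0" "!!z. abs (w z) <= B" "!!z. abs (w1 z) <= B" "!!z. abs (w2 z) <= B" using C1b_bound[OF w] by blast
  note wb[measurable] = C1b_borel[OF w]
  have pB: "abs (w z) powr e <= B powr e" if "0 < e" for z e using B(2)[of z] that by (intro powr_mono2) auto
  have sqB: "abs ((w1 z)^2) <= B^2" "abs ((w2 z)^2) <= B^2" for z
   using power_mono[OF B(3)[of z], of 2] power_mono[OF B(4)[of z], of 2] by simp_all
  have sqi: "integrable M (%z. (w1 z)^2)" "integrable M (%z. (w2 z)^2)"
   by (rule bounded_integrable[OF _ sqB(1)] bounded_integrable[OF _ sqB(2)]; measurable)+
  have fm: "(%z. fst z powr - \<kappa> * (w z)^2) : borel_measurable M" "(%z. snd z powr - \<kappa> * (w z)^2) : borel_measurable M"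
   by measurable
  have E: "(LINT z|M. (w1 z)^2) + (LINT z|M. (w2 z)^2) <= R^2" using D sqi by (simp add: energy_def)
  moreover have E0: "0 <= (LINT z|M. (w1 z)^2)" "0 <= (LINT z|M. (w2 z)^2)" by simp_all
  ultimately have E12: "(LINT z|M. (w1 z)^2) <= R^2" "(LINT z|M. (w2 z)^2) <= R^2" by linarith+
  define X where "X = (LINT z|M. (om z)^2 * abs (w z) powr p)"
  define G where "G v z = om z * abs (\<gamma> * (w z * abs (w z) powr (\<gamma> - 2)) * v z)" for v z
  define J where "J z = (om z)^2 * (fst z ^ (k1 - 1) * snd z ^ (k2 - 1)) * abs (w z) powr (p + 2)" for z
  have G_eq: "G v z = (om z * (\<gamma> * abs (w z) powr (\<gamma> - 1))) * abs (v z)" for v z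
   using powr_add[of "abs (w z)" 1 "\<gamma> - 2"] par by (simp add: G_def abs_mult)
  have Xi: "integrable M (%z. (om z)^2 * abs (w z) powr p)"
  proof (rule bounded_integrable)
   show "abs ((om z)^2 * abs (w z) powr p) <= 1 * B powr p" for z
    unfolding abs_mult by (intro mult_mono) (use pB[of p z] p om0[of z] in \<open>auto simp: power_le_one\<close>)
  qed measurable
  have Gm: "G v : borel_measurable borel" if [measurable]: "v : borel_measurable borel" for v
   unfolding G_def[abs_def] by measurable
  have Gb: "abs (G v z) <= 1 * (\<gamma> * B powr (\<gamma> - 1)) * B" if "abs (v z) <= B" for v z
   unfolding G_eq abs_mult by (intro mult_mono) (use that par(1) om0[of z] pB[of "\<gamma> - 1" z] B(1) in auto)
  note G1 = Gm[OF wb(2)] Gb[OF B(3)] and G2 = Gm[OF wb(3)] Gb[OF B(4)]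
  have GM: "(LINT z|M. G v z)^2 <= \<gamma>^2 * X * (LINT z|M. (v z)^2)"
   if "integrable M (%z. (v z)^2)" "integrable M (G v)" for v
  proof -
   have e: "(om z * (\<gamma> * abs (w z) powr (\<gamma> - 1)))^2 = \<gamma>^2 * ((om z)^2 * abs (w z) powr p)" for z
    using powr_add[of "abs (w z)" "\<gamma> - 1" "\<gamma> - 1"] par by (simp add: power2_eq_square mult_ac)
   have "G v = (%z. (om z * (\<gamma> * abs (w z) powr (\<gamma> - 1))) * abs (v z))" by (rule ext) (rule G_eq)
   then show ?thesis
    using integral_Cauchy_Schwarz[of M "%z. om z * (\<gamma> * abs (w z) powr (\<gamma> - 1))" "%z. abs (v z)"] that Xi
    unfolding e by (simp add: X_def)
  qed
  have slice: "((%t. abs (f t) powr \<gamma>) has_real_derivative \<gamma> * (f t * abs (f t) powr (\<gamma> - 2)) * f' t) (at t)"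
   "continuous_on UNIV (%t. \<gamma> * (f t * abs (f t) powr (\<gamma> - 2)) * f' t)"
   if f: "!!t. (f has_real_derivative f' t) (at t)" "continuous_on UNIV f'" for f f' :: "real => real" and t
  proof -
   show "((%t. abs (f t) powr \<gamma>) has_real_derivative \<gamma> * (f t * abs (f t) powr (\<gamma> - 2)) * f' t) (at t)"
    using DERIV_chain2[OF DERIV_abs_powr[OF par(1)] f(1)] .
   have "continuous_on UNIV f" using f(1) DERIV_isCont by (blast intro: continuous_at_imp_continuous_on)
   then show "continuous_on UNIV (%t. \<gamma> * (f t * abs (f t) powr (\<gamma> - 2)) * f' t)"
    using f(2) par by (intro continuous_intros continuous_on_powr') auto
  qed
  have k: "k1 > 0" "k2 > 0" using k1 k2 by auto
  have J_le: "J (r, s) <= (LINT t|N1. G w1 (t, s)) * (LINT t|N2. G w2 (r, t))" for r s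
  proof (cases "0 <= r & r <= 1 & 0 <= s & s <= 1")
   case True
   note sl = C1b_slices[OF w]
   have omb: "(%t. om (t, s)) : borel_measurable borel" "(%t. om (r, t)) : borel_measurable borel" by measurable
   have 1: "r ^ (k1 - 1) * (om (r, s) * abs (abs (w (r, s)) powr \<gamma>)) <= (LINT t|N1. G w1 (t, s))"
    unfolding G_def by (rule rmeas_slice_bound[OF slice[OF sl(5) sl(1)] _ omb(1)]) (use True om_mono om0 k sl(3) in auto)
   have 2: "s ^ (k2 - 1) * (om (r, s) * abs (abs (w (r, s)) powr \<gamma>)) <= (LINT t|N2. G w2 (r, t))"
    unfolding G_def by (rule rmeas_slice_bound[OF slice[OF sl(6) sl(2)] _ omb(2)]) (use True om_mono om0 k sl(4) in auto)
   have "J (r, s) = (r ^ (k1 - 1) * (om (r, s) * abs (abs (w (r, s)) powr \<gamma>))) * (s ^ (k2 - 1) * (om (r, s) * abs (abs (w (r, s)) powr \<gamma>)))"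
    using powr_add[of "abs (w (r, s))" \<gamma> \<gamma>] par by (simp add: J_def power2_eq_square mult_ac)
   also have "... <= (LINT t|N1. G w1 (t, s)) * (LINT t|N2. G w2 (r, t))"
    by (intro mult_mono 1 2 order_trans[OF _ 1]) (use True om0 in auto)
   finally show ?thesis .
  next
   case False
   then have "om (r, s) = 0" by (auto simp: om_def)
   then show ?thesis using om0 by (auto simp: J_def G_def intro!: mult_nonneg_nonneg integral_nonneg_AE)
  qed
  have J0: "0 <= J z" for z by (auto simp: J_def om_def indicator_def)
  have Jm[measurable]: "J : borel_measurable borel" unfolding J_def[abs_def] by measurable
  have Jb: "abs (J z) <= B powr (p + 2)" for z
  proof -
   have "fst z ^ (k1 - 1) * snd z ^ (k2 - 1) <= 1" "0 <= fst z ^ (k1 - 1) * snd z ^ (k2 - 1)" if "om z ~= 0"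
    using that by (auto simp: om_def indicator_def intro!: mult_le_one power_le_one split: if_splits)
   then have "J z <= 1 * 1 * B powr (p + 2)"
    unfolding J_def using om0[of z] pB[of "p + 2" z] p
    by (cases "om z = 0", simp) (intro mult_mono; simp add: power_le_one)
   then show ?thesis using J0[of z] by simp
  qed
  define P where "P = (LINT z|M. J z)"
  \<comment> \<open>The first slice integral depends only on s and the second only on r, so the
    double integral of their product factors.\<close>
  have "P <= (LINT z|M. G w1 z) * (LINT z|M. G w2 z)"
  proof -
   have "P = (LINT r|N1. (LINT s|N2. J (r, s)))" unfolding P_def by (rule Fubini_M(2)[OF Jm Jb])
   also have "... <= (LINT r|N1. (LINT s|N2. (LINT t|N1. G w1 (t, s)) * (LINT t|N2. G w2 (r, t))))"
    using Fubini_M(5)[OF G1] Fubini_M(6)[OF G2]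
    by (intro integral_mono Fubini_M(6)[OF Jm Jb] Fubini_M(4)[OF Jm Jb] J_le) auto
   also have "... = (LINT z|M. G w1 z) * (LINT z|M. G w2 z)"
    by (simp add: Fubini_M(1)[OF G1] Fubini_M(2)[OF G2])
   finally show ?thesis .
  qed
  moreover have "(LINT z|M. G w1 z) * (LINT z|M. G w2 z) <= \<gamma>^2 * X * R^2"
  proof (rule power2_le_imp_le)
   have X0: "0 <= X" unfolding X_def by (intro integral_nonneg_AE) auto
   then show "0 <= \<gamma>^2 * X * R^2" by simp
   have "((LINT z|M. G w1 z) * (LINT z|M. G w2 z))^2 <= (\<gamma>^2 * X * (LINT z|M. (w1 z)^2)) * (\<gamma>^2 * X * (LINT z|M. (w2 z)^2))"
    unfolding power_mult_distrib by (intro mult_mono GM sqi bounded_integrable[OF G1] bounded_integrable[OF G2]) (use X0 E0 in auto)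
   also have "... <= (\<gamma>^2 * X * R^2) * (\<gamma>^2 * X * R^2)" using X0 E12 E0 by (intro mult_mono) auto
   finally show "((LINT z|M. G w1 z) * (LINT z|M. G w2 z))^2 <= (\<gamma>^2 * X * R^2)^2" by (simp add: power2_eq_square)
  qed
  ultimately have P: "P <= \<gamma>^2 * X * R^2" by linarith
  \<comment> \<open>The threshold makes \<open>l * (\<gamma>^2 * X * R^2)\<close> equal to X / 2.
    Absorbing this half is legitimate because \<open>X\<close> is the integral of a bounded function
    over a finite measure.\<close>
  define l where "l = 1 / (2 * \<gamma>^2 * R^2)"
  have l: "l > 0" using par R by (simp add: l_def)
  \<comment> \<open>Where l \<rho> w^2 >= 1, with \<rho> the density, the integrand is dominated by
    \<open>l * J\<close>. Elsewhere w^2 is at most 1 / (l \<rho>), and its power q produces the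
    Hardy weights through \<open>om_split\<close>.\<close>
  have pt: "(om z)^2 * abs (w z) powr p <= l * J z + l powr - q * (fst z powr - \<kappa> * (w z)^2 + snd z powr - \<kappa> * (w z)^2)"
   if z: "0 < fst z" "fst z <= 1" "0 < snd z" "snd z <= 1" "w z ~= 0" for z
  proof -
   let ?\<rho> = "fst z ^ (k1 - 1) * snd z ^ (k2 - 1)"
   have \<rho>: "?\<rho> > 0" using z by simp
   have wp: "abs (w z) powr p = (w z)^2 * ((w z)^2) powr q" "abs (w z) powr (p + 2) = (w z)^2 * abs (w z) powr p"
    using z(5) powr_add[of "abs (w z)" 2 "2 * q"] powr_add[of "abs (w z)" 2 p] powr_powr[of "abs (w z)" 2 q]
    by (simp_all add: par(3) add.commute)
   show ?thesis
   proof (cases "1 <= l * ?\<rho> * (w z)^2")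
    case True
    then have "1 * ((om z)^2 * abs (w z) powr p) <= l * ?\<rho> * (w z)^2 * ((om z)^2 * abs (w z) powr p)" by (intro mult_right_mono) auto
    then show ?thesis by (simp add: J_def wp(2) mult_ac add_increasing2)
   next
    case False
    then have "(w z)^2 <= 1 / (l * ?\<rho>)" using l \<rho> by (simp add: pos_le_divide_eq mult_ac)
    then have "((w z)^2) powr q <= (1 / (l * ?\<rho>)) powr q" using par by (intro powr_mono2) auto
    also have "... = l powr - q * ?\<rho> powr - q" using l \<rho> by (simp add: powr_divide powr_mult powr_minus divide_simps)
    finally have "(om z)^2 * (w z)^2 * ((w z)^2) powr q <= (om z)^2 * (w z)^2 * (l powr - q * ?\<rho> powr - q)" by (intro mult_left_mono) auto
    also have "... = (l powr - q * (w z)^2) * ((om z)^2 * ?\<rho> powr - q)" by (simp add: mult_ac)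
    also have "... <= (l powr - q * (w z)^2) * (fst z powr - \<kappa> + snd z powr - \<kappa>)"
     using om_split[of "fst z" "snd z"] z by (intro mult_left_mono) auto
    finally show ?thesis using l J0[of z] by (simp add: wp(1) algebra_simps add_increasing2 add_increasing)
   qed
  qed
  have ae: "AE z in M. 0 < fst z & 0 < snd z & z : unit_square"
  proof -
   have "AE z in N1 \<Otimes>\<^sub>M N2. fst z ~= 0 & snd z ~= 0"
    using rmeas_AE_neq[of 0 k1] rmeas_AE_neq[of 0 k2] by (intro NN.AE_pair_measure, measurable) (auto elim!: eventually_mono)
   then show ?thesis using AE_unit_square unfolding M_def by eventually_elim (auto simp: unit_square_def)
  qed
  have "ennreal X = (\<integral>\<^sup>+z. ennreal ((om z)^2 * abs (w z) powr p) \<partial>M)"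
   unfolding X_def by (rule nn_integral_eq_integral[OF Xi, symmetric]) simp
  also have "... <= (\<integral>\<^sup>+z. ennreal (l * J z) + ennreal (l powr - q) * (ennreal (fst z powr - \<kappa> * (w z)^2) + ennreal (snd z powr - \<kappa> * (w z)^2)) \<partial>M)"
  proof (rule nn_integral_mono_AE, use ae in eventually_elim)
   case (elim z)
   then have "(om z)^2 * abs (w z) powr p <= l * J z + l powr - q * (fst z powr - \<kappa> * (w z)^2 + snd z powr - \<kappa> * (w z)^2)"
    using pt[of z] by (cases "w z = 0") (auto simp: unit_square_def J_def)
   then show ?case using l J0[of z] by (simp flip: ennreal_plus ennreal_mult)
  qed
  also have "... = ennreal (l * P) + ennreal (l powr - q) * ((\<integral>\<^sup>+z. ennreal (fst z powr - \<kappa> * (w z)^2) \<partial>M) + (\<integral>\<^sup>+z. ennreal (snd z powr - \<kappa> * (w z)^2) \<partial>M))"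
   using nn_integral_eq_integral[OF integrable_mult_right[OF bounded_integrable[OF Jm Jb], of l]] J0 l
   by (simp add: nn_integral_add nn_integral_cmult P_def)
  also have "... <= ennreal (l * P) + ennreal (l powr - q) * (ennreal (c * (LINT z|M. (w1 z)^2)) + ennreal (c * (LINT z|M. (w2 z)^2)))"
  proof (intro add_mono mult_mono)
   have sqm: "(%z. (w1 z)^2) : borel_measurable borel" "(%z. (w2 z)^2) : borel_measurable borel" by measurable
   have "(\<integral>\<^sup>+z. ennreal (fst z powr - \<kappa> * (w z)^2) \<partial>M) = (\<integral>\<^sup>+s. (\<integral>\<^sup>+r. ennreal (r powr - \<kappa> * (w (r, s))^2) \<partial>N1) \<partial>N2)"
    using fm(1) unfolding M_def by (subst NN.nn_integral_snd[symmetric]) auto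
   also have "... <= (\<integral>\<^sup>+s. ennreal (c * (LINT r|N1. (w1 (r, s))^2)) \<partial>N2)"
    unfolding c_def using C1b_slices[OF w] \<kappa> k1 k2 by (intro nn_integral_mono rmeas_Hardy) auto
   also have "... = ennreal (c * (LINT z|M. (w1 z)^2))"
    using Fubini_M(5)[OF sqm(1) sqB(1)] c0
    by (subst nn_integral_eq_integral) (auto simp: Fubini_M(1)[OF sqm(1) sqB(1)])
   finally show "(\<integral>\<^sup>+z. ennreal (fst z powr - \<kappa> * (w z)^2) \<partial>M) <= ennreal (c * (LINT z|M. (w1 z)^2))" .
   have "(\<integral>\<^sup>+z. ennreal (snd z powr - \<kappa> * (w z)^2) \<partial>M) = (\<integral>\<^sup>+r. (\<integral>\<^sup>+s. ennreal (s powr - \<kappa> * (w (r, s))^2) \<partial>N2) \<partial>N1)"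
    using fm(2) unfolding M_def by (subst N2.nn_integral_fst[symmetric]) auto
   also have "... <= (\<integral>\<^sup>+r. ennreal (c * (LINT s|N2. (w2 (r, s))^2)) \<partial>N1)"
    unfolding c_def using C1b_slices[OF w] \<kappa> k1 k2 by (intro nn_integral_mono rmeas_Hardy) auto
   also have "... = ennreal (c * (LINT z|M. (w2 z)^2))"
    using Fubini_M(6)[OF sqm(2) sqB(2)] c0
    by (subst nn_integral_eq_integral) (auto simp: Fubini_M(2)[OF sqm(2) sqB(2)])
   finally show "(\<integral>\<^sup>+z. ennreal (snd z powr - \<kappa> * (w z)^2) \<partial>M) <= ennreal (c * (LINT z|M. (w2 z)^2))" .
  qed auto
  also have "... = ennreal (l * P + l powr - q * (c * (LINT z|M. (w1 z)^2) + c * (LINT z|M. (w2 z)^2)))"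
   using l J0 by (simp add: c_def P_def integral_nonneg_AE flip: ennreal_plus ennreal_mult)
  finally have "X <= l * P + l powr - q * (c * (LINT z|M. (w1 z)^2) + c * (LINT z|M. (w2 z)^2))"
   using l J0 by (subst (asm) ennreal_le_iff) (auto simp: c_def P_def intro!: add_nonneg_nonneg mult_nonneg_nonneg)
  also have "... <= l * (\<gamma>^2 * X * R^2) + l powr - q * (c * R^2)"
   using mult_left_mono[OF E c0] l P by (intro add_mono mult_left_mono) (auto simp: distrib_left)
  also have "l * (\<gamma>^2 * X * R^2) = X / 2" using par R by (simp add: l_def field_simps)
  also have "l powr - q * (c * R^2) = C / 4 * R powr p"
  proof -
   have "l powr - q = (2 * \<gamma>^2) powr q * (R^2) powr q" using R par by (simp add: l_def powr_divide powr_minus powr_mult)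
   also have "(R^2) powr q = R powr (2 * q)" using R powr_powr[of R 2 q] by simp
   finally show ?thesis using R powr_add[of R 2 "2 * q"] by (simp add: C_def par(3) mult_ac)
  qed
  finally have "X <= C * R powr p" using mult_nonneg_nonneg[OF \<open>0 \<le> C\<close> powr_ge_zero[of R p]] by linarith
  also have "X = (LINT z|M. \<tau> z powr (p - 2) * abs (w z) powr p)"
  proof -
   have "(\<tau> z powr q)^2 = \<tau> z powr (p - 2)" for z using powr_add[of "\<tau> z" q q] by (simp add: par(3) power2_eq_square)
   then show ?thesis unfolding X_def using AE_unit_square
    by (intro integral_cong_AE) (auto elim!: eventually_mono simp: om_def unit_square_def)
  qed
  finally show "(LINT z|M. \<tau> z powr (p - 2) * abs (w z) powr p) <= C * R powr p" .
 qed
qed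

end

subsection \<open>Block-radial functions\<close>

definition blk :: "'a set => 'a => 'a::euclidean_space" where
 "blk B x = (SUM b:B. (x \<bullet> b) *\<^sub>R b)"

locale blocks =
 fixes B1 B2 :: "'a::euclidean_space set"
 assumes un: "B1 \<union> B2 = Basis" and disj: "B1 \<inter> B2 = {}"
begin

lemma fin: "finite B1" "finite B2" using un finite_Basis by (metis finite_Un)+

lemma sub: "B1 \<subseteq> Basis" "B2 \<subseteq> Basis" using un by auto

lemma blk_linear: "linear (blk B)"
 unfolding blk_def by (intro linearI) (auto simp: inner_add_left scaleR_add_left sum.distrib scaleR_sum_right)

lemma blk_borel[measurable]: "blk B : borel_measurable borel"
 using linear_continuous_on[of "blk B" UNIV] blk_linear linear_conv_bounded_linear
 by (blast intro: borel_measurable_continuous_onI)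

lemma blk_inner_Basis: "B \<subseteq> Basis ==> c : Basis ==> blk B x \<bullet> c = (if c : B then x \<bullet> c else 0)"
proof -
 assume B: "B \<subseteq> Basis" and c: "c : Basis"
 have "blk B x \<bullet> c = (SUM b:B. if b = c then x \<bullet> c else 0)"
  unfolding blk_def inner_sum_left using B c by (intro sum.cong) (auto simp: inner_Basis)
 then show ?thesis using finite_subset[OF B finite_Basis] by simp
qed

lemma blk_sum: "blk B1 x + blk B2 x = x"
proof (rule euclidean_eqI)
 fix b :: 'a assume b: "b : Basis"
 then have "b : B1 & b ~: B2 | b ~: B1 & b : B2" using un disj by blast
 then show "(blk B1 x + blk B2 x) \<bullet> b = x \<bullet> b"
  using b by (auto simp: inner_add_left blk_inner_Basis[OF sub(1)] blk_inner_Basis[OF sub(2)])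
qed

lemma blk_blk: "blk B1 (blk B1 x) = blk B1 x" "blk B2 (blk B2 x) = blk B2 x" "blk B1 (blk B2 x) = 0" "blk B2 (blk B1 x) = 0"
 by (rule euclidean_eqI; use disj in \<open>auto simp: blk_inner_Basis[OF sub(1)] blk_inner_Basis[OF sub(2)]\<close>)+

lemma blk_self_adjoint: "B \<subseteq> Basis ==> blk B x \<bullet> y = x \<bullet> blk B y"
 unfolding blk_def by (simp add: inner_sum_left inner_sum_right inner_commute mult.commute)

lemma blk_orthogonal: "blk B1 x \<bullet> blk B2 y = 0" "blk B2 x \<bullet> blk B1 y = 0"
 using blk_self_adjoint[OF sub(1), of x "blk B2 y"] blk_self_adjoint[OF sub(2), of x "blk B1 y"] by (simp_all add: blk_blk)

lemma norm_blk: "(norm x)^2 = (norm (blk B1 x))^2 + (norm (blk B2 x))^2"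
proof -
 have "x \<bullet> x = (blk B1 x + blk B2 x) \<bullet> (blk B1 x + blk B2 x)" by (simp add: blk_sum)
 then show ?thesis by (simp add: power2_norm_eq_inner inner_add_left inner_add_right blk_orthogonal)
qed

lemma norm_blk_le: "norm (blk B1 x) <= norm x" "norm (blk B2 x) <= norm x"
 by (rule power2_le_imp_le; use norm_blk[of x] in simp)+

lemma smooth_norm_blk: "B \<subseteq> Basis ==> smooth (%x. (norm (blk B x))^2)"
proof -
 assume B: "B \<subseteq> Basis"
 have "(norm (blk B x))^2 = (SUM b:B. (x \<bullet> b)^2)" for x
 proof -
  have "(norm (blk B x))^2 = (SUM b:B. (x \<bullet> b) * (b \<bullet> blk B x))" unfolding power2_norm_eq_inner by (subst blk_def) (simp add: inner_sum_left)
  also have "... = (SUM b:B. (x \<bullet> b)^2)"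
   using B by (intro sum.cong) (auto simp: inner_commute[of _ "blk B x"] blk_inner_Basis subsetD power2_eq_square)
  finally show ?thesis .
 qed
 then show ?thesis using finite_subset[OF B finite_Basis] by (auto intro!: smooth_sum smooth_power smooth_inner)
qed

definition same :: "'a => 'a => bool" where
 "same x y \<longleftrightarrow> norm (blk B1 x) = norm (blk B1 y) & norm (blk B2 x) = norm (blk B2 y)"

text \<open>This is the product of the orthogonal groups of the two blocks, described by its
  invariants.\<close>

definition G :: "('a => 'a) set" where
 "G = {g. orthogonal_transformation g & (ALL x. same (g x) x)}"

lemma G_monoid: "isometry_monoid G"
 unfolding isometry_monoid_def G_def
 by (auto simp: same_def orthogonal_transformation_id[unfolded id_def] orthogonal_transformation_compose[unfolded o_def])

definition XS :: "('a => real) set" where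
 "XS = {u : TF. ALL x y. same x y --> u x = u y}"

text \<open>The Householder reflection along \<open>v\<close>; for v = 0 it is the identity.\<close>

definition refl :: "'a => 'a => 'a" where
 "refl v x = x - (2 * (x \<bullet> v) / (v \<bullet> v)) *\<^sub>R v"

lemma refl_orthogonal: "orthogonal_transformation (refl v)"
proof (cases "v = 0")
 case True
 then show ?thesis by (simp add: refl_def[abs_def] orthogonal_transformation_id[unfolded id_def])
next
 case False
 have "linear (refl v)" unfolding refl_def[abs_def]
  by (intro linearI) (simp_all add: inner_add_left algebra_simps add_divide_distrib)
 moreover have "refl v x \<bullet> refl v y = x \<bullet> y" for x y
 proof -
  define p q where "p = 2 * (x \<bullet> v) / (v \<bullet> v)" and "q = 2 * (y \<bullet> v) / (v \<bullet> v)"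
  have "refl v x \<bullet> refl v y = x \<bullet> y - q * (x \<bullet> v) - p * (y \<bullet> v) + p * q * (v \<bullet> v)"
   by (simp add: refl_def flip: p_def q_def)
    (simp add: inner_diff_left inner_diff_right inner_commute[of v y] right_diff_distrib)
  also have "p * q * (v \<bullet> v) = q * (x \<bullet> v) + p * (y \<bullet> v)" using False by (simp add: p_def q_def field_simps)
  finally show ?thesis by simp
 qed
 ultimately show ?thesis by (simp add: orthogonal_transformation_def)
qed

lemma refl_blk:
 assumes "blk B v = v" "B \<subseteq> Basis"
 shows "blk B (refl v x) = refl v (blk B x)"
proof -
 have "blk B x \<bullet> v = x \<bullet> v" using blk_self_adjoint[OF assms(2), of x v] assms(1) by simp
 then show ?thesis using assms(1) by (simp add: refl_def linear_diff[OF blk_linear] linear_scale[OF blk_linear])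
qed

lemma refl_swap:
 assumes "norm x = norm y" shows "refl (x - y) x = y"
proof (cases "x = y")
 case False
 have "x \<bullet> x = y \<bullet> y" using assms by (simp flip: power2_norm_eq_inner)
 then have "2 * (x \<bullet> (x - y)) = (x - y) \<bullet> (x - y)" by (simp add: inner_diff_left inner_diff_right inner_commute)
 moreover have "(x - y) \<bullet> (x - y) ~= 0" using False by simp
 ultimately show ?thesis by (simp add: refl_def)
qed (simp add: refl_def)

lemma refl_G1: "blk B1 v = v ==> refl v : G" and refl_G2: "blk B2 v = v ==> refl v : G"
proof -
 have n: "norm (refl v x) = norm x" for v x using orthogonal_transformation_norm[OF refl_orthogonal] .
 show "refl v : G" if v: "blk B1 v = v"
 proof -
  have "blk B2 v = 0" using v blk_blk(4)[of v] by simp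
  then have "blk B2 (refl v x) = blk B2 x" for x by (simp add: refl_def linear_diff[OF blk_linear] linear_scale[OF blk_linear])
  then show ?thesis using refl_blk[OF v sub(1)] by (simp add: G_def same_def refl_orthogonal n)
 qed
 show "refl v : G" if v: "blk B2 v = v"
 proof -
  have "blk B1 v = 0" using v blk_blk(3)[of v] by simp
  then have "blk B1 (refl v x) = blk B1 x" for x by (simp add: refl_def linear_diff[OF blk_linear] linear_scale[OF blk_linear])
  then show ?thesis using refl_blk[OF v sub(2)] by (simp add: G_def same_def refl_orthogonal n)
 qed
qed

text \<open>One reflection in each block is enough, since a reflection along a vector of one block
  fixes the other block pointwise.\<close>

lemma G_transitive:
 assumes "same x y" shows "EX g:G. g x = y"
proof -
 define v1 where "v1 = blk B1 x - blk B1 y"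
 define v2 where "v2 = blk B2 x - blk B2 y"
 have v1: "blk B1 v1 = v1" "blk B2 v1 = 0" and v2: "blk B2 v2 = v2" "blk B1 v2 = 0"
  by (simp_all add: v1_def v2_def linear_diff[OF blk_linear] blk_blk)
 have z1: "refl v1 (blk B2 z) = blk B2 z" "refl v2 (blk B1 z) = blk B1 z" for z
  using blk_self_adjoint[OF sub(2), of z v1] blk_self_adjoint[OF sub(1), of z v2] v1 v2 by (simp_all add: refl_def)
 have lin: "linear (refl v)" for v using refl_orthogonal orthogonal_transformation_linear by blast
 have "refl v1 (blk B1 x) = blk B1 y" "refl v2 (blk B2 x) = blk B2 y"
  unfolding v1_def v2_def using assms by (auto intro: refl_swap simp: same_def)
 then have "refl v2 (refl v1 (blk B1 x + blk B2 x)) = blk B1 y + blk B2 y"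
  by (simp add: linear_add[OF lin] z1)
 then have "refl v2 (refl v1 x) = y" by (simp only: blk_sum)
 moreover have "(%z. refl v2 (refl v1 z)) : G"
  using refl_G1[OF v1(1)] refl_G2[OF v2(1)] G_monoid by (auto simp: isometry_monoid_def)
 ultimately show ?thesis by (intro bexI[of _ "%z. refl v2 (refl v1 z)"]) simp
qed

lemma XS_invariant: "u : XS ==> g : G ==> u (g x) = u x"
 by (auto simp: XS_def G_def)

lemma XS_I: "u : TF ==> (!!g x. g : G ==> u (g x) = u x) ==> u : XS"
 unfolding XS_def using G_transitive by fastforce

lemma XS_TF: "u : XS ==> u : TF" by (simp add: XS_def)

lemma XS_same: "u : XS ==> same x y ==> u x = u y" by (simp add: XS_def)

end

text \<open>The map is diagonal with determinant a^|B1| b^|B2|. This scaling law takes the place of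
  polar coordinates in the blocks.\<close>

lemma emeasure_lborel_block_scaling:
 fixes B1 B2 :: "'a::euclidean_space set"
 assumes "blocks B1 B2" and ab: "a > 0" "b > 0" and A[measurable]: "A : sets borel"
 shows "emeasure lborel A = ennreal (a ^ card B1 * b ^ card B2) * emeasure lborel {x. a *\<^sub>R blk B1 x + b *\<^sub>R blk B2 x : A}"
proof -
 interpret blocks B1 B2 by fact
 define c where "c j = (if j : B1 then a else b)" for j :: 'a
 have T: "0 + (SUM j:Basis. (c j * (x \<bullet> j)) *\<^sub>R j) = a *\<^sub>R blk B1 x + b *\<^sub>R blk B2 x" for x
 proof (rule euclidean_eqI)
  fix i :: 'a assume i: "i : Basis"
  have "(0 + (SUM j:Basis. (c j * (x \<bullet> j)) *\<^sub>R j)) \<bullet> i = (SUM j:Basis. if j = i then c i * (x \<bullet> i) else 0)"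
   using i by (simp add: inner_sum_left inner_Basis if_distrib cong: if_cong sum.cong)
  also have "... = c i * (x \<bullet> i)" using i by simp
  also have "... = (a *\<^sub>R blk B1 x + b *\<^sub>R blk B2 x) \<bullet> i"
   using i un disj sub by (auto simp: c_def inner_add_left blk_inner_Basis)
  finally show "(0 + (SUM j:Basis. (c j * (x \<bullet> j)) *\<^sub>R j)) \<bullet> i = (a *\<^sub>R blk B1 x + b *\<^sub>R blk B2 x) \<bullet> i" .
 qed
 have prod: "(PROD j:(Basis :: 'a set). abs (c j)) = a ^ card B1 * b ^ card B2"
 proof -
  have "(PROD j:(Basis :: 'a set). abs (c j)) = (PROD j:B1. abs (c j)) * (PROD j:B2. abs (c j))"
   unfolding un[symmetric] by (rule prod.union_disjoint[OF fin disj])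
  also have "(PROD j:B1. abs (c j)) = a ^ card B1" using ab by (simp add: c_def)
  also have "(PROD j:B2. abs (c j)) = (PROD j:B2. b)" using ab disj by (intro prod.cong) (auto simp: c_def)
  finally show ?thesis by simp
 qed
 have "lborel = density (distr lborel borel (%x. 0 + (SUM j:Basis. (c j * (x \<bullet> j)) *\<^sub>R j))) (%_. PROD j:(Basis :: 'a set). abs (c j))"
  by (rule lborel_affine_euclidean) (use ab in \<open>simp add: c_def\<close>)
 then have eq: "lborel = density (distr lborel borel (%x. a *\<^sub>R blk B1 x + b *\<^sub>R blk B2 x)) (%_. ennreal (a ^ card B1 * b ^ card B2))"
  by (simp only: T prod)
 have m[measurable]: "(%x. a *\<^sub>R blk B1 x + b *\<^sub>R blk B2 x) : borel_measurable borel" by measurable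
 show ?thesis
  by (subst eq) (simp add: emeasure_density nn_integral_cmult emeasure_distr vimage_def)
qed

subsection \<open>The Dirichlet form\<close>

definition Dir :: "('a::euclidean_space => real) => ('a => real) => real" where
 "Dir u v = (LBINT x. gradient u x \<bullet> gradient v x)"

lemma Dir_integrable:
 assumes "u : TF" "v : TF" shows "integrable lborel (%x. gradient u x \<bullet> gradient v x)"
 by (rule continuous_ball_support_integrable)
  (auto intro!: continuous_on_inner TF_gradient_continuous assms simp: TF_gradient_zero[OF assms(1)])

section \<open>Block-radial functions as functions on the unit square\<close>

locale block_pair = blocks B1 B2 for B1 B2 :: "'a::euclidean_space set" +
 assumes c2: "2 <= card B2" and c1: "card B2 <= card B1"
begin

sublocale weighted_square "card B1" "card B2"
 using c1 c2 by unfold_locales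

abbreviation "k1 \<equiv> card B1"
abbreviation "k2 \<equiv> card B2"

definition Nrm :: "'a => real \<times> real" where "Nrm x = (norm (blk B1 x), norm (blk B2 x))"
text \<open>The product of the unit balls of the blocks, not the unit ball itself: its block radii
  fill the whole unit square, where the radii are independent. Test functions vanish on the part of
  it outside the unit ball.\<close>

definition Z :: "'a set" where "Z = {x. norm (blk B1 x) < 1 & norm (blk B2 x) < 1}"
definition \<kappa> :: real where "\<kappa> = measure lborel Z"

lemma Nrm_borel[measurable]: "Nrm : borel_measurable borel"
 unfolding Nrm_def[abs_def] by measurable

lemma Z_borel[measurable]: "Z : sets borel"
 unfolding Z_def by measurable

lemma ball_Z: "ball 0 1 \<subseteq> Z"
 by (auto simp: Z_def intro: le_less_trans[OF norm_blk_le(1)] le_less_trans[OF norm_blk_le(2)])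

lemma Z_finite: "emeasure lborel Z < \<infinity>"
proof -
 have "Z \<subseteq> ball 0 2"
 proof
  fix x assume "x : Z"
  then have "norm (blk B1 x) < 1" "norm (blk B2 x) < 1" by (auto simp: Z_def)
  then have "norm (blk B1 x + blk B2 x) < 2" using norm_triangle_ineq[of "blk B1 x" "blk B2 x"] by linarith
  then show "x : ball 0 2" by (simp add: blk_sum)
 qed
 then show ?thesis using emeasure_mono[of Z "ball 0 2" lborel] emeasure_lborel_ball_finite[of "0::'a" 2] le_less_trans by auto
qed

lemma \<kappa>: "\<kappa> > 0" "emeasure lborel Z = ennreal \<kappa>"
proof -
 show e: "emeasure lborel Z = ennreal \<kappa>" using Z_finite by (simp add: \<kappa>_def measure_def less_top)
 have "emeasure lborel (ball (0::'a) 1) <= emeasure lborel Z" using ball_Z by (intro emeasure_mono) auto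
 moreover have "emeasure lborel (ball (0::'a) 1) = ennreal (unit_ball_vol (real DIM('a)))" by (simp add: emeasure_ball)
 moreover have "unit_ball_vol (real DIM('a)) > 0" by simp
 ultimately show "\<kappa> > 0" unfolding e by (metis ennreal_le_iff2 leD linorder_not_less order_less_le_trans)
qed

lemma emeasure_block:
 assumes ab: "0 < a" "0 < b"
 shows "emeasure lborel {x. norm (blk B1 x) < a & norm (blk B2 x) < b} = ennreal (a ^ k1 * b ^ k2 * \<kappa>)"
proof -
 let ?A = "{x. norm (blk B1 x) < a & norm (blk B2 x) < b}"
 have "blk B1 (a *\<^sub>R blk B1 x + b *\<^sub>R blk B2 x) = a *\<^sub>R blk B1 x" "blk B2 (a *\<^sub>R blk B1 x + b *\<^sub>R blk B2 x) = b *\<^sub>R blk B2 x" for x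
  by (simp_all add: linear_add[OF blk_linear] linear_scale[OF blk_linear] blk_blk)
 then have "{x. a *\<^sub>R blk B1 x + b *\<^sub>R blk B2 x : ?A} = Z"
  using ab by (auto simp: Z_def)
 moreover have "?A : sets borel" by measurable
 ultimately have "emeasure lborel ?A = ennreal (a ^ k1 * b ^ k2) * emeasure lborel Z"
  using emeasure_lborel_block_scaling[OF blocks_axioms ab, of ?A] by simp
 also have "... = ennreal (a ^ k1 * b ^ k2 * \<kappa>)" using ab \<kappa> by (simp add: ennreal_mult)
 finally show ?thesis .
qed

lemma rmeas_lessThan:
 assumes "k > 0" shows "emeasure (rmeas k) {..<a} = ennreal ((max 0 (min a 1)) ^ k)"
proof -
 have "emeasure (rmeas k) {..<a} = emeasure (rmeas k) {0..<max 0 (min a 1)}"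
  using rmeas_AE_unit[of k] rmeas_AE_neq[of 1 k]
  by (intro emeasure_eq_AE) (auto elim!: eventually_elim2)
 then show ?thesis using emeasure_rmeas_Ico[OF assms, of 0 "max 0 (min a 1)"] assms by simp
qed

text \<open>Both measures agree on quadrants, by the scaling of volumes, and quadrants are an
  intersection-stable generator of the Borel sets of the plane.\<close>

lemma pushforward: "distr (density lborel (indicator Z)) borel Nrm = density M (%_. ennreal \<kappa>)" (is "?P = ?Q")
proof (rule measure_eqI_generator_eq)
 let ?E = "range (%a::real \<times> real. {x. eucl_less x a})"
 have el: "{x. eucl_less x a} = {..<fst a} \<times> {..<snd a}" for a :: "real \<times> real"
  by (cases a) (auto simp: eucl_less_def Basis_prod_def)
 show "Int_stable ?E"
 proof (rule Int_stableI)
  fix A B assume "A : ?E" "B : ?E"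
  then obtain a b where "A = {..<fst a} \<times> {..<snd a}" "B = {..<fst b} \<times> {..<snd b}" unfolding el by blast
  then have "A \<inter> B = {x. eucl_less x (min (fst a) (fst b), min (snd a) (snd b))}" unfolding el by auto
  then show "A \<inter> B : ?E" by blast
 qed
 show "?E \<subseteq> Pow UNIV" by simp
 show "sets ?P = sigma_sets UNIV ?E" "sets ?Q = sigma_sets UNIV ?E"
 proof -
  have "sets (borel :: (real \<times> real) measure) = sigma_sets UNIV ?E"
   by (subst borel_eq_lessThan) (simp add: sets_measure_of)
  then show "sets ?P = sigma_sets UNIV ?E" "sets ?Q = sigma_sets UNIV ?E" by simp_all
 qed
 show "range (%n::nat. {x. eucl_less x (real n, real n)}) \<subseteq> ?E" by blast
 show "(UN n::nat. {x. eucl_less x (real n, real n)}) = UNIV"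
 proof -
  have "EX n. fst z < real n & snd z < real n" for z
   using reals_Archimedean2[of "max (fst z) (snd z)"] by auto
  then show ?thesis unfolding el by (auto simp: mem_Times_iff)
 qed
 have P: "emeasure ?P A = emeasure lborel {x : Z. Nrm x : A}" if [measurable]: "A : sets borel" for A
 proof -
  have [measurable]: "Nrm -` A : sets borel" using measurable_sets[OF Nrm_borel, of A] by simp
  have "emeasure ?P A = (\<integral>\<^sup>+x. indicator Z x * indicator (Nrm -` A) x \<partial>lborel)"
   by (simp add: emeasure_distr emeasure_density)
  also have "... = (\<integral>\<^sup>+x. indicator {x : Z. Nrm x : A} x \<partial>lborel)"
   by (intro nn_integral_cong) (auto simp: indicator_def)
  also have "... = emeasure lborel {x : Z. Nrm x : A}" by (rule nn_integral_indicator) measurable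
  finally show ?thesis .
 qed
 have Q: "emeasure ?Q A = ennreal \<kappa> * emeasure M A" if "A : sets borel" for A
  using that by (simp add: emeasure_density nn_integral_cmult)
 show "emeasure ?P X = emeasure ?Q X" if XE: "X : ?E" for X
 proof -
  obtain p where "X = {..<fst p} \<times> {..<snd p}" using XE unfolding el by blast
  then obtain a b where X: "X = {..<a} \<times> {..<b}" by blast
  have k: "k1 > 0" "k2 > 0" using c1 c2 by auto
  have Xb: "X : sets borel" unfolding X by (intro borel_Times) auto
  define a' where "a' = max 0 (min a 1)"
  define b' where "b' = max 0 (min b 1)"
  have "emeasure M X = ennreal (a' ^ k1) * ennreal (b' ^ k2)"
   unfolding X a'_def b'_def by (simp add: M_times rmeas_lessThan k)
  then have "emeasure ?Q X = ennreal \<kappa> * (ennreal (a' ^ k1) * ennreal (b' ^ k2))" by (simp only: Q[OF Xb])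
  also have "... = ennreal (a' ^ k1 * b' ^ k2 * \<kappa>)"
   using \<kappa>(1) by (simp add: a'_def b'_def mult_ac flip: ennreal_mult)
  also have "... = emeasure ?P X"
  proof (cases "a > 0 & b > 0")
   case True
   then have "{x : Z. Nrm x : X} = {x. norm (blk B1 x) < a' & norm (blk B2 x) < b'}"
    by (auto simp: Z_def Nrm_def X a'_def b'_def)
   moreover have "0 < a'" "0 < b'" using True by (auto simp: a'_def b'_def)
   ultimately show ?thesis unfolding P[OF Xb] using emeasure_block[of a' b'] by simp
  next
   case False
   then have em: "{x : Z. Nrm x : X} = {}" by (auto simp: X Nrm_def) (meson norm_ge_zero order_le_less_trans linorder_not_less)+
   have "a' = 0 | b' = 0" using False by (auto simp: a'_def b'_def)
   then show ?thesis unfolding P[OF Xb] em using k by (auto simp: zero_power)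
  qed
  finally show ?thesis by simp
 qed
 show "emeasure ?P {x. eucl_less x (real n, real n)} ~= \<infinity>" for n
 proof -
  have b: "{x. eucl_less x (real n, real n)} : sets borel" unfolding el by (intro borel_Times) auto
  have "emeasure ?P {x. eucl_less x (real n, real n)} <= emeasure lborel Z"
   unfolding P[OF b] by (intro emeasure_mono) auto
  then show ?thesis using Z_finite by (metis infinity_ennreal_def linorder_not_less top.not_eq_extremum)
 qed
qed

lemma transfer_integral:
 fixes h :: "real \<times> real => real"
 assumes [measurable]: "h : borel_measurable borel"
 shows "(LBINT x. indicator Z x * h (Nrm x)) = \<kappa> * (LINT z|M. h z)"
proof -
 have "(LBINT x. indicator Z x * h (Nrm x)) = (\<integral>x. h (Nrm x) \<partial>density lborel (indicator Z))"
 proof -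
  have "(indicator Z :: 'a => ennreal) = (%x. ennreal (indicator Z x))" by (simp add: ennreal_indicator)
  then show ?thesis by (simp add: integral_density)
 qed
 also have "... = (\<integral>z. h z \<partial>distr (density lborel (indicator Z)) borel Nrm)"
  by (subst integral_distr) auto
 also have "... = (LINT z|M. \<kappa> * h z)"
  unfolding pushforward using \<kappa>(1) by (subst integral_density) auto
 finally show ?thesis by simp
qed

lemma transfer_AE:
 assumes "AE z in M. Q z" "{z. Q z} : sets borel"
 shows "AE x in lborel. x : Z --> Q (Nrm x)"
proof -
 have "AE z in density M (%_. ennreal \<kappa>). Q z" using assms(1) by (subst AE_density) auto
 then have "AE z in distr (density lborel (indicator Z)) borel Nrm. Q z" unfolding pushforward .
 then have "AE x in density lborel (indicator Z). Q (Nrm x)"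
  using assms(2) by (subst (asm) AE_distr_iff) auto
 then show ?thesis by (subst (asm) AE_density) (auto simp: indicator_def elim!: eventually_mono split: if_splits)
qed

definition e1 :: 'a where "e1 = (SOME b. b : B1)"
definition e2 :: 'a where "e2 = (SOME b. b : B2)"

lemma e12: "e1 : B1" "e2 : B2" "e1 : Basis" "e2 : Basis" "blk B1 e1 = e1" "blk B2 e1 = 0" "blk B2 e2 = e2" "blk B1 e2 = 0"
proof -
 have "B1 ~= {}" "B2 ~= {}" using c1 c2 by auto
 then show e: "e1 : B1" "e2 : B2" unfolding e1_def e2_def by (auto intro: someI_ex)
 then show e': "e1 : Basis" "e2 : Basis" using sub by auto
 have "e1 ~: B2" "e2 ~: B1" using e disj by auto
 then show "blk B1 e1 = e1" "blk B2 e1 = 0" "blk B2 e2 = e2" "blk B1 e2 = 0"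
  using e e' by (auto intro!: euclidean_eqI[where 'a='a] simp: blk_inner_Basis[OF sub(1)] blk_inner_Basis[OF sub(2)] inner_Basis)
qed

text \<open>The profile of a block-radial function, read off along one unit vector of each block. It
  is defined for arguments of either sign, so that its derivatives on the axes are
  two-sided.\<close>

definition W :: "('a => real) => real \<times> real => real" where "W u z = u (fst z *\<^sub>R e1 + snd z *\<^sub>R e2)"
definition W1 :: "('a => real) => real \<times> real => real" where "W1 u z = gradient u (fst z *\<^sub>R e1 + snd z *\<^sub>R e2) \<bullet> e1"
definition W2 :: "('a => real) => real \<times> real => real" where "W2 u z = gradient u (fst z *\<^sub>R e1 + snd z *\<^sub>R e2) \<bullet> e2"

lemma W_u: "u : XS ==> W u (Nrm x) = u x"
 unfolding W_def Nrm_def using e12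
 by (intro XS_same) (auto simp: same_def linear_add[OF blk_linear] linear_scale[OF blk_linear])

lemma C1b_W:
 assumes u: "u : TF" shows "C1b (W u) (W1 u) (W2 u)"
proof -
 have sm: "smooth u" by (rule TF_smooth[OF u])
 have lin: "continuous_on UNIV (%z :: real \<times> real. fst z *\<^sub>R e1 + snd z *\<^sub>R e2)" by (intro continuous_intros)
 have c: "continuous_on UNIV (W u)"
  unfolding W_def[abs_def] by (rule continuous_on_compose2[OF smooth_continuous[OF sm, of UNIV] lin]) simp
 have g: "continuous_on UNIV (%z. gradient u (fst z *\<^sub>R e1 + snd z *\<^sub>R e2))"
  by (rule continuous_on_compose2[OF smooth_gradient_continuous[OF sm, of UNIV] lin]) simp
 have c': "continuous_on UNIV (W1 u)" "continuous_on UNIV (W2 u)"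
  unfolding W1_def[abs_def] W2_def[abs_def] by (intro continuous_on_inner g continuous_on_const)+
 obtain K0 where K0: "!!x. abs (u x) <= K0" using TF_bounded[OF u] by blast
 obtain K1 where K1: "!!x. norm (gradient u x) <= K1" using TF_gradient_bounded[OF u] by blast
 have "abs (gradient u x \<bullet> e) <= K1" if "e : Basis" for x e
  using Cauchy_Schwarz_ineq2[of "gradient u x" e] K1[of x] that by simp
 then have "abs (W u z) <= max K0 K1 & abs (W1 u z) <= max K0 K1 & abs (W2 u z) <= max K0 K1" for z
  unfolding W_def W1_def W2_def using K0 e12(3,4) by (auto simp: le_max_iff_disj)
 then have b: "EX B. ALL z. abs (W u z) <= B & abs (W1 u z) <= B & abs (W2 u z) <= B" by blast
 have d1: "((%r. W u (r, s)) has_real_derivative W1 u (r, s)) (at r)" for r s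
  using directional_derivative[OF sm, of "s *\<^sub>R e2" e1 r] by (simp add: W_def W1_def add.commute)
 have d2: "((%s. W u (r, s)) has_real_derivative W2 u (r, s)) (at s)" for r s
  using directional_derivative[OF sm, of "r *\<^sub>R e1" e2 s] by (simp add: W_def W2_def)
 have "W u (1, s) = 0 & W u (s, 1) = 0" for s
 proof -
  have "norm (blk B1 (1 *\<^sub>R e1 + s *\<^sub>R e2)) = 1" "norm (blk B2 (s *\<^sub>R e1 + 1 *\<^sub>R e2)) = 1"
   using e12 by (simp_all add: linear_add[OF blk_linear] linear_scale[OF blk_linear])
  then have "1 <= norm (1 *\<^sub>R e1 + s *\<^sub>R e2)" "1 <= norm (s *\<^sub>R e1 + 1 *\<^sub>R e2)" using norm_blk_le by metis+
  then show ?thesis unfolding W_def using TF_zero_outside[OF u] by simp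
 qed
 then show ?thesis unfolding C1b_def using c c' b d1 d2 by blast
qed

text \<open>Off the axes the derivatives of the profile are the components of the gradient along the
  unit vectors of the two blocks of \<open>x\<close>. These are orthonormal, and Bessel's inequality
  concludes.\<close>

lemma gradient_ge_W:
 assumes u: "u : XS" and x: "blk B1 x ~= 0" "blk B2 x ~= 0"
 shows "(W1 u (Nrm x))^2 + (W2 u (Nrm x))^2 <= (norm (gradient u x))^2"
proof -
 have sm: "smooth u" by (rule TF_smooth[OF XS_TF[OF u]])
 define a b where "a = (1 / norm (blk B1 x)) *\<^sub>R blk B1 x" and "b = (1 / norm (blk B2 x)) *\<^sub>R blk B2 x"
 have n: "norm a = 1" "norm b = 1" using x by (auto simp: a_def b_def)
 have ab: "a \<bullet> b = 0" by (simp add: a_def b_def blk_orthogonal)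
 have bl: "blk B1 a = a" "blk B2 a = 0" "blk B2 b = b" "blk B1 b = 0"
  by (simp_all add: a_def b_def linear_scale[OF blk_linear] blk_blk)
 have xab: "x = norm (blk B1 x) *\<^sub>R a + norm (blk B2 x) *\<^sub>R b" using x blk_sum[of x] by (simp add: a_def b_def)
 have eq: "u (r *\<^sub>R a + s *\<^sub>R b) = W u (r, s)" for r s
  unfolding W_def using e12 bl n
  by (intro XS_same[OF u]) (auto simp: same_def linear_add[OF blk_linear] linear_scale[OF blk_linear])
 define r s where "r = norm (blk B1 x)" and "s = norm (blk B2 x)"
 then have rs: "Nrm x = (r, s)" "x = r *\<^sub>R a + s *\<^sub>R b" using xab by (simp_all add: Nrm_def)
 note C = C1b_W[OF XS_TF[OF u]]
 have 1: "gradient u x \<bullet> a = W1 u (r, s)"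
 proof (rule DERIV_unique)
  show "((%r. W u (r, s)) has_real_derivative gradient u x \<bullet> a) (at r)"
   using directional_derivative[OF sm, of "s *\<^sub>R b" a r] by (simp add: rs(2) add.commute[of "s *\<^sub>R b"] eq)
  show "((%r. W u (r, s)) has_real_derivative W1 u (r, s)) (at r)" using C by (simp add: C1b_def)
 qed
 have 2: "gradient u x \<bullet> b = W2 u (r, s)"
 proof (rule DERIV_unique)
  show "((%s. W u (r, s)) has_real_derivative gradient u x \<bullet> b) (at s)"
   using directional_derivative[OF sm, of "r *\<^sub>R a" b s] by (simp add: rs(2) eq)
  show "((%s. W u (r, s)) has_real_derivative W2 u (r, s)) (at s)" using C by (simp add: C1b_def)
 qed
 let ?g = "gradient u x"
 have "0 <= (norm (?g - (?g \<bullet> a) *\<^sub>R a - (?g \<bullet> b) *\<^sub>R b))^2" by simp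
 also have "... = (norm ?g)^2 - (?g \<bullet> a)^2 - (?g \<bullet> b)^2"
 proof -
  have "a \<bullet> a = 1" "b \<bullet> b = 1" "b \<bullet> a = 0" using n ab by (simp_all add: norm_eq_1 inner_commute)
  then show ?thesis using ab unfolding power2_norm_eq_inner
   by (simp add: inner_diff_left inner_diff_right inner_commute[of a ?g] inner_commute[of b ?g] power2_eq_square)
 qed
 finally show ?thesis unfolding rs(1) 1[symmetric] 2[symmetric] by simp
qed

lemma energy_le_Dir:
 assumes u: "u : XS" shows "\<kappa> * energy (W1 u) (W2 u) <= Dir u u"
proof -
 note C = C1b_W[OF XS_TF[OF u]]
 note [measurable] = C1b_borel[OF C]
 have "AE z in M. fst z ~= 0 & snd z ~= 0"
 proof -
  have "emeasure M ({0} \<times> UNIV) = 0" "emeasure M (UNIV \<times> {0}) = 0"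
   using emeasure_rmeas_Icc[of k1 0 0] emeasure_rmeas_Icc[of k2 0 0] c1 c2 by (simp_all add: M_times)
  then have "{0} \<times> UNIV \<union> UNIV \<times> {0} : null_sets M" by (intro null_sets.Un) (auto intro!: null_setsI borel_Times)
  then show ?thesis by (rule AE_I') auto
 qed
 then have "AE x in lborel. x : Z --> fst (Nrm x) ~= 0 & snd (Nrm x) ~= 0"
 proof (rule transfer_AE)
  have "open {z :: real \<times> real. fst z ~= 0 & snd z ~= 0}"
   by (intro open_Collect_conj open_Collect_neq continuous_intros)
  then show "{z :: real \<times> real. fst z ~= 0 & snd z ~= 0} : sets borel" by (rule borel_open)
 qed
 then have ae: "AE x in lborel. indicator Z x * ((W1 u (Nrm x))^2 + (W2 u (Nrm x))^2) <= gradient u x \<bullet> gradient u x"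
  by eventually_elim (use gradient_ge_W[OF u] in \<open>auto simp: Nrm_def indicator_def power2_norm_eq_inner\<close>)
 have "\<kappa> * energy (W1 u) (W2 u) = (LBINT x. indicator Z x * ((W1 u (Nrm x))^2 + (W2 u (Nrm x))^2))"
  unfolding energy_def by (subst transfer_integral[symmetric]) auto
 also have "... <= Dir u u"
  unfolding Dir_def
 proof (rule integral_mono_AE'[OF _ ae])
  show "integrable lborel (%x. gradient u x \<bullet> gradient u x)" by (rule Dir_integrable[OF XS_TF[OF u] XS_TF[OF u]])
 qed auto
 finally show ?thesis .
qed

lemma XS_indicator_Z: "u : XS ==> h 0 = 0 ==> indicator Z x * h (W u (Nrm x)) = h (u x)" for h :: "real => real"
proof (cases "x : Z")
 case False
 assume u: "u : XS" "h 0 = 0"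
 have "1 <= norm x" using False ball_Z by (auto simp: not_less[symmetric])
 then show ?thesis using u TF_zero_outside[OF XS_TF[OF u(1)]] False by simp
qed (simp add: W_u)

lemma transfer_XS:
 assumes u: "u : XS" and h: "h : borel_measurable borel" "h 0 = (0 :: real)"
 shows "(LBINT x. h (u x)) = \<kappa> * (LINT z|M. h (W u z))"
proof -
 note [measurable] = C1b_borel[OF C1b_W[OF XS_TF[OF u]]] h(1)
 have "(LBINT x. indicator Z x * h (W u (Nrm x))) = \<kappa> * (LINT z|M. h (W u z))"
  by (rule transfer_integral[of "%z. h (W u z)"]) measurable
 then show ?thesis by (simp add: XS_indicator_Z[where h=h, OF u h(2)])
qed

lemma Poincare_XS:
 assumes u: "u : XS" shows "(LBINT x. (u x)^2) <= Dir u u"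
proof -
 have "(LBINT x. (u x)^2) = \<kappa> * (LINT z|M. (W u z)^2)"
  using transfer_XS[OF u, of "%t. t^2"] by simp
 also have "... <= \<kappa> * energy (W1 u) (W2 u)"
  using \<kappa>(1) Poincare_M[OF C1b_W[OF XS_TF[OF u]]] by (intro mult_left_mono) auto
 also have "... <= Dir u u" by (rule energy_le_Dir[OF u])
 finally show ?thesis .
qed

end

context blocks
begin

lemma XS_add: "u : XS ==> v : XS ==> (%x. u x + v x) : XS"
 and XS_diff: "u : XS ==> v : XS ==> (%x. u x - v x) : XS"
 and XS_cmult: "u : XS ==> (%x. c * u x) : XS"
 and XS_zero: "(%x. 0) : XS"
 by (simp_all add: XS_def TF_add TF_diff TF_cmult TF_zero)

end

context block_pair
begin

lemma norm_le_max: "norm x <= sqrt 2 * max (fst (Nrm x)) (snd (Nrm x))"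
proof (rule power2_le_imp_le)
 let ?m = "max (fst (Nrm x)) (snd (Nrm x))"
 have "(norm (blk B1 x))^2 <= ?m^2" "(norm (blk B2 x))^2 <= ?m^2" by (intro power_mono; simp add: Nrm_def)+
 then show "(norm x)^2 <= (sqrt 2 * ?m)^2" unfolding norm_blk[of x] by (simp add: power_mult_distrib)
 show "0 <= sqrt 2 * ?m" by (simp add: Nrm_def le_max_iff_disj)
qed

text \<open>In the unit ball |x|^\<alpha> is at most |x|^\<beta>, where \<open>\<beta>\<close> is
  the lower bound for \<alpha>, and |x| is at most sqrt 2 times the larger block radius; so the
  weight is at most a constant times \<open>\<tau>\<close> to the power p - 2. The constant
  \<open>C\<close> does not depend on \<alpha>.\<close>

lemma Sobolev_XS:
 assumes p: "2 < p" "(real k1 - 1) * (p - 2) < 4"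
 shows "EX C>=0. ALL \<alpha> u R. (real k2 - 1) * (p - 2) / 2 <= \<alpha> --> u : XS --> 0 < R --> Dir u u <= R^2 -->
  (LBINT x. norm x powr \<alpha> * abs (u x) powr p) <= C * R powr p"
proof -
 define \<beta> where "\<beta> = (real k2 - 1) * (p - 2) / 2"
 have \<beta>: "\<beta> > 0" using p c2 by (simp add: \<beta>_def)
 define K where "K = sqrt 2 powr \<beta>"
 obtain C where C: "C >= 0" "!!w w1 w2 R. C1b w w1 w2 ==> 0 < R ==> energy w1 w2 <= R^2 ==>
  (LINT z|M. \<tau> z powr (p - 2) * abs (w z) powr p) <= C * R powr p"
  using weighted_Sobolev[OF p] by auto
 define C' where "C' = K * \<kappa> * C * (1 / sqrt \<kappa>) powr p"
 show ?thesis
 proof (intro exI[of _ C'] conjI allI impI)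
  show "0 <= C'" using C(1) \<kappa>(1) by (simp add: C'_def K_def)
  fix \<alpha> R :: real and u :: "'a => real"
  assume \<alpha>: "(real k2 - 1) * (p - 2) / 2 <= \<alpha>" and u: "u : XS" and R: "0 < R" and D: "Dir u u <= R^2"
  note Cb = C1b_W[OF XS_TF[OF u]]
  note [measurable] = C1b_borel[OF Cb] \<tau>_borel
  have "\<kappa> * energy (W1 u) (W2 u) <= R^2" using energy_le_Dir[OF u] D by linarith
  then have en: "energy (W1 u) (W2 u) <= (R * (1 / sqrt \<kappa>))^2"
   using \<kappa>(1) by (simp add: power_mult_distrib power_divide field_simps)
  let ?h = "%z. \<tau> z powr (p - 2) * abs (W u z) powr p"
  have hz: "?h (Nrm x) = 0" if "x ~: Z" for x
  proof -
   have "1 <= norm x" using that ball_Z by (auto simp: not_less[symmetric])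
   then show ?thesis using W_u[OF u, of x] TF_zero_outside[OF XS_TF[OF u]] by simp
  qed
  have pt: "norm x powr \<alpha> * abs (u x) powr p <= K * (indicator Z x * ?h (Nrm x))" for x
  proof (cases "norm x < 1 & x ~= 0")
   case True
   let ?m = "max (fst (Nrm x)) (snd (Nrm x))"
   have m: "?m > 0" using norm_le_max[of x] True by (smt (verit) mult_nonneg_nonpos real_sqrt_ge_zero zero_less_norm_iff)
   have "norm x powr \<alpha> <= norm x powr \<beta>" using True \<alpha> by (intro powr_mono') (auto simp: \<beta>_def)
   also have "... <= (sqrt 2 * ?m) powr \<beta>" using norm_le_max[of x] \<beta> by (intro powr_mono2) auto
   also have "... = K * ?m powr \<beta>" using m by (simp add: powr_mult K_def)
   also have "?m powr \<beta> = \<tau> (Nrm x) powr (p - 2)"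
   proof -
    have k: "real (k2 - 1) = real k2 - 1" using c2 by simp
    have "\<tau> (Nrm x) = (?m powr real (k2 - 1)) powr (1 / 2)" using m by (simp add: \<tau>_def powr_half_sqrt powr_realpow)
    then show ?thesis unfolding k by (simp add: powr_powr \<beta>_def)
   qed
   finally have "norm x powr \<alpha> * abs (u x) powr p <= (K * \<tau> (Nrm x) powr (p - 2)) * abs (u x) powr p" by (intro mult_right_mono) auto
   then show ?thesis using True ball_Z W_u[OF u, of x] by (auto simp: mult.assoc)
  next
   case False
   then have "x = 0 | u x = 0" using TF_zero_outside[OF XS_TF[OF u], of x] by auto
   then have "norm x powr \<alpha> * abs (u x) powr p = 0" by auto
   then show ?thesis by (simp only:) (intro mult_nonneg_nonneg, auto simp: K_def)
  qed
  have cont: "continuous_on UNIV (%x. abs (u x) powr p)"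
   using p TF_continuous[OF XS_TF[OF u], of UNIV] by (intro continuous_on_powr' continuous_intros) auto
  have "(LBINT x. norm x powr \<alpha> * abs (u x) powr p) <= (LBINT x. K * (indicator Z x * ?h (Nrm x)))"
  proof (rule integral_mono')
   show "integrable lborel (%x. K * (indicator Z x * ?h (Nrm x)))"
   proof (rule integrable_mult_right)
    obtain B where B: "!!x. abs (u x) <= B" using TF_bounded[OF XS_TF[OF u]] by blast
    have "norm (indicator Z x * ?h (Nrm x)) <= norm (B powr p * indicator Z x)" for x
    proof (cases "x : Z")
     case True
     then have "Nrm x : unit_square" by (auto simp: Nrm_def Z_def unit_square_def)
     then have "\<tau> (Nrm x) powr (p - 2) <= 1" using \<tau>_bounds[of "Nrm x"] p by (intro powr_le1) auto
     moreover have "abs (u x) powr p <= B powr p" using B[of x] p by (intro powr_mono2) auto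
     ultimately have "?h (Nrm x) <= 1 * B powr p" unfolding W_u[OF u] by (intro mult_mono) auto
     then show ?thesis using True by simp
    qed simp
    moreover have "integrable lborel (%x. B powr p * indicator Z x)" using Z_finite by (intro integrable_mult_right) simp
    moreover have "(%x. indicator Z x * ?h (Nrm x)) : borel_measurable lborel" by measurable
    ultimately show "integrable lborel (%x. indicator Z x * ?h (Nrm x))"
     by (blast intro: Bochner_Integration.integrable_bound AE_I2)
   qed
  qed (use pt in \<open>auto simp: K_def\<close>)
  also have "... = K * (\<kappa> * (LINT z|M. ?h z))"
   by (simp only: integral_mult_right_zero) (subst transfer_integral, auto)
  also have "... <= K * (\<kappa> * (C * (R * (1 / sqrt \<kappa>)) powr p))"
   using \<kappa>(1) R by (intro mult_left_mono C(2)[OF Cb _ en]) (auto simp: K_def)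
  also have "... = C' * R powr p" using R \<kappa>(1) by (simp add: C'_def powr_divide)
  finally show "(LBINT x. norm x powr \<alpha> * abs (u x) powr p) <= C' * R powr p" .
 qed
qed

lemma Rellich_XS:
 fixes u :: "nat => 'a => real"
 assumes u: "!!i. u i : XS" and Q: "!!i. Dir (u i) (u i) <= Q"
 shows "EX s :: nat => nat. strict_mono s & (ALL \<epsilon>>0. EX N. ALL m>=N. ALL n>=N. (LBINT x. (u (s m) x - u (s n) x)^2) <= \<epsilon>)"
proof -
 have "energy (W1 (u i)) (W2 (u i)) <= Q / \<kappa>" for i
  using energy_le_Dir[OF u[of i]] Q[of i] \<kappa>(1) by (simp add: field_simps)
 then obtain s :: "nat => nat" where s: "strict_mono s"
  "!!\<epsilon>. \<epsilon> > 0 ==> EX N. ALL m>=N. ALL n>=N. (LINT z|M. (W (u (s m)) z - W (u (s n)) z)^2) <= \<epsilon>"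
  using Rellich[of "%i. W (u i)" "%i. W1 (u i)" "%i. W2 (u i)" "Q / \<kappa>", OF C1b_W[OF XS_TF[OF u]]] by auto
 have "EX N. ALL m>=N. ALL n>=N. (LBINT x. (u (s m) x - u (s n) x)^2) <= \<epsilon>" if \<epsilon>: "\<epsilon> > 0" for \<epsilon> :: real
 proof -
  have eq: "(LBINT x. (u (s m) x - u (s n) x)^2) = \<kappa> * (LINT z|M. (W (u (s m)) z - W (u (s n)) z)^2)" for m n
   using transfer_XS[OF XS_diff[OF u u], of "%t. t^2" "s m" "s n"] by (simp add: W_def)
  obtain N where "ALL m>=N. ALL n>=N. (LINT z|M. (W (u (s m)) z - W (u (s n)) z)^2) <= \<epsilon> / \<kappa>"
   using s(2)[of "\<epsilon> / \<kappa>"] \<kappa>(1) \<epsilon> by auto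
  then show ?thesis unfolding eq using \<kappa>(1) by (intro exI[of _ N]) (auto simp: field_simps)
 qed
 then show ?thesis using s(1) by (intro exI[of _ s]) simp
qed

end

section \<open>Bilinearity, norm and invariance of the Dirichlet form\<close>

lemma Dir_sym: "Dir u v = Dir v u"
 by (simp add: Dir_def inner_commute)

lemma Dir_add: "u : TF ==> v : TF ==> w : TF ==> Dir u (%x. v x + w x) = Dir u v + Dir u w"
 unfolding Dir_def by (simp add: gradient_add TF_smooth inner_add_right Dir_integrable)

lemma Dir_diff: "u : TF ==> v : TF ==> w : TF ==> Dir u (%x. v x - w x) = Dir u v - Dir u w"
 unfolding Dir_def by (simp add: gradient_diff TF_smooth inner_diff_right Dir_integrable)

lemma Dir_cmult: "v : TF ==> Dir u (%x. c * v x) = c * Dir u v"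
 unfolding Dir_def by (simp add: gradient_cmult TF_smooth)

lemma Dir_nonneg: "0 <= Dir u u"
 unfolding Dir_def by (intro integral_nonneg_AE) auto

lemma Dir_Cauchy_Schwarz:
 assumes "u : TF" "v : TF" shows "(Dir u v)^2 <= Dir u u * Dir v v"
proof (rule quadratic_nonneg_imp)
 fix t
 have tv: "(%x. t * v x) : TF" by (rule TF_cmult[OF assms(2)])
 let ?w = "%x. u x - t * v x"
 have w: "?w : TF" by (rule TF_diff[OF assms(1) tv])
 have "Dir ?w ?w = Dir ?w u - t * Dir ?w v" by (simp add: Dir_diff[OF w assms(1) tv] Dir_cmult[OF assms(2)])
 also have "Dir ?w u = Dir u u - t * Dir u v" by (subst Dir_sym) (simp add: Dir_diff[OF assms(1) assms(1) tv] Dir_cmult[OF assms(2)])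
 also have "Dir ?w v = Dir u v - t * Dir v v" by (subst Dir_sym) (simp add: Dir_diff[OF assms(2) assms(1) tv] Dir_cmult[OF assms(2)] Dir_sym[of v u])
 finally show "0 <= Dir u u - 2 * t * Dir u v + t^2 * Dir v v"
  using Dir_nonneg[of ?w] by (simp add: algebra_simps power2_eq_square)
qed (rule Dir_nonneg)

definition dnorm :: "('a::euclidean_space => real) => real" where "dnorm u = sqrt (Dir u u)"

lemma dnorm_nonneg: "0 <= dnorm u" by (simp add: dnorm_def Dir_nonneg)

lemma dnorm_square: "(dnorm u)^2 = Dir u u" by (simp add: dnorm_def Dir_nonneg)

lemma abs_Dir_le: "u : TF ==> v : TF ==> abs (Dir u v) <= dnorm u * dnorm v"
 using real_sqrt_le_mono[OF Dir_Cauchy_Schwarz[of u v]] by (simp add: dnorm_def real_sqrt_mult)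

lemma dnorm_triangle: "u : TF ==> v : TF ==> dnorm (%x. u x + v x) <= dnorm u + dnorm v"
proof (rule power2_le_imp_le)
 assume uv: "u : TF" "v : TF"
 have w: "(%x. u x + v x) : TF" by (rule TF_add[OF uv])
 have "Dir (%x. u x + v x) (%x. u x + v x) = Dir u u + 2 * Dir u v + Dir v v"
  using Dir_add[OF w uv] Dir_add[OF uv(1) uv] Dir_add[OF uv(2) uv] Dir_sym[of "%x. u x + v x" u]
   Dir_sym[of "%x. u x + v x" v] Dir_sym[of v u] by linarith
 also have "... <= (dnorm u + dnorm v)^2" using abs_Dir_le[OF uv] by (simp add: power2_sum dnorm_square)
 finally show "(dnorm (%x. u x + v x))^2 <= (dnorm u + dnorm v)^2" by (simp add: dnorm_square)
qed (simp add: dnorm_nonneg)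

lemma dnorm_cmult: "u : TF ==> dnorm (%x. c * u x) = abs c * dnorm u"
 using Dir_cmult[of u "%x. c * u x" c] Dir_cmult[of u u c]
 by (simp add: dnorm_def Dir_sym[of "%x. c * u x" u] real_sqrt_mult flip: mult.assoc power2_eq_square)

lemma gradient_orthogonal:
 fixes g :: "'a::euclidean_space => 'a"
 assumes g: "orthogonal_transformation g" and "smooth u" "smooth v"
 shows "gradient (%x. u (g x)) x \<bullet> gradient (%x. v (g x)) x = gradient u (g x) \<bullet> gradient v (g x)"
proof -
 have lin: "linear g" using g orthogonal_transformation_linear by blast
 \<comment> \<open>The transpose of an isometry is its inverse, so the isometry itself carries the
   gradient of the composition to the gradient of \<open>u\<close>.\<close>
 have gr: "g (gradient (%x. u (g x)) x) = gradient u (g x)" if "smooth u" for u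
 proof -
  obtain y where y: "g y = gradient u (g x)" using orthogonal_transformation_surj[OF g] by (metis surjD)
  have "gradient (%x. u (g x)) x = y"
  proof (rule gradient_eqI)
   have "((%x. u (g x)) has_derivative (%w. gradient u (g x) \<bullet> g w)) (at x)"
    by (rule has_derivative_compose[OF linear_imp_has_derivative[OF lin] smooth_has_derivative[OF that]])
   moreover have "gradient u (g x) \<bullet> g w = y \<bullet> w" for w
    unfolding y[symmetric] using g by (simp add: orthogonal_transformation_def)
   ultimately show "((%x. u (g x)) has_derivative (\<bullet>) y) (at x)" by simp
  qed
  then show ?thesis using y by simp
 qed
 have "gradient (%x. u (g x)) x \<bullet> gradient (%x. v (g x)) x = g (gradient (%x. u (g x)) x) \<bullet> g (gradient (%x. v (g x)) x)"
  using g by (simp add: orthogonal_transformation_def)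
 then show ?thesis by (simp add: gr assms)
qed

lemma Dir_orthogonal:
 fixes g :: "'a::euclidean_space => 'a"
 assumes g: "orthogonal_transformation g" and "u : TF" "v : TF"
 shows "Dir (%x. u (g x)) (%x. v (g x)) = Dir u v"
 unfolding Dir_def gradient_orthogonal[OF g TF_smooth[OF assms(2)] TF_smooth[OF assms(3)]]
 using assms
 by (intro integral_orthogonal[OF g, of "%x. gradient u x \<bullet> gradient v x"] borel_measurable_continuous_onI continuous_on_inner TF_gradient_continuous)

subsection \<open>The nonlinearity\<close>

text \<open>A substitute for a Lipschitz bound on a function that is merely continuous. The first
  term, with a small factor and the larger exponent, is meant for a Sobolev bound with a spare
  exponent; the second, with a large factor, is meant for L2 convergence.\<close>

lemma continuous_difference_bound:
 fixes h :: "real => real"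
 assumes h: "continuous_on UNIV h" and g: "!!z. abs (h z) <= K * (1 + abs z) powr r" and r: "0 <= r" "r < r'" and \<delta>: "\<delta> > 0"
 shows "EX C>=0. ALL a b. abs (h a - h b) <= \<delta> * (1 + abs a + abs b) powr r' + C * abs (a - b)"
proof -
 have K: "K >= 0" using g[of 0] by simp
 \<comment> \<open>Beyond this size the higher power \<open>r'\<close> with the small factor
   \<open>\<delta>\<close> dominates the growth bound for both values of \<open>h\<close>.\<close>
 define m where "m = (2 * K / \<delta> + 1) powr (1 / (r' - r))"
 have m0: "m >= 0" by (simp add: m_def)
 have far: "2 * K * (1 + x) powr r <= \<delta> * (1 + x) powr r'" if x: "x >= m" for x
 proof -
  have x0: "0 < 1 + x" using x m0 by linarith
  have "2 * K / \<delta> <= m powr (r' - r)"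
   using r K \<delta> by (simp add: m_def powr_powr)
  also have "... <= (1 + x) powr (r' - r)" using x m0 r by (intro powr_mono2) auto
  finally have "2 * K <= \<delta> * (1 + x) powr (r' - r)" using \<delta> by (simp add: field_simps)
  then have "2 * K * (1 + x) powr r <= \<delta> * (1 + x) powr (r' - r) * (1 + x) powr r" by (intro mult_right_mono) auto
  then show ?thesis using x0 by (simp add: mult.assoc powr_add[symmetric])
 qed
 have "uniformly_continuous_on {-m..m} h"
  using h by (intro compact_uniformly_continuous) (auto intro: continuous_on_subset)
 then obtain \<eta> where \<eta>: "\<eta> > 0" "!!a b. a : {-m..m} ==> b : {-m..m} ==> dist b a < \<eta> ==> dist (h b) (h a) < \<delta>"
  unfolding uniformly_continuous_on_def using \<delta> by metis
 \<comment> \<open>An oscillation bound on [-m, m] divided by \<open>\<eta>\<close>, for the pairs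
   so far apart that uniform continuity says nothing.\<close>
 define C where "C = 2 * K * (1 + m) powr r / \<eta>"
 have C: "C >= 0" using K \<eta>(1) by (simp add: C_def)
 have sum: "abs (h a - h b) <= 2 * K * (1 + x) powr r" if "abs a <= x" "abs b <= x" for a b x
 proof -
  have "abs (h y) <= K * (1 + x) powr r" if "abs y <= x" for y
  proof -
   have "(1 + abs y) powr r <= (1 + x) powr r" using that r by (intro powr_mono2) auto
   then show ?thesis using g[of y] K by (meson mult_left_mono order_trans)
  qed
  from this[OF that(1)] this[OF that(2)] show ?thesis by linarith
 qed
 show ?thesis
 proof (intro exI[of _ C] conjI allI C)
  fix a b :: real
  have one: "1 <= (1 + abs a + abs b) powr r'" using r by (intro ge_one_powr_ge_zero) auto
  have nn: "0 <= C * abs (a - b)" using C by simp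
  show "abs (h a - h b) <= \<delta> * (1 + abs a + abs b) powr r' + C * abs (a - b)"
  proof (cases "abs a + abs b >= m")
   case True
   have "abs (h a - h b) <= 2 * K * (1 + (abs a + abs b)) powr r" by (rule sum) auto
   also have "... <= \<delta> * (1 + (abs a + abs b)) powr r'" by (rule far[OF True])
   finally show ?thesis using nn by (simp add: add.assoc)
  next
   case False
   show ?thesis
   proof (cases "abs (a - b) < \<eta>")
    case True
    have "dist (h a) (h b) < \<delta>" using False True by (intro \<eta>(2)) (auto simp: dist_real_def)
    moreover have "\<delta> * 1 <= \<delta> * (1 + abs a + abs b) powr r'" using one \<delta> by (intro mult_left_mono) auto
    ultimately show ?thesis using nn by (simp add: dist_real_def)
   next
    case ab: False
    have "abs (h a - h b) <= 2 * K * (1 + m) powr r" using False by (intro sum) auto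
    also have "... = C * \<eta>" using \<eta>(1) by (simp add: C_def)
    also have "... <= C * abs (a - b)" using ab C by (intro mult_left_mono) auto
    moreover have "0 <= \<delta> * (1 + abs a + abs b) powr r'" using \<delta> by simp
    ultimately show ?thesis by linarith
   qed
  qed
 qed
qed

text \<open>The consequences of (f1) to (f4) on which the variational argument rests:
  \<open>q\<close> is the Ambrosetti-Rabinowitz exponent of (f3), \<open>\<mu>\<close> the exponent
  \<open>\<mu>1\<close> of (f4).\<close>

locale nonlinearity =
 fixes f :: "real => real" and K p q \<mu> :: real
 assumes f_cont: "continuous_on UNIV f" and f_nonneg: "!!z. 0 <= f z" and f_nonpos: "!!z. z <= 0 ==> f z = 0"
  and f_small: "!!\<delta>. \<delta> > 0 ==> EX \<eta>>0. ALL z. abs z <= \<eta> --> abs (f z) <= \<delta> * abs z"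
  and f_large: "EX z>0. ALL x>=z. f x > 0"
  and p: "2 < p" and f_growth: "!!z. abs (f z) <= K * (1 + abs z) powr (p - 1)"
  and q: "2 < q" and AR: "!!t. q * primitive f t <= t * f t"
  and \<mu>: "2 < \<mu>" and f_scale: "!!t v. 0 <= t ==> t <= 1 ==> 0 <= v ==> t powr (\<mu> - 1) * f v <= f (t * v)"
begin

definition F :: "real => real" where "F = primitive f"

lemma F_0: "F 0 = 0" by (simp add: F_def primitive_def)

lemma F_deriv: "(F has_real_derivative f x) (at x)"
proof -
 define a b where "a = min 0 x - 1" and "b = max 0 x + 1"
 have ab: "a < 0" "0 < b" "a < x" "x < b" by (auto simp: a_def b_def)
 have "((%u. LBINT y=ereal 0..ereal u. f y) has_vector_derivative f x) (at x within {a..b})"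
  using ab f_cont by (intro interval_integral_FTC2) (auto intro: continuous_on_subset)
 then have "(F has_real_derivative f x) (at x within {a..b})"
  by (simp add: F_def primitive_def[abs_def] has_real_derivative_iff_has_vector_derivative)
 moreover have "x : interior {a..b}" using ab by simp
 ultimately show ?thesis using at_within_interior[of x "{a..b}"] by simp
qed

lemma F_cont: "continuous_on S F"
 using F_deriv DERIV_isCont by (blast intro: continuous_at_imp_continuous_on)

lemma F_mono: "a <= b ==> F a <= F b"
 using F_deriv f_nonneg by (intro DERIV_nonneg_imp_nondecreasing[of a b F]) auto

lemma F_nonpos: "z <= 0 ==> F z = 0"
proof -
 assume z: "z <= 0"
 show "F z = 0"
 proof (cases "z = 0")
  case False
  obtain x where "z < x" "x < 0" "F 0 - F z = (0 - z) * f x"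
   using MVT2[of z 0 F f] F_deriv z False by auto
  then show ?thesis using f_nonpos[of x] F_0 by simp
 qed (simp add: F_0)
qed

lemma F_nonneg: "0 <= F z"
 using F_mono[of 0 z] F_nonpos[of z] F_0 by (cases "z <= 0") auto

lemma F_le: "F z <= z * f z"
proof -
 have "1 * F z <= q * F z" using q F_nonneg by (intro mult_right_mono) auto
 then show ?thesis using AR[of z] by (simp add: F_def)
qed

lemma K_nonneg: "0 <= K" using f_growth[of 0] by simp

lemma zf_growth: "abs (z * f z) <= K * (1 + abs z) powr p"
proof -
 have "abs (z * f z) <= (1 + abs z) * (K * (1 + abs z) powr (p - 1))"
  unfolding abs_mult by (intro mult_mono f_growth) auto
 also have "... = K * (1 + abs z) powr p" using powr_add[of "1 + abs z" 1 "p - 1"] by simp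
 finally show ?thesis .
qed

lemma F_growth: "abs (F z) <= K * (1 + abs z) powr p"
 using F_le[of z] F_nonneg[of z] zf_growth[of z] by linarith

text \<open>Near zero \<open>f\<close> is o(z). Away from zero 1 + |z| is comparable with |z|, so
  the growth bound becomes a pure power.\<close>

lemma zf_small:
 assumes \<delta>: "\<delta> > 0"
 shows "EX C>=0. ALL z. z * f z <= \<delta> * z^2 + C * abs z powr p"
proof -
 obtain \<eta> where \<eta>: "\<eta> > 0" "!!z. abs z <= \<eta> ==> abs (f z) <= \<delta> * abs z" using f_small[OF \<delta>] by auto
 define C where "C = K * (1 / \<eta> + 1) powr p"
 have C: "C >= 0" using K_nonneg by (simp add: C_def)
 show ?thesis
 proof (intro exI[of _ C] conjI allI C)
  fix z
  show "z * f z <= \<delta> * z^2 + C * abs z powr p"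
  proof (cases "abs z <= \<eta>")
   case True
   have "z * f z <= abs z * abs (f z)" by (metis abs_ge_self abs_mult)
   also have "... <= abs z * (\<delta> * abs z)" by (intro mult_left_mono \<eta>(2) True) auto
   also have "... = \<delta> * z^2" by (simp add: power2_eq_square)
   finally show ?thesis using C by (simp add: add_increasing2)
  next
   case False
   have "1 + abs z <= (1 / \<eta> + 1) * abs z" using False \<eta>(1) by (simp add: field_simps)
   then have "(1 + abs z) powr p <= ((1 / \<eta> + 1) * abs z) powr p" using p by (intro powr_mono2) auto
   also have "... = (1 / \<eta> + 1) powr p * abs z powr p" using \<eta>(1) by (simp add: powr_mult)
   finally have "K * (1 + abs z) powr p <= K * ((1 / \<eta> + 1) powr p * abs z powr p)" using K_nonneg by (intro mult_left_mono)
   then have "z * f z <= C * abs z powr p" using zf_growth[of z] by (simp add: C_def mult.assoc)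
   then show ?thesis using \<delta> by (simp add: add_increasing)
  qed
 qed
qed

text \<open>The quotient s^(-q) F(s v) does not decrease for s >= 1, because its derivative is a
  nonnegative multiple of the Ambrosetti-Rabinowitz difference.\<close>

lemma F_scale_up:
 assumes t: "1 <= t" shows "t powr q * F v <= F (t * v)"
proof (cases "v > 0")
 case True
 define g where "g s = s powr (- q) * F (s * v)" for s
 have "g 1 <= g t"
 proof (rule DERIV_nonneg_imp_nondecreasing[OF t])
  fix s :: real assume s: "1 <= s"
  have "(g has_real_derivative s powr (- q) * (f (s * v) * v) + (- q) * s powr (- q - 1) * F (s * v)) (at s)"
   unfolding g_def[abs_def] using s
   by (auto intro!: derivative_eq_intros DERIV_chain2[OF F_deriv] simp: algebra_simps)
  moreover have "s powr (- q) = s powr (- q - 1) * s" using s powr_add[of s "- q - 1" 1] by simp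
  then have "s powr (- q) * (f (s * v) * v) + (- q) * s powr (- q - 1) * F (s * v) = s powr (- q - 1) * (s * v * f (s * v) - q * F (s * v))"
   by (simp add: algebra_simps)
  moreover have "0 <= s powr (- q - 1) * (s * v * f (s * v) - q * F (s * v))" using AR[of "s * v"] by (intro mult_nonneg_nonneg) (auto simp: F_def)
  ultimately show "EX y. (g has_real_derivative y) (at s) & 0 <= y" by metis
 qed
 then have "F v <= t powr (- q) * F (t * v)" by (simp add: g_def)
 then have "t powr q * F v <= t powr q * (t powr (- q) * F (t * v))" by (intro mult_left_mono) auto
 also have "... = F (t * v)" using t by (simp add: mult.assoc[symmetric] powr_add[symmetric])
 finally show ?thesis .
next
 case False
 then show ?thesis using F_nonneg[of "t * v"] F_nonpos[of v] by simp
qed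

text \<open>The inequality \<open>f_scale\<close> integrated in its second argument from 0 to v, in
  the form of a monotone difference.\<close>

lemma F_scale_down:
 assumes t: "0 <= t" "t <= 1" and v: "0 <= v" shows "t powr \<mu> * F v <= F (t * v)"
proof (cases "t = 0")
 case False
 define g where "g s = F (t * s) - t powr \<mu> * F s" for s
 have "g 0 <= g v"
 proof (rule DERIV_nonneg_imp_nondecreasing[OF v])
  fix s :: real assume s: "0 <= s"
  have "(g has_real_derivative f (t * s) * t - t powr \<mu> * f s) (at s)"
   unfolding g_def[abs_def] by (auto intro!: derivative_eq_intros DERIV_chain2[OF F_deriv] F_deriv)
  moreover have "t powr \<mu> = t * t powr (\<mu> - 1)" using t False powr_add[of t 1 "\<mu> - 1"] by simp
  moreover have "t * (t powr (\<mu> - 1) * f s) <= t * f (t * s)" using t s by (intro mult_left_mono f_scale) auto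
  ultimately show "EX y. (g has_real_derivative y) (at s) & 0 <= y"
   by (intro exI[of _ "f (t * s) * t - t powr \<mu> * f s"]) (simp add: algebra_simps)
 qed
 then show ?thesis by (simp add: g_def F_0)
qed (simp add: F_0)

text \<open>The converse of the Ambrosetti-Rabinowitz inequality, obtained by integrating
  \<open>f_scale\<close> over its first argument from 0 to 1. It lets the integral of F control the
  Dirichlet energy of a solution.\<close>

lemma zf_le_F: "v * f v <= \<mu> * F v"
proof (cases "v > 0")
 case True
 define g where "g s = F (s * v) - s powr \<mu> * (v * f v / \<mu>)" for s
 have d: "(g has_real_derivative f (s * v) * v - s powr (\<mu> - 1) * (v * f v)) (at s)" if s: "0 < s" for s
  unfolding g_def[abs_def] using s \<mu> by (auto intro!: derivative_eq_intros DERIV_chain2[OF F_deriv])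
 have "continuous_on {0..1} (%s. F (s * v))"
  by (rule continuous_on_compose2[OF F_cont[of UNIV]]) (auto intro!: continuous_intros)
 moreover have "continuous_on {0..1} (%s :: real. s powr \<mu>)"
  using \<mu> by (intro continuous_on_powr' continuous_intros) auto
 ultimately have "continuous_on {0..1} g"
  unfolding g_def[abs_def] by (intro continuous_on_diff continuous_on_mult continuous_on_const)
 then obtain l s where s: "0 < s" "s < 1" "(g has_real_derivative l) (at s)" "g 1 - g 0 = (1 - 0) * l"
  using MVT[of 0 1 g] d real_differentiable_def by (metis zero_less_one)
 have "l = f (s * v) * v - s powr (\<mu> - 1) * (v * f v)" using DERIV_unique[OF s(3) d[OF s(1)]] .
 moreover have "v * (s powr (\<mu> - 1) * f v) <= v * f (s * v)" using s True by (intro mult_left_mono f_scale) auto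
 ultimately have "0 <= l" by (simp add: algebra_simps)
 then have "g 0 <= g 1" using s(4) by simp
 then show ?thesis using \<mu> by (simp add: g_def F_0 field_simps)
next
 case False
 then show ?thesis using f_nonpos[of v] F_nonneg[of v] \<mu> by simp
qed

lemma F_positive: "EX z>0. F z > 0"
proof -
 obtain z where z: "z > 0" "!!x. x >= z ==> f x > 0" using f_large by auto
 obtain x where x: "z < x" "x < z + 1" "F (z + 1) - F z = (z + 1 - z) * f x"
  using MVT2[of z "z + 1" F f] F_deriv by auto
 then have "F (z + 1) > 0" using z(2)[of x] F_nonneg[of z] by simp
 then show ?thesis using z(1) by (intro exI[of _ "z + 1"]) auto
qed

end

subsection \<open>The variational functional\<close>

text \<open>Pointwise scalar multiples make test functions a subspace of a real vector space, as the
  mountain pass locale requires.\<close>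

instantiation "fun" :: (type, real_vector) real_vector
begin
definition scaleR_fun :: "real => ('a => 'b) => 'a => 'b" where "scaleR_fun r g = (%x. r *\<^sub>R g x)"
instance by intro_classes (simp_all add: scaleR_fun_def plus_fun_def fun_eq_iff algebra_simps)
end

lemma abs_integral_le:
 fixes h g :: "'a => real"
 assumes "integrable N h" "integrable N g" "!!x. abs (h x) <= g x"
 shows "abs (\<integral>x. h x \<partial>N) <= (LINT x|N. g x)"
 by (rule order_trans[OF integral_abs_bound integral_mono]) (use assms in auto)

lemma L2_inner:
 fixes a b :: "'a => 'b::euclidean_space"
 assumes m[measurable]: "a : borel_measurable N" "b : borel_measurable N"
  and i: "integrable N (%x. (norm (a x))^2)" "integrable N (%x. (norm (b x))^2)"
 shows "integrable N (%x. a x \<bullet> b x)" "abs (\<integral>x. a x \<bullet> b x \<partial>N) <= sqrt (LINT x|N. (norm (a x))^2) * sqrt (LINT x|N. (norm (b x))^2)"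
proof -
 have ip: "integrable N (%x. norm (a x) * norm (b x))"
 proof (rule Bochner_Integration.integrable_bound)
  show "integrable N (%x. (norm (a x))^2 + (norm (b x))^2)" by (rule Bochner_Integration.integrable_add[OF i])
  have "s * t <= s^2 + t^2" if "0 <= s" "0 <= t" for s t :: real
   using sum_squares_bound[of s t] that mult_nonneg_nonneg[OF that] by linarith
  then show "AE x in N. norm (norm (a x) * norm (b x)) <= norm ((norm (a x))^2 + (norm (b x))^2)"
   by (intro AE_I2) simp
 qed simp
 have cs: "norm (a x \<bullet> b x) <= norm (a x) * norm (b x)" for x by (simp add: Cauchy_Schwarz_ineq2)
 show ii: "integrable N (%x. a x \<bullet> b x)"
  by (rule Bochner_Integration.integrable_bound[OF ip]) (use cs in auto)
 have "abs (\<integral>x. a x \<bullet> b x \<partial>N) <= (LINT x|N. norm (a x) * norm (b x))"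
  by (rule abs_integral_le[OF ii ip]) (use cs in simp)
 also have "... <= sqrt ((LINT x|N. (norm (a x))^2) * (LINT x|N. (norm (b x))^2))"
  by (rule real_le_rsqrt) (rule integral_Cauchy_Schwarz[OF i ip])
 finally show "abs (\<integral>x. a x \<bullet> b x \<partial>N) <= sqrt (LINT x|N. (norm (a x))^2) * sqrt (LINT x|N. (norm (b x))^2)"
  by (simp add: real_sqrt_mult)
qed

lemma L2_diff_square:
 fixes a b :: "'a => 'b::euclidean_space"
 assumes m[measurable]: "a : borel_measurable N" "b : borel_measurable N"
  and i: "integrable N (%x. (norm (a x))^2)" "integrable N (%x. (norm (b x))^2)"
 shows "integrable N (%x. (norm (a x - b x))^2)"
proof -
 have "(%x. (norm (a x - b x))^2) = (%x. (norm (a x))^2 + (norm (b x))^2 - 2 * (a x \<bullet> b x))"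
  by (simp add: power2_norm_eq_inner inner_diff_left inner_diff_right inner_commute fun_eq_iff)
 then show ?thesis
  by (simp only:) (intro Bochner_Integration.integrable_diff Bochner_Integration.integrable_add integrable_mult_right i L2_inner(1) m)
qed

lemma TF_borel: "\<phi> : TF ==> \<phi> : borel_measurable borel" "\<phi> : TF ==> gradient \<phi> : borel_measurable borel" for \<phi> :: "'a::euclidean_space => real"
 by (auto intro: borel_measurable_continuous_onI TF_continuous TF_gradient_continuous)

text \<open>\<open>p1\<close> is a spare exponent between \<open>p\<close> and \<open>p\<^sup>*(n)\<close>. The bound on \<open>\<alpha>\<close> keeps \<open>|x|\<^sup>\<alpha>\<close> at most a multiple
 of the weight \<open>\<tau>\<^sup>p\<^sup>-\<^sup>2\<close> of the Sobolev inequality.\<close>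

locale henon = block_pair B1 B2 + nonlinearity f K p q \<mu>
 for B1 B2 :: "'a::euclidean_space set" and f K p q \<mu> +
 fixes \<alpha> p1 :: real
 assumes p1: "p < p1" "(real (card B1) - 1) * (p1 - 2) < 4"
  and \<alpha>: "(real (card B2) - 1) * (p1 - 2) / 2 <= \<alpha>"
begin

lemma \<alpha>_pos: "\<alpha> > 0"
proof -
 have "0 < (real k2 - 1) * (p1 - 2) / 2" using c2 p p1(1) by simp
 then show ?thesis using \<alpha> by linarith
qed

abbreviation wt :: "'a => real" where "wt x \<equiv> norm x powr \<alpha>"

lemma wt_continuous: "continuous_on S wt"
 using \<alpha>_pos by (intro continuous_on_powr' continuous_intros) auto

lemma wt_le_1: "norm x <= 1 ==> wt x <= 1"
 using \<alpha>_pos by (intro powr_le1) auto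

lemma wt_integrable:
 fixes h :: "real => real"
 assumes u: "u : TF" and h: "continuous_on UNIV h" "h 0 = 0"
 shows "integrable lborel (%x. wt x * h (u x))"
proof (rule continuous_ball_support_integrable)
 show "continuous_on UNIV (%x. wt x * h (u x))"
  by (intro continuous_on_mult wt_continuous continuous_on_compose2[OF h(1) TF_continuous[OF u]]) auto
qed (simp add: TF_zero_outside[OF u] h)

lemma wt_integrable2:
 fixes h :: "real => real"
 assumes u: "u : TF" and \<phi>: "\<phi> : TF" and h: "continuous_on UNIV h"
 shows "integrable lborel (%x. wt x * h (u x) * \<phi> x)"
proof (rule continuous_ball_support_integrable)
 show "continuous_on UNIV (%x. wt x * h (u x) * \<phi> x)"
  by (intro continuous_on_mult wt_continuous continuous_on_compose2[OF h TF_continuous[OF u]] TF_continuous \<phi>) auto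
qed (simp add: TF_zero_outside[OF \<phi>])

definition I :: "('a => real) => real" where
 "I u = Dir u u / 2 - (LBINT x. wt x * F (u x))"

definition dI :: "('a => real) => ('a => real) => real" where
 "dI u \<phi> = Dir u \<phi> - (LBINT x. wt x * f (u x) * \<phi> x)"

lemma wtF_integrable: "u : TF ==> integrable lborel (%x. wt x * F (u x))"
 by (rule wt_integrable[where h=F, OF _ F_cont F_0])

lemma wtf_integrable: "u : TF ==> \<phi> : TF ==> integrable lborel (%x. wt x * f (u x) * \<phi> x)"
 by (rule wt_integrable2[where h=f, OF _ _ f_cont])

text \<open>The Dirichlet part is a quadratic polynomial in \<open>t\<close>. The other part is
  differentiated under the integral: \<open>u\<close> and \<open>\<phi>\<close> are bounded, so
  \<open>F\<close> has a Lipschitz constant on all values that occur.\<close>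

lemma line_derivative:
 assumes u: "u : TF" and \<phi>: "\<phi> : TF"
 shows "((%t. I (%x. u x + t * \<phi> x)) has_real_derivative dI (%x. u x + t * \<phi> x) \<phi>) (at t)"
proof -
 have w: "(%x. u x + t * \<phi> x) : TF" for t by (rule TF_add[OF u TF_cmult[OF \<phi>]])
 have left: "Dir (%x. u x + t * \<phi> x) v = Dir u v + t * Dir \<phi> v" if v: "v : TF" for t v
 proof -
  have "Dir (%x. u x + t * \<phi> x) v = Dir v (%x. u x + t * \<phi> x)" by (rule Dir_sym)
  also have "... = Dir v u + Dir v (%x. t * \<phi> x)" by (rule Dir_add[OF v u TF_cmult[OF \<phi>]])
  also have "Dir v (%x. t * \<phi> x) = t * Dir v \<phi>" by (rule Dir_cmult[OF \<phi>])
  also have "Dir v u = Dir u v" by (rule Dir_sym)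
  also have "Dir v \<phi> = Dir \<phi> v" by (rule Dir_sym)
  finally show ?thesis .
 qed
 note lin = left[OF \<phi>]
 have quad: "Dir (%x. u x + t * \<phi> x) (%x. u x + t * \<phi> x) = Dir u u + 2 * t * Dir u \<phi> + t^2 * Dir \<phi> \<phi>" for t
 proof -
  let ?w = "%x. u x + t * \<phi> x"
  have "Dir ?w ?w = Dir u ?w + t * Dir \<phi> ?w" by (rule left[OF w])
  also have "Dir u ?w = Dir ?w u" by (rule Dir_sym)
  also have "Dir ?w u = Dir u u + t * Dir \<phi> u" by (rule left[OF u])
  also have "Dir \<phi> ?w = Dir ?w \<phi>" by (rule Dir_sym)
  also have "Dir ?w \<phi> = Dir u \<phi> + t * Dir \<phi> \<phi>" by (rule lin)
  also have "Dir \<phi> u = Dir u \<phi>" by (rule Dir_sym)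
  finally show ?thesis by (simp only: power2_eq_square) (simp add: algebra_simps)
 qed
 define H where "H t = (LBINT x. wt x * F (u x + t * \<phi> x))" for t
 define H' where "H' = (LBINT x. wt x * f (u x + t * \<phi> x) * \<phi> x)"
 obtain A where A: "A > 0" "!!x. abs (u x) <= A" using TF_bounded[OF u] by blast
 obtain B where B: "B > 0" "!!x. abs (\<phi> x) <= B" using TF_bounded[OF \<phi>] by blast
 \<comment> \<open>A bound for |u + s \<phi>| at all s within distance 1 of
   \<open>t\<close>.\<close>
 define m where "m = A + (abs t + 1) * B"
 have "compact (f ` {-m..m})" using f_cont by (intro compact_continuous_image) (auto intro: continuous_on_subset)
 then obtain L where L: "!!z. z : {-m..m} ==> abs (f z) <= L"
  using compact_imp_bounded by (fastforce simp: bounded_iff)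
 have dF: "((%s. F (u x + s * \<phi> x)) has_real_derivative f (u x + s * \<phi> x) * \<phi> x) (at s within S)" for x s S
  by (auto intro!: derivative_eq_intros DERIV_chain2[OF F_deriv])
 let ?S = "{t - 1<..<t + 1}"
 have Lip: "abs ((F (u x + y * \<phi> x) - F (u x + t * \<phi> x)) / (y - t)) <= L * abs (\<phi> x)" if y: "y : ?S - {t}" for x y
 proof -
  have "abs (F (u x + y * \<phi> x) - F (u x + t * \<phi> x)) <= L * abs (\<phi> x) * abs (y - t)"
  proof (rule field_differentiable_bound[of ?S, unfolded real_norm_def])
   fix s assume s: "s : ?S"
   then have "abs (s * \<phi> x) <= (abs t + 1) * B" unfolding abs_mult using B by (intro mult_mono) auto
   then have "abs (f (u x + s * \<phi> x)) <= L" using A(2)[of x] by (intro L) (auto simp: m_def)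
   then show "abs (f (u x + s * \<phi> x) * \<phi> x) <= L * abs (\<phi> x)" unfolding abs_mult by (intro mult_right_mono) auto
  qed (use y dF in auto)
  then show ?thesis using y by (simp add: abs_divide divide_le_eq)
 qed
 have "(H has_real_derivative H') (at t within ?S)"
  unfolding has_field_derivative_iff tendsto_at_iff_sequentially
 proof (intro allI impI)
  fix X assume X: "ALL i. X i : ?S - {t}" "X ----> t"
  let ?q = "%i x. wt x * ((F (u x + X i * \<phi> x) - F (u x + t * \<phi> x)) / (X i - t))"
  have "((%y. (H y - H t) / (y - t)) \<circ> X) i = (LBINT x. ?q i x)" for i
   using wtF_integrable[OF w] by (simp add: H_def right_diff_distrib diff_divide_distrib)
  moreover have "(%i. \<integral>x. ?q i x \<partial>lborel) ----> H'"
   unfolding H'_def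
  proof (rule integral_dominated_convergence)
   show "integrable lborel (%x. L * (wt x * abs (\<phi> x)))"
    by (intro integrable_mult_right wt_integrable[OF \<phi>]) (auto intro!: continuous_intros)
   show "(%x. wt x * f (u x + t * \<phi> x) * \<phi> x) : borel_measurable lborel" using wtf_integrable[OF w \<phi>] by (rule borel_measurable_integrable)
   show "?q i : borel_measurable lborel" for i
    using wtF_integrable[OF w, THEN borel_measurable_integrable] by (simp add: right_diff_distrib)
   show "AE x in lborel. norm (?q i x) <= L * (wt x * abs (\<phi> x))" for i
    using mult_left_mono[OF Lip[OF X(1)[rule_format, of i]], of "wt x" for x] by (auto simp: abs_mult mult_ac)
   have "(%i. (F (u x + X i * \<phi> x) - F (u x + t * \<phi> x)) / (X i - t)) ----> f (u x + t * \<phi> x) * \<phi> x" for x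
    using dF[of x t ?S] X unfolding has_field_derivative_iff tendsto_at_iff_sequentially by (auto simp: o_def)
   then show "AE x in lborel. (%i. ?q i x) ----> wt x * f (u x + t * \<phi> x) * \<phi> x"
    unfolding mult.assoc by (intro AE_I2 tendsto_mult_left)
  qed
  ultimately show "((%y. (H y - H t) / (y - t)) \<circ> X) ----> H'" by presburger
 qed
 then have "(H has_real_derivative H') (at t)" by (simp add: at_within_open[of t ?S])
 note dH = this
 have "((%t. (a + 2 * t * b + t^2 * c) / 2) has_real_derivative b + t * c) (at t)" for a b c
  by (auto intro!: derivative_eq_intros simp: field_simps)
 note D = DERIV_diff[OF this[of "Dir u u" "Dir u \<phi>" "Dir \<phi> \<phi>"] dH]
 have e1: "I (%x. u x + t * \<phi> x) = (Dir u u + 2 * t * Dir u \<phi> + t^2 * Dir \<phi> \<phi>) / 2 - H t" for t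
  unfolding I_def H_def by (subst quad) (rule refl)
 have e2: "dI (%x. u x + t * \<phi> x) \<phi> = Dir u \<phi> + t * Dir \<phi> \<phi> - H'"
  unfolding dI_def H'_def by (subst lin) (rule refl)
 show ?thesis unfolding e1 e2 by (rule D)
qed

end

lemma powr_sum3_le:
 assumes "r >= (1::real)"
 shows "(1 + abs a + abs b) powr r <= 3 powr r * (1 + abs a powr r + abs b powr r)"
proof -
 define m where "m = max 1 (max (abs a) (abs b))"
 have "1 + abs a + abs b <= 3 * m" by (simp add: m_def)
 then have "(1 + abs a + abs b) powr r <= (3 * m) powr r" using assms by (intro powr_mono2) auto
 also have "... = 3 powr r * m powr r" by (simp add: powr_mult m_def)
 also have "m powr r <= 1 + abs a powr r + abs b powr r"
  by (auto simp: m_def max_def)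
 finally show ?thesis by simp
qed

text \<open>Young's inequality without sharp constants, by comparing |c| with 1 + |a| + |b|.\<close>

lemma powr_sum_le:
 assumes "r >= (1::real)"
 shows "(1 + abs a + abs b) powr (r - 1) * abs c <= 3 powr r * (1 + abs a powr r + abs b powr r) + abs c powr r"
proof -
 define s where "s = 1 + abs a + abs b"
 have s: "s >= 1" by (simp add: s_def)
 have "s powr (r - 1) * abs c <= s powr r + abs c powr r"
 proof (cases "abs c <= s")
  case True
  have "s powr (r - 1) * abs c <= s powr (r - 1) * s powr 1" using True s by (intro mult_left_mono) auto
  also have "... = s powr r" by (simp only: powr_add[symmetric]) simp
  finally show ?thesis by (simp add: add_increasing2)
 next
  case False
  have "s powr (r - 1) * abs c <= abs c powr (r - 1) * abs c powr 1" using False s assms by (intro mult_mono powr_mono2) auto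
  also have "... = abs c powr r" by (simp only: powr_add[symmetric]) simp
  finally show ?thesis by (simp add: add_increasing)
 qed
 then show ?thesis using powr_sum3_le[OF assms, of a b] by (simp add: s_def)
qed

text \<open>Bernoulli's inequality for t^2 with exponent q / 2. It compares the growth of the
  nonlinear and of the quadratic term along a ray.\<close>

lemma powr_ge_square:
 assumes "1 <= t" "2 <= (q::real)" shows "q / 2 * (t^2 - 1) <= t powr q - 1"
proof -
 have "t powr q - q / 2 * t^2 >= 1 powr q - q / 2 * 1^2"
 proof (rule DERIV_nonneg_imp_nondecreasing[OF assms(1)])
  fix x assume x: "1 <= x" "x <= t"
  have "x powr 1 <= x powr (q - 1)" using x assms by (intro powr_mono) auto
  then have "0 <= q * x powr (q - 1) - q / 2 * (2 * x)" using x assms by simp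
  moreover have "((%x. x powr q - q / 2 * x^2) has_real_derivative (q * x powr (q - 1) - q / 2 * (2 * x))) (at x)"
   using x by (intro DERIV_diff has_real_derivative_powr DERIV_cmult) (auto intro!: derivative_eq_intros)
  ultimately show "EX y. ((%x. x powr q - q / 2 * x^2) has_real_derivative y) (at x) & 0 <= y" by blast
 qed
 then show ?thesis by (simp add: algebra_simps)
qed

section \<open>Control of the nonlinear term and the mountain pass geometry\<close>

context henon
begin

lemma wt_square_le: "u : TF ==> (LBINT x. wt x * (u x)^2) <= (LBINT x. (u x)^2)"
proof (rule integral_mono)
 assume u: "u : TF"
 show "integrable lborel (%x. wt x * (u x)^2)" by (rule wt_integrable[OF u]) (auto intro!: continuous_intros)
 show "integrable lborel (%x. (u x)^2)" by (rule TF_integrable_power2[OF u])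
 show "wt x * (u x)^2 <= (u x)^2" for x
  using wt_le_1[of x] TF_zero_outside[OF u, of x] by (cases "norm x <= 1") (auto simp: mult_left_le_one_le)
qed

lemma integrable_wt_powr: "u : TF ==> r > 0 ==> integrable lborel (%x. wt x * abs (u x) powr r)"
 by (rule wt_integrable[where h="%z. abs z powr r"], assumption, rule continuous_on_powr', intro continuous_on_rabs continuous_on_id, intro continuous_on_const) auto

lemma Sobolev_wt:
 assumes "2 < r" "r <= p1"
 shows "EX C>=0. ALL u:XS. ALL R>0. dnorm u <= R --> (LBINT x. wt x * abs (u x) powr r) <= C * R powr r"
proof -
 have r: "(real k1 - 1) * (r - 2) < 4"
 proof -
  have "(real k1 - 1) * (r - 2) <= (real k1 - 1) * (p1 - 2)" using assms c1 c2 by (intro mult_left_mono) auto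
  then show ?thesis using p1(2) by simp
 qed
 have \<alpha>': "(real k2 - 1) * (r - 2) / 2 <= \<alpha>"
 proof -
  have "(real k2 - 1) * (r - 2) <= (real k2 - 1) * (p1 - 2)" using assms c2 by (intro mult_left_mono) auto
  then show ?thesis using \<alpha> by simp
 qed
 obtain C where C: "C >= 0" "!!\<alpha> u R. (real k2 - 1) * (r - 2) / 2 <= \<alpha> ==> u : XS ==> 0 < R ==> Dir u u <= R^2 ==>
  (LBINT x. norm x powr \<alpha> * abs (u x) powr r) <= C * R powr r"
  using Sobolev_XS[OF assms(1) r] by (elim exE conjE) simp
 show ?thesis
 proof (intro exI[of _ C] conjI ballI allI impI C(1))
  fix u R assume u: "u : XS" and R: "(0::real) < R" "dnorm u <= R"
  have "(dnorm u)^2 <= R^2" by (rule power_mono[OF R(2) dnorm_nonneg])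
  then show "(LBINT x. wt x * abs (u x) powr r) <= C * R powr r"
   by (intro C(2) \<alpha>' u R) (simp only: dnorm_square)
 qed
qed

text \<open>One estimate for two purposes: \<open>\<phi>\<close> is a test direction when the
  continuity of \<open>dI\<close> is proved, and the indicator of the ball when integrals converge
  along a Palais-Smale sequence. For this reason only measurability and integrability are
  demanded.\<close>

lemma weighted_difference_le:
 fixes u v \<phi> h :: "'a => real"
 assumes m: "u : borel_measurable lborel" "v : borel_measurable lborel" "\<phi> : borel_measurable lborel"
  and i: "integrable lborel (%x. (norm (u x))^2)" "integrable lborel (%x. (norm (v x))^2)" "integrable lborel (%x. (norm (\<phi> x))^2)"
  and ip: "integrable lborel (%x. wt x * abs (u x) powr p1)" "integrable lborel (%x. wt x * abs (v x) powr p1)" "integrable lborel (%x. wt x * abs (\<phi> x) powr p1)"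
  and S: "(LBINT x. wt x * abs (u x) powr p1) <= S" "(LBINT x. wt x * abs (v x) powr p1) <= S" "(LBINT x. wt x * abs (\<phi> x) powr p1) <= S"
  and C: "0 <= \<delta>" "0 <= C" and h: "integrable lborel (%x. wt x * abs (h x))" "!!x. 1 <= norm x ==> h x = 0"
   "!!x. abs (h x) <= \<delta> * (3 powr p1 * (1 + abs (u x) powr p1 + abs (v x) powr p1) + abs (\<phi> x) powr p1) + C * (abs (u x - v x) * abs (\<phi> x))"
 shows "(LBINT x. wt x * abs (h x)) <= \<delta> * (3 powr p1 * (measure lborel (ball (0::'a) 1) + S + S) + S) +
  C * (sqrt (LBINT x. (u x - v x)^2) * sqrt (LBINT x. (\<phi> x)^2))"
proof -
 let ?i = "indicator (ball (0::'a) 1) :: 'a => real"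
 let ?U = "%x. wt x * abs (u x) powr p1" and ?V = "%x. wt x * abs (v x) powr p1" and ?P = "%x. wt x * abs (\<phi> x) powr p1"
 note L2 = L2_inner[OF borel_measurable_abs[OF borel_measurable_diff[OF m(1,2)]] borel_measurable_abs[OF m(3)], simplified, OF L2_diff_square[OF m(1,2) i(1,2), simplified] i(3)[simplified]]
 have ii: "integrable lborel ?i" by (rule integrable_real_indicator[OF _ emeasure_lborel_ball_finite]) simp
 have "(LBINT x. wt x * abs (h x)) <= (LBINT x. \<delta> * (3 powr p1 * (?i x + ?U x + ?V x) + ?P x) + C * (abs (u x - v x) * abs (\<phi> x)))"
 proof (rule integral_mono[OF h(1)])
  fix x
  show "wt x * abs (h x) <= \<delta> * (3 powr p1 * (?i x + ?U x + ?V x) + ?P x) + C * (abs (u x - v x) * abs (\<phi> x))"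
  proof (cases "norm x < 1")
   case False
   then show ?thesis using h(2)[of x] C by simp
  next
   case True
   have w: "wt x <= 1" using wt_le_1[of x] True by simp
   have "wt x * abs (h x) <= wt x * (\<delta> * (3 powr p1 * (1 + abs (u x) powr p1 + abs (v x) powr p1) + abs (\<phi> x) powr p1) + C * (abs (u x - v x) * abs (\<phi> x)))"
    by (intro mult_left_mono h(3)) simp
   also have "... = \<delta> * (3 powr p1 * (wt x + ?U x + ?V x) + ?P x) + wt x * (C * (abs (u x - v x) * abs (\<phi> x)))" by (simp add: algebra_simps)
   also have "... <= \<delta> * (3 powr p1 * (1 + ?U x + ?V x) + ?P x) + 1 * (C * (abs (u x - v x) * abs (\<phi> x)))"
    using w C by (intro add_mono mult_left_mono mult_right_mono order.refl) auto
   finally show ?thesis using True by simp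
  qed
 qed (use ii ip L2(1) in simp)
 also have "... = \<delta> * (3 powr p1 * (measure lborel (ball (0::'a) 1) + integral\<^sup>L lborel ?U + integral\<^sup>L lborel ?V) + integral\<^sup>L lborel ?P) + C * (LBINT x. abs (u x - v x) * abs (\<phi> x))"
  using ii ip L2(1) by simp
 also have "... <= \<delta> * (3 powr p1 * (measure lborel (ball (0::'a) 1) + S + S) + S) + C * (sqrt (LBINT x. (u x - v x)^2) * sqrt (LBINT x. (\<phi> x)^2))"
  using L2(2) by (intro add_mono mult_left_mono order.refl S C) (auto intro: order_trans[OF abs_ge_self])
 finally show ?thesis .
qed

text \<open>Up to an arbitrarily small error, the nonlinear part of \<open>dI\<close> is controlled
  by the L2 distance, uniformly over directions of norm at most 1. This is where the room between
  \<open>p\<close> and \<open>p1\<close> is spent, and it gives both uniform continuity of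
  \<open>dI\<close> and strong convergence.\<close>

lemma nonlinear_estimate:
 fixes \<epsilon> R :: real and h :: "real => real"
 assumes h: "continuous_on UNIV h" "!!z. abs (h z) <= K' * (1 + abs z) powr (p - 1)" and \<epsilon>: "\<epsilon> > 0"
 shows "EX C>=0. ALL u:XS. ALL v:XS. ALL \<phi>:XS. dnorm u <= R --> dnorm v <= R --> dnorm \<phi> <= 1 -->
  (LBINT x. wt x * abs (h (u x) - h (v x)) * abs (\<phi> x)) <= \<epsilon> + C * sqrt (LBINT x. (u x - v x)^2)"
proof -
 have pp: "p1 > 2" "p1 > 0" using p p1 by simp_all
 obtain S where S: "S >= 0" "!!u R. u : XS ==> R > 0 ==> dnorm u <= R ==> (LBINT x. wt x * abs (u x) powr p1) <= S * R powr p1"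
  using Sobolev_wt[OF pp(1) order.refl] by (elim exE conjE) simp
 define R' where "R' = max R 1"
 have R': "R' > 0" "R <= R'" "1 <= R'" by (auto simp: R'_def)
 define S' where "S' = S * R' powr p1"
 define T where "T = 3 powr p1 * (measure lborel (ball (0::'a) 1) + S' + S') + S'"
 have T: "T >= 0" using S by (simp add: T_def S'_def)
 \<comment> \<open>\<open>T\<close> collects the p1-power integrals, which the Sobolev inequality
   bounds; this choice makes their contribution at most \<epsilon>.\<close>
 define \<delta> where "\<delta> = \<epsilon> / (T + 1)"
 have \<delta>: "\<delta> > 0" "\<delta> * T <= \<epsilon>" using T \<epsilon> by (auto simp: \<delta>_def divide_simps)
 obtain C where C: "C >= 0" "!!a b. abs (h a - h b) <= \<delta> * (1 + abs a + abs b) powr (p1 - 1) + C * abs (a - b)"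
  using continuous_difference_bound[OF h, of "p1 - 1" \<delta>] p p1(1) \<delta>(1) by auto
 show ?thesis
 proof (intro exI[of _ C] conjI ballI impI C(1))
  fix u v \<phi> assume X: "u : XS" "v : XS" "\<phi> : XS" and d: "dnorm u <= R" "dnorm v <= R" "dnorm \<phi> <= 1"
  note TF = XS_TF[OF X(1)] XS_TF[OF X(2)] XS_TF[OF X(3)]
  have "(LBINT x. wt x * abs ((h (u x) - h (v x)) * \<phi> x)) <= \<delta> * T + C * (sqrt (LBINT x. (u x - v x)^2) * sqrt (LBINT x. (\<phi> x)^2))"
   unfolding T_def
  proof (rule weighted_difference_le)
   show "integrable lborel (%x. wt x * abs ((h (u x) - h (v x)) * \<phi> x))"
    by (rule continuous_ball_support_integrable, intro continuous_on_mult continuous_on_rabs continuous_on_diff wt_continuous TF_continuous TF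
      continuous_on_compose2[OF h(1) TF_continuous[OF TF(1)]] continuous_on_compose2[OF h(1) TF_continuous[OF TF(2)]])
     (auto simp: TF_zero_outside[OF TF(3)])
   fix x
   have "abs (h (u x) - h (v x)) * abs (\<phi> x) <= (\<delta> * (1 + abs (u x) + abs (v x)) powr (p1 - 1) + C * abs (u x - v x)) * abs (\<phi> x)"
    by (intro mult_right_mono C) auto
   also have "... = \<delta> * ((1 + abs (u x) + abs (v x)) powr (p1 - 1) * abs (\<phi> x)) + C * (abs (u x - v x) * abs (\<phi> x))" by (simp add: algebra_simps)
   also have "... <= \<delta> * (3 powr p1 * (1 + abs (u x) powr p1 + abs (v x) powr p1) + abs (\<phi> x) powr p1) + C * (abs (u x - v x) * abs (\<phi> x))"
    using pp \<delta>(1) by (intro add_right_mono mult_left_mono powr_sum_le) auto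
   finally show "abs ((h (u x) - h (v x)) * \<phi> x) <= \<delta> * (3 powr p1 * (1 + abs (u x) powr p1 + abs (v x) powr p1) + abs (\<phi> x) powr p1) + C * (abs (u x - v x) * abs (\<phi> x))"
    by (simp only: abs_mult)
  qed (use TF TF_borel TF_integrable_power2 integrable_wt_powr pp d R' \<delta>(1) C(1) TF_zero_outside[OF TF(3)] in \<open>auto simp: S'_def intro!: S(2) X\<close>)
  also have "... <= \<epsilon> + C * (sqrt (LBINT x. (u x - v x)^2) * 1)"
   using order_trans[OF real_sqrt_le_mono[OF Poincare_XS[OF X(3)], folded dnorm_def] d(3)]
   by (intro add_mono \<delta>(2) mult_left_mono C(1)) auto
  finally show "(LBINT x. wt x * abs (h (u x) - h (v x)) * abs (\<phi> x)) <= \<epsilon> + C * sqrt (LBINT x. (u x - v x)^2)"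
   by (simp only: abs_mult mult.assoc mult_1_right)
 qed
qed

lemma dI_difference:
 assumes TF: "u : TF" "v : TF" "\<phi> : TF"
 shows "abs (dI u \<phi> - dI v \<phi> - Dir (%x. u x - v x) \<phi>) <= (LBINT x. wt x * abs (f (u x) - f (v x)) * abs (\<phi> x))"
proof -
 have D: "Dir (%x. u x - v x) \<phi> = Dir u \<phi> - Dir v \<phi>"
  using Dir_diff[OF TF(3,1,2)] by (metis Dir_sym)
 note i1 = wtf_integrable[OF TF(1,3)] and i2 = wtf_integrable[OF TF(2,3)]
 have "dI u \<phi> - dI v \<phi> = Dir (%x. u x - v x) \<phi> - (LBINT x. wt x * f (u x) * \<phi> x - wt x * f (v x) * \<phi> x)"
  by (simp only: dI_def D Bochner_Integration.integral_diff[OF i1 i2])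
 moreover have "abs (\<integral>x. wt x * f (u x) * \<phi> x - wt x * f (v x) * \<phi> x \<partial>lborel) <= (LBINT x. wt x * abs (f (u x) - f (v x)) * abs (\<phi> x))"
 proof -
  have "(%x. abs (wt x * f (u x) * \<phi> x - wt x * f (v x) * \<phi> x)) = (%x. wt x * abs (f (u x) - f (v x)) * abs (\<phi> x))"
  proof
   fix x
   have "wt x * f (u x) * \<phi> x - wt x * f (v x) * \<phi> x = wt x * (f (u x) - f (v x)) * \<phi> x" by (simp add: algebra_simps)
   then show "abs (wt x * f (u x) * \<phi> x - wt x * f (v x) * \<phi> x) = wt x * abs (f (u x) - f (v x)) * abs (\<phi> x)" by (simp only: abs_mult) simp
  qed
  then show ?thesis using integral_abs_bound[of lborel "%x. wt x * f (u x) * \<phi> x - wt x * f (v x) * \<phi> x"] by simp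
 qed
 ultimately show ?thesis by linarith
qed

lemma dI_add:
 assumes TF: "u : TF" "\<phi> : TF" "\<psi> : TF" shows "dI u (%x. \<phi> x + \<psi> x) = dI u \<phi> + dI u \<psi>"
proof -
 have "(LBINT x. wt x * f (u x) * (\<phi> x + \<psi> x)) = (LBINT x. wt x * f (u x) * \<phi> x + wt x * f (u x) * \<psi> x)"
  by (simp only: distrib_left)
 then show ?thesis
  by (simp only: dI_def Dir_add[OF TF] Bochner_Integration.integral_add[OF wtf_integrable[OF TF(1,2)] wtf_integrable[OF TF(1,3)]])
qed

lemma dI_cmult:
 assumes "\<phi> : TF" shows "dI u (%x. c * \<phi> x) = c * dI u \<phi>"
proof -
 have "(LBINT x. wt x * f (u x) * (c * \<phi> x)) = (LBINT x. c * (wt x * f (u x) * \<phi> x))"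
  by (simp only: mult_ac)
 then show ?thesis
  by (simp only: dI_def Dir_cmult[OF assms] integral_mult_right_zero right_diff_distrib)
qed

text \<open>The mountain pass geometry comes from \<open>zf_small\<close> and the Sobolev inequality
  near 0, and from the Ambrosetti-Rabinowitz condition far out. The bound \<open>m\<close> on a
  single ray bounds the level, which is what the later comparison exploits.\<close>

lemma PS_sequence_exists:
 assumes \<psi>: "\<psi> : XS" "dnorm \<psi> > 0" and m: "!!t. 0 <= t ==> I (%x. t * \<psi> x) <= m"
 obtains c R where "0 < c" "c <= m" "0 < R"
  "!!\<epsilon>. \<epsilon> > 0 ==> EX u:XS. dnorm u <= R & abs (I u - c) <= \<epsilon> & (ALL \<phi>:XS. dnorm \<phi> <= 1 --> abs (dI u \<phi>) <= \<epsilon>)"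
proof -
 have dI_diff: "abs (dI u \<phi> - dI v \<phi>) <= dnorm (%x. u x - v x) + (LBINT x. wt x * abs (f (u x) - f (v x)) * abs (\<phi> x))"
  if X: "u : XS" "v : XS" "\<phi> : XS" and n: "dnorm \<phi> <= 1" for u v \<phi>
 proof -
  note TF = XS_TF[OF X(1)] XS_TF[OF X(2)] XS_TF[OF X(3)]
  have "abs (Dir (%x. u x - v x) \<phi>) <= dnorm (%x. u x - v x) * 1"
   by (rule order_trans[OF abs_Dir_le[OF TF_diff[OF TF(1,2)] TF(3)] mult_left_mono[OF n dnorm_nonneg]])
  then show ?thesis using dI_difference[OF TF] by linarith
 qed
 have L2_le: "sqrt (LBINT x. (u x)^2) <= dnorm u" if "u : XS" for u
  unfolding dnorm_def by (rule real_sqrt_le_mono[OF Poincare_XS[OF that]])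
 define a where "a = Dir \<psi> \<psi>"
 \<comment> \<open>At Dirichlet norm at least R - 1, the quantity (1/2 - 1/q) Dir v v is at least
   |m| + 1. Then \<open>I v\<close> <= m + 1 forces the integral of F to be at least Dir v v / q,
   and from such a point \<open>I\<close> does not increase along the outward ray.\<close>
 define R where "R = 2 + sqrt ((abs m + 1) / (1 / 2 - 1 / q))"
 have q2: "1 / 2 - 1 / q > 0" using q by (simp add: field_simps)
 have R: "R >= 2" using q2 by (simp add: R_def)
 have R2: "abs m + 1 <= (1 / 2 - 1 / q) * a" if "R - 1 <= sqrt a" for a
 proof -
  have "sqrt ((abs m + 1) / (1 / 2 - 1 / q)) <= sqrt a" using that unfolding R_def by linarith
  then have "(abs m + 1) / (1 / 2 - 1 / q) <= a" by simp
  then show ?thesis by (simp only: pos_divide_le_eq[OF q2] mult.commute)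
 qed
 \<comment> \<open>With the Poincare constant 1, the coefficient 1/4 uses up half of the Dirichlet
   term of \<open>I\<close>.\<close>
 obtain C where C: "C >= 0" "!!z. z * f z <= (1/4) * z^2 + C * abs z powr p" using zf_small[of "1/4"] by auto
 obtain S where S: "S >= 0" "!!u R. u : XS ==> R > 0 ==> dnorm u <= R ==> (LBINT x. wt x * abs (u x) powr p) <= S * R powr p"
  using Sobolev_wt[of p] p p1(1) by auto
 have p0: "p > 0" using p by simp
 have I_lower: "r^2 / 4 - C * S * r powr p <= I u" if u: "u : XS" and r: "dnorm u = r" "r > 0" for u r
 proof -
  note TF = XS_TF[OF u]
  have iq: "integrable lborel (%x. wt x * (u x)^2)" by (rule wt_integrable[OF TF]) (auto intro!: continuous_intros)
  note ip = integrable_wt_powr[OF TF p0]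
  have "(LBINT x. wt x * F (u x)) <= (LBINT x. (1/4) * (wt x * (u x)^2) + C * (wt x * abs (u x) powr p))"
  proof (rule integral_mono[OF wtF_integrable[OF TF]])
   show "integrable lborel (%x. (1/4) * (wt x * (u x)^2) + C * (wt x * abs (u x) powr p))"
    by (intro Bochner_Integration.integrable_add integrable_mult_right iq ip)
   fix x
   have "wt x * F (u x) <= wt x * ((1/4) * (u x)^2 + C * abs (u x) powr p)"
    by (rule mult_left_mono[OF order_trans[OF F_le C(2)]]) simp
   then show "wt x * F (u x) <= (1/4) * (wt x * (u x)^2) + C * (wt x * abs (u x) powr p)" by (simp add: algebra_simps)
  qed
  also have "... = (1/4) * (LBINT x. wt x * (u x)^2) + C * (LBINT x. wt x * abs (u x) powr p)"
   by (simp only: Bochner_Integration.integral_add[OF integrable_mult_right[OF iq] integrable_mult_right[OF ip]] integral_mult_right_zero)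
  also have "... <= (1/4) * Dir u u + C * (S * r powr p)"
   using r C(1) by (intro add_mono mult_left_mono S(2) u order_trans[OF wt_square_le[OF TF] Poincare_XS[OF u]]) auto
  finally have "Dir u u / 2 - ((1/4) * Dir u u + C * (S * r powr p)) <= I u" by (simp only: I_def)
  moreover have "Dir u u = r^2" using dnorm_square[of u] r by simp
  ultimately show ?thesis by simp
 qed
 \<comment> \<open>At this radius the superquadratic term is at most r0^2 / 8, half of the quadratic
   gain r0^2 / 4.\<close>
 define r0 where "r0 = min 1 ((1 / (8 * (C * S + 1))) powr (1 / (p - 2)))"
 have CS: "C * S >= 0" using C S by simp
 have r0: "r0 > 0" "r0 <= 1" using CS by (auto simp: r0_def add_nonneg_eq_0_iff)
 have r0p: "C * S * r0 powr p <= r0^2 / 8"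
 proof -
  have "r0 powr (p - 2) <= ((1 / (8 * (C * S + 1))) powr (1 / (p - 2))) powr (p - 2)"
   using r0 p by (intro powr_mono2) (auto simp: r0_def)
  also have "... = 1 / (8 * (C * S + 1))" using p CS by (simp add: powr_powr)
  finally have "C * S * r0 powr (p - 2) <= C * S * (1 / (8 * (C * S + 1)))" using CS by (intro mult_left_mono)
  also have "... <= 1 / 8" using CS by (simp add: field_simps)
  finally have "C * S * r0 powr (p - 2) * r0^2 <= 1 / 8 * r0^2" by (rule mult_right_mono) simp
  moreover have "r0 powr p = r0 powr (p - 2) * r0^2" using powr_add[of r0 "p - 2" 2] r0(1) by simp
  ultimately show ?thesis by (simp add: mult.assoc)
 qed
 define e where "e = (%x. (R / dnorm \<psi>) * \<psi> x)"
 interpret mp: mountain_pass XS dnorm I dI R m r0 "r0^2 / 8" e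
 proof
  show "subspace XS"
   unfolding subspace_def using XS_add XS_cmult XS_zero by (auto simp: plus_fun_def zero_fun_def scaleR_fun_def)
 next
  show "0 <= dnorm u" for u by (rule dnorm_nonneg)
 next
  show "dnorm (u + v) <= dnorm u + dnorm v" if "u : XS" "v : XS" for u v
   unfolding plus_fun_def by (rule dnorm_triangle[OF XS_TF[OF that(1)] XS_TF[OF that(2)]])
 next
  show "dnorm (c *\<^sub>R u) = abs c * dnorm u" if "u : XS" for c u
   unfolding scaleR_fun_def real_scaleR_def by (rule dnorm_cmult[OF XS_TF[OF that]])
 next
  show "dI u (\<phi> + \<psi>) = dI u \<phi> + dI u \<psi>" if "u : XS" "\<phi> : XS" "\<psi> : XS" for u \<phi> \<psi>
   unfolding plus_fun_def using that by (intro dI_add XS_TF)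
 next
  show "dI u (c *\<^sub>R \<phi>) = c * dI u \<phi>" if "u : XS" "\<phi> : XS" for u \<phi> c
   unfolding scaleR_fun_def real_scaleR_def by (rule dI_cmult[OF XS_TF[OF that(2)]])
 next
  fix u \<phi> :: "'a => real" and t assume X: "u : XS" "\<phi> : XS"
  show "((%t. I (u + t *\<^sub>R \<phi>)) has_real_derivative dI (u + t *\<^sub>R \<phi>) \<phi>) (at t)"
   unfolding plus_fun_def scaleR_fun_def real_scaleR_def by (rule line_derivative[OF XS_TF[OF X(1)] XS_TF[OF X(2)]])
 next
  fix r \<delta> :: real assume \<delta>: "\<delta> > 0"
  obtain C where C: "C >= 0" "!!u v \<phi>. u : XS ==> v : XS ==> \<phi> : XS ==> dnorm u <= r ==> dnorm v <= r ==> dnorm \<phi> <= 1 ==>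
   (LBINT x. wt x * abs (f (u x) - f (v x)) * abs (\<phi> x)) <= \<delta> / 2 + C * sqrt (LBINT x. (u x - v x)^2)"
   using nonlinear_estimate[OF f_cont f_growth half_gt_zero[OF \<delta>], of r] by (elim exE conjE) simp
  define \<eta> where "\<eta> = \<delta> / (2 * (C + 1))"
  have \<eta>: "\<eta> > 0" "(1 + C) * \<eta> = \<delta> / 2" using C(1) \<delta> by (auto simp: \<eta>_def field_simps)
  show "EX \<eta>>0. ALL u:XS. ALL v:XS. dnorm u <= r --> dnorm v <= r --> dnorm (u - v) <= \<eta> --> (ALL \<phi>:XS. dnorm \<phi> <= 1 --> abs (dI u \<phi> - dI v \<phi>) <= \<delta>)"
  proof (intro exI[of _ \<eta>] conjI ballI impI \<eta>(1))
   fix u v \<phi> assume X: "u : XS" "v : XS" "\<phi> : XS" and d: "dnorm u <= r" "dnorm v <= r" "dnorm (u - v) <= \<eta>" "dnorm \<phi> <= 1"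
   have d3: "dnorm (%x. u x - v x) <= \<eta>" using d(3) by (simp add: fun_diff_def)
   have "sqrt (LBINT x. (u x - v x)^2) <= \<eta>" by (rule order_trans[OF L2_le[OF XS_diff[OF X(1,2)]] d3])
   then have "C * sqrt (LBINT x. (u x - v x)^2) <= C * \<eta>" using C(1) by (rule mult_left_mono)
   then show "abs (dI u \<phi> - dI v \<phi>) <= \<delta>"
    using dI_diff[OF X d(4)] C(2)[OF X d(1,2,4)] d3 \<eta>(2) by (simp add: distrib_right)
  qed
 next
  fix r :: real
  \<comment> \<open>The bound comes from comparison with the derivative at the zero function, which
    lies in the ball only if the radius is nonnegative.\<close>
  define r' where "r' = max r 0"
  obtain C where C: "C >= 0" "!!u v \<phi>. u : XS ==> v : XS ==> \<phi> : XS ==> dnorm u <= r' ==> dnorm v <= r' ==> dnorm \<phi> <= 1 ==>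
   (LBINT x. wt x * abs (f (u x) - f (v x)) * abs (\<phi> x)) <= 1 + C * sqrt (LBINT x. (u x - v x)^2)"
   using nonlinear_estimate[OF f_cont f_growth zero_less_one, of r'] by (elim exE conjE) simp
  have Dir0: "Dir (%x. 0) \<phi> = 0" for \<phi> :: "'a => real" by (simp add: Dir_def gradient_const)
  have z: "dnorm (%x::'a. 0) = 0" by (simp add: dnorm_def Dir0)
  show "EX C. ALL u:XS. dnorm u <= r --> (ALL \<phi>:XS. dnorm \<phi> <= 1 --> abs (dI u \<phi>) <= C)"
  proof (intro exI[of _ "r' + 1 + C * r'"] ballI impI)
   fix u \<phi> assume X: "u : XS" "\<phi> : XS" and d: "dnorm u <= r" "dnorm \<phi> <= 1"
   have d': "dnorm u <= r'" "dnorm (%x::'a. 0) <= r'" using d(1) z by (auto simp: r'_def)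
   have "sqrt (LBINT x. (u x)^2) <= r'" by (rule order_trans[OF L2_le[OF X(1)] d'(1)])
   then have "C * sqrt (LBINT x. (u x)^2) <= C * r'" using C(1) by (rule mult_left_mono)
   moreover have "dI (%x. 0) \<phi> = 0" by (simp add: dI_def Dir0 f_nonpos)
   ultimately show "abs (dI u \<phi>) <= r' + 1 + C * r'"
    using dI_diff[OF X(1) XS_zero X(2) d(2)] C(2)[OF X(1) XS_zero X(2) d' d(2)] d'(1) by simp
  qed
 next
  have "Dir (%x. 0) (%x::'a. 0) = 0" by (simp add: Dir_def gradient_const)
  then show "I 0 = 0" by (simp add: I_def zero_fun_def F_0)
 next
  show "0 < r0" "r0 < R" "1 < R" "0 < r0^2 / 8" using r0 R by auto
 next
  show "r0^2 / 8 <= I u" if "u : XS" "dnorm u = r0" for u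
   using I_lower[OF that r0(1)] r0p by simp
 next
  fix v t assume v: "v : XS" "R - 1 <= dnorm v" "I v <= m + 1" and t: "(1::real) <= t"
  note TF = XS_TF[OF v(1)]
  define a where "a = Dir v v"
  define b where "b = (LBINT x. wt x * F (v x))"
  have a0: "a >= 0" by (simp add: a_def Dir_nonneg)
  have Iv: "I v = a / 2 - b" by (simp add: I_def a_def b_def)
  have "abs m + 1 <= (1 / 2 - 1 / q) * a" by (rule R2) (use v(2) in \<open>simp add: dnorm_def a_def\<close>)
  then have ba: "a / q <= b" using v(3) Iv abs_ge_self[of m] by (simp add: left_diff_distrib)
  have D: "Dir (%x. t * v x) (%x. t * v x) = t^2 * a"
   using Dir_cmult[OF TF, of "%x. t * v x" t] Dir_cmult[OF TF, of v t] Dir_sym[of "%x. t * v x" v] by (simp add: a_def power2_eq_square)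
  have "t powr q * b = (LBINT x. t powr q * (wt x * F (v x)))" by (simp add: b_def)
  also have "... <= (LBINT x. wt x * F (t * v x))"
  proof (rule integral_mono[OF integrable_mult_right[OF wtF_integrable[OF TF]] wtF_integrable[OF TF_cmult[OF TF]]])
   show "t powr q * (wt x * F (v x)) <= wt x * F (t * v x)" for x
    using mult_left_mono[OF F_scale_up[OF t, of "v x"], of "wt x"] by (simp add: mult.left_commute)
  qed
  finally have "I (%x. t * v x) <= t^2 * a / 2 - t powr q * b" unfolding I_def D by simp
  moreover have "q / 2 * (t^2 - 1) * (a / q) <= (t powr q - 1) * b"
  proof (rule mult_mono[OF powr_ge_square[OF t] ba])
   show "2 <= q" "0 <= a / q" using q a0 by auto
   show "0 <= t powr q - 1" using t q by (simp add: ge_one_powr_ge_zero)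
  qed
  moreover have "q / 2 * (t^2 - 1) * (a / q) = (t^2 - 1) * a / 2" using q by simp
  ultimately show "I (t *\<^sub>R v) <= I v" unfolding scaleR_fun_def real_scaleR_def Iv by (simp add: algebra_simps diff_divide_distrib)
 next
  show "e : XS" unfolding e_def by (rule XS_cmult[OF \<psi>(1)])
  have "dnorm e = abs (R / dnorm \<psi>) * dnorm \<psi>" unfolding e_def by (rule dnorm_cmult[OF XS_TF[OF \<psi>(1)]])
  then show "R <= dnorm e" using \<psi>(2) R by simp
  show "I (t *\<^sub>R e) <= m" if "0 <= t" "t <= 1" for t
   using m[of "t * (R / dnorm \<psi>)"] that \<psi>(2) R by (simp add: e_def scaleR_fun_def mult.assoc)
 qed
 obtain c where c: "r0^2 / 8 <= c" "c <= m"
  "!!\<epsilon>. \<epsilon> > 0 ==> EX u:XS. dnorm u <= R & abs (I u - c) <= \<epsilon> & (ALL \<phi>:XS. dnorm \<phi> <= 1 --> abs (dI u \<phi>) <= \<epsilon>)"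
  using mp.critical_sequence by (elim exE conjE) simp
 have "0 < c" "0 < R" using c(1) r0 R by (auto intro: less_le_trans[of 0 "r0^2 / 8"])
 then show thesis by (rule that[OF _ c(2) _ c(3)])
qed

end

subsection \<open>Palais--Smale sequences\<close>

lemma ennreal_le_suminf: "a k <= (\<Sum>j. a j)" for a :: "nat => ennreal"
 using sum_le_suminf[OF summableI, of "{k}" a] by simp

lemma Fatou_real:
 fixes g :: "nat => 'a => real"
 assumes g: "!!k. integrable N (g k)" "!!k x. 0 <= g k x" "!!k. (LINT x|N. g k x) <= B"
  and lim: "AE x in N. (%k. g k x) ----> h x" and h: "h : borel_measurable N" "!!x. 0 <= h x"
 shows "integrable N h" "(LINT x|N. h x) <= B"
proof -
 have B: "B >= 0" by (rule order_trans[OF integral_nonneg_AE g(3)[of 0]]) (use g(2) in auto)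
 have [measurable]: "g k : borel_measurable N" for k using g(1)[of k] by (rule borel_measurable_integrable)
 have "(\<integral>\<^sup>+x. ennreal (h x) \<partial>N) = (\<integral>\<^sup>+x. liminf (%k. ennreal (g k x)) \<partial>N)"
 proof (rule nn_integral_cong_AE)
  show "AE x in N. ennreal (h x) = liminf (%k. ennreal (g k x))"
   using lim
  proof eventually_elim
   case (elim x)
   have "(%k. ennreal (g k x)) ----> ennreal (h x)" by (rule tendsto_ennrealI[OF elim])
   then show ?case by (rule lim_imp_Liminf[symmetric, OF sequentially_bot])
  qed
 qed
 also have "... <= liminf (%k. \<integral>\<^sup>+x. ennreal (g k x) \<partial>N)" by (rule nn_integral_liminf) simp
 also have "... <= ennreal B"
 proof (rule Liminf_le)
  show "\<forall>\<^sub>F k in sequentially. (\<integral>\<^sup>+x. ennreal (g k x) \<partial>N) <= ennreal B"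
   using g by (intro always_eventually allI) (simp add: nn_integral_eq_integral ennreal_leI)
 qed simp
 finally have le: "(\<integral>\<^sup>+x. ennreal (h x) \<partial>N) <= ennreal B" .
 show i: "integrable N h" using h le by (intro integrableI_nonneg) (auto intro: le_less_trans)
 have "ennreal (LINT x|N. h x) <= ennreal B" using le by (subst nn_integral_eq_integral[symmetric, OF i]) (use h(2) in auto)
 then show "(LINT x|N. h x) <= B" using B by simp
qed

text \<open>The Riesz-Fischer theorem with a definite representative: the pointwise limit along a
  subsequence, written with \<open>lim\<close>. Properties shared by all terms at a given point,
  such as vanishing outside the ball, then hold for the limit at that very point.\<close>

lemma L2_complete:
 fixes w :: "nat => 'a => 'b::euclidean_space"
 assumes m[measurable]: "!!k. w k : borel_measurable N" and i: "!!k. integrable N (%x. (norm (w k x))^2)"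
  and c: "!!\<epsilon>. \<epsilon> > 0 ==> EX n. ALL j>=n. ALL k>=n. (LINT x|N. (norm (w j x - w k x))^2) <= \<epsilon>"
 obtains s :: "nat => nat" and W where "strict_mono s" "W : borel_measurable N" "AE x in N. (%k. w (s k) x) ----> W x"
  "integrable N (%x. (norm (W x))^2)" "(%k. \<integral>x. (norm (w k x - W x))^2 \<partial>N) ----> 0" "W = (%x. lim (%k. w (s k) x))"
proof -
 have id: "integrable N (%x. (norm (w j x - w k x))^2)" for j k by (intro L2_diff_square m i)
 \<comment> \<open>The rate 8^(-l) leaves room for the factor 2^k in the series below, whose
   finiteness makes the increments geometrically small at almost every point.\<close>
 obtain n where n: "!!l j k. j >= n l ==> k >= n l ==> (LINT x|N. (norm (w j x - w k x))^2) <= (1/8)^l" for l :: nat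
 proof -
  have "ALL l. EX n. ALL j>=n. ALL k>=n. (LINT x|N. (norm (w j x - w k x))^2) <= (1/8)^l" by (intro allI c) simp
  from choice[OF this] that show thesis by auto
 qed
 define s where "s k = (SUM i<=k. Suc (n i))" for k :: nat
 have s: "strict_mono s" by (rule strict_mono_Suc_iff[THEN iffD2]) (simp add: s_def)
 have sn: "n k <= s k" for k
  using member_le_sum[of k "{..k}" "%i. Suc (n i)"] by (simp add: s_def)
 define D where "D k x = w (s (Suc k)) x - w (s k) x" for k x
 have Dm[measurable]: "D k : borel_measurable N" for k unfolding D_def by measurable
 have "AE x in N. (\<Sum>k. ennreal (2 ^ k * (norm (D k x))^2)) ~= \<infinity>"
 proof (rule nn_integral_PInf_AE)
  have "(\<integral>\<^sup>+x. (\<Sum>k. ennreal (2 ^ k * (norm (D k x))^2)) \<partial>N) = (\<Sum>k. \<integral>\<^sup>+x. ennreal (2 ^ k * (norm (D k x))^2) \<partial>N)"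
   by (rule nn_integral_suminf) simp
  also have "... <= (\<Sum>k. ennreal ((1/4) ^ k))"
  proof (rule suminf_le[OF _ summableI summableI])
   fix k
   have "s k <= s (Suc k)" using s by (simp add: strict_mono_less_eq)
   then have "(LINT x|N. (norm (D k x))^2) <= (1/8) ^ k" unfolding D_def using sn[of k] by (intro n) auto
   then have "2 ^ k * (LINT x|N. (norm (D k x))^2) <= 2 ^ k * (1/8) ^ k" by (intro mult_left_mono) auto
   also have "(2::real) ^ k * (1/8) ^ k = (1/4) ^ k" by (simp add: power_mult_distrib[symmetric])
   finally have "ennreal (LINT x|N. 2 ^ k * (norm (D k x))^2) <= ennreal ((1/4) ^ k)" by (simp add: ennreal_leI)
   then show "(\<integral>\<^sup>+x. ennreal (2 ^ k * (norm (D k x))^2) \<partial>N) <= ennreal ((1/4) ^ k)"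
    unfolding D_def by (subst nn_integral_eq_integral[OF integrable_mult_right[OF id]]) auto
  qed
  also have "... = ennreal (\<Sum>k. (1/4) ^ k)" by (rule suminf_ennreal2) (auto intro: summable_geometric)
  finally show "(\<integral>\<^sup>+x. (\<Sum>k. ennreal (2 ^ k * (norm (D k x))^2)) \<partial>N) ~= \<infinity>" by (auto simp: top_unique)
 qed simp
 then have cv: "AE x in N. convergent (%k. w (s k) x)"
 proof eventually_elim
  case (elim x)
  define C where "C = enn2real (\<Sum>k. ennreal (2 ^ k * (norm (D k x))^2))"
  have "norm (D k x) <= sqrt C * (1 / sqrt 2) ^ k" for k
  proof -
   have "ennreal (2 ^ k * (norm (D k x))^2) <= (\<Sum>k. ennreal (2 ^ k * (norm (D k x))^2))" by (rule ennreal_le_suminf)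
   also have "... = ennreal C" using elim by (simp add: C_def less_top)
   finally have "2 ^ k * (norm (D k x))^2 <= C" by (subst (asm) ennreal_le_iff) (simp_all add: C_def)
   then have "(norm (D k x))^2 <= C * (1 / 2) ^ k" by (simp add: field_simps power_divide)
   from real_sqrt_le_mono[OF this] show ?thesis by (simp add: real_sqrt_mult real_sqrt_power real_sqrt_divide)
  qed
  note bnd = this
  have "summable (%k. sqrt C * (1 / sqrt 2) ^ k)" by (rule summable_mult[OF summable_geometric]) simp
  then have "summable (%k. D k x)" by (rule summable_comparison_test'[of _ 0]) (rule bnd)
  then have "convergent (%k. SUM i<k. D i x)" by (simp add: summable_iff_convergent)
  moreover have "(SUM i<k. D i x) = w (s k) x - w (s 0) x" for k
   unfolding D_def by (rule sum_lessThan_telescope)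
  ultimately have "convergent (%k. (w (s k) x - w (s 0) x) + w (s 0) x)" by (intro convergent_add convergent_const) simp
  then show ?case by simp
 qed
 define W where "W x = lim (%k. w (s k) x)" for x
 have Wm[measurable]: "W : borel_measurable N" unfolding W_def by measurable
 have W: "AE x in N. (%k. w (s k) x) ----> W x"
  using cv by eventually_elim (simp add: W_def convergent_LIMSEQ_iff)
 have F: "integrable N (%x. (norm (w m x - W x))^2) & (LINT x|N. (norm (w m x - W x))^2) <= \<epsilon>"
  if e: "!!j k. j >= n ==> k >= n ==> (LINT x|N. (norm (w j x - w k x))^2) <= \<epsilon>" and mn: "m >= n" for n m \<epsilon>
 proof -
  have kn: "n <= s (k + n)" for k using strict_mono_imp_increasing[OF s, of "k + n"] by simp
  have lim: "AE x in N. (%k. (norm (w m x - w (s (k + n)) x))^2) ----> (norm (w m x - W x))^2"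
   using W
  proof eventually_elim
   case (elim x)
   show ?case by (intro tendsto_power tendsto_norm tendsto_diff tendsto_const LIMSEQ_ignore_initial_segment elim)
  qed
  show ?thesis
   using Fatou_real[of N "%k x. (norm (w m x - w (s (k + n)) x))^2" \<epsilon> "%x. (norm (w m x - W x))^2", OF id _ e[OF mn kn] lim] by simp
 qed
 obtain n1 where "ALL j>=n1. ALL k>=n1. (LINT x|N. (norm (w j x - w k x))^2) <= 1" using c[of 1] by auto
 then have i1: "integrable N (%x. (norm (w n1 x - W x))^2)" using F[of n1 1 n1] by auto
 have iW: "integrable N (%x. (norm (W x))^2)" using L2_diff_square[OF m[of n1] _ i[of n1] i1] by simp
 have "(%k. \<integral>x. (norm (w k x - W x))^2 \<partial>N) ----> 0"
 proof (rule LIMSEQ_I)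
  fix r :: real assume r: "r > 0"
  obtain n where "ALL j>=n. ALL k>=n. (LINT x|N. (norm (w j x - w k x))^2) <= r / 2" using c[of "r / 2"] r by auto
  then have "(LINT x|N. (norm (w m x - W x))^2) <= r / 2" if "m >= n" for m using F[of n "r / 2" m] that by auto
  moreover have "0 <= (LINT x|N. (norm (w m x - W x))^2)" for m by (intro integral_nonneg_AE) auto
  ultimately show "EX no. ALL m>=no. norm ((LINT x|N. (norm (w m x - W x))^2) - 0) < r"
   using r by (intro exI[of _ n]) fastforce
 qed
 moreover have "W = (%x. lim (%k. w (s k) x))" by (simp add: W_def fun_eq_iff)
 ultimately show thesis using s Wm W iW by (rule_tac that)
qed

text \<open>A Palais-Smale sequence with the L2 limits \<open>u\<close> of its functions and
  \<open>g\<close> of its gradients, both with representatives that vanish everywhere outside the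
  ball. That \<open>g\<close> is the weak gradient of \<open>u\<close> is derived later.\<close>

locale ps_limit = henon +
 fixes U :: "nat => 'a => real" and u :: "'a => real" and g :: "'a => 'a" and Q c :: real
 assumes U: "!!k. U k : XS" and U_bounded: "!!k. dnorm (U k) <= Q"
  and I_U: "(%k. I (U k)) ----> c"
  and dI_U: "!!k \<phi>. \<phi> : XS ==> dnorm \<phi> <= 1 ==> abs (dI (U k) \<phi>) <= 1 / real (Suc k)"
  and u_borel[measurable]: "u : borel_measurable borel" and g_borel[measurable]: "g : borel_measurable borel"
  and u_AE: "AE x in lborel. (%k. U k x) ----> u x"
  and u_square: "integrable lborel (%x. (u x)^2)" and g_square: "integrable lborel (%x. (norm (g x))^2)"
  and U_L2: "(%k. \<integral>x. (U k x - u x)^2 \<partial>lborel) ----> 0"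
  and gradU_L2: "(%k. \<integral>x. (norm (gradient (U k) x - g x))^2 \<partial>lborel) ----> 0"
  and u_outside: "!!x. 1 <= norm x ==> u x = 0" and g_outside: "!!x. 1 <= norm x ==> g x = 0"

context henon
begin

text \<open>Compactness yields a subsequence that is Cauchy in L2. Testing the difference of two
  derivatives with the normalised difference of the two functions bounds its Dirichlet energy by the
  nonlinear term, hence by the L2 distance; so the gradients converge strongly as well.\<close>

lemma ps_limit_exists:
 assumes PS: "!!\<epsilon>. \<epsilon> > 0 ==> EX u:XS. dnorm u <= Q & abs (I u - c) <= \<epsilon> & (ALL \<phi>:XS. dnorm \<phi> <= 1 --> abs (dI u \<phi>) <= \<epsilon>)"
 shows "EX U u g. ps_limit B1 B2 f K p q \<mu> \<alpha> p1 U u g Q c"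
proof -
 have "EX u. u : XS & dnorm u <= Q & abs (I u - c) <= 1 / real (Suc k) & (ALL \<phi>:XS. dnorm \<phi> <= 1 --> abs (dI u \<phi>) <= 1 / real (Suc k))" for k
  using PS[of "1 / real (Suc k)"] by auto
 then obtain U0 where U0: "!!k. U0 k : XS" "!!k. dnorm (U0 k) <= Q" "!!k. abs (I (U0 k) - c) <= 1 / real (Suc k)"
  "!!k \<phi>. \<phi> : XS ==> dnorm \<phi> <= 1 ==> abs (dI (U0 k) \<phi>) <= 1 / real (Suc k)" by metis
 have Q: "Q >= 0" by (rule order_trans[OF dnorm_nonneg U0(2)])
 have DU0: "Dir (U0 k) (U0 k) <= Q^2" for k
  using power_mono[OF U0(2)[of k] dnorm_nonneg, of 2] by (simp add: dnorm_square)
 obtain s :: "nat => nat" where s: "strict_mono s"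
  "!!\<epsilon>. \<epsilon> > 0 ==> EX N. ALL m>=N. ALL n>=N. (LBINT x. (U0 (s m) x - U0 (s n) x)^2) <= \<epsilon>"
  using Rellich_XS[of U0 "Q^2", OF U0(1) DU0] by (elim exE conjE) simp
 define V where "V k = U0 (s k)" for k
 have sk: "1 / real (Suc (s k)) <= 1 / real (Suc k)" for k
  using strict_mono_imp_increasing[OF s(1), of k] by (intro divide_left_mono) auto
 have V: "V k : XS" "dnorm (V k) <= Q" "abs (I (V k) - c) <= 1 / real (Suc k)" for k
  unfolding V_def using U0(1-3)[of "s k"] sk[of k] by auto
 have dV: "abs (dI (V k) \<phi>) <= 1 / real (Suc k)" if "\<phi> : XS" "dnorm \<phi> <= 1" for k \<phi>
  unfolding V_def using U0(4)[OF that, of "s k"] sk[of k] by linarith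
 note VT = XS_TF[OF V(1)]
 define L where "L = 2 * Q + 1"
 have L: "L >= 1" using Q by (simp add: L_def)
 have cauchy: "EX n. ALL j>=n. ALL k>=n. Dir (%x. V j x - V k x) (%x. V j x - V k x) <= \<epsilon>" if \<epsilon>: "\<epsilon> > 0" for \<epsilon>
 proof -
  \<comment> \<open>Four errors of size \<open>e\<close> occur: one for each of the two derivatives,
    and two in the nonlinear estimate. The factor \<open>L\<close> comes from normalising the test
    direction.\<close>
  define e where "e = \<epsilon> / (4 * L)"
  have e: "e > 0" using \<epsilon> L by (simp add: e_def)
  obtain C where C: "C >= 0" "!!u v \<phi>. u : XS ==> v : XS ==> \<phi> : XS ==> dnorm u <= Q ==> dnorm v <= Q ==> dnorm \<phi> <= 1 ==>
   (LBINT x. wt x * abs (f (u x) - f (v x)) * abs (\<phi> x)) <= e + C * sqrt (LBINT x. (u x - v x)^2)"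
   using nonlinear_estimate[OF f_cont f_growth e, of Q] by (elim exE conjE) simp
  have "(e / (C + 1))^2 > 0" using e C(1) by simp
  from s(2)[OF this, folded V_def] obtain n1 where n1: "ALL j>=n1. ALL k>=n1. (LBINT x. (V j x - V k x)^2) <= (e / (C + 1))^2" ..
  obtain n2 where n2: "1 / real (Suc n2) < e" using nat_approx_posE[OF e] by metis
  show ?thesis
  proof (intro exI[of _ "max n1 n2"] allI impI)
   fix j k assume jk: "max n1 n2 <= j" "max n1 n2 <= k"
   define \<phi> where "\<phi> = (%x. V j x - V k x)"
   have X: "\<phi> : XS" unfolding \<phi>_def by (rule XS_diff[OF V(1) V(1)])
   have "dnorm \<phi> = dnorm (%x. V j x + (-1) * V k x)" by (simp add: \<phi>_def)
   also have "... <= dnorm (V j) + dnorm (%x. (-1) * V k x)" by (rule dnorm_triangle[OF VT TF_cmult[OF VT]])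
   also have "... <= L" using V(2)[of j] V(2)[of k] by (simp only: dnorm_cmult[OF VT]) (simp add: L_def)
   finally have nL: "dnorm \<phi> <= L" .
   define \<psi> where "\<psi> = (%x. (1 / L) * \<phi> x)"
   have X': "\<psi> : XS" unfolding \<psi>_def by (rule XS_cmult[OF X])
   have n': "dnorm \<psi> <= 1" unfolding \<psi>_def dnorm_cmult[OF XS_TF[OF X]] using nL L by (simp add: divide_simps)
   have sm: "1 / real (Suc j) <= e" "1 / real (Suc k) <= e"
   proof -
    have "1 / real (Suc i) <= 1 / real (Suc n2)" if "n2 <= i" for i using that by (intro divide_left_mono) auto
    from this[of j] this[of k] show "1 / real (Suc j) <= e" "1 / real (Suc k) <= e" using jk n2 by auto
   qed
   have "C * sqrt (LBINT x. (V j x - V k x)^2) <= C * (e / (C + 1))"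
    using jk e C(1) by (intro mult_left_mono real_le_lsqrt n1[rule_format]) auto
   also have "... <= e" using e C(1) by (simp add: field_simps)
   finally have "(LBINT x. wt x * abs (f (V j x) - f (V k x)) * abs (\<psi> x)) <= e + e"
    using C(2)[OF V(1) V(1) X' V(2) V(2) n', of j k] by linarith
   then have "abs (Dir \<phi> \<psi>) <= 4 * e"
    using dI_difference[OF VT VT XS_TF[OF X'], of j k] dV[OF X' n', of j] dV[OF X' n', of k] sm unfolding \<phi>_def[symmetric] by linarith
   moreover have "Dir \<phi> \<phi> = L * Dir \<phi> \<psi>"
    using L unfolding \<psi>_def Dir_cmult[OF XS_TF[OF X]] by simp
   ultimately have "Dir \<phi> \<phi> <= L * (4 * e)" using L by (auto intro: mult_left_mono)
   also have "... = \<epsilon>" using L by (simp add: e_def)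
   finally show "Dir (%x. V j x - V k x) (%x. V j x - V k x) <= \<epsilon>" unfolding \<phi>_def .
  qed
 qed
 \<comment> \<open>Function and gradient are paired into one vector, so that a single completeness
   argument provides both limits along the same subsequence.\<close>
 define w where "w k x = (V k x, gradient (V k) x)" for k x
 have Vm[measurable]: "V k : borel_measurable borel" "gradient (V k) : borel_measurable borel" for k
  using TF_continuous[OF VT] TF_gradient_continuous[OF VT] by (auto intro: borel_measurable_continuous_onI)
 have n2: "(norm (w k x))^2 = (V k x)^2 + (norm (gradient (V k) x))^2" for k x by (simp add: w_def norm_Pair)
 have grad_sq: "integrable lborel (%x. (norm (gradient v x))^2)" if "v : TF" for v :: "'a => real"
  using Dir_integrable[OF that that] by (simp add: power2_norm_eq_inner)
 have nd: "(LBINT x. (norm (w j x - w k x))^2) = (LBINT x. (V j x - V k x)^2) + Dir (%x. V j x - V k x) (%x. V j x - V k x)" for j k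
 proof -
  have T: "(%x. V j x - V k x) : TF" by (rule TF_diff[OF VT VT])
  have "(norm (w j x - w k x))^2 = (V j x - V k x)^2 + (norm (gradient (%x. V j x - V k x) x))^2" for x
   by (simp add: w_def norm_Pair gradient_diff[OF TF_smooth[OF VT] TF_smooth[OF VT]])
  then show ?thesis
   using Bochner_Integration.integral_add[OF TF_integrable_power2[OF T] grad_sq[OF T]] by (simp add: Dir_def power2_norm_eq_inner)
 qed
 have wm: "w k : borel_measurable lborel" for k unfolding w_def by measurable
 have iw: "integrable lborel (%x. (norm (w k x))^2)" for k
  unfolding n2 by (intro Bochner_Integration.integrable_add TF_integrable_power2 grad_sq VT)
 obtain t W where W: "strict_mono t" "W : borel_measurable lborel" "AE x in lborel. (%k. w (t k) x) ----> W x"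
  "integrable lborel (%x. (norm (W x))^2)" "(%k. \<integral>x. (norm (w k x - W x))^2 \<partial>lborel) ----> 0" "W = (%x. lim (%k. w (t k) x))"
 proof (rule L2_complete[of w lborel])
  show "w k : borel_measurable lborel" "integrable lborel (%x. (norm (w k x))^2)" for k by (rule wm iw)+
  fix \<epsilon> :: real assume "\<epsilon> > 0"
  then have h: "\<epsilon> / 2 > 0" by simp
  from s(2)[OF h, folded V_def] obtain n1 where n1: "ALL j>=n1. ALL k>=n1. (LBINT x. (V j x - V k x)^2) <= \<epsilon> / 2" ..
  from cauchy[OF h] obtain n2 where n2: "ALL j>=n2. ALL k>=n2. Dir (%x. V j x - V k x) (%x. V j x - V k x) <= \<epsilon> / 2" ..
  show "EX n. ALL j>=n. ALL k>=n. (LBINT x. (norm (w j x - w k x))^2) <= \<epsilon>"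
  proof (intro exI[of _ "max n1 n2"] allI impI)
   fix j k assume "max n1 n2 <= j" "max n1 n2 <= k"
   then show "(LBINT x. (norm (w j x - w k x))^2) <= \<epsilon>" unfolding nd using n1[rule_format, of j k] n2[rule_format, of j k] by simp
  qed
 qed
 define u where "u x = fst (W x)" for x
 define g where "g x = snd (W x)" for x
 have Wm[measurable]: "W : borel_measurable borel" using W(2) by simp
 have um[measurable]: "u : borel_measurable borel" and gm[measurable]: "g : borel_measurable borel"
  unfolding u_def g_def
  by (rule measurable_compose[OF Wm borel_measurable_continuous_onI[OF continuous_on_fst[OF continuous_on_id]]]
    measurable_compose[OF Wm borel_measurable_continuous_onI[OF continuous_on_snd[OF continuous_on_id]]])+
 have nW: "(norm (W x))^2 = (u x)^2 + (norm (g x))^2" for x by (cases "W x") (simp add: u_def g_def norm_Pair)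
 have nV: "(norm (w k x - W x))^2 = (V k x - u x)^2 + (norm (gradient (V k) x - g x))^2" for k x
  by (cases "W x") (simp add: u_def g_def w_def norm_Pair)
 have iW: "integrable lborel (%x. (norm (w k x - W x))^2)" for k by (rule L2_diff_square[OF wm W(2) iw W(4)])
 have half: "(%k. \<integral>x. h k x \<partial>lborel) ----> 0"
  if "!!k x. 0 <= h k x" "!!k x. h k x <= (norm (w (t k) x - W x))^2" "!!k. h k : borel_measurable borel" for h :: "nat => 'a => real"
 proof (rule tendsto_sandwich[of "%k. 0"])
  show "(%k. \<integral>x. (norm (w (t k) x - W x))^2 \<partial>lborel) ----> 0"
   using LIMSEQ_subseq_LIMSEQ[OF W(5) W(1)] by (simp add: o_def)
  have ih: "integrable lborel (h k)" for k
   by (rule Bochner_Integration.integrable_bound[OF iW[of "t k"]]) (use that in auto)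
  show "\<forall>\<^sub>F k in sequentially. (LBINT x. h k x) <= (LBINT x. (norm (w (t k) x - W x))^2)"
   by (intro always_eventually allI integral_mono ih iW that(2))
  show "\<forall>\<^sub>F k in sequentially. 0 <= (LBINT x. h k x)"
   by (intro always_eventually allI integral_nonneg_AE AE_I2 that(1))
 qed simp
 have tk: "1 / real (Suc (t k)) <= 1 / real (Suc k)" for k
  using strict_mono_imp_increasing[OF W(1), of k] by (intro divide_left_mono) auto
 have out: "W x = 0" if "1 <= norm x" for x
  using that TF_zero_outside[OF VT] TF_gradient_zero[OF VT] by (simp add: W(6) w_def zero_prod_def)
 have "ps_limit B1 B2 f K p q \<mu> \<alpha> p1 (%k. V (t k)) u g Q c"
 proof
  show "V (t k) : XS" "dnorm (V (t k)) <= Q" for k by (rule V)+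
  have "(%k. I (V (t k)) - c) ----> 0"
  proof (rule tendsto_rabs_zero_cancel, rule tendsto_sandwich[of "%k. 0" _ _ "%k. 1 / real (Suc k)"])
   show "\<forall>\<^sub>F k in sequentially. abs (I (V (t k)) - c) <= 1 / real (Suc k)"
    by (intro always_eventually allI order_trans[OF V(3) tk])
   show "(%k. 1 / real (Suc k)) ----> 0" by (rule LIMSEQ_Suc[OF lim_1_over_n])
  qed auto
  then show "(%k. I (V (t k))) ----> c" by (simp only: LIM_zero_iff)
  show "abs (dI (V (t k)) \<phi>) <= 1 / real (Suc k)" if "\<phi> : XS" "dnorm \<phi> <= 1" for k \<phi>
   by (rule order_trans[OF dV[OF that] tk])
  show "u : borel_measurable borel" "g : borel_measurable borel" by (rule um gm)+
  show "AE x in lborel. (%k. V (t k) x) ----> u x"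
   using W(3)
  proof eventually_elim
   case (elim x)
   from tendsto_fst[OF elim] show ?case by (simp only: w_def fst_conv u_def)
  qed
  show "integrable lborel (%x. (u x)^2)" "integrable lborel (%x. (norm (g x))^2)"
   by (rule Bochner_Integration.integrable_bound[OF W(4)], simp, simp add: nW)+
  show "(%k. \<integral>x. (V (t k) x - u x)^2 \<partial>lborel) ----> 0"
   by (rule half) (simp_all add: nV)
  show "(%k. \<integral>x. (norm (gradient (V (t k)) x - g x))^2 \<partial>lborel) ----> 0"
   by (rule half) (simp_all add: nV)
  show "u x = 0" "g x = 0" if "1 <= norm x" for x using out[OF that] by (simp_all add: u_def g_def)
 qed
 then show ?thesis by blast
qed

end

section \<open>Passage to the limit in the energy and the nonlinear terms\<close>

lemma L2_tendsto_inner: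
 fixes a :: "nat => 'a => 'b::euclidean_space"
 assumes m[measurable]: "!!k. a k : borel_measurable N" "a0 : borel_measurable N" "b : borel_measurable N"
  and i: "!!k. integrable N (%x. (norm (a k x))^2)" "integrable N (%x. (norm (a0 x))^2)" "integrable N (%x. (norm (b x))^2)"
  and lim: "(%k. \<integral>x. (norm (a k x - a0 x))^2 \<partial>N) ----> 0"
 shows "(%k. \<integral>x. a k x \<bullet> b x \<partial>N) ----> (LINT x|N. a0 x \<bullet> b x)"
proof -
 let ?B = "sqrt (LINT x|N. (norm (b x))^2)"
 have le: "abs ((LINT x|N. a k x \<bullet> b x) - (LINT x|N. a0 x \<bullet> b x)) <= sqrt (LINT x|N. (norm (a k x - a0 x))^2) * ?B" for k
 proof -
  have "(LINT x|N. a k x \<bullet> b x) - (LINT x|N. a0 x \<bullet> b x) = (LINT x|N. (a k x - a0 x) \<bullet> b x)"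
   by (simp only: inner_diff_left Bochner_Integration.integral_diff[OF L2_inner(1)[OF m(1,3) i(1,3)] L2_inner(1)[OF m(2,3) i(2,3)]])
  also have "abs ... <= sqrt (LINT x|N. (norm (a k x - a0 x))^2) * ?B"
   by (rule L2_inner(2)[OF _ m(3) L2_diff_square[OF m(1,2) i(1,2)] i(3)]) measurable
  finally show ?thesis .
 qed
 have "(%k. sqrt (LINT x|N. (norm (a k x - a0 x))^2) * ?B) ----> sqrt 0 * ?B"
  by (intro tendsto_mult tendsto_const tendsto_real_sqrt lim)
 then have z: "(%k. sqrt (LINT x|N. (norm (a k x - a0 x))^2) * ?B) ----> 0" by simp
 have "(%k. (LINT x|N. a k x \<bullet> b x) - (LINT x|N. a0 x \<bullet> b x)) ----> 0"
 proof (rule tendsto_rabs_zero_cancel, rule tendsto_sandwich[OF _ _ tendsto_const z])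
  show "\<forall>\<^sub>F k in sequentially. abs ((LINT x|N. a k x \<bullet> b x) - (LINT x|N. a0 x \<bullet> b x)) <= sqrt (LINT x|N. (norm (a k x - a0 x))^2) * ?B"
   by (intro always_eventually allI le)
 qed simp
 then show ?thesis by (simp only: LIM_zero_iff)
qed

lemma L2_ball_integrable:
 fixes v :: "'a::euclidean_space => 'b::euclidean_space"
 assumes m[measurable]: "v : borel_measurable borel" and i: "integrable lborel (%x. (norm (v x))^2)" and z: "!!x. 1 <= norm x ==> v x = 0"
 shows "integrable lborel v"
proof (rule Bochner_Integration.integrable_bound)
 show "integrable lborel (%x. indicator (ball 0 1) x + (norm (v x))^2)"
  by (rule Bochner_Integration.integrable_add[OF integrable_real_indicator[OF _ emeasure_lborel_ball_finite] i]) simp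
 have "norm (v x) <= indicator (ball 0 1) x + (norm (v x))^2" for x
 proof (cases "norm x < 1")
  case True
  have "norm (v x) <= 1 + (norm (v x))^2" using sum_squares_bound[of "norm (v x)" 1] norm_ge_zero[of "v x"] by (simp del: norm_ge_zero)
  then show ?thesis using True by simp
 qed (use z in simp)
 then show "AE x in lborel. norm (v x) <= norm (indicator (ball 0 1) x + (norm (v x))^2)"
  by (intro AE_I2) (simp add: abs_of_nonneg)
qed simp

context ps_limit
begin

lemma U_TF: "U k : TF" by (rule XS_TF[OF U])

lemma U_borel[measurable]: "U k : borel_measurable borel" "gradient (U k) : borel_measurable borel"
 using TF_continuous[OF U_TF] TF_gradient_continuous[OF U_TF] by (auto intro: borel_measurable_continuous_onI)

lemma TF_gradient_square: "\<phi> : TF ==> integrable lborel (%x. (norm (gradient \<phi> x))^2)" for \<phi> :: "'a => real"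
 using Dir_integrable[of \<phi> \<phi>] by (simp add: power2_norm_eq_inner)

lemma u_integrable: "integrable lborel u" and g_integrable: "integrable lborel g"
 using L2_ball_integrable[OF u_borel] L2_ball_integrable[OF g_borel g_square g_outside] u_square u_outside by simp_all

definition \<Theta> :: real where "\<Theta> = (LBINT x. (norm (g x))^2)"

lemma Dir_U_tendsto: "\<phi> : TF ==> (%k. Dir (U k) \<phi>) ----> (LBINT x. g x \<bullet> gradient \<phi> x)"
 unfolding Dir_def by (rule L2_tendsto_inner) (simp_all add: TF_borel TF_gradient_square U_TF g_square gradU_L2)

lemma Dir_U_U_tendsto: "(%k. Dir (U k) (U k)) ----> \<Theta>"
proof -
 have eq: "Dir (U k) (U k) = (LBINT x. (norm (gradient (U k) x - g x))^2) + 2 * (LBINT x. gradient (U k) x \<bullet> g x) - \<Theta>" for k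
 proof -
  have i1: "integrable lborel (%x. (norm (gradient (U k) x - g x))^2)"
   by (rule L2_diff_square) (simp_all add: TF_gradient_square U_TF g_square)
  have i2: "integrable lborel (%x. gradient (U k) x \<bullet> g x)"
   by (rule L2_inner(1)) (simp_all add: TF_gradient_square U_TF g_square)
  have "Dir (U k) (U k) = (LBINT x. (norm (gradient (U k) x - g x))^2 + 2 * (gradient (U k) x \<bullet> g x) - (norm (g x))^2)"
   unfolding Dir_def by (rule Bochner_Integration.integral_cong) (simp_all add: power2_norm_eq_inner inner_diff_left inner_diff_right inner_commute)
  then show ?thesis
   by (simp only: Bochner_Integration.integral_diff[OF Bochner_Integration.integrable_add[OF i1 integrable_mult_right[OF i2]] g_square]
    Bochner_Integration.integral_add[OF i1 integrable_mult_right[OF i2]] integral_mult_right_zero \<Theta>_def)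
 qed
 have "(%k. \<integral>x. gradient (U k) x \<bullet> g x \<partial>lborel) ----> (LBINT x. g x \<bullet> g x)"
  by (rule L2_tendsto_inner) (simp_all add: TF_gradient_square U_TF g_square gradU_L2)
 then have "(%k. \<integral>x. gradient (U k) x \<bullet> g x \<partial>lborel) ----> \<Theta>" by (simp add: \<Theta>_def power2_norm_eq_inner)
 then have "(%k. (LBINT x. (norm (gradient (U k) x - g x))^2) + 2 * (LBINT x. gradient (U k) x \<bullet> g x) - \<Theta>) ----> 0 + 2 * \<Theta> - \<Theta>"
  by (intro tendsto_diff tendsto_add tendsto_mult tendsto_const gradU_L2)
 then show ?thesis unfolding eq by simp
qed

lemma p1_gt: "p1 > 2" using p p1(1) by simp

text \<open>The limit is not a test function, so the Sobolev inequality does not apply to it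
  directly; Fatou's lemma transfers the uniform bound.\<close>

lemma U_powr_bound: obtains S where "S >= 0" "!!k. (LBINT x. wt x * abs (U k x) powr p1) <= S"
  "integrable lborel (%x. wt x * abs (u x) powr p1)" "(LBINT x. wt x * abs (u x) powr p1) <= S"
proof -
 obtain C where C: "C >= 0" "!!u R. u : XS ==> R > 0 ==> dnorm u <= R ==> (LBINT x. wt x * abs (u x) powr p1) <= C * R powr p1"
  using Sobolev_wt[OF p1_gt order.refl] by (elim exE conjE) simp
 define S where "S = C * (max Q 1) powr p1"
 have S: "(LBINT x. wt x * abs (U k x) powr p1) <= S" for k
  unfolding S_def using U_bounded[of k] by (intro C(2) U) auto
 have p10: "p1 > 0" using p1_gt by simp
 have lim: "AE x in lborel. (%k. wt x * abs (U k x) powr p1) ----> wt x * abs (u x) powr p1"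
  using u_AE
 proof eventually_elim
  case (elim x)
  show ?case using p10 by (intro tendsto_mult tendsto_const tendsto_powr' tendsto_rabs elim) auto
 qed
 have wm: "(%x. wt x) : borel_measurable borel" by (rule borel_measurable_continuous_onI[OF wt_continuous])
 have "(%x. wt x * abs (u x) powr p1) : borel_measurable lborel" using wm by measurable
 note F = Fatou_real[OF integrable_wt_powr[OF U_TF p10] _ S lim this]
 have "S >= 0" using C(1) by (simp add: S_def)
 then show thesis using that S F by auto
qed

text \<open>The permitted growth is one power higher than that of \<open>f\<close>, so that F and z
  f(z) are covered too. The convergence is \<open>weighted_difference_le\<close> with the indicator
  of the ball as the third function.\<close>

lemma nonlinear_limit:
 fixes h :: "real => real"
 assumes h: "continuous_on UNIV h" "!!z. abs (h z) <= K' * (1 + abs z) powr p" and h0: "h 0 = 0"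
 shows "integrable lborel (%x. wt x * h (u x))" "(%k. \<integral>x. wt x * abs (h (U k x) - h (u x)) \<partial>lborel) ----> 0"
  "!!k. integrable lborel (%x. wt x * abs (h (U k x) - h (u x)))"
proof -
 obtain S where S: "S >= 0" "!!k. (LBINT x. wt x * abs (U k x) powr p1) <= S"
  "integrable lborel (%x. wt x * abs (u x) powr p1)" "(LBINT x. wt x * abs (u x) powr p1) <= S"
  by (rule U_powr_bound) (rule that)
 let ?i = "indicator (ball (0::'a) 1) :: 'a => real"
 have ii: "integrable lborel ?i" by (rule integrable_real_indicator[OF _ emeasure_lborel_ball_finite]) simp
 have im: "?i : borel_measurable lborel" by (rule borel_measurable_integrable[OF ii])
 have p10: "p1 > 0" "p1 >= 1" using p1_gt by auto
 note iU = integrable_wt_powr[OF U_TF p10(1)]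
 have wm[measurable]: "(%x::'a. wt x) : borel_measurable borel" by (rule borel_measurable_continuous_onI[OF wt_continuous])
 have hm[measurable]: "h : borel_measurable borel" by (rule borel_measurable_continuous_onI[OF h(1)])
 have K': "K' >= 0" using h(2)[of 0] by simp
 show ihu: "integrable lborel (%x. wt x * h (u x))"
 proof (rule Bochner_Integration.integrable_bound)
  show "integrable lborel (%x. K' * 3 powr p1 * (?i x + wt x * abs (u x) powr p1))"
   by (intro integrable_mult_right Bochner_Integration.integrable_add ii S(3))
  have "abs (wt x * h (u x)) <= K' * 3 powr p1 * (?i x + wt x * abs (u x) powr p1)" for x
  proof (cases "norm x < 1")
   case False
   then show ?thesis using u_outside[of x] h0 p10 by simp
  next
   case True
   have "abs (h (u x)) <= K' * (1 + abs (u x)) powr p" by (rule h(2))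
   also have "... <= K' * (1 + abs (u x) + abs 0) powr p1" using K' p1(1) by (intro mult_left_mono) (auto intro: powr_mono)
   also have "... <= K' * (3 powr p1 * (1 + abs (u x) powr p1 + abs 0 powr p1))" by (rule mult_left_mono[OF powr_sum3_le[OF p10(2)] K'])
   finally have "wt x * abs (h (u x)) <= wt x * (K' * (3 powr p1 * (1 + abs (u x) powr p1)))" using p10 by (intro mult_left_mono) auto
   also have "... = K' * 3 powr p1 * (wt x + wt x * abs (u x) powr p1)" by (simp add: algebra_simps)
   also have "... <= K' * 3 powr p1 * (1 + wt x * abs (u x) powr p1)" using wt_le_1[of x] True K' by (intro mult_left_mono add_right_mono) auto
   finally show ?thesis using True by (simp add: abs_mult)
  qed
  then show "AE x in lborel. norm (wt x * h (u x)) <= norm (K' * 3 powr p1 * (?i x + wt x * abs (u x) powr p1))"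
   by (intro AE_I2) (metis abs_ge_self order_trans real_norm_def)
 qed simp
 have il: "integrable lborel (%x. wt x * abs (h (U k x) - h (u x)))" for k
 proof -
  have "integrable lborel (%x. abs (wt x * h (U k x) - wt x * h (u x)))"
   by (intro integrable_abs Bochner_Integration.integrable_diff ihu wt_integrable[OF U_TF h(1) h0])
  moreover have "(%x. abs (wt x * h (U k x) - wt x * h (u x))) = (%x. wt x * abs (h (U k x) - h (u x)))"
   by (simp only: right_diff_distrib[symmetric] abs_mult) simp
  ultimately show ?thesis by simp
 qed
 then show "!!k. integrable lborel (%x. wt x * abs (h (U k x) - h (u x)))" .
 let ?b = "measure lborel (ball (0::'a) 1)"
 define T where "T = 3 powr p1 * (?b + (S + ?b) + (S + ?b)) + (S + ?b)"
 have T: "T >= 0" using S(1) by (simp add: T_def)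
 have bound: "EX C. ALL k. (LBINT x. wt x * abs (h (U k x) - h (u x))) <= \<delta> * T + C * sqrt (LBINT x. (U k x - u x)^2)"
  if \<delta>: "\<delta> > 0" for \<delta>
 proof -
  obtain C where C: "C >= 0" "!!a b. abs (h a - h b) <= \<delta> * (1 + abs a + abs b) powr p1 + C * abs (a - b)"
   using continuous_difference_bound[OF h, of p1 \<delta>] p p1(1) \<delta> by auto
  have i2: "(%x. (norm (?i x))^2) = ?i" "(%x. (?i x)^2) = ?i" "?i x powr p1 = ?i x" for x
   by (auto simp: indicator_def)
  have wi: "wt x * ?i x <= ?i x" for x using wt_le_1[of x] by (simp add: indicator_def)
  have iwi: "integrable lborel (%x. wt x * ?i x)"
   by (rule Bochner_Integration.integrable_bound[OF ii], measurable) (use wi in auto)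
  have "(LBINT x. wt x * abs (h (U k x) - h (u x))) <= \<delta> * T + C * (sqrt (LBINT x. (U k x - u x)^2) * sqrt (LBINT x. (?i x)^2))" for k
   unfolding T_def
  proof (rule weighted_difference_le[OF _ _ im _ _ _ iU S(3)])
   have "(LBINT x. wt x * ?i x) <= ?b" using integral_mono[OF iwi ii wi] by simp
   then show "(LBINT x. wt x * abs (?i x) powr p1) <= S + ?b" using S(1) by (simp add: i2)
   show "(LBINT x. wt x * abs (U k x) powr p1) <= S + ?b" "(LBINT x. wt x * abs (u x) powr p1) <= S + ?b"
    using S(2)[of k] S(4) by (simp_all add: add_increasing2)
   fix x
   show "abs (h (U k x) - h (u x)) <= \<delta> * (3 powr p1 * (1 + abs (U k x) powr p1 + abs (u x) powr p1) + abs (?i x) powr p1) + C * (abs (U k x - u x) * abs (?i x))"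
   proof (cases "norm x < 1")
    case False
    then show ?thesis using TF_zero_outside[OF U_TF, of x k] u_outside[of x] \<delta> by simp
   next
    case True
    have "abs (h (U k x) - h (u x)) <= \<delta> * (3 powr p1 * (1 + abs (U k x) powr p1 + abs (u x) powr p1)) + C * abs (U k x - u x)"
     by (rule order_trans[OF C(2) add_right_mono[OF mult_left_mono[OF powr_sum3_le[OF p10(2)]]]]) (use \<delta> in simp)
    then show ?thesis using True \<delta> by (simp add: distrib_left)
   qed
  qed (use TF_borel[OF U_TF] TF_integrable_power2[OF U_TF] u_square il \<delta> C(1) TF_zero_outside[OF U_TF] u_outside ii iwi in \<open>auto simp: i2\<close>)
  then show ?thesis by (intro exI[of _ "C * sqrt ?b"]) (simp add: i2 mult_ac)
 qed
 show "(%k. \<integral>x. wt x * abs (h (U k x) - h (u x)) \<partial>lborel) ----> 0"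
 proof (rule LIMSEQ_I)
  fix r :: real assume r: "r > 0"
  define \<delta> where "\<delta> = r / (2 * (T + 1))"
  have \<delta>: "\<delta> > 0" "\<delta> * T < r" using r T by (auto simp: \<delta>_def field_simps add_increasing add_nonneg_pos)
  from bound[OF \<delta>(1)] obtain C where C: "!!k. (LBINT x. wt x * abs (h (U k x) - h (u x))) <= \<delta> * T + C * sqrt (LBINT x. (U k x - u x)^2)" by blast
  have "(%k. \<delta> * T + C * sqrt (LBINT x. (U k x - u x)^2)) ----> \<delta> * T + C * sqrt 0"
   by (intro tendsto_add tendsto_mult tendsto_const tendsto_real_sqrt U_L2)
  then have "\<forall>\<^sub>F k in sequentially. \<delta> * T + C * sqrt (LBINT x. (U k x - u x)^2) < r"
   using \<delta>(2) by (intro order_tendstoD(2)) auto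
  moreover have "0 <= (LBINT x. wt x * abs (h (U k x) - h (u x)))" for k by (intro integral_nonneg_AE) auto
  ultimately show "EX no. ALL k>=no. norm ((LBINT x. wt x * abs (h (U k x) - h (u x))) - 0) < r"
   unfolding eventually_sequentially using le_less_trans[OF C] by simp blast
 qed
qed

end

section \<open>The equation and the energy identities for the limit\<close>

context ps_limit
begin

lemma f_growth_p: "abs (f z) <= K * (1 + abs z) powr p"
proof -
 have "(1 + abs z) powr (p - 1) <= (1 + abs z) powr p" by (rule powr_mono) auto
 then show ?thesis using f_growth[of z] K_nonneg by (meson mult_left_mono order_trans)
qed

lemma f_0: "f 0 = 0" by (rule f_nonpos) simp

lemmas f_limit = nonlinear_limit[OF f_cont f_growth_p f_0]
lemmas F_limit = nonlinear_limit[OF F_cont F_growth F_0]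

lemma zf_limit:
 "integrable lborel (%x. wt x * (u x * f (u x)))" "(%k. \<integral>x. wt x * abs (U k x * f (U k x) - u x * f (u x)) \<partial>lborel) ----> 0"
 "integrable lborel (%x. wt x * abs (U k x * f (U k x) - u x * f (u x)))"
 using nonlinear_limit[of "%z. z * f z", OF continuous_on_mult[OF continuous_on_id f_cont] zf_growth] by simp_all

lemma weighted_tendsto:
 fixes h :: "real => real"
 assumes \<phi>: "\<phi> : borel_measurable borel" "!!x. abs (\<phi> x) <= B" and iU: "!!k. integrable lborel (%x. wt x * h (U k x))"
  and h: "integrable lborel (%x. wt x * h (u x))" "(%k. \<integral>x. wt x * abs (h (U k x) - h (u x)) \<partial>lborel) ----> 0"
   "!!k. integrable lborel (%x. wt x * abs (h (U k x) - h (u x)))"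
 shows "integrable lborel (%x. wt x * h (u x) * \<phi> x)"
  "(%k. \<integral>x. wt x * h (U k x) * \<phi> x \<partial>lborel) ----> (LBINT x. wt x * h (u x) * \<phi> x)"
proof -
 have B: "B >= 0" using \<phi>(2)[of 0] by simp
 have mul: "integrable lborel (%x. v x * \<phi> x)" if "integrable lborel v" for v :: "'a => real"
 proof (rule Bochner_Integration.integrable_bound)
  show "integrable lborel (%x. B * abs (v x))" by (intro integrable_mult_right integrable_abs that)
  have [measurable]: "v : borel_measurable borel" using borel_measurable_integrable[OF that] by simp
  show "(%x. v x * \<phi> x) : borel_measurable lborel" using \<phi>(1) by measurable
  show "AE x in lborel. norm (v x * \<phi> x) <= norm (B * abs (v x))"
  proof (rule AE_I2)
   fix x
   show "norm (v x * \<phi> x) <= norm (B * abs (v x))"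
    using mult_right_mono[OF \<phi>(2)[of x] abs_ge_zero[of "v x"]] B by (simp add: abs_mult mult.commute)
  qed
 qed
 show i: "integrable lborel (%x. wt x * h (u x) * \<phi> x)" by (rule mul[OF h(1)])
 have "(%k. (LBINT x. wt x * h (U k x) * \<phi> x) - (LBINT x. wt x * h (u x) * \<phi> x)) ----> 0"
 proof (rule tendsto_rabs_zero_cancel, rule tendsto_sandwich[OF _ _ tendsto_const])
  have "(%k. B * (LBINT x. wt x * abs (h (U k x) - h (u x)))) ----> B * 0" by (intro tendsto_mult tendsto_const h(2))
  then show "(%k. B * (LBINT x. wt x * abs (h (U k x) - h (u x)))) ----> 0" by simp
  show "\<forall>\<^sub>F k in sequentially. abs ((LBINT x. wt x * h (U k x) * \<phi> x) - (LBINT x. wt x * h (u x) * \<phi> x)) <= B * (LBINT x. wt x * abs (h (U k x) - h (u x)))"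
  proof (intro always_eventually allI)
   fix k
   have eq: "(LBINT x. wt x * h (U k x) * \<phi> x) - (LBINT x. wt x * h (u x) * \<phi> x) = (LBINT x. wt x * h (U k x) * \<phi> x - wt x * h (u x) * \<phi> x)"
    by (simp only: Bochner_Integration.integral_diff[OF mul[OF iU] i])
   have "abs (\<integral>x. wt x * h (U k x) * \<phi> x - wt x * h (u x) * \<phi> x \<partial>lborel) <= (LBINT x. B * (wt x * abs (h (U k x) - h (u x))))"
   proof (rule abs_integral_le[OF Bochner_Integration.integrable_diff[OF mul[OF iU] i] integrable_mult_right[OF h(3)]])
    fix x
    have "wt x * h (U k x) * \<phi> x - wt x * h (u x) * \<phi> x = (wt x * (h (U k x) - h (u x))) * \<phi> x" by (simp add: algebra_simps)
    then have "abs (wt x * h (U k x) * \<phi> x - wt x * h (u x) * \<phi> x) = (wt x * abs (h (U k x) - h (u x))) * abs (\<phi> x)" by (simp only: abs_mult) simp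
    also have "... <= (wt x * abs (h (U k x) - h (u x))) * B" by (rule mult_left_mono[OF \<phi>(2)]) simp
    finally show "abs (wt x * h (U k x) * \<phi> x - wt x * h (u x) * \<phi> x) <= B * (wt x * abs (h (U k x) - h (u x)))" by (simp only: mult.commute)
   qed
   then show "abs ((LBINT x. wt x * h (U k x) * \<phi> x) - (LBINT x. wt x * h (u x) * \<phi> x)) <= B * (LBINT x. wt x * abs (h (U k x) - h (u x)))"
    unfolding eq by simp
  qed
 qed simp
 then show "(%k. \<integral>x. wt x * h (U k x) * \<phi> x \<partial>lborel) ----> (LBINT x. wt x * h (u x) * \<phi> x)" by (simp only: LIM_zero_iff)
qed

lemma wtf_mult_integrable: "\<phi> : TF ==> integrable lborel (%x. wt x * f (u x) * \<phi> x)"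
 and wtf_mult_tendsto: "\<phi> : TF ==> (%k. \<integral>x. wt x * f (U k x) * \<phi> x \<partial>lborel) ----> (LBINT x. wt x * f (u x) * \<phi> x)"
proof -
 assume \<phi>: "\<phi> : TF"
 obtain B where "!!x. abs (\<phi> x) <= B" by (rule TF_bounded[OF \<phi>]) (rule that)
 note w = weighted_tendsto[OF TF_borel(1)[OF \<phi>] this wt_integrable[OF U_TF f_cont f_0] f_limit]
 show "integrable lborel (%x. wt x * f (u x) * \<phi> x)" by (rule w(1))
 show "(%k. \<integral>x. wt x * f (U k x) * \<phi> x \<partial>lborel) ----> (LBINT x. wt x * f (u x) * \<phi> x)" by (rule w(2))
qed

lemma integral_limits:
 "(%k. \<integral>x. wt x * F (U k x) \<partial>lborel) ----> (LBINT x. wt x * F (u x))"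
 "(%k. \<integral>x. wt x * (U k x * f (U k x)) \<partial>lborel) ----> (LBINT x. wt x * (u x * f (u x)))"
proof -
 show "(%k. \<integral>x. wt x * F (U k x) \<partial>lborel) ----> (LBINT x. wt x * F (u x))"
  using weighted_tendsto(2)[of "%x. 1" 1 F, OF _ _ wtF_integrable[OF U_TF] F_limit] by simp
 have "integrable lborel (%x. wt x * (U k x * f (U k x)))" for k
  by (rule wt_integrable[of _ "%z. z * f z", OF U_TF continuous_on_mult[OF continuous_on_id f_cont]]) simp
 from weighted_tendsto(2)[of "%x. 1" 1 "%z. z * f z", OF _ _ this zf_limit(1,2,3)]
 show "(%k. \<integral>x. wt x * (U k x * f (U k x)) \<partial>lborel) ----> (LBINT x. wt x * (u x * f (u x)))" by simp
qed

lemma dI_U_le: "\<phi> : XS ==> abs (dI (U k) \<phi>) <= (dnorm \<phi> + 1) * (1 / real (Suc k))"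
proof -
 assume \<phi>: "\<phi> : XS"
 define s where "s = dnorm \<phi> + 1"
 have s: "s > 0" using dnorm_nonneg[of \<phi>] by (simp add: s_def)
 have "dnorm (%x. (1 / s) * \<phi> x) <= 1" using s dnorm_nonneg[of \<phi>] unfolding dnorm_cmult[OF XS_TF[OF \<phi>]] by (simp add: s_def)
 from dI_U[OF XS_cmult[OF \<phi>] this, of k] have "abs (dI (U k) \<phi>) / s <= 1 / real (Suc k)"
  using s unfolding dI_cmult[OF XS_TF[OF \<phi>]] by (simp add: abs_mult)
 then have "abs (dI (U k) \<phi>) <= 1 / real (Suc k) * s" by (simp only: pos_divide_le_eq[OF s])
 then show ?thesis by (simp add: s_def mult.commute)
qed

lemma over_Suc_tendsto: "(%k. C * (1 / real (Suc k))) ----> 0"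
 using tendsto_mult[OF tendsto_const[of C] LIMSEQ_Suc[OF lim_1_over_n]] by simp

text \<open>The derivative of the functional at the limit, with \<open>g\<close> in place of the
  classical gradient, which \<open>u\<close> need not have.\<close>

definition Lim :: "('a => real) => real" where
 "Lim \<phi> = (LBINT x. g x \<bullet> gradient \<phi> x) - (LBINT x. wt x * f (u x) * \<phi> x)"

lemma dI_tendsto: "\<phi> : TF ==> (%k. dI (U k) \<phi>) ----> Lim \<phi>"
 unfolding dI_def Lim_def by (intro tendsto_diff Dir_U_tendsto wtf_mult_tendsto)

lemma Lim_XS: "\<phi> : XS ==> Lim \<phi> = 0"
proof -
 assume \<phi>: "\<phi> : XS"
 have "(%k. dI (U k) \<phi>) ----> 0"
 proof (rule tendsto_rabs_zero_cancel, rule tendsto_sandwich[OF _ _ tendsto_const over_Suc_tendsto])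
  show "\<forall>\<^sub>F k in sequentially. abs (dI (U k) \<phi>) <= (dnorm \<phi> + 1) * (1 / real (Suc k))"
   by (intro always_eventually allI dI_U_le \<phi>)
 qed simp
 then show ?thesis by (rule LIMSEQ_unique[OF dI_tendsto[OF XS_TF[OF \<phi>]]])
qed

text \<open>Symmetric criticality: \<open>U k\<close>, the weight and Lebesgue measure are
  invariant, so the linear form \<open>dI (U k)\<close> takes the same value at all members of an
  orbit, and therefore at their midpoints.\<close>

lemma dI_orbit_hull:
 assumes \<phi>: "\<phi> : TF" and "\<eta> : orbit_hull G \<phi>" shows "dI (U k) \<eta> = dI (U k) \<phi>"
 using assms(2)
proof (induction rule: orbit_hull.induct)
 case (orbit h)
 have o: "orthogonal_transformation h" using G_monoid orbit by (auto simp: isometry_monoid_def)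
 have inv: "U k (h x) = U k x" for x by (rule XS_invariant[OF U orbit])
 have "Dir (U k) (%x. \<phi> (h x)) = Dir (U k) \<phi>"
  using Dir_orthogonal[OF o U_TF \<phi>, of k] by (simp only: inv)
 moreover have "(LBINT x. wt x * f (U k x) * \<phi> (h x)) = (LBINT x. wt x * f (U k x) * \<phi> x)"
 proof -
  have "(LBINT x. wt x * f (U k x) * \<phi> (h x)) = (LBINT x. wt (h x) * f (U k (h x)) * \<phi> (h x))"
   by (simp only: inv orthogonal_transformation_norm[OF o])
  also have "... = (LBINT x. wt x * f (U k x) * \<phi> x)"
   by (rule integral_orthogonal[OF o, of "%x. wt x * f (U k x) * \<phi> x"])
    (use borel_measurable_integrable[OF wtf_integrable[OF U_TF \<phi>, of k]] in simp)
  finally show ?thesis .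
 qed
 ultimately show ?case by (simp only: dI_def)
next
 case (midpoint v w)
 have T: "v : TF" "w : TF" using orbit_hull_TF[OF G_monoid \<phi>] midpoint(1,2) by auto
 have "dI (U k) (%x. (1/2) * (v x + w x)) = (1/2) * (dI (U k) v + dI (U k) w)"
  by (simp only: dI_cmult[OF TF_add[OF T]] dI_add[OF U_TF T])
 then show ?case using midpoint(3,4) by simp
qed

text \<open>The functional \<open>Lim\<close> is constant on the orbit hull of
  \<open>\<phi>\<close>. It is also continuous under the C^1 convergence of
  \<open>averaging\<close>, because \<open>g\<close> and the weighted f(u) are integrable, and it
  vanishes at the block-radial average.\<close>

lemma Lim_TF: assumes \<phi>: "\<phi> : TF" shows "Lim \<phi> = 0"
proof -
 obtain \<psi> w where \<psi>: "\<psi> : TF" "!!h x. h : G ==> \<psi> (h x) = \<psi> x" and w: "!!j::nat. w j : orbit_hull G \<phi>"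
  and lim: "uniform_limit UNIV w \<psi> sequentially"
   "!!b. b : Basis ==> uniform_limit UNIV (%j. partial_deriv b (w j)) (partial_deriv b \<psi>) sequentially"
  by (rule averaging[OF G_monoid \<phi>]) (rule that; assumption)
 have wT: "w j : TF" for j using orbit_hull_TF[OF G_monoid \<phi>] w by auto
 have "\<psi> : XS" by (rule XS_I[OF \<psi>(1)]) (rule \<psi>(2))
 then have L\<psi>: "Lim \<psi> = 0" by (rule Lim_XS)
 have Lw: "Lim (w j) = Lim \<phi>" for j
  using LIMSEQ_unique[OF dI_tendsto[OF wT[of j]]] dI_tendsto[OF \<phi>] by (simp only: dI_orbit_hull[OF \<phi> w])
 define T where "T = real (card (Basis :: 'a set)) * (LBINT x. norm (g x)) + (LBINT x. abs (wt x * f (u x)))"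
 have T: "T >= 0" unfolding T_def by (intro add_nonneg_nonneg mult_nonneg_nonneg integral_nonneg_AE) auto
 have "abs (Lim \<phi>) <= \<epsilon> * T" if \<epsilon>: "\<epsilon> > 0" for \<epsilon>
 proof -
  have "\<forall>\<^sub>F j in sequentially. (ALL x:UNIV. dist (w j x) (\<psi> x) < \<epsilon>) & (ALL b:Basis. ALL x:UNIV. dist (partial_deriv b (w j) x) (partial_deriv b \<psi> x) < \<epsilon>)"
   by (intro eventually_conj eventually_ball_finite ballI uniform_limitD[OF lim(1) \<epsilon>] uniform_limitD[OF lim(2) \<epsilon>]) auto
  from eventually_happens[OF this] obtain j where j: "!!x. abs (w j x - \<psi> x) < \<epsilon>" "!!b x. b : Basis ==> abs (partial_deriv b (w j) x - partial_deriv b \<psi> x) < \<epsilon>"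
   by (auto simp: dist_real_def)
  have gr: "norm (gradient (w j) x - gradient \<psi> x) <= real (card (Basis :: 'a set)) * \<epsilon>" for x
  proof -
   have "norm (gradient (w j) x - gradient \<psi> x) <= (SUM b:Basis. abs ((gradient (w j) x - gradient \<psi> x) \<bullet> b))" by (rule norm_le_l1)
   also have "... <= (SUM b:(Basis::'a set). \<epsilon>)"
    by (rule sum_mono) (use j(2) in \<open>simp add: inner_diff_left gradient_inner_Basis less_imp_le\<close>)
   finally show ?thesis by simp
  qed
  have i: "integrable lborel (%x. g x \<bullet> gradient \<eta> x)" if "\<eta> : TF" for \<eta>
   using that by (intro L2_inner(1)) (simp_all add: TF_borel TF_gradient_square g_square)
  have "abs ((LBINT x. g x \<bullet> gradient (w j) x) - (LBINT x. g x \<bullet> gradient \<psi> x)) <= (LBINT x. (real (card (Basis :: 'a set)) * \<epsilon>) * norm (g x))"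
   unfolding Bochner_Integration.integral_diff[OF i[OF wT[of j]] i[OF \<psi>(1)], symmetric]
  proof (rule abs_integral_le[OF Bochner_Integration.integrable_diff[OF i[OF wT] i[OF \<psi>(1)]] integrable_mult_right[OF integrable_norm[OF g_integrable]]])
   fix x
   have "abs (g x \<bullet> gradient (w j) x - g x \<bullet> gradient \<psi> x) <= norm (g x) * norm (gradient (w j) x - gradient \<psi> x)"
    unfolding inner_diff_right[symmetric] by (rule Cauchy_Schwarz_ineq2)
   also have "... <= norm (g x) * (real (card (Basis :: 'a set)) * \<epsilon>)" by (rule mult_left_mono[OF gr]) simp
   finally show "abs (g x \<bullet> gradient (w j) x - g x \<bullet> gradient \<psi> x) <= (real (card (Basis :: 'a set)) * \<epsilon>) * norm (g x)" by (simp only: mult.commute)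
  qed
  moreover have "abs ((LBINT x. wt x * f (u x) * w j x) - (LBINT x. wt x * f (u x) * \<psi> x)) <= (LBINT x. \<epsilon> * abs (wt x * f (u x)))"
   unfolding Bochner_Integration.integral_diff[OF wtf_mult_integrable[OF wT[of j]] wtf_mult_integrable[OF \<psi>(1)], symmetric]
  proof (rule abs_integral_le[OF Bochner_Integration.integrable_diff[OF wtf_mult_integrable[OF wT] wtf_mult_integrable[OF \<psi>(1)]] integrable_mult_right[OF integrable_abs[OF f_limit(1)]]])
   fix x
   have "abs (wt x * f (u x) * w j x - wt x * f (u x) * \<psi> x) = abs (wt x * f (u x)) * abs (w j x - \<psi> x)"
    by (simp only: right_diff_distrib[symmetric] abs_mult)
   also have "... <= abs (wt x * f (u x)) * \<epsilon>" by (rule mult_left_mono) (use j(1)[of x] in auto)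
   finally show "abs (wt x * f (u x) * w j x - wt x * f (u x) * \<psi> x) <= \<epsilon> * abs (wt x * f (u x))" by (simp only: mult.commute)
  qed
  ultimately have "abs (Lim (w j) - Lim \<psi>) <= (real (card (Basis :: 'a set)) * \<epsilon>) * (LBINT x. norm (g x)) + \<epsilon> * (LBINT x. abs (wt x * f (u x)))"
   unfolding Lim_def integral_mult_right_zero by linarith
  also have "... = \<epsilon> * T" by (simp add: T_def algebra_simps)
  finally show ?thesis by (simp only: Lw L\<psi>)
 qed
 note le = this
 have "abs (Lim \<phi>) <= 0 + e" if e: "e > 0" for e
 proof -
  have pos: "e / (T + 1) > 0" using e T by simp
  have "e / (T + 1) * T <= e" using e T by (simp add: field_simps)
  then show ?thesis using le[OF pos] by linarith
 qed
 then have "abs (Lim \<phi>) <= 0" by (rule field_le_epsilon)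
 then show ?thesis by simp
qed

text \<open>For the second identity the sequence is tested with its own members; their norms are
  bounded, so the Palais-Smale property still gives a null sequence.\<close>

lemma energy_identity:
 "c = \<Theta> / 2 - (LBINT x. wt x * F (u x))" "\<Theta> = (LBINT x. wt x * (u x * f (u x)))"
proof -
 have "(%k. I (U k)) ----> \<Theta> / 2 - (LBINT x. wt x * F (u x))"
  unfolding I_def by (intro tendsto_diff tendsto_divide tendsto_const Dir_U_U_tendsto integral_limits(1)) simp
 then show "c = \<Theta> / 2 - (LBINT x. wt x * F (u x))" by (rule LIMSEQ_unique[OF I_U])
 have "(%k. dI (U k) (U k)) ----> 0"
 proof (rule tendsto_rabs_zero_cancel, rule tendsto_sandwich[OF _ _ tendsto_const over_Suc_tendsto])
  show "\<forall>\<^sub>F k in sequentially. abs (dI (U k) (U k)) <= (Q + 1) * (1 / real (Suc k))"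
   by (intro always_eventually allI order_trans[OF dI_U_le[OF U]] mult_right_mono add_right_mono U_bounded) simp
 qed simp
 moreover have "dI (U k) (U k) = Dir (U k) (U k) - (LBINT x. wt x * (U k x * f (U k x)))" for k
  by (simp only: dI_def mult.assoc mult.commute[of "f _" "U k _"])
 ultimately have "(%k. Dir (U k) (U k) - (LBINT x. wt x * (U k x * f (U k x)))) ----> 0" by simp
 from LIMSEQ_unique[OF this tendsto_diff[OF Dir_U_U_tendsto integral_limits(2)]]
 show "\<Theta> = (LBINT x. wt x * (u x * f (u x)))" by simp
qed

text \<open>The level and the energy are comparable by the Ambrosetti-Rabinowitz condition on one
  side and F >= 0 on the other. The last bound converts an upper estimate of the integral of F into
  one of the energy.\<close>

lemma \<Theta>_bounds: "(1 / 2 - 1 / q) * \<Theta> <= c" "c <= \<Theta> / 2" "\<Theta> <= \<mu> * (LBINT x. wt x * F (u x))"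
proof -
 have q0: "q > 0" using q by simp
 have "(LBINT x. q * (wt x * F (u x))) <= (LBINT x. wt x * (u x * f (u x)))"
 proof (rule integral_mono[OF integrable_mult_right[OF F_limit(1)] zf_limit(1)])
  show "q * (wt x * F (u x)) <= wt x * (u x * f (u x))" for x
   using mult_left_mono[OF AR[of "u x"], of "wt x"] by (simp add: F_def mult.left_commute)
 qed
 then have "q * (LBINT x. wt x * F (u x)) <= \<Theta>" by (simp add: energy_identity(2))
 then have "(LBINT x. wt x * F (u x)) <= \<Theta> / q" using q0 by (simp add: pos_le_divide_eq mult.commute)
 then show "(1 / 2 - 1 / q) * \<Theta> <= c" unfolding energy_identity(1) by (simp add: left_diff_distrib)
 have "0 <= (LBINT x. wt x * F (u x))" by (intro integral_nonneg_AE AE_I2 mult_nonneg_nonneg F_nonneg) simp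
 then show "c <= \<Theta> / 2" unfolding energy_identity(1) by simp
 have "(LBINT x. wt x * (u x * f (u x))) <= (LBINT x. \<mu> * (wt x * F (u x)))"
 proof (rule integral_mono[OF zf_limit(1) integrable_mult_right[OF F_limit(1)]])
  show "wt x * (u x * f (u x)) <= \<mu> * (wt x * F (u x))" for x
   using mult_left_mono[OF zf_le_F[of "u x"], of "wt x"] by (simp add: mult.left_commute)
 qed
 then show "\<Theta> <= \<mu> * (LBINT x. wt x * F (u x))" by (simp add: energy_identity(2))
qed

end

section \<open>From Borel to Lebesgue measurability, and uniqueness of weak gradients\<close>

lemma lebesgue_on_ball_eq_lborel:
 fixes h :: "'a::euclidean_space => 'b::{banach, second_countable_topology}"
 assumes "h : borel_measurable borel" "!!x. 1 <= norm x ==> h x = 0"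
 shows "(\<integral>x. h x \<partial>lebesgue_on (ball 0 1)) = (LBINT x. h x)"
proof -
 have "(LBINT x. h x) = (LINT x|lebesgue. h x)" using assms(1) by (simp add: integral_completion)
 also have "... = (LINT x|lebesgue. indicator (ball 0 1) x *\<^sub>R h x)"
  using assms(2) by (intro Bochner_Integration.integral_cong) (auto simp: indicator_def)
 also have "... = (\<integral>x. h x \<partial>lebesgue_on (ball 0 1))" by (subst integral_restrict_space) auto
 finally show ?thesis by simp
qed

lemma integrable_lebesgue_on:
 fixes h :: "'a::euclidean_space => 'b::{banach, second_countable_topology}"
 assumes "integrable lborel h" "S : sets lebesgue"
 shows "integrable (lebesgue_on S) h"
proof -
 have "integrable lebesgue h" using assms(1) borel_measurable_integrable[OF assms(1)] by (simp add: integrable_completion)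
 then have "integrable lebesgue (%x. indicator S x *\<^sub>R h x)" using assms(2) by (intro integrable_mult_indicator)
 then show ?thesis using assms(2) by (subst integrable_restrict_space) auto
qed

text \<open>Completeness of Lebesgue measure. It applies to \<open>weak_gradient\<close>, an
  arbitrary choice of which only the almost everywhere class is known.\<close>

lemma borel_measurable_lebesgue_AE_eq:
 fixes v w :: "'a::euclidean_space => 'b::topological_space"
 assumes "v : borel_measurable lebesgue" "AE x in lebesgue. w x = v x"
 shows "w : borel_measurable lebesgue"
proof (rule measurableI)
 fix A :: "'b set" assume A: "A : sets borel"
 have "AE x in lebesgue. x : v -` A \<inter> space lebesgue \<longleftrightarrow> x : w -` A \<inter> space lebesgue"
  using assms(2) by eventually_elim simp
 then show "w -` A \<inter> space lebesgue : sets lebesgue"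
  by (rule completion.in_sets_AE) (use measurable_sets[OF assms(1) A] in auto)
qed simp

lemma TF_support: "\<phi> : TF ==> EX r<1. ALL x. r < norm x --> \<phi> x = 0" by (simp add: TF_iff)

lemma L1_loc_mult_TF:
 fixes v :: "'a::euclidean_space => real"
 assumes v: "v : L1_loc (ball 0 1)" and \<phi>: "\<phi> : TF"
 shows "integrable (lebesgue_on (ball 0 1)) (%x. v x * \<phi> x)"
proof -
 obtain r where r: "r < 1" "!!x. r < norm x ==> \<phi> x = 0" using TF_support[OF \<phi>] by (elim exE conjE) simp
 have "cball (0::'a) r \<subseteq> ball 0 1" using r by auto
 then have "integrable (lebesgue_on (cball 0 r)) v" using v by (auto simp: L1_loc_def)
 then have i: "integrable lebesgue (%x. indicator (cball 0 r) x *\<^sub>R v x)" by (subst (asm) integrable_restrict_space) auto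
 obtain B where B: "!!x. abs (\<phi> x) <= B" by (rule TF_bounded[OF \<phi>]) (rule that)
 have [measurable]: "(%x. indicator (cball 0 r) x *\<^sub>R v x) : borel_measurable lebesgue" by (rule borel_measurable_integrable[OF i])
 have "\<phi> : borel_measurable borel" by (rule borel_measurable_continuous_onI[OF TF_continuous[OF \<phi>]])
 then have [measurable]: "\<phi> : borel_measurable lebesgue" by (simp add: measurable_completion)
 have "integrable lebesgue (%x. (indicator (cball 0 r) x *\<^sub>R v x) * \<phi> x)"
 proof (rule Bochner_Integration.integrable_bound[OF integrable_mult_right[OF integrable_norm[OF i], of B]])
  show "AE x in lebesgue. norm ((indicator (cball 0 r) x *\<^sub>R v x) * \<phi> x) <= norm (B * norm (indicator (cball 0 r) x *\<^sub>R v x))"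
  proof (rule AE_I2)
   fix x
   have "0 <= B" using order_trans[OF abs_ge_zero B[of x]] .
   then show "norm ((indicator (cball 0 r) x *\<^sub>R v x) * \<phi> x) <= norm (B * norm (indicator (cball 0 r) x *\<^sub>R v x))"
    using mult_right_mono[OF B[of x] abs_ge_zero[of "indicator (cball 0 r) x *\<^sub>R v x"]] by (simp add: abs_mult mult_ac)
  qed
 qed measurable
 moreover have "(%x. (indicator (cball 0 r) x *\<^sub>R v x) * \<phi> x) = (%x. indicator (ball 0 1) x *\<^sub>R (v x * \<phi> x))"
  using r by (auto simp: indicator_def fun_eq_iff)
 ultimately show ?thesis by (subst integrable_restrict_space) auto
qed

lemma weak_gradient_unique:
 fixes u :: "'a::euclidean_space => real"
 assumes "has_weak_gradient (ball 0 1) u G1" "has_weak_gradient (ball 0 1) u G2"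
 shows "AE x in lebesgue_on (ball 0 1). G1 x = G2 x"
proof -
 have L: "(%x. G1 x \<bullet> b) : L1_loc (ball 0 1)" "(%x. G2 x \<bullet> b) : L1_loc (ball 0 1)" for b
  using assms by (auto simp: has_weak_gradient_def L1_loc_def)
 have "AE x in lebesgue_on (ball 0 1). G1 x \<bullet> b - G2 x \<bullet> b = 0" if b: "b : Basis" for b
 proof (rule du_Bois_Reymond)
  show "(%x. G1 x \<bullet> b - G2 x \<bullet> b) : L1_loc (ball 0 1)" using L[of b] by (auto simp: L1_loc_def)
  fix \<phi> :: "'a => real" assume \<phi>: "\<phi> : TF"
  have "(\<integral>x. (G1 x \<bullet> b) * \<phi> x \<partial>lebesgue_on (ball 0 1)) = (\<integral>x. (G2 x \<bullet> b) * \<phi> x \<partial>lebesgue_on (ball 0 1))"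
   using assms b \<phi> by (auto simp: has_weak_gradient_def)
  then show "(\<integral>x. (G1 x \<bullet> b - G2 x \<bullet> b) * \<phi> x \<partial>lebesgue_on (ball 0 1)) = 0"
   by (simp add: left_diff_distrib Bochner_Integration.integral_diff[OF L1_loc_mult_TF[OF L(1) \<phi>] L1_loc_mult_TF[OF L(2) \<phi>]])
 qed simp
 then have "AE x in lebesgue_on (ball 0 1). ALL b:Basis. G1 x \<bullet> b - G2 x \<bullet> b = 0" by (intro AE_finite_allI) auto
 then show ?thesis by eventually_elim (auto intro: euclidean_eqI)
qed

lemma gradient_E_cases:
 fixes h :: "'a::euclidean_space => real"
 assumes "smooth h"
 obtains e where "0 <= e" "e <= 1" "h x <= 0 ==> e = 0" "gradient (%x. E (h x)) x = e *\<^sub>R gradient h x"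
proof
 let ?e = "if h x > 0 then exp (- (1 / h x)) / (h x)^2 else 0"
 show "0 <= ?e" "?e <= 1" using E_deriv_bounds[of "h x"] by auto
 show "gradient (%x. E (h x)) x = ?e *\<^sub>R gradient h x"
  using has_derivative_compose[OF smooth_has_derivative[OF assms] E_deriv[unfolded has_field_derivative_def, of "h x"]]
  by (intro gradient_eqI) simp
qed auto

lemma gradient_E:
 assumes "smooth h"
 shows "norm (gradient (%x. E (h x)) x) <= norm (gradient h x)" "h x <= 0 ==> gradient (%x. E (h x)) x = 0"
 by (rule gradient_E_cases[OF assms, of x]; simp add: mult_left_le_one_le)+

section \<open>The limit is a nonnegative weak solution\<close>

context ps_limit
begin

text \<open>The function E (- U k) is a smooth substitute for the negative part. It is an admissible
  direction on which the nonlinear term vanishes, since \<open>f\<close> is zero on the nonpositive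
  half-line. As the slope of \<open>E\<close> lies in [0, 1], its Dirichlet energy is at most - dI
  (U k) (w k), which tends to 0.\<close>

lemma u_nonneg: "AE x in lborel. 0 <= u x"
proof -
 define w where "w k x = E (- U k x)" for k x
 have mU: "smooth (%x. (-1) * U k x)" for k by (rule TF_smooth[OF TF_cmult[OF U_TF]])
 have E0: "E 0 = 0" by (simp add: E_def)
 have wT: "w k : TF" for k
 proof -
  have "smooth (w k)" using smooth_E[OF mU[of k]] by (simp add: w_def[abs_def])
  moreover obtain r where "r < 1" "ALL x. r < norm x --> U k x = 0" using TF_support[OF U_TF] by blast
  then have "EX r<1. ALL x. r < norm x --> w k x = 0" by (auto simp: w_def E0)
  ultimately show ?thesis by (simp add: TF_iff)
 qed
 have wX: "w k : XS" for k
  by (rule XS_I[OF wT]) (simp add: w_def XS_invariant[OF U])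
 have f0: "wt x * f (U k x) * w k x = 0" for k x by (cases "U k x > 0") (auto simp: w_def E_def f_nonpos)
 have le: "Dir (w k) (w k) <= - Dir (U k) (w k)" for k
 proof -
  have "Dir (w k) (w k) <= (LBINT x. - (gradient (U k) x \<bullet> gradient (w k) x))"
   unfolding Dir_def
  proof (rule integral_mono[OF Dir_integrable[OF wT wT] Bochner_Integration.integrable_minus[OF Dir_integrable[OF U_TF wT]]])
   fix x
   obtain e where e: "0 <= e" "e <= 1" "gradient (w k) x = - (e *\<^sub>R gradient (U k) x)"
    using gradient_E_cases[OF mU[of k], of x] gradient_cmult[OF TF_smooth[OF U_TF[of k]], of "-1" x] unfolding w_def[abs_def] by auto
   then have "(e * e) * (gradient (U k) x \<bullet> gradient (U k) x) <= (e * 1) * (gradient (U k) x \<bullet> gradient (U k) x)"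
    by (intro mult_right_mono mult_left_mono) auto
   then show "gradient (w k) x \<bullet> gradient (w k) x <= - (gradient (U k) x \<bullet> gradient (w k) x)" by (simp add: e mult_ac)
  qed
  also have "... = - Dir (U k) (w k)" by (simp add: Dir_def)
  finally show ?thesis .
 qed
 have bnd: "(LBINT x. (w k x)^2) <= 3 * (1 / real (Suc k))" for k
 proof -
  define a where "a = dnorm (w k)"
  have a0: "a >= 0" by (simp add: a_def dnorm_nonneg)
  have "dI (U k) (w k) = Dir (U k) (w k)" by (simp add: dI_def f0)
  then have "Dir (w k) (w k) <= (a + 1) * (1 / real (Suc k))" using le[of k] dI_U_le[OF wX, of k k] by (simp add: a_def)
  then have a: "a^2 <= (a + 1) * (1 / real (Suc k))" by (simp add: a_def dnorm_square)
  also have "... <= (a + 1) * 1" using a0 by (intro mult_left_mono) auto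
  \<comment> \<open>A crude bound from a^2 <= a + 1; it turns the right-hand side into a multiple of
    1 / (k + 1).\<close>
  finally have "a <= 2"
  proof -
   assume h: "a^2 <= (a + 1) * 1"
   show "a <= 2"
   proof (rule ccontr)
    assume "~a <= 2"
    then have "2 * a < a * a" by (intro mult_strict_right_mono) auto
    moreover have "a * a <= a + 1" using h by (simp add: power2_eq_square)
    ultimately show False using \<open>\<not> a \<le> 2\<close> by linarith
   qed
  qed
  then have "(a + 1) * (1 / real (Suc k)) <= 3 * (1 / real (Suc k))" by (intro mult_right_mono) auto
  then show ?thesis using a Poincare_XS[OF wX, of k] dnorm_square[of "w k"] by (simp add: a_def)
 qed
 have Ec: "isCont E t" for t by (rule DERIV_isCont[OF E_deriv])
 then have Em: "E : borel_measurable borel" by (intro borel_measurable_continuous_onI) (simp add: continuous_at_imp_continuous_on)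
 have "(%x. (E (- u x))^2) : borel_measurable lborel" using Em by measurable
 note F = Fatou_real[OF TF_integrable_power2[OF wT] zero_le_power2 _ _ this zero_le_power2]
 have lim: "AE x in lborel. (%k. (w (k + n) x)^2) ----> (E (- u x))^2" for n
  using u_AE
 proof eventually_elim
  case (elim x)
  show ?case unfolding w_def
   by (intro tendsto_power isCont_tendsto_compose[OF Ec] tendsto_minus LIMSEQ_ignore_initial_segment elim)
 qed
 have B: "integrable lborel (%x. (E (- u x))^2)" "(LBINT x. (E (- u x))^2) <= 3 * (1 / real (Suc n))" for n
 proof -
  have b: "(LBINT x. (w (k + n) x)^2) <= 3 * (1 / real (Suc n))" for k
   by (rule order_trans[OF bnd]) (intro mult_left_mono divide_left_mono, auto)
  show "integrable lborel (%x. (E (- u x))^2)" "(LBINT x. (E (- u x))^2) <= 3 * (1 / real (Suc n))"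
   by (rule F[OF b lim])+
 qed
 have "(LBINT x. (E (- u x))^2) <= 0"
  by (rule LIMSEQ_le_const[OF over_Suc_tendsto[of 3]]) (use B(2) in auto)
 then have "(LBINT x. (E (- u x))^2) = 0" by (intro antisym integral_nonneg_AE) auto
 then have "AE x in lborel. (E (- u x))^2 = 0" using integral_nonneg_eq_0_iff_AE[OF B(1)] by simp
 then show ?thesis
 proof eventually_elim
  case (elim x)
  then show ?case using E_bounds(3)[of "- u x"] by (simp add: not_less[symmetric])
 qed
qed

lemma u_weak_gradient: "has_weak_gradient (ball 0 1) u g"
 unfolding has_weak_gradient_def
proof (intro conjI ballI)
 show "u : L1_loc (ball 0 1)" "g : L1_loc (ball 0 1)"
  unfolding L1_loc_def by (auto intro: integrable_lebesgue_on u_integrable g_integrable simp: compact_imp_closed)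
 fix \<phi> :: "'a => real" and b assume \<phi>: "\<phi> : TF" and b: "b : (Basis :: 'a set)"
 note pT = TF_partial[OF \<phi> b]
 note bm[measurable] = TF_borel(1)[OF \<phi>] TF_borel(1)[OF pT]
 have "(%k. \<integral>x. U k x \<bullet> partial_deriv b \<phi> x \<partial>lborel) ----> (LBINT x. u x \<bullet> partial_deriv b \<phi> x)"
  by (rule L2_tendsto_inner) (simp_all add: TF_integrable_power2 U_TF pT u_square U_L2)
 then have l1: "(%k. \<integral>x. U k x * partial_deriv b \<phi> x \<partial>lborel) ----> (LBINT x. u x * partial_deriv b \<phi> x)" by simp
 have "integrable lborel (%x. (norm (\<phi> x *\<^sub>R b))^2)" using b by (simp add: power_mult_distrib TF_integrable_power2 \<phi>)
 then have "(%k. \<integral>x. gradient (U k) x \<bullet> (\<phi> x *\<^sub>R b) \<partial>lborel) ----> (LBINT x. g x \<bullet> (\<phi> x *\<^sub>R b))"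
  by (intro L2_tendsto_inner) (simp_all add: TF_gradient_square U_TF g_square gradU_L2)
 then have l2: "(%k. - (LBINT x. partial_deriv b (U k) x * \<phi> x)) ----> - (LBINT x. (g x \<bullet> b) * \<phi> x)"
  using b by (intro tendsto_minus) (simp add: gradient_inner_Basis mult.commute)
 have "(LBINT x. u x * partial_deriv b \<phi> x) = - (LBINT x. (g x \<bullet> b) * \<phi> x)"
  using l2 by (intro LIMSEQ_unique[OF l1]) (simp add: TF_integration_by_parts[OF U_TF \<phi> b])
 moreover have "(\<integral>x. u x * partial_deriv b \<phi> x \<partial>lebesgue_on (ball 0 1)) = (LBINT x. u x * partial_deriv b \<phi> x)"
  by (rule lebesgue_on_ball_eq_lborel) (simp_all add: u_outside)
 moreover have "(\<integral>x. (g x \<bullet> b) * \<phi> x \<partial>lebesgue_on (ball 0 1)) = (LBINT x. (g x \<bullet> b) * \<phi> x)"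
  by (rule lebesgue_on_ball_eq_lborel) (simp_all add: g_outside)
 ultimately show "(\<integral>x. u x * partial_deriv b \<phi> x \<partial>lebesgue_on (ball 0 1)) = - (\<integral>x. (g x \<bullet> b) * \<phi> x \<partial>lebesgue_on (ball 0 1))" by simp
qed

lemma weak_gradient_u: "has_weak_gradient (ball 0 1) u (weak_gradient (ball 0 1) u)"
 "AE x in lebesgue_on (ball 0 1). weak_gradient (ball 0 1) u x = g x"
proof -
 show h: "has_weak_gradient (ball 0 1) u (weak_gradient (ball 0 1) u)"
  unfolding weak_gradient_def by (rule someI[where P="has_weak_gradient (ball 0 1) u", OF u_weak_gradient])
 show "AE x in lebesgue_on (ball 0 1). weak_gradient (ball 0 1) u x = g x" by (rule weak_gradient_unique[OF h u_weak_gradient])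
qed

lemma weak_gradient_measurable: "weak_gradient (ball 0 1) u : borel_measurable (lebesgue_on (ball 0 1))"
proof -
 let ?w = "%x. if x : ball 0 1 then weak_gradient (ball 0 1) u x else 0"
 have "?w : borel_measurable lebesgue"
 proof (rule borel_measurable_lebesgue_AE_eq)
  show "g : borel_measurable lebesgue" by (simp add: measurable_completion)
  have "AE x in lebesgue. x : ball 0 1 --> weak_gradient (ball 0 1) u x = g x"
   using weak_gradient_u(2) by (subst (asm) AE_restrict_space_iff) auto
  then show "AE x in lebesgue. ?w x = g x" by eventually_elim (auto simp: g_outside)
 qed
 then have "?w : borel_measurable (lebesgue_on (ball 0 1))" by (rule measurable_restrict_space1)
 then show ?thesis by (rule measurable_cong[THEN iffD1, rotated]) simp
qed

text \<open>Integrals over the ball with the arbitrarily chosen weak gradient become Borel integrals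
  with \<open>g\<close>. The integrand may depend on the point as well, to cover products with and
  differences from gradients of test functions.\<close>

lemma lebesgue_on_transfer:
 fixes h :: "'a => 'a => real"
 assumes m[measurable]: "case_prod h : borel_measurable borel" and z: "!!x. 1 <= norm x ==> h x 0 = 0"
 shows "(\<integral>x. h x (weak_gradient (ball 0 1) u x) \<partial>lebesgue_on (ball 0 1)) = (LBINT x. h x (g x))"
  "integrable lborel (%x. h x (g x)) ==> integrable (lebesgue_on (ball 0 1)) (%x. h x (weak_gradient (ball 0 1) u x))"
proof -
 have cm: "(%x. case_prod h (v x)) : borel_measurable N" if "v : borel_measurable N" for v :: "'a => 'a \<times> 'a" and N :: "'a measure"
  by (rule measurable_compose[OF that m])
 have gm: "(%x. h x (g x)) : borel_measurable borel" using cm[of "%x. (x, g x)" borel] by simp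
 have gm': "(%x. h x (g x)) : borel_measurable (lebesgue_on (ball 0 1))"
  using gm by (intro measurable_restrict_space1) (simp add: measurable_completion)
 have "id : borel_measurable (lebesgue_on (ball (0::'a) 1))" by (intro measurable_restrict_space1) (simp add: measurable_completion)
 then have "(%x. (x, weak_gradient (ball 0 1) u x)) : borel_measurable (lebesgue_on (ball 0 1))"
  using weak_gradient_measurable by (intro borel_measurable_Pair) (simp_all add: id_def)
 from cm[OF this] have wm: "(%x. h x (weak_gradient (ball 0 1) u x)) : borel_measurable (lebesgue_on (ball 0 1))" by simp
 have ae: "AE x in lebesgue_on (ball 0 1). h x (weak_gradient (ball 0 1) u x) = h x (g x)"
  using weak_gradient_u(2) by eventually_elim simp
 have "(\<integral>x. h x (weak_gradient (ball 0 1) u x) \<partial>lebesgue_on (ball 0 1)) = (\<integral>x. h x (g x) \<partial>lebesgue_on (ball 0 1))"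
  by (rule integral_cong_AE[OF wm gm' ae])
 also have "... = (LBINT x. h x (g x))" by (rule lebesgue_on_ball_eq_lborel[OF gm]) (simp add: g_outside z)
 finally show "(\<integral>x. h x (weak_gradient (ball 0 1) u x) \<partial>lebesgue_on (ball 0 1)) = (LBINT x. h x (g x))" .
 show "integrable (lebesgue_on (ball 0 1)) (%x. h x (weak_gradient (ball 0 1) u x))" if "integrable lborel (%x. h x (g x))"
  using integrable_lebesgue_on[OF that, of "ball 0 1"] integrable_cong_AE[OF wm gm' ae] by simp
qed

lemma u_H1_0: "u : H1_0 (ball 0 1)"
proof -
 have um: "u : borel_measurable (lebesgue_on (ball 0 1))" by (intro measurable_restrict_space1) (simp add: measurable_completion)
 have "u : L2 (ball 0 1)" unfolding L2_def using um integrable_lebesgue_on[OF u_square, of "ball 0 1"] by simp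
 moreover have "weak_gradient (ball 0 1) u : L2 (ball 0 1)"
  unfolding L2_def using weak_gradient_measurable lebesgue_on_transfer(2)[of "%x v. (norm v)^2"] g_square
  by (simp add: split_beta' borel_measurable_continuous_onI continuous_intros)
 ultimately have H1: "u : H1 (ball 0 1)" unfolding H1_def using u_weak_gradient by blast
 have eq: "(\<integral>x. (U k x - u x)^2 \<partial>lebesgue_on (ball 0 1)) + (\<integral>x. (norm (gradient (U k) x - weak_gradient (ball 0 1) u x))^2 \<partial>lebesgue_on (ball 0 1))
  = (LBINT x. (U k x - u x)^2) + (LBINT x. (norm (gradient (U k) x - g x))^2)" for k
 proof -
  have "(\<integral>x. (U k x - u x)^2 \<partial>lebesgue_on (ball 0 1)) = (LBINT x. (U k x - u x)^2)"
   by (rule lebesgue_on_ball_eq_lborel) (simp_all add: u_outside TF_zero_outside[OF U_TF])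
  moreover have "case_prod (%x v. (norm (gradient (U k) x - v))^2) : borel_measurable borel"
   unfolding split_beta' by (intro borel_measurable_continuous_onI continuous_intros continuous_on_compose2[OF TF_gradient_continuous[OF U_TF, of UNIV]]) auto
  from lebesgue_on_transfer(1)[OF this]
  have "(\<integral>x. (norm (gradient (U k) x - weak_gradient (ball 0 1) u x))^2 \<partial>lebesgue_on (ball 0 1)) = (LBINT x. (norm (gradient (U k) x - g x))^2)"
   by (simp add: TF_gradient_zero[OF U_TF])
  ultimately show ?thesis by simp
 qed
 have "(%k. (LBINT x. (U k x - u x)^2) + (LBINT x. (norm (gradient (U k) x - g x))^2)) ----> 0 + 0"
  by (intro tendsto_add U_L2 gradU_L2)
 then show ?thesis
  unfolding H1_0_def using H1 U_TF by (intro CollectI conjI exI[of _ U]) (simp_all add: eq)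
qed

lemma u_weak_solution: "weak_solution (ball 0 1) \<alpha> f u"
 unfolding weak_solution_def
proof (intro conjI ballI u_H1_0)
 fix \<phi> :: "'a => real" assume \<phi>: "\<phi> : TF"
 note i = wtf_mult_integrable[OF \<phi>]
 show "integrable (lebesgue_on (ball 0 1)) (%x. wt x * f (u x) * \<phi> x)" by (rule integrable_lebesgue_on[OF i]) simp
 have "(\<integral>x. wt x * f (u x) * \<phi> x \<partial>lebesgue_on (ball 0 1)) = (LBINT x. wt x * f (u x) * \<phi> x)"
  using borel_measurable_integrable[OF i] by (intro lebesgue_on_ball_eq_lborel) (simp_all add: TF_zero_outside[OF \<phi>])
 moreover have "case_prod (%x v. v \<bullet> gradient \<phi> x) : borel_measurable borel"
  unfolding split_beta' by (intro borel_measurable_continuous_onI continuous_intros continuous_on_compose2[OF TF_gradient_continuous[OF \<phi>, of UNIV]]) auto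
 from lebesgue_on_transfer(1)[OF this]
 have "(\<integral>x. weak_gradient (ball 0 1) u x \<bullet> gradient \<phi> x \<partial>lebesgue_on (ball 0 1)) = (LBINT x. g x \<bullet> gradient \<phi> x)" by simp
 ultimately show "(\<integral>x. weak_gradient (ball 0 1) u x \<bullet> gradient \<phi> x \<partial>lebesgue_on (ball 0 1)) = (\<integral>x. wt x * f (u x) * \<phi> x \<partial>lebesgue_on (ball 0 1))"
  using Lim_TF[OF \<phi>] by (simp add: Lim_def)
qed

end

subsection \<open>Energy of radial solutions\<close>

definition ubvol :: "'a::euclidean_space itself => real" where "ubvol _ = measure lborel (ball (0::'a) 1)"

lemma ubvol_pos: "ubvol TYPE('a::euclidean_space) > 0"
 by (simp add: ubvol_def content_ball_gt_0_iff)

text \<open>Integration in polar coordinates for radial functions: half-lines determine a measure on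
  the real line that is finite on them, and on half-lines both sides are volumes of spherical
  shells.\<close>

lemma norm_pushforward:
 "distr (density lborel (indicator (ball (0::'a::euclidean_space) 1))) borel norm = density (rmeas (DIM('a))) (%_. ennreal (ubvol TYPE('a)))"
  (is "?P = ?Q")
proof (rule measure_eqI_lessThan)
 let ?B = "ball (0::'a) 1" and ?n = "DIM('a)" and ?\<nu> = "ubvol TYPE('a)"
 have [measurable]: "?B : sets borel" by simp
 have P: "emeasure ?P {t<..} = emeasure lborel {x : ?B. t < norm x}" for t
 proof -
  have [measurable]: "norm -` {t<..} : sets (borel :: 'a measure)" by (intro borel_open open_vimage) (auto intro: continuous_intros)
  have "emeasure ?P {t<..} = (\<integral>\<^sup>+x. indicator ?B x * indicator (norm -` {t<..}) x \<partial>lborel)"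
   by (simp add: emeasure_distr emeasure_density)
  also have "... = (\<integral>\<^sup>+x. indicator {x : ?B. t < norm x} x \<partial>lborel)"
   by (intro nn_integral_cong) (auto simp: indicator_def)
  also have "... = emeasure lborel {x : ?B. t < norm x}" by (rule nn_integral_indicator) measurable
  finally show ?thesis .
 qed
 have fin: "emeasure lborel ?B < \<infinity>" by (rule emeasure_lborel_ball_finite)
 show "emeasure ?P {t<..} < \<infinity>" for t
  unfolding P by (rule le_less_trans[OF emeasure_mono fin]) auto
 show "emeasure ?P {t<..} = emeasure ?Q {t<..}" for t
 proof -
  define s where "s = max 0 (min t 1)"
  have s: "0 <= s" "s <= 1" by (auto simp: s_def)
  have vol: "emeasure lborel (cball (0::'a) s) = ennreal (?\<nu> * s ^ ?n)" "emeasure lborel ?B = ennreal ?\<nu>"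
   using s by (simp_all add: emeasure_cball emeasure_ball ubvol_def content_ball)
  have "emeasure (rmeas ?n) {t<..} = emeasure (rmeas ?n) {s..1}"
  proof (rule emeasure_eq_AE)
   show "AE r in rmeas ?n. (r : {t<..}) = (r : {s..1})"
    using rmeas_AE_unit[of ?n] rmeas_AE_neq[of t ?n] rmeas_AE_neq[of 1 ?n] by eventually_elim (auto simp: s_def)
  qed simp_all
  also have "... = ennreal (1 - s ^ ?n)" using emeasure_rmeas_Icc[of ?n s 1] s by simp
  finally have Q: "emeasure ?Q {t<..} = ennreal (?\<nu> * (1 - s ^ ?n))"
   using ubvol_pos[where 'a='a] s by (simp add: emeasure_density nn_integral_cmult ennreal_mult power_le_one)
  have "emeasure lborel {x : ?B. t < norm x} = emeasure lborel (?B - cball 0 s)"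
  proof (rule emeasure_eq_AE)
   show "AE x in lborel. (x : {x : ?B. t < norm x}) = (x : ?B - cball 0 s)"
    using AE_lborel_singleton[of "0::'a"]
   proof eventually_elim
    case (elim x)
    then show ?case using norm_ge_zero[of x] by (auto simp: s_def max_def min_def simp del: norm_ge_zero split: if_splits)
   qed
  qed measurable
  also have "... = ennreal (?\<nu> * (1 - s ^ ?n))"
  proof (cases "s < 1")
   case True
   then have "emeasure lborel (?B - cball 0 s) = emeasure lborel ?B - emeasure lborel (cball (0::'a) s)"
    using emeasure_lborel_cball_finite[of "0::'a" s] by (intro emeasure_Diff) (auto simp: less_top)
   also have "... = ennreal (?\<nu> - ?\<nu> * s ^ ?n)" unfolding vol using ubvol_pos[where 'a='a] s by (intro ennreal_minus) auto
   finally show ?thesis by (simp add: right_diff_distrib)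
  next
   case False
   then have "?B - cball (0::'a) s = {}" "s = 1" using s by auto
   then show ?thesis by (simp only: emeasure_empty) simp
  qed
  finally show ?thesis unfolding P Q .
 qed
qed simp_all

lemma integral_radial:
 fixes h :: "real => real"
 assumes [measurable]: "h : borel_measurable borel"
 shows "(LBINT x. indicator (ball (0::'a) 1) x * h (norm x)) = ubvol TYPE('a::euclidean_space) * (\<integral>r. h r \<partial>rmeas DIM('a))"
proof -
 have [measurable]: "ball (0::'a) 1 : sets borel" by simp
 have "(LBINT x. indicator (ball (0::'a) 1) x * h (norm x)) = (\<integral>x. h (norm x) \<partial>density lborel (indicator (ball (0::'a) 1)))"
 proof -
  have "(indicator (ball (0::'a) 1) :: 'a => ennreal) = (%x. ennreal (indicator (ball 0 1) x))" by (simp add: ennreal_indicator)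
  then show ?thesis by (simp add: integral_density)
 qed
 also have "... = (\<integral>r. h r \<partial>distr (density lborel (indicator (ball (0::'a) 1))) borel norm)"
  by (subst integral_distr) auto
 also have "... = (\<integral>r. ubvol TYPE('a) * h r \<partial>rmeas DIM('a))"
  unfolding norm_pushforward using ubvol_pos[where 'a='a] by (subst integral_density) auto
 finally show ?thesis by simp
qed

text \<open>The case of \<open>G_transitive\<close> in which one block is empty.\<close>

lemma isometry_exists:
 fixes x y :: "'a::euclidean_space"
 assumes "norm x = norm y" obtains h where "orthogonal_transformation h" "h x = y"
proof -
 interpret b: blocks "Basis :: 'a set" "{}" by unfold_locales auto
 have "blk Basis z = z" "blk {} z = 0" for z :: 'a by (simp_all add: blk_def euclidean_representation)
 then have "b.same x y" using assms by (simp add: b.same_def)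
 then obtain h where h: "h : b.G" "h x = y" using b.G_transitive by blast
 have "orthogonal_transformation h" using b.G_monoid h(1) by (auto simp: isometry_monoid_def)
 then show thesis using h(2) by (rule that)
qed

text \<open>A radial lemma with the additional factor 1 - |x| from the zero boundary values. At
  distance 1 / \<alpha> from the boundary it limits the square of a radial function to the order of
  its energy over \<alpha>.\<close>

lemma radial_decay:
 fixes v :: "'a::euclidean_space => real"
 assumes v: "v : TF" and radial: "!!x y. norm x = norm y ==> v x = v y" and x: "norm x < 1"
 shows "norm x ^ (DIM('a) - 1) * (v x)^2 <= Dir v v * (1 - norm x) / (DIM('a) * ubvol TYPE('a))"
proof -
 let ?n = "DIM('a)" and ?\<nu> = "ubvol TYPE('a)"
 define a :: 'a where "a = (SOME b. b : Basis)"
 have aB: "a : Basis" unfolding a_def by (simp add: some_in_eq)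
 have a: "norm a = 1" using aB by simp
 define w where "w r = v (r *\<^sub>R a)" for r
 define w' where "w' r = gradient v (r *\<^sub>R a) \<bullet> a" for r
 have sm: "smooth v" by (rule TF_smooth[OF v])
 have dd: "((%r. v (r *\<^sub>R b)) has_real_derivative gradient v (r *\<^sub>R b) \<bullet> b) (at r)" for b r
  using directional_derivative[OF sm, of 0 b r] by simp
 have d: "(w has_real_derivative w' r) (at r)" for r using dd[of a r] by (simp add: w_def[abs_def] w'_def)
 have c': "continuous_on UNIV w'"
  unfolding w'_def[abs_def]
  by (intro continuous_on_inner continuous_on_const continuous_on_compose2[OF smooth_gradient_continuous[OF sm, of UNIV]] continuous_intros) simp
 have w'm[measurable]: "w' : borel_measurable borel" by (rule borel_measurable_continuous_onI[OF c'])
 define s where "s = norm x"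
 have s: "0 <= s" "s < 1" using x by (auto simp: s_def)
 have ws: "w s = v x" unfolding w_def using a by (intro radial) (simp add: s_def)
 have w1: "w 1 = 0" unfolding w_def using a by (intro TF_zero_outside[OF v]) simp
 have grad: "(w' (norm y))^2 <= gradient v y \<bullet> gradient v y" for y
 proof -
  define b where "b = (if y = 0 then a else y /\<^sub>R norm y)"
  have b: "norm b = 1" "norm y *\<^sub>R b = y" using a by (auto simp: b_def)
  have "v (r *\<^sub>R b) = w r" for r unfolding w_def using a b by (intro radial) simp
  then have "(w has_real_derivative gradient v (norm y *\<^sub>R b) \<bullet> b) (at (norm y))" using dd[of b "norm y"] by simp
  then have "w' (norm y) = gradient v y \<bullet> b" using DERIV_unique[OF d] b(2) by metis
  moreover have "abs (gradient v y \<bullet> b) <= norm (gradient v y)" using Cauchy_Schwarz_ineq2[of "gradient v y" b] b(1) by simp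
  then have "abs (gradient v y \<bullet> b)^2 <= (norm (gradient v y))^2" by (intro power_mono) auto
  ultimately show ?thesis by (simp add: power2_norm_eq_inner)
 qed
 have "?\<nu> * (\<integral>r. (w' r)^2 \<partial>rmeas ?n) = (LBINT y. indicator (ball (0::'a) 1) y * (w' (norm y))^2)"
  by (rule integral_radial[symmetric]) measurable
 also have "... <= Dir v v"
  unfolding Dir_def
 proof (rule integral_mono')
  show "integrable lborel (%x. gradient v x \<bullet> gradient v x)" by (rule Dir_integrable[OF v v])
  show "indicator (ball 0 1) y * (w' (norm y))^2 <= gradient v y \<bullet> gradient v y" for y
   using grad[of y] by (auto simp: indicator_def)
 qed simp
 finally have e1: "?\<nu> * (\<integral>r. (w' r)^2 \<partial>rmeas ?n) <= Dir v v" .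
 have ii: "integrable lborel (%t. indicator {c..e} t * h t)" if "continuous_on UNIV h" for h :: "real => real" and c e
  using borel_integrable_compact[of "{c..e}" h] continuous_on_subset[OF that] by simp
 have "real ?n * (LBINT t. indicator {s..1} t * ((w' t)^2 * t ^ (?n - 1))) = (LBINT t. real ?n * (indicator {s..1} t * ((w' t)^2 * t ^ (?n - 1))))" by simp
 also have "... <= (LBINT t. indicator {0..1} t * (real ?n * t ^ (?n - 1) * (w' t)^2))"
 proof (rule integral_mono)
  show "integrable lborel (%t. real ?n * (indicator {s..1} t * ((w' t)^2 * t ^ (?n - 1))))"
   by (intro integrable_mult_right ii continuous_intros c')
  show "integrable lborel (%t. indicator {0..1} t * (real ?n * t ^ (?n - 1) * (w' t)^2))"
   by (intro ii continuous_intros c')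
  show "real ?n * (indicator {s..1} t * ((w' t)^2 * t ^ (?n - 1))) <= indicator {0..1} t * (real ?n * t ^ (?n - 1) * (w' t)^2)" for t
   using s by (auto simp: indicator_def mult_ac)
 qed
 also have "... = (\<integral>r. (w' r)^2 \<partial>rmeas ?n)" by (subst rmeas_integral) (simp_all add: mult.assoc)
 finally have e2: "real ?n * (LBINT t. indicator {s..1} t * ((w' t)^2 * t ^ (?n - 1))) <= (\<integral>r. (w' r)^2 \<partial>rmeas ?n)" .
 define T where "T = (LBINT t. indicator {s..1} t * ((w' t)^2 * t ^ (?n - 1)))"
 have n\<nu>: "real ?n * ?\<nu> > 0" using ubvol_pos[where 'a='a] by simp
 have "?\<nu> * (real ?n * T) <= Dir v v"
  using order_trans[OF mult_left_mono[OF e2] e1] ubvol_pos[where 'a='a] by (simp add: T_def)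
 then have T: "T <= Dir v v / (real ?n * ?\<nu>)" using n\<nu> by (simp add: pos_le_divide_eq mult_ac)
 have "s ^ (?n - 1) * (w s - w 1)^2 <= (1 - s) * T"
  unfolding T_def using s by (intro weighted_FTC_bound d c') auto
 also have "... <= (1 - s) * (Dir v v / (real ?n * ?\<nu>))" using s by (intro mult_left_mono T) auto
 finally show ?thesis by (simp add: ws w1 mult.commute flip: s_def)
qed

lemma square_midpoint_le: "((a + b) / 2 - c)^2 <= ((a - c)^2 + (b - c)^2) / 2" for a b c :: real
proof -
 have "((a - c)^2 + (b - c)^2) / 2 - ((a + b) / 2 - c)^2 = ((a - b) / 2)^2"
  by (simp add: field_simps power2_eq_square)
 then show ?thesis using zero_le_power2[of "(a - b) / 2"] by linarith
qed

text \<open>Even if the limit is radial, its approximants are only block-radial. Averaging an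
  approximant over all isometries gives a radial test function. The energy and the L2 distance to
  the invariant function \<open>u\<close> do not increase, since both are convex and invariant; so a
  pointwise bound for radial test functions can be passed on to \<open>u\<close>.\<close>

lemma average_radial:
 fixes u \<phi> :: "'a::euclidean_space => real"
 assumes \<phi>: "\<phi> : TF" and u[measurable]: "u : borel_measurable borel" and iu: "integrable lborel (%x. (u x)^2)"
  and inv: "!!h. orthogonal_transformation h ==> AE x in lborel. u (h x) = u x"
 obtains v where "v : TF" "!!x y. norm x = norm y ==> v x = v y" "Dir v v <= Dir \<phi> \<phi>"
  "(LBINT x. (v x - u x)^2) <= (LBINT x. (\<phi> x - u x)^2)" "integrable lborel (%x. (v x - u x)^2)"
proof -
 let ?O = "{h :: 'a => 'a. orthogonal_transformation h}"
 have G: "isometry_monoid ?O"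
  unfolding isometry_monoid_def
  by (auto simp: orthogonal_transformation_id[unfolded id_def] orthogonal_transformation_compose[unfolded o_def])
 obtain v w where v: "v : TF" "!!h x. h : ?O ==> v (h x) = v x" and w: "!!j::nat. w j : orbit_hull ?O \<phi>"
  and lim: "uniform_limit UNIV w v sequentially"
   "!!b. b : Basis ==> uniform_limit UNIV (%j. partial_deriv b (w j)) (partial_deriv b v) sequentially"
  by (rule averaging[OF G \<phi>]) (rule that; assumption)
 have TFm: "\<psi> : borel_measurable borel" if "\<psi> : TF" for \<psi> :: "'a => real"
  by (rule borel_measurable_continuous_onI[OF TF_continuous[OF that]])
 have isq: "integrable lborel (%x. (\<psi> x - u x)^2)" if "\<psi> : TF" for \<psi>
  using L2_diff_square[of \<psi> lborel u] TFm[OF that] TF_integrable_power2[OF that] iu by simp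
 have hull: "\<psi> : TF & dnorm \<psi> <= dnorm \<phi> & (LBINT x. (\<psi> x - u x)^2) <= (LBINT x. (\<phi> x - u x)^2)" if "\<psi> : orbit_hull ?O \<phi>" for \<psi>
  using that
 proof (induction rule: orbit_hull.induct)
  case (orbit h)
  then have o: "orthogonal_transformation h" by simp
  have [measurable]: "h : borel_measurable borel" "\<phi> : borel_measurable borel" by (rule orthogonal_transformation_measurable[OF o]) (rule TFm[OF \<phi>])
  have T: "(%x. \<phi> (h x)) : TF" by (rule TF_orthogonal[OF o \<phi>])
  have "(LBINT x. (\<phi> (h x) - u x)^2) = (LBINT x. (\<phi> (h x) - u (h x))^2)"
   using inv[OF o] by (intro integral_cong_AE) auto
  also have "... = (LBINT x. (\<phi> x - u x)^2)" by (rule integral_orthogonal[OF o, of "%x. (\<phi> x - u x)^2"]) measurable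
  finally show ?case using T Dir_orthogonal[OF o \<phi> \<phi>] by (simp add: dnorm_def)
 next
  case (midpoint a b)
  have T: "(%x. (1/2) * (a x + b x)) : TF" using midpoint by (intro TF_cmult TF_add) auto
  have "dnorm (%x. (1/2) * (a x + b x)) = (1/2) * dnorm (%x. a x + b x)" using midpoint by (subst dnorm_cmult[OF TF_add]) auto
  also have "... <= (1/2) * (dnorm \<phi> + dnorm \<phi>)"
   using midpoint by (intro mult_left_mono order_trans[OF dnorm_triangle]) auto
  finally have d: "dnorm (%x. (1/2) * (a x + b x)) <= dnorm \<phi>" by simp
  have i: "integrable lborel (%x. (a x - u x)^2)" "integrable lborel (%x. (b x - u x)^2)" using midpoint by (auto intro: isq)
  have "(LBINT x. ((1/2) * (a x + b x) - u x)^2) <= (LBINT x. ((a x - u x)^2 + (b x - u x)^2) / 2)"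
   using i square_midpoint_le by (intro integral_mono isq[OF T] integrable_divide Bochner_Integration.integrable_add) auto
  also have "... = ((LBINT x. (a x - u x)^2) + (LBINT x. (b x - u x)^2)) / 2" using i by simp
  also have "... <= (LBINT x. (\<phi> x - u x)^2)" using midpoint by simp
  finally show ?case using T d by simp
 qed
 have wT: "w j : TF" "dnorm (w j) <= dnorm \<phi>" "(LBINT x. (w j x - u x)^2) <= (LBINT x. (\<phi> x - u x)^2)" for j
  using hull[OF w] by auto
 have pw: "(%j. w j x) ----> v x" "(%j. gradient (w j) x) ----> gradient v x" for x
  using tendsto_uniform_limitI[OF lim(1)] tendsto_uniform_limitI[OF lim(2)] unfolding gradient_def
  by (auto intro!: tendsto_sum tendsto_scaleR)
 have "Dir v v <= Dir \<phi> \<phi>"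
  unfolding Dir_def[of v v]
 proof (rule Fatou_real(2)[OF Dir_integrable[OF wT(1) wT(1)]])
  show "(LBINT x. gradient (w k) x \<bullet> gradient (w k) x) <= Dir \<phi> \<phi>" for k
   using power_mono[OF wT(2)[of k] dnorm_nonneg, of 2] unfolding dnorm_square by (simp add: Dir_def)
  show "AE x in lborel. (%k. gradient (w k) x \<bullet> gradient (w k) x) ----> gradient v x \<bullet> gradient v x"
   by (intro AE_I2 tendsto_inner pw)
  show "(%x. gradient v x \<bullet> gradient v x) : borel_measurable lborel"
   using borel_measurable_integrable[OF Dir_integrable[OF v(1) v(1)]] .
 qed auto
 moreover have "(LBINT x. (v x - u x)^2) <= (LBINT x. (\<phi> x - u x)^2)"
 proof (rule Fatou_real(2)[OF isq[OF wT(1)] _ wT(3)])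
  show "AE x in lborel. (%k. (w k x - u x)^2) ----> (v x - u x)^2"
   by (intro AE_I2 tendsto_power tendsto_diff tendsto_const pw)
  show "(%x. (v x - u x)^2) : borel_measurable lborel" by (rule borel_measurable_integrable[OF isq[OF v(1)]])
 qed auto
 moreover have "v x = v y" if "norm x = norm y" for x y
 proof -
  obtain h where "orthogonal_transformation h" "h x = y" by (rule isometry_exists[OF \<open>norm x = norm y\<close>])
  then show ?thesis using v(2)[of h x] by simp
 qed
 ultimately show thesis using v(1) isq[OF v(1)] by (intro that)
qed

context ps_limit
begin

text \<open>The profile in \<open>radial_on\<close> need not be measurable, so invariance is deduced
  from the exceptional null set and the invariance of Lebesgue measure, without treating
  \<open>u\<close> as a measurable function of |x|.\<close>

lemma radial_invariant:
 assumes "radial_on (ball 0 1) u" "orthogonal_transformation h" shows "AE x in lborel. u (h x) = u x"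
proof -
 obtain \<omega> where "AE x in lebesgue_on (ball 0 1). u x = \<omega> (norm x)" using assms(1) by (auto simp: radial_on_def)
 then have "AE x in lebesgue. x : ball 0 1 --> u x = \<omega> (norm x)" by (subst (asm) AE_restrict_space_iff) auto
 then have ae: "AE x in lborel. x : ball 0 1 --> u x = \<omega> (norm x)" by (simp only: AE_completion_iff)
 have hm: "h : measurable lborel lborel" using orthogonal_transformation_measurable[OF assms(2)] by simp
 have "AE x in distr lborel lborel h. x : ball 0 1 --> u x = \<omega> (norm x)"
 proof -
  have "distr lborel lborel h = lborel" using distr_lborel_orthogonal[OF assms(2)] by (simp cong: distr_cong)
  from this[symmetric] ae show ?thesis by (rule subst)
 qed
 then have "AE x in lborel. h x : ball 0 1 --> u (h x) = \<omega> (norm (h x))" by (rule AE_distrD[OF hm])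
 from ae this show ?thesis
 proof eventually_elim
  case (elim x)
  then show ?case using u_outside[of x] u_outside[of "h x"] orthogonal_transformation_norm[OF assms(2), of x]
   by (cases "norm x < 1") auto
 qed
qed

lemma radial_bound:
 assumes "radial_on (ball 0 1) u"
 shows "AE x in lborel. norm x < 1 --> norm x ^ (DIM('a) - 1) * (u x)^2 <= \<Theta> * (1 - norm x) / (DIM('a) * ubvol TYPE('a))"
proof -
 let ?P = "%k v. v : TF & (ALL x y. norm x = norm y --> v x = v y) & Dir v v <= Dir (U k) (U k) &
  (LBINT x. (v x - u x)^2) <= (LBINT x. (U k x - u x)^2) & integrable lborel (%x. (v x - u x)^2)"
 have "EX v. ?P k v" for k
  by (rule average_radial[OF U_TF u_borel u_square radial_invariant[OF assms], of k], assumption) (rule exI, intro conjI allI impI; (assumption | blast))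
 then have "EX v. ALL k. ?P k (v k)" by (intro choice allI)
 then obtain v where v: "ALL k. ?P k (v k)" ..
 note v1 = v[THEN spec, THEN conjunct1] and v2 = v[THEN spec, THEN conjunct2, THEN conjunct1] and v3 = v[THEN spec, THEN conjunct2, THEN conjunct2, THEN conjunct1]
  and v4 = v[THEN spec, THEN conjunct2, THEN conjunct2, THEN conjunct2, THEN conjunct1] and v5 = v[THEN spec, THEN conjunct2, THEN conjunct2, THEN conjunct2, THEN conjunct2]
 have "(%k. \<integral>x. norm ((v k x - u x)^2) \<partial>lborel) ----> 0"
 proof (rule tendsto_sandwich[OF _ _ tendsto_const U_L2])
  show "\<forall>\<^sub>F k in sequentially. (LBINT x. norm ((v k x - u x)^2)) <= (LBINT x. (U k x - u x)^2)"
   using v4 by (intro always_eventually allI) simp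
  show "\<forall>\<^sub>F k in sequentially. 0 <= (LBINT x. norm ((v k x - u x)^2))" by (intro always_eventually allI integral_nonneg_AE) auto
 qed
 from tendsto_L1_AE_subseq[OF v5 this] obtain r :: "nat => nat"
  where r: "strict_mono r" "AE x in lborel. (%k. (v (r k) x - u x)^2) ----> 0" by (elim exE conjE)
 show ?thesis
  using r(2)
 proof eventually_elim
  case (elim x)
  show ?case
  proof
   assume x: "norm x < 1"
   have "(%k. sqrt ((v (r k) x - u x)^2)) ----> sqrt 0" by (rule tendsto_real_sqrt[OF elim])
   then have "(%k. v (r k) x - u x) ----> 0" by (simp add: tendsto_rabs_zero_iff)
   then have vu: "(%k. v (r k) x) ----> u x" by (simp only: LIM_zero_iff)
   have b0: "0 <= (1 - norm x) / (DIM('a) * ubvol TYPE('a))" using x ubvol_pos[where 'a='a] by simp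
   show "norm x ^ (DIM('a) - 1) * (u x)^2 <= \<Theta> * (1 - norm x) / (DIM('a) * ubvol TYPE('a))"
   proof (rule tendsto_le[OF sequentially_bot])
    show "(%k. norm x ^ (DIM('a) - 1) * (v (r k) x)^2) ----> norm x ^ (DIM('a) - 1) * (u x)^2"
     by (intro tendsto_mult tendsto_const tendsto_power vu)
    have "(%k. Dir (U (r k)) (U (r k))) ----> \<Theta>" using LIMSEQ_subseq_LIMSEQ[OF Dir_U_U_tendsto r(1)] by (simp add: o_def)
    then show "(%k. Dir (U (r k)) (U (r k)) * ((1 - norm x) / (DIM('a) * ubvol TYPE('a)))) ----> \<Theta> * (1 - norm x) / (DIM('a) * ubvol TYPE('a))"
     unfolding times_divide_eq_right[symmetric] by (intro tendsto_mult tendsto_const)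
    show "\<forall>\<^sub>F k in sequentially. norm x ^ (DIM('a) - 1) * (v (r k) x)^2 <= Dir (U (r k)) (U (r k)) * ((1 - norm x) / (DIM('a) * ubvol TYPE('a)))"
    proof (intro always_eventually allI)
     fix k
     have "norm x ^ (DIM('a) - 1) * (v (r k) x)^2 <= Dir (v (r k)) (v (r k)) * ((1 - norm x) / (DIM('a) * ubvol TYPE('a)))"
      using radial_decay[OF v1 v2[rule_format] x, of "r k"] unfolding times_divide_eq_right[symmetric] .
     also have "... <= Dir (U (r k)) (U (r k)) * ((1 - norm x) / (DIM('a) * ubvol TYPE('a)))"
      by (rule mult_right_mono[OF v3 b0])
     finally show "norm x ^ (DIM('a) - 1) * (v (r k) x)^2 <= Dir (U (r k)) (U (r k)) * ((1 - norm x) / (DIM('a) * ubvol TYPE('a)))" .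
    qed
   qed
  qed
 qed
qed

end

text \<open>The product z^m exp(-z/2) is largest at z = 2 m. The tangent inequality for ln is used
  at that point, and the favourable factor exp(-m) is dropped.\<close>

lemma powr_le_exp:
 fixes z m :: real
 assumes "0 <= z" "0 < m" shows "z powr m <= (2 * m) powr m * exp (z / 2)"
proof (cases "z = 0")
 case False
 then have z: "z > 0" using assms by simp
 have "m * ln (z / (2 * m)) <= m * (z / (2 * m) - 1)" using z assms by (intro mult_left_mono ln_le_minus_one) auto
 also have "... <= z / 2" using assms by (simp add: right_diff_distrib)
 finally have "m * ln z <= m * ln (2 * m) + z / 2" using z assms by (simp add: ln_div right_diff_distrib)
 then have "exp (m * ln z) <= exp (m * ln (2 * m)) * exp (z / 2)" by (simp add: exp_add[symmetric])
 then show ?thesis using z assms by (simp add: powr_def)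
qed (use assms in simp)

lemma ball_powr_integral:
 assumes \<gamma>: "\<gamma> > 0"
 shows "integrable lborel (%x. indicator (ball (0::'a::euclidean_space) 1) x * norm x powr \<gamma>)"
  "(LBINT x. indicator (ball (0::'a) 1) x * norm x powr \<gamma>) <= ubvol TYPE('a) * DIM('a) / \<gamma>"
proof -
 let ?n = "DIM('a)"
 have [measurable]: "ball (0::'a) 1 : sets borel" by simp
 have b: "integrable lborel (indicator (ball (0::'a) 1) :: 'a => real)" by (rule integrable_real_indicator[OF _ emeasure_lborel_ball_finite]) simp
 show "integrable lborel (%x. indicator (ball (0::'a) 1) x * norm x powr \<gamma>)"
 proof (rule Bochner_Integration.integrable_bound[OF b])
  show "AE x in lborel. norm (indicator (ball (0::'a) 1) x * norm x powr \<gamma>) <= norm (indicator (ball (0::'a) 1) x :: real)"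
   using \<gamma> by (intro AE_I2) (auto simp: indicator_def intro!: powr_le1)
 qed measurable
 \<comment> \<open>Rounding the exponent down leaves the integral of an integer power. The loss is
   at most 1 and is made up by the dimension in n + k >= \<gamma>.\<close>
 define k where "k = nat \<lfloor>\<gamma>\<rfloor>"
 have k: "real k <= \<gamma>" "\<gamma> <= real k + 1" using \<gamma> by (auto simp: k_def)
 have "(\<integral>r. r powr \<gamma> \<partial>rmeas ?n) = (LBINT r. indicator {0..1} r * (real ?n * r ^ (?n - 1)) * r powr \<gamma>)"
  by (rule rmeas_integral) measurable
 also have "... <= (LBINT r. real ?n * (r ^ (?n - 1 + k) * indicator {0..1} r))"
 proof (rule integral_mono')
  show "integrable lborel (%r. real ?n * (r ^ (?n - 1 + k) * indicator {0..1} r))"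
   using borel_integrable_compact[of "{0..1::real}" "%r. r ^ (?n - 1 + k)"]
   by (intro integrable_mult_right) (simp add: continuous_intros mult.commute)
  fix r :: real
  have "r powr \<gamma> <= r ^ k" if r: "0 <= r" "r <= 1"
  proof (cases "r = 0")
   case False
   then have "r powr \<gamma> <= r powr real k" using r k(1) by (intro powr_mono') auto
   then show ?thesis using r False by (simp add: powr_realpow)
  qed (use \<gamma> in simp)
  then show "indicator {0..1} r * (real ?n * r ^ (?n - 1)) * r powr \<gamma> <= real ?n * (r ^ (?n - 1 + k) * indicator {0..1} r)"
   unfolding power_add by (auto simp: indicator_def mult.assoc intro!: mult_left_mono)
 qed (auto simp: indicator_def)
 also have "... = real ?n / (real ?n + real k)"
  by (simp add: integral_power of_nat_diff Suc_leI)
 also have "... <= real ?n / \<gamma>"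
 proof (rule divide_left_mono)
  have "1 <= real ?n" by (simp add: Suc_leI)
  then show "\<gamma> <= real ?n + real k" using k by linarith
  show "0 < (real ?n + real k) * \<gamma>" using \<gamma> by (intro mult_pos_pos add_pos_nonneg) auto
 qed simp
 finally have "ubvol TYPE('a) * (\<integral>r. r powr \<gamma> \<partial>rmeas ?n) <= ubvol TYPE('a) * (real ?n / \<gamma>)"
  using ubvol_pos[where 'a='a] by (intro mult_left_mono) auto
 moreover have "(LBINT x. indicator (ball (0::'a) 1) x * norm x powr \<gamma>) = ubvol TYPE('a) * (\<integral>r. r powr \<gamma> \<partial>rmeas ?n)"
  by (rule integral_radial) measurable
 ultimately show "(LBINT x. indicator (ball (0::'a) 1) x * norm x powr \<gamma>) <= ubvol TYPE('a) * ?n / \<gamma>" by simp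
qed

text \<open>The constant of \<open>radial_energy\<close>: \<mu> compares the energy with the
  integral of F, \<nu> n comes from the mass of a power of |x| in the ball, and the 4 reflects that
  the exponent left in the second term is at least \<alpha> / 4.\<close>

definition radial_const :: "real => real => real => real" where
 "radial_const n \<nu> \<mu> = \<mu> * \<nu> * n * (1 + 4 * (\<mu> / (n * \<nu>)) powr (\<mu> / 2))"

context ps_limit
begin

text \<open>Beyond \<open>A\<close>, scaling down by the ratio A / z bounds F(z) by F(A). So all
  values of F are measured at one scale.\<close>

lemma F_le_powr:
 assumes "A > 0" shows "F z <= F A * (1 + (abs z / A) powr \<mu>)"
proof (cases "z <= A")
 case True
 have "F z <= F A" by (rule F_mono[OF True])
 then show ?thesis using F_nonneg[of A] by (simp add: distrib_left add_increasing2)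
next
 case False
 then have z: "z > A" "z > 0" using assms by auto
 have "(A / z) powr \<mu> * F z <= F (A / z * z)" using z assms by (intro F_scale_down) auto
 then have h: "(A / z) powr \<mu> * F z <= F A" using z by simp
 have "F z = (z / A) powr \<mu> * ((A / z) powr \<mu> * F z)" using z assms by (simp add: powr_divide)
 also have "... <= (z / A) powr \<mu> * F A" by (rule mult_left_mono[OF h]) simp
 finally show ?thesis using z F_nonneg[of A] by (simp add: distrib_left mult.commute add_increasing)
qed

text \<open>In the variable z = \<alpha> (1 - |x|) the radial decay bounds (|u| / A)^2 by a multiple
  of z |x|^(1-n), with A^2 = \<Theta> / \<alpha>. Half of the weight absorbs the power of z, since
  |x|^(\<alpha>/2) <= exp(-z/2). What remains has mass of order 1 / \<alpha>, so the integral of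
  F(u) is at most of order F(A) / \<alpha>.\<close>

lemma radial_energy:
 assumes rad: "radial_on (ball 0 1) u" and \<Theta>: "\<Theta> > 0" and large: "2 * (real DIM('a) - 1) * \<mu> <= \<alpha>"
 shows "\<alpha> * \<Theta> <= radial_const (real DIM('a)) (ubvol TYPE('a)) \<mu> * F (sqrt (\<Theta> / \<alpha>))"
proof -
 let ?n = "DIM('a)" and ?\<nu> = "ubvol TYPE('a)" and ?i = "indicator (ball (0::'a) 1) :: 'a => real"
 define m where "m = \<mu> / 2"
 have m: "m > 0" using \<mu> by (simp add: m_def)
 define A where "A = sqrt (\<Theta> / \<alpha>)"
 have A: "A > 0" "A^2 = \<Theta> / \<alpha>" using \<Theta> \<alpha>_pos by (auto simp: A_def)
 define C0 where "C0 = 1 / (real ?n * ?\<nu>)"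
 have C0: "C0 > 0" using ubvol_pos[where 'a='a] by (simp add: C0_def)
 \<comment> \<open>What is left of \<alpha> after \<alpha> / 2 has been spent on the power of z and
   (n - 1) m on the negative power of |x|; the hypothesis \<open>large\<close> keeps it at least
   \<alpha> / 4.\<close>
 define \<gamma> where "\<gamma> = \<alpha> / 2 - (real ?n - 1) * m"
 have \<gamma>: "\<alpha> / 4 <= \<gamma>" "\<gamma> > 0" using large \<alpha>_pos by (auto simp: \<gamma>_def m_def field_simps)
 define C where "C = (C0 * (2 * m)) powr m"
 have C: "C >= 0" by (simp add: C_def)
 have pt: "AE x in lborel. wt x * F (u x) <= F A * (?i x * norm x powr \<alpha> + C * (?i x * norm x powr \<gamma>))"
  using radial_bound[OF rad] AE_lborel_singleton[of "0::'a"]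
 proof eventually_elim
  case (elim x)
  show ?case
  proof (cases "norm x < 1")
   case False
   then show ?thesis using u_outside[of x] by (simp add: F_0)
  next
   case True
   define s where "s = norm x"
   have s: "0 < s" "s < 1" using True elim(2) by (auto simp: s_def)
   define z where "z = \<alpha> * (1 - s)"
   have z: "z >= 0" using s \<alpha>_pos by (simp add: z_def)
   define T where "T = C0 * z * s powr (1 - real ?n)"
   have T0: "T >= 0" using C0 z by (simp add: T_def)
   have "s ^ (?n - 1) * (u x)^2 <= \<Theta> * (1 - s) * C0" using elim(1) True by (simp add: s_def C0_def)
   moreover have sp: "s ^ (?n - 1) = s powr (real ?n - 1)" using s by (simp add: powr_realpow[symmetric] of_nat_diff Suc_leI)
   ultimately have "s powr (1 - real ?n) * (s powr (real ?n - 1) * (u x)^2) <= s powr (1 - real ?n) * (\<Theta> * (1 - s) * C0)"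
    by (intro mult_left_mono) auto
   moreover have "s powr (1 - real ?n) * s powr (real ?n - 1) = 1" using s by (simp add: powr_add[symmetric])
   ultimately have "(u x)^2 <= s powr (1 - real ?n) * (\<Theta> * (1 - s) * C0)" by (simp add: mult.assoc[symmetric])
   also have "... = A^2 * T" using \<alpha>_pos by (simp add: A(2) T_def z_def)
   finally have "(abs (u x) / A)^2 <= T" using A(1) by (simp add: power_divide divide_le_eq mult.commute)
   then have "abs (u x) / A <= T powr (1/2)" using real_le_rsqrt by (simp add: powr_half_sqrt T0)
   then have "(abs (u x) / A) powr \<mu> <= (T powr (1/2)) powr \<mu>" using A(1) \<mu> by (intro powr_mono2) auto
   also have "... = T powr m" by (simp add: powr_powr m_def)
   also have "... = C0 powr m * z powr m * s powr (- ((real ?n - 1) * m))"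
    using C0 z s by (simp add: T_def powr_mult powr_powr algebra_simps)
   also have "... <= C0 powr m * ((2 * m) powr m * s powr (- (\<alpha> / 2))) * s powr (- ((real ?n - 1) * m))"
   proof (intro mult_right_mono mult_left_mono)
    have "exp (z / 2) <= s powr (- (\<alpha> / 2))"
    proof -
     have "1 - s <= - ln s" using ln_le_minus_one[OF s(1)] by simp
     then have "\<alpha> / 2 * (1 - s) <= \<alpha> / 2 * (- ln s)" using \<alpha>_pos by (intro mult_left_mono) auto
     then show ?thesis using s by (simp add: powr_def z_def)
    qed
    then show "z powr m <= (2 * m) powr m * s powr (- (\<alpha> / 2))"
     using powr_le_exp[OF z m] by (meson mult_left_mono order_trans powr_ge_zero)
   qed auto
   also have "... = C * s powr (- (\<alpha> / 2) - (real ?n - 1) * m)"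
    using C0 m by (simp add: C_def powr_mult powr_add[symmetric] mult.assoc)
   finally have le: "(abs (u x) / A) powr \<mu> <= C * s powr (- (\<alpha> / 2) - (real ?n - 1) * m)" .
   have "wt x * F (u x) <= wt x * (F A * (1 + C * s powr (- (\<alpha> / 2) - (real ?n - 1) * m)))"
    by (intro mult_left_mono order_trans[OF F_le_powr[OF A(1)]] add_left_mono le F_nonneg) simp
   also have "... = F A * (s powr \<alpha> + C * (s powr \<alpha> * s powr (- (\<alpha> / 2) - (real ?n - 1) * m)))" by (simp add: s_def algebra_simps)
   also have "s powr \<alpha> * s powr (- (\<alpha> / 2) - (real ?n - 1) * m) = s powr \<gamma>" by (simp add: powr_add[symmetric] \<gamma>_def)
   finally show ?thesis using True by (simp add: s_def)
  qed
 qed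
 note i1 = ball_powr_integral[OF \<alpha>_pos, where 'a='a] and i2 = ball_powr_integral[OF \<gamma>(2), where 'a='a]
 have "(LBINT x. wt x * F (u x)) <= (LBINT x. F A * (?i x * norm x powr \<alpha> + C * (?i x * norm x powr \<gamma>)))"
  by (rule integral_mono_AE[OF F_limit(1) _ pt]) (intro integrable_mult_right Bochner_Integration.integrable_add i1(1) i2(1))
 also have "... = F A * ((LBINT x. ?i x * norm x powr \<alpha>) + C * (LBINT x. ?i x * norm x powr \<gamma>))"
  by (simp only: integral_mult_right_zero Bochner_Integration.integral_add[OF i1(1) integrable_mult_right[OF i2(1)]])
 also have "... <= F A * (?\<nu> * ?n / \<alpha> + C * (?\<nu> * ?n / (\<alpha> / 4)))"
 proof (intro mult_left_mono add_mono i1(2) order_trans[OF i2(2)] divide_left_mono C F_nonneg \<gamma>(1))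
  show "0 <= ?\<nu> * real ?n" using ubvol_pos[where 'a='a] by simp
  show "0 < \<gamma> * (\<alpha> / 4)" using \<gamma>(2) \<alpha>_pos by simp
 qed
 finally have "\<Theta> <= \<mu> * (F A * (?\<nu> * ?n / \<alpha> + C * (?\<nu> * ?n / (\<alpha> / 4))))"
  using \<Theta>_bounds(3) \<mu> by (meson mult_left_mono order_trans less_imp_le less_trans zero_less_numeral)
 then have "\<alpha> * \<Theta> <= \<alpha> * (\<mu> * (F A * (?\<nu> * ?n / \<alpha> + C * (?\<nu> * ?n / (\<alpha> / 4)))))" using \<alpha>_pos by (intro mult_left_mono) auto
 also have "... = radial_const (real ?n) ?\<nu> \<mu> * F A"
  using \<alpha>_pos by (simp add: radial_const_def C_def C0_def m_def field_simps)
 finally show ?thesis by (simp add: A_def)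
qed

end

subsection \<open>The mountain pass level\<close>

lemma E_ge: "1 <= t ==> exp (-1) <= E t" by (simp add: E_def)

context block_pair
begin

lemma gradient_norm_blk:
 "gradient (%x. (norm (blk B1 x))^2) x = 2 *\<^sub>R blk B1 x" "gradient (%x. (norm (blk B2 x))^2) x = 2 *\<^sub>R blk B2 x"
proof -
 have d: "((%x. (norm (blk B x))^2) has_derivative (%v. 2 * (blk B x \<bullet> blk B v))) (at x)" for B
 proof -
  have "(blk B has_derivative blk B) (at x)" using blk_linear linear_imp_has_derivative by blast
  from has_derivative_inner[OF this this] show ?thesis by (simp add: power2_norm_eq_inner inner_commute)
 qed
 have "blk B1 x \<bullet> blk B1 v = blk B1 x \<bullet> v" "blk B2 x \<bullet> blk B2 v = blk B2 x \<bullet> v" for v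
  using blk_self_adjoint[OF sub(1), of "blk B1 x" v] blk_self_adjoint[OF sub(2), of "blk B2 x" v] by (simp_all add: blk_blk)
 with d[of B1] d[of B2] show "gradient (%x. (norm (blk B1 x))^2) x = 2 *\<^sub>R blk B1 x" "gradient (%x. (norm (blk B2 x))^2) x = 2 *\<^sub>R blk B2 x"
  by (intro gradient_eqI; simp)+
qed

definition shell :: "real => real => real => 'a set" where
 "shell a a' b = {x. a <= norm (blk B1 x) & norm (blk B1 x) < a' & norm (blk B2 x) < b}"

lemma shell_borel[measurable]: "shell a a' b : sets borel" unfolding shell_def by measurable

lemma measure_shell:
 assumes "0 < a" "a <= a'" "0 < b"
 shows "emeasure lborel (shell a a' b) < \<infinity>" "measure lborel (shell a a' b) = (a' ^ k1 - a ^ k1) * b ^ k2 * \<kappa>"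
proof -
 let ?S = "%a. {x. norm (blk B1 x) < a & norm (blk B2 x) < b}"
 have S: "?S c : sets lborel" for c by measurable
 have e: "emeasure lborel (?S c) = ennreal (c ^ k1 * b ^ k2 * \<kappa>)" if "0 < c" for c by (rule emeasure_block[OF that assms(3)])
 have m: "measure lborel (?S c) = c ^ k1 * b ^ k2 * \<kappa>" if "0 < c" for c
  using e[OF that] that assms(3) \<kappa>(1) by (simp add: measure_def)
 have fin: "?S c : fmeasurable lborel" if "0 < c" for c using e[OF that] S by (intro fmeasurableI) auto
 have eq: "shell a a' b = ?S a' - ?S a" by (auto simp: shell_def)
 have a': "0 < a'" using assms by simp
 have "?S a' - ?S a : fmeasurable lborel" by (rule fmeasurable_Diff[OF fin[OF a'] S])
 then show "emeasure lborel (shell a a' b) < \<infinity>" unfolding eq by (simp add: fmeasurable_def)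
 have "measure lborel (?S a' - ?S a) = measure lborel (?S a') - measure lborel (?S a)"
  using assms by (intro measurable_measure_Diff fin[OF a'] S) auto
 then show "measure lborel (shell a a' b) = (a' ^ k1 - a ^ k1) * b ^ k2 * \<kappa>"
  unfolding eq using m[OF a'] m[OF assms(1)] by (simp add: left_diff_distrib)
qed

text \<open>The support of the bump is a tube of radius about \<open>1 / \<alpha>\<close>, at distance about \<open>1 / \<alpha>\<close> from the boundary,
 around a sphere of codimension \<open>k2 + 1\<close>; there the weight \<open>|x|\<^sup>\<alpha>\<close> is bounded below.\<close>

definition bump :: "real => 'a => real" where
 "bump \<alpha> x = exp 3 * (E (\<alpha> * (1 - (norm (blk B1 x))^2) - 1) * E (4 - \<alpha> * (1 - (norm (blk B1 x))^2)) * E (4 - \<alpha>^2 * (norm (blk B2 x))^2))"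

text \<open>Here the arguments of all three cut-offs in \<open>bump\<close> are at least 1, so each
  factor is at least exp(-1), and the prefactor exp 3 lifts the bump to at least 1.\<close>

definition plateau :: "real => 'a set" where "plateau \<alpha> = shell (sqrt (1 - 3 / \<alpha>)) (sqrt (1 - 2 / \<alpha>)) (1 / \<alpha>)"

lemma bump_XS:
 assumes \<alpha>: "8 <= \<alpha>" shows "bump \<alpha> : XS"
proof (rule XS_I)
 note s = smooth_norm_blk[OF sub(1)] smooth_norm_blk[OF sub(2)]
 have sm: "smooth (bump \<alpha>)"
  unfolding bump_def[abs_def] by (intro smooth_cmult smooth_mult smooth_E smooth_diff smooth_const s)
 \<comment> \<open>Where the bump is nonzero, the squared block norms are at most 1 - 1/\<alpha> and
   4/\<alpha>^2. For \<alpha> >= 8 the latter is at most 1/(2 \<alpha>), which leaves a gap to the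
   boundary.\<close>
 have "bump \<alpha> x = 0" if x: "sqrt (1 - 1 / (2 * \<alpha>)) < norm x" for x
 proof (rule ccontr)
  assume "bump \<alpha> x ~= 0"
  then have "E (\<alpha> * (1 - (norm (blk B1 x))^2) - 1) ~= 0" "E (4 - \<alpha>^2 * (norm (blk B2 x))^2) ~= 0" by (auto simp: bump_def)
  then have 1: "1 < \<alpha> * (1 - (norm (blk B1 x))^2)" "\<alpha>^2 * (norm (blk B2 x))^2 < 4" by (auto simp: E_def split: if_splits)
  have "(norm (blk B1 x))^2 <= 1 - 1 / \<alpha>" "(norm (blk B2 x))^2 <= 4 / \<alpha>^2" using 1 \<alpha> by (auto simp: field_simps)
  moreover have "4 / \<alpha>^2 <= 1 / (2 * \<alpha>)" using \<alpha> by (simp add: field_simps power2_eq_square)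
  moreover have "1 / \<alpha> = 1 / (2 * \<alpha>) + 1 / (2 * \<alpha>)" by simp
  ultimately have "(norm x)^2 <= 1 - 1 / (2 * \<alpha>)" unfolding norm_blk[of x] by linarith
  then have "norm x <= sqrt (1 - 1 / (2 * \<alpha>))" by (rule real_le_rsqrt)
  then show False using x by simp
 qed
 moreover have "sqrt (1 - 1 / (2 * \<alpha>)) < 1" using \<alpha> by simp
 ultimately show "bump \<alpha> : TF" unfolding TF_iff using sm by blast
 show "bump \<alpha> (g x) = bump \<alpha> x" if "g : G" for g x using that by (simp add: G_def same_def bump_def)
qed

text \<open>The gradient is of order \<alpha> on a shell of volume of order \<alpha>^(-k2-1):
  thickness 1/\<alpha> in the first block and radius 1/\<alpha> in the k2 variables of the
  second.\<close>

lemma Dir_bump: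
 assumes \<alpha>: "8 <= \<alpha>"
 shows "Dir (bump \<alpha>) (bump \<alpha>) <= ((8 * exp 3)^2 * (4 * real k1) * 2 ^ k2 * \<kappa>) * \<alpha>^2 / \<alpha> ^ (k2 + 1)"
proof -
 \<comment> \<open>On the support the squared first norm exceeds 1 - 4/\<alpha>; since the norm is
   below 1 it is at least its square, so the same lower bound serves without a root.\<close>
 define S where "S = shell (1 - 4 / \<alpha>) 1 (2 / \<alpha>)"
 have [measurable]: "S : sets borel" by (simp add: S_def)
 define h1 where "h1 x = \<alpha> * (1 - (norm (blk B1 x))^2) - 1" for x
 define h2 where "h2 x = 4 - \<alpha> * (1 - (norm (blk B1 x))^2)" for x
 define h3 where "h3 x = 4 - \<alpha>^2 * (norm (blk B2 x))^2" for x
 note s = smooth_norm_blk[OF sub(1)] smooth_norm_blk[OF sub(2)]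
 have sm: "smooth h1" "smooth h2" "smooth h3" unfolding h1_def[abs_def] h2_def[abs_def] h3_def[abs_def]
  by (intro smooth_cmult smooth_diff smooth_const s)+
 have g: "gradient h1 x = (-2 * \<alpha>) *\<^sub>R blk B1 x" "gradient h2 x = (2 * \<alpha>) *\<^sub>R blk B1 x" "gradient h3 x = (-2 * \<alpha>^2) *\<^sub>R blk B2 x" for x
  unfolding h1_def[abs_def] h2_def[abs_def] h3_def[abs_def]
  by (simp_all add: gradient_diff smooth_diff smooth_cmult smooth_const s gradient_cmult gradient_const gradient_norm_blk)
 have b: "bump \<alpha> = (%x. exp 3 * ((E (h1 x) * E (h2 x)) * E (h3 x)))" by (simp add: bump_def[abs_def] h1_def h2_def h3_def)
 have gb: "gradient (bump \<alpha>) x = exp 3 *\<^sub>R ((E (h1 x) * E (h2 x)) *\<^sub>R gradient (%x. E (h3 x)) x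
   + E (h3 x) *\<^sub>R (E (h1 x) *\<^sub>R gradient (%x. E (h2 x)) x + E (h2 x) *\<^sub>R gradient (%x. E (h1 x)) x))" for x
  unfolding b by (simp add: gradient_cmult gradient_mult smooth_mult smooth_E sm)
 have E1: "abs (E t) <= 1" for t using E_bounds[of t] by simp
 have le: "gradient (bump \<alpha>) x \<bullet> gradient (bump \<alpha>) x <= indicator S x * (8 * exp 3 * \<alpha>)^2" for x
 proof (cases "h1 x > 0 & h2 x > 0 & h3 x > 0")
  case False
  then have "gradient (bump \<alpha>) x = 0"
   unfolding gb using gradient_E(2)[OF sm(1), of x] gradient_E(2)[OF sm(2), of x] gradient_E(2)[OF sm(3), of x]
   by (auto simp: E_def not_less)
  then show ?thesis by simp
 next
  case True
  have n2: "norm (blk B2 x) < 2 / \<alpha>"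
  proof -
   have "(\<alpha> * norm (blk B2 x))^2 < 2^2" using True by (simp add: h3_def power_mult_distrib)
   then have "\<alpha> * norm (blk B2 x) < 2" by (rule power2_less_imp_less) simp
   then show ?thesis using \<alpha> by (simp add: field_simps)
  qed
  have a: "1 - 4 / \<alpha> < (norm (blk B1 x))^2" "(norm (blk B1 x))^2 < 1" using True \<alpha>
   by (auto simp: h1_def h2_def field_simps) (smt (verit) mult_le_cancel_left1 mult_nonneg_nonneg)
  have n1: "norm (blk B1 x) < 1" using a(2) by (simp add: power_less_one_iff abs_square_less_1)
  have "(norm (blk B1 x))^2 <= norm (blk B1 x)" using n1 by (simp add: power2_eq_square mult_left_le_one_le)
  then have S: "x : S" using a n1 n2 by (simp add: S_def shell_def)
  have sc: "norm (c *\<^sub>R v) <= d" if "abs c <= 1" "norm v <= d" for c d and v :: 'a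
   using mult_left_le_one_le[OF norm_ge_zero abs_ge_zero that(1), of v] that(2) by simp
  have "norm ((E (h1 x) * E (h2 x)) *\<^sub>R gradient (%x. E (h3 x)) x) <= norm (gradient h3 x)"
   by (rule sc[OF _ gradient_E(1)[OF sm(3)]]) (simp add: abs_mult mult_le_one E1)
  moreover have "norm (E (h3 x) *\<^sub>R (E (h1 x) *\<^sub>R gradient (%x. E (h2 x)) x + E (h2 x) *\<^sub>R gradient (%x. E (h1 x)) x))
   <= norm (gradient h2 x) + norm (gradient h1 x)"
   by (rule sc[OF E1 norm_triangle_mono[OF sc[OF E1 gradient_E(1)[OF sm(2)]] sc[OF E1 gradient_E(1)[OF sm(1)]]]])
  ultimately have "norm (gradient (bump \<alpha>) x) <= exp 3 * (norm (gradient h3 x) + (norm (gradient h2 x) + norm (gradient h1 x)))"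
   unfolding gb norm_scaleR by (intro mult_mono norm_triangle_mono) auto
  moreover have "norm (gradient h3 x) <= 4 * \<alpha>"
  proof -
   have "norm (gradient h3 x) = 2 * \<alpha>^2 * norm (blk B2 x)" by (simp add: g)
   also have "... <= 2 * \<alpha>^2 * (2 / \<alpha>)" using n2 by (intro mult_left_mono) auto
   finally show ?thesis using \<alpha> by (simp add: power2_eq_square)
  qed
  moreover have "norm (gradient h2 x) <= 2 * \<alpha>" "norm (gradient h1 x) <= 2 * \<alpha>" using n1 \<alpha> by (simp_all add: g)
  ultimately have "norm (gradient (bump \<alpha>) x) <= exp 3 * (4 * \<alpha> + (2 * \<alpha> + 2 * \<alpha>))"
   by (elim order_trans) (intro mult_left_mono add_mono, auto)
  then have "norm (gradient (bump \<alpha>) x) <= 8 * exp 3 * \<alpha>" by simp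
  then have "(norm (gradient (bump \<alpha>) x))^2 <= (8 * exp 3 * \<alpha>)^2" by (intro power_mono) auto
  then show ?thesis using S by (simp add: power2_norm_eq_inner)
 qed
 have pos: "0 < 1 - 4 / \<alpha>" "1 - 4 / \<alpha> <= 1" "0 < 2 / \<alpha>" using \<alpha> by (auto simp: field_simps)
 note ms = measure_shell[OF pos, folded S_def]
 have "Dir (bump \<alpha>) (bump \<alpha>) <= (LBINT x. indicator S x * (8 * exp 3 * \<alpha>)^2)"
  unfolding Dir_def
  by (rule integral_mono[OF Dir_integrable[OF XS_TF[OF bump_XS[OF \<alpha>]] XS_TF[OF bump_XS[OF \<alpha>]]] _ le]) (use ms(1) in simp)
 also have "... = (8 * exp 3 * \<alpha>)^2 * ((1 - (1 - 4 / \<alpha>) ^ k1) * (2 / \<alpha>) ^ k2 * \<kappa>)" using ms(2) by simp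
 also have "... <= (8 * exp 3 * \<alpha>)^2 * ((4 * real k1 / \<alpha>) * (2 / \<alpha>) ^ k2 * \<kappa>)"
 proof (intro mult_left_mono mult_right_mono)
  have "1 + real k1 * (- (4 / \<alpha>)) <= (1 + - (4 / \<alpha>)) ^ k1" using \<alpha> by (intro Bernoulli_inequality) (simp add: field_simps)
  then show "1 - (1 - 4 / \<alpha>) ^ k1 <= 4 * real k1 / \<alpha>" by (simp add: mult.commute)
 qed (use \<alpha> \<kappa>(1) in auto)
 also have "... = ((8 * exp 3)^2 * (4 * real k1) * 2 ^ k2 * \<kappa>) * \<alpha>^2 / \<alpha> ^ (k2 + 1)"
  using \<alpha> by (simp add: power_mult_distrib power_divide)
 finally show ?thesis .
qed

lemma plateau_borel[measurable]: "plateau \<alpha> : sets borel" by (simp add: plateau_def)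

lemma plateau:
 assumes \<alpha>: "8 <= \<alpha>"
 shows "emeasure lborel (plateau \<alpha>) < \<infinity>" "(1 / 2) ^ k1 * \<kappa> / \<alpha> ^ (k2 + 1) <= measure lborel (plateau \<alpha>)"
  "!!x. x : plateau \<alpha> ==> 1 <= bump \<alpha> x" "!!x. x : plateau \<alpha> ==> exp (- 3) <= norm x powr \<alpha>"
proof -
 define r0 where "r0 = sqrt (1 - 3 / \<alpha>)"
 define r1 where "r1 = sqrt (1 - 2 / \<alpha>)"
 have q: "0 < 1 - 3 / \<alpha>" "1 / 4 <= 1 - 2 / \<alpha>" using \<alpha> by (auto simp: field_simps)
 have r: "0 < r0" "r0 <= r1" "r1 <= 1" "r0^2 = 1 - 3 / \<alpha>" "r1^2 = 1 - 2 / \<alpha>"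
  using q \<alpha> by (auto simp: r0_def r1_def field_simps)
 have r1: "1 / 2 <= r1" unfolding r1_def by (rule real_le_rsqrt) (use q in \<open>simp add: power2_eq_square\<close>)
 have p: "0 < 1 / \<alpha>" using \<alpha> by simp
 note ms = measure_shell[OF r(1,2) p]
 show "emeasure lborel (plateau \<alpha>) < \<infinity>" using ms(1) by (simp add: plateau_def r0_def r1_def)
 obtain m where m: "k1 = Suc m" using c1 c2 by (cases k1) auto
 have "1 / \<alpha> = (r1 - r0) * (r1 + r0)" using r(4,5) by (simp add: field_simps power2_eq_square)
 also have "... <= (r1 - r0) * 2" using r by (intro mult_left_mono) auto
 finally have d: "1 / (2 * \<alpha>) <= r1 - r0" by simp
 have "(1 / 2) ^ k1 * (1 / \<alpha>) = (1 / 2) ^ m * (1 / (2 * \<alpha>))" by (simp add: m)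
 also have "... <= r1 ^ m * (r1 - r0)" using r r1 d \<alpha> by (intro mult_mono power_mono) auto
 also have "... <= r1 ^ k1 - r0 ^ k1"
 proof -
  have "r0 ^ m * r0 <= r1 ^ m * r0" using r by (intro mult_right_mono power_mono) auto
  then show ?thesis by (simp add: m algebra_simps)
 qed
 finally have "(1 / 2) ^ k1 * (1 / \<alpha>) * ((1 / \<alpha>) ^ k2 * \<kappa>) <= (r1 ^ k1 - r0 ^ k1) * ((1 / \<alpha>) ^ k2 * \<kappa>)"
  using \<alpha> \<kappa>(1) by (intro mult_right_mono) auto
 then show "(1 / 2) ^ k1 * \<kappa> / \<alpha> ^ (k2 + 1) <= measure lborel (plateau \<alpha>)"
  using ms(2) by (simp add: plateau_def r0_def r1_def power_divide mult_ac)
 fix x assume "x : plateau \<alpha>"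
 then have x: "r0 <= norm (blk B1 x)" "norm (blk B1 x) < r1" "norm (blk B2 x) < 1 / \<alpha>" by (auto simp: plateau_def shell_def r0_def r1_def)
 have "r0^2 <= (norm (blk B1 x))^2" "(norm (blk B1 x))^2 <= r1^2" "(norm (blk B2 x))^2 <= (1 / \<alpha>)^2"
  by (rule power_mono; use x r(1) in simp)+
 then have "2 <= \<alpha> * (1 - (norm (blk B1 x))^2)" "\<alpha> * (1 - (norm (blk B1 x))^2) <= 3" "\<alpha>^2 * (norm (blk B2 x))^2 <= 1"
  using \<alpha> unfolding r by (auto simp: field_simps)
 then have "exp (-1) * exp (-1) * exp (-1) <= E (\<alpha> * (1 - (norm (blk B1 x))^2) - 1) * E (4 - \<alpha> * (1 - (norm (blk B1 x))^2)) * E (4 - \<alpha>^2 * (norm (blk B2 x))^2)"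
  by (intro mult_mono E_ge mult_nonneg_nonneg E_bounds(1)) auto
 then have "exp 3 * (exp (-1) * exp (-1) * exp (-1)) <= bump \<alpha> x" unfolding bump_def by (intro mult_left_mono) auto
 then show "1 <= bump \<alpha> x" by (simp add: exp_add[symmetric])
 \<comment> \<open>The bound ln(1 - y) >= -2 y for y <= 1/2 gives (1 - 3/\<alpha>)^(\<alpha>/2) >=
   exp(-3), uniformly in \<alpha>.\<close>
 define y where "y = 3 / \<alpha>"
 have y: "0 <= y" "y <= 1 / 2" "\<alpha> * y = 3" using \<alpha> by (auto simp: y_def field_simps)
 have "2 * y^2 <= y" using y mult_left_mono[OF y(2,1)] by (simp add: power2_eq_square)
 then have "- (2 * y) <= ln (1 - y)" using ln_one_minus_pos_lower_bound[OF y(1,2)] by linarith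
 then have "\<alpha> / 2 * (- (2 * y)) <= \<alpha> / 2 * ln (1 - y)" using \<alpha> by (intro mult_left_mono) auto
 then have "exp (- 3) <= exp (\<alpha> / 2 * ln (1 - y))" using y(3) by simp
 also have "... = (1 - y) powr (\<alpha> / 2)" using y by (simp add: powr_def)
 also have "... = (r0^2) powr (\<alpha> / 2)" by (simp add: r(4) y_def)
 also have "... = r0 powr \<alpha>" using r(1) by (simp add: powr_powr flip: powr_numeral)
 also have "... <= norm x powr \<alpha>" using r(1) x(1) norm_blk_le(1)[of x] \<alpha> by (intro powr_mono2) auto
 finally show "exp (- 3) <= norm x powr \<alpha>" .
qed

end

text \<open>Not the exact maximum, but with the right dependence on a / b: either t^(q-2) is at most
  a / b, which bounds the quadratic term, or the higher power wins and the difference is at most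
  0.\<close>

lemma quadratic_minus_powr_le:
 fixes a b q t :: real
 assumes a: "0 < a" and b: "0 < b" and q: "2 < q" and t: "0 <= t"
 shows "a * t^2 - b * t powr q <= a * (a / b) powr (2 / (q - 2))"
proof (cases "t powr (q - 2) <= a / b")
 case True
 have "(q - 2) * (2 / (q - 2)) = 2" using q by (simp add: divide_eq_eq)
 then have "t^2 = (t powr (q - 2)) powr (2 / (q - 2))" using t by (cases "t = 0") (simp_all only: powr_powr, simp_all)
 also have "... <= (a / b) powr (2 / (q - 2))" using True q by (intro powr_mono2) auto
 finally have "a * t^2 <= a * (a / b) powr (2 / (q - 2))" using a by (intro mult_left_mono) auto
 then show ?thesis using b by (simp add: add_increasing2 diff_le_eq)
next
 case False
 then have "a * t^2 <= b * t powr (q - 2) * t^2" using b by (intro mult_right_mono) (auto simp: field_simps)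
 also have "t powr (q - 2) * t^2 = t powr q" if "t > 0" using powr_add[of t "q - 2" 2] that by simp
 then have "b * t powr (q - 2) * t^2 = b * t powr q" using t by (cases "t = 0") (simp_all add: mult.assoc)
 finally have "a * t^2 - b * t powr q <= 0" by simp
 also have "0 <= a * (a / b) powr (2 / (q - 2))" using a by simp
 finally show ?thesis .
qed

context block_pair
begin

definition Dir_const :: real where "Dir_const = (8 * exp 3)^2 * (4 * real k1) * 2 ^ k2 * \<kappa> / 2"
definition mass_const :: real where "mass_const = exp (- 3) * (1 / 2) ^ k1 * \<kappa>"

lemma const_pos: "0 < Dir_const" "0 < mass_const"
 using \<kappa>(1) c1 c2 by (auto simp: Dir_const_def mass_const_def)

text \<open>The summand 1 covers parameters up to the scale \<open>A\<close>, where the quadratic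
  term alone is bounded; the power bounds the difference of the quadratic and the q-th power term
  beyond \<open>A\<close>.\<close>

definition level_const :: "real => real => real" where
 "level_const q \<mu> = Dir_const * (1 + (Dir_const / (mass_const / radial_const (real DIM('a)) (ubvol TYPE('a)) \<mu>)) powr (2 / (q - 2)))"

end

context henon
begin

lemma I_bump_le:
 assumes \<alpha>8: "8 <= \<alpha>" and t: "0 <= t"
 shows "I (%x. t * bump \<alpha> x) <= (Dir_const * \<alpha>^2 * t^2 - mass_const * F t) / \<alpha> ^ (k2 + 1)"
proof -
 note T = XS_TF[OF bump_XS[OF \<alpha>8]]
 have "Dir (%x. t * bump \<alpha> x) (%x. t * bump \<alpha> x) = t^2 * Dir (bump \<alpha>) (bump \<alpha>)"
  using Dir_cmult[OF T, of "%x. t * bump \<alpha> x" t] Dir_cmult[OF T, of "bump \<alpha>" t] Dir_sym[of "%x. t * bump \<alpha> x" "bump \<alpha>"]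
  by (simp add: power2_eq_square)
 also have "... <= t^2 * (2 * Dir_const * \<alpha>^2 / \<alpha> ^ (k2 + 1))"
  using Dir_bump[OF \<alpha>8] by (intro mult_left_mono) (simp_all add: Dir_const_def mult_ac)
 finally have D: "Dir (%x. t * bump \<alpha> x) (%x. t * bump \<alpha> x) / 2 <= Dir_const * \<alpha>^2 * t^2 / \<alpha> ^ (k2 + 1)" by (simp add: mult_ac)
 have "mass_const * F t / \<alpha> ^ (k2 + 1) = exp (- 3) * F t * ((1 / 2) ^ k1 * \<kappa> / \<alpha> ^ (k2 + 1))" by (simp add: mass_const_def mult_ac)
 also have "... <= exp (- 3) * F t * measure lborel (plateau \<alpha>)"
  by (intro mult_left_mono plateau(2)[OF \<alpha>8] mult_nonneg_nonneg F_nonneg) simp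
 also have "... = (LBINT x. indicator (plateau \<alpha>) x * (exp (- 3) * F t))" by simp
 also have "... <= (LBINT x. wt x * F (t * bump \<alpha> x))"
 proof (rule integral_mono'[OF wtF_integrable[OF TF_cmult[OF T]]])
  fix x
  show "0 <= wt x * F (t * bump \<alpha> x)" by (simp add: F_nonneg)
  show "indicator (plateau \<alpha>) x * (exp (- 3) * F t) <= wt x * F (t * bump \<alpha> x)"
  proof (cases "x : plateau \<alpha>")
   case True
   have "t * 1 <= t * bump \<alpha> x" using t plateau(3)[OF \<alpha>8 True] by (intro mult_left_mono) auto
   then have "F t <= F (t * bump \<alpha> x)" by (intro F_mono) simp
   then have "exp (- 3) * F t <= wt x * F (t * bump \<alpha> x)"
    using plateau(4)[OF \<alpha>8 True] F_nonneg by (intro mult_mono) auto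
   then show ?thesis using True by simp
  qed (simp add: F_nonneg)
 qed
 finally show ?thesis using D unfolding I_def diff_divide_distrib by linarith
qed

text \<open>A crude bound without uniformity in \<alpha>; it only ensures that the supremum over the
  ray really bounds the functional on it.\<close>

lemma bump_level_bounded:
 assumes \<alpha>8: "8 <= \<alpha>" shows "bdd_above ((%t. I (%x. t * bump \<alpha> x)) ` {0..})"
proof -
 obtain z where z: "z > 0" "F z > 0" using F_positive by auto
 define b where "b = mass_const * F z / z powr q"
 have b: "b > 0" using z const_pos by (simp add: b_def)
 have a: "Dir_const * \<alpha>^2 > 0" using const_pos \<alpha>8 by simp
 have "I (%x. t * bump \<alpha> x) <= (Dir_const * \<alpha>^2 * ((Dir_const * \<alpha>^2) / b) powr (2 / (q - 2)) + mass_const * F z) / \<alpha> ^ (k2 + 1)" if t: "0 <= t" for t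
 proof -
  have "t powr q / z powr q * F z - F z <= F t"
  proof (cases "z <= t")
   case True
   have "(t / z) powr q * F z <= F (t / z * z)" using True z by (intro F_scale_up) auto
   then show ?thesis using z True F_nonneg[of z] by (simp add: powr_divide)
  next
   case False
   then have "t powr q <= z powr q" using t q by (intro powr_mono2) auto
   then have "t powr q / z powr q <= 1" using z by simp
   from mult_right_mono[OF this F_nonneg[of z]] show ?thesis using F_nonneg[of t] by simp
  qed
  then have "mass_const * (t powr q / z powr q * F z - F z) <= mass_const * F t" using const_pos by (intro mult_left_mono) auto
  then have "b * t powr q - mass_const * F z <= mass_const * F t" by (simp add: b_def right_diff_distrib mult_ac)
  moreover have "Dir_const * \<alpha>^2 * t^2 - b * t powr q <= Dir_const * \<alpha>^2 * ((Dir_const * \<alpha>^2) / b) powr (2 / (q - 2))"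
   by (rule quadratic_minus_powr_le[OF a b q t])
  ultimately have "Dir_const * \<alpha>^2 * t^2 - mass_const * F t <= Dir_const * \<alpha>^2 * ((Dir_const * \<alpha>^2) / b) powr (2 / (q - 2)) + mass_const * F z" by linarith
  then show ?thesis using \<alpha>8 by (intro order_trans[OF I_bump_le[OF \<alpha>8 t]] divide_right_mono) auto
 qed
 then show ?thesis by (intro bdd_aboveI2) auto
qed

lemma dnorm_bump_pos:
 assumes \<alpha>8: "8 <= \<alpha>" shows "0 < dnorm (bump \<alpha>)"
proof -
 note X = bump_XS[OF \<alpha>8]
 have "0 < (1 / 2) ^ k1 * \<kappa> / \<alpha> ^ (k2 + 1)" using \<kappa>(1) \<alpha>8 by simp
 also have "... <= measure lborel (plateau \<alpha>)" by (rule plateau(2)[OF \<alpha>8])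
 also have "... = (LBINT x. indicator (plateau \<alpha>) x)" by simp
 also have "... <= (LBINT x. (bump \<alpha> x)^2)"
 proof (rule integral_mono'[OF TF_integrable_power2[OF XS_TF[OF X]]])
  show "indicator (plateau \<alpha>) x <= (bump \<alpha> x)^2" for x
   using power_mono[OF plateau(3)[OF \<alpha>8, of x], of 2] by (auto simp: indicator_def)
 qed simp
 also have "... <= Dir (bump \<alpha>) (bump \<alpha>)" by (rule Poincare_XS[OF X])
 finally show ?thesis by (simp add: dnorm_def)
qed

end

context ps_limit
begin

text \<open>Both levels are compared at the scale \<open>A\<^sup>2 = \<Theta> / \<alpha>\<close>: a radial solution has energy at least of order \<open>\<alpha> A\<^sup>2\<close>,
 while the level of the bump is at most of order \<open>\<alpha>\<^sup>1\<^sup>-\<^sup>k\<^sup>2 A\<^sup>2\<close>.\<close>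

lemma radial_level:
 assumes rad: "radial_on (ball 0 1) u" and c: "0 < c" "c <= (SUP t\<in>{0..}. I (%x. t * bump \<alpha> x))"
  and \<alpha>8: "8 <= \<alpha>" and large: "2 * (real DIM('a) - 1) * \<mu> <= \<alpha>"
 shows "(1 / 2 - 1 / q) * \<alpha> <= level_const q \<mu>"
proof -
 define C1 where "C1 = radial_const (real DIM('a)) (ubvol TYPE('a)) \<mu>"
 have C1: "C1 > 0" using ubvol_pos[where 'a='a] \<mu> by (auto simp: C1_def radial_const_def intro!: mult_pos_pos add_pos_nonneg)
 have \<Theta>: "\<Theta> > 0" using c(1) \<Theta>_bounds(2) by simp
 define A where "A = sqrt (\<Theta> / \<alpha>)"
 have A: "A > 0" "A^2 = \<Theta> / \<alpha>" using \<Theta> \<alpha>_pos by (auto simp: A_def)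
 have FA: "\<alpha> * \<Theta> / C1 <= F A" using radial_energy[OF rad \<Theta> large] C1 by (simp add: A_def C1_def pos_divide_le_eq mult.commute)
 define b where "b = mass_const / C1"
 have b: "b > 0" using const_pos C1 by (simp add: b_def)
 define L where "L = (Dir_const / b) powr (2 / (q - 2))"
 have L: "L >= 0" by (simp add: L_def)
 have lev: "level_const q \<mu> = Dir_const * (1 + L)" by (simp add: level_const_def L_def b_def C1_def)
 have P: "0 < \<alpha> ^ (k2 + 1)" using \<alpha>_pos by simp
 have "I (%x. t * bump \<alpha> x) <= \<Theta> * \<alpha> * level_const q \<mu> / \<alpha> ^ (k2 + 1)" if t: "0 <= t" for t
 proof -
  \<comment> \<open>The parameter in units of \<open>A\<close>. For s >= 1 the function F grows at
    least like s^q from F(A), which is bounded below by the radial energy estimate; for s < 1 the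
    quadratic term is small enough by itself.\<close>
  define s where "s = t / A"
  have s: "0 <= s" "t = s * A" using t A by (auto simp: s_def)
  have t2: "\<alpha>^2 * t^2 = \<Theta> * \<alpha> * s^2" using A(2) \<alpha>_pos by (simp add: s(2) power_mult_distrib power2_eq_square)
  have "Dir_const * \<alpha>^2 * t^2 - mass_const * F t <= \<Theta> * \<alpha> * level_const q \<mu>"
  proof (cases "1 <= s")
   case True
   have "s powr q * (\<alpha> * \<Theta> / C1) <= s powr q * F A" by (rule mult_left_mono[OF FA]) simp
   also have "... <= F t" unfolding s(2) by (rule F_scale_up[OF True])
   finally have "mass_const * (s powr q * (\<alpha> * \<Theta> / C1)) <= mass_const * F t" using const_pos by (intro mult_left_mono) auto
   then have "Dir_const * \<alpha>^2 * t^2 - mass_const * F t <= \<Theta> * \<alpha> * (Dir_const * s^2 - b * s powr q)"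
    using t2 by (simp add: b_def algebra_simps)
   also have "... <= \<Theta> * \<alpha> * (Dir_const * L)"
    unfolding L_def using \<Theta> \<alpha>_pos by (intro mult_left_mono quadratic_minus_powr_le const_pos b q s) auto
   also have "... <= \<Theta> * \<alpha> * level_const q \<mu>"
    unfolding lev using \<Theta> \<alpha>_pos const_pos by (intro mult_left_mono) auto
   finally show ?thesis .
  next
   case False
   have "Dir_const * \<alpha>^2 * t^2 = \<Theta> * \<alpha> * (Dir_const * s^2)" using t2 by (simp add: mult_ac)
   also have "... <= \<Theta> * \<alpha> * (Dir_const * (1 + L))"
   proof (intro mult_left_mono)
    have "s^2 <= 1" using False s by (simp add: power_le_one)
    then show "s^2 <= 1 + L" using L by simp
   qed (use \<Theta> \<alpha>_pos const_pos in auto)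
   finally show ?thesis using F_nonneg[of t] const_pos unfolding lev by (simp add: add_increasing2 diff_le_eq)
  qed
  then have "(Dir_const * \<alpha>^2 * t^2 - mass_const * F t) / \<alpha> ^ (k2 + 1) <= \<Theta> * \<alpha> * level_const q \<mu> / \<alpha> ^ (k2 + 1)"
   using P by (intro divide_right_mono) auto
  then show ?thesis by (rule order_trans[OF I_bump_le[OF \<alpha>8 t]])
 qed
 then have "(SUP t\<in>{0..}. I (%x. t * bump \<alpha> x)) <= \<Theta> * \<alpha> * level_const q \<mu> / \<alpha> ^ (k2 + 1)"
  by (intro cSUP_least) auto
 \<comment> \<open>Both sides are proportional to \<Theta>, which therefore cancels; only a power of
   \<alpha> remains.\<close>
 then have "(1 / 2 - 1 / q) * \<Theta> <= \<Theta> * (level_const q \<mu> / \<alpha> ^ k2)" using \<Theta>_bounds(1) c(2) \<alpha>_pos by simp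
 then have "1 / 2 - 1 / q <= level_const q \<mu> / \<alpha> ^ k2" by (subst (asm) mult.commute) (rule mult_left_le_imp_le[OF _ \<Theta>])
 then have "(1 / 2 - 1 / q) * \<alpha> ^ k2 <= level_const q \<mu>" using \<alpha>_pos by (simp add: pos_le_divide_eq)
 moreover have "\<alpha> <= \<alpha> ^ k2" using \<alpha>8 c2 self_le_power[of \<alpha> k2] by simp
 then have "(1 / 2 - 1 / q) * \<alpha> <= (1 / 2 - 1 / q) * \<alpha> ^ k2" using q by (intro mult_left_mono) (auto simp: field_simps)
 ultimately show ?thesis by linarith
qed

end

section \<open>Conclusion\<close>

lemma (in block_pair) nonradial_solutions:
 assumes N: "nonlinearity f K p q \<mu>" and p1: "p < p1" "(real k1 - 1) * (p1 - 2) < 4"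
 shows "EX \<alpha>0>0. ALL \<alpha>>=\<alpha>0. EX u :: 'a => real. weak_solution (ball 0 1) \<alpha> f u & ~radial_on (ball 0 1) u & (AE x in lebesgue_on (ball 0 1). u x >= 0)"
proof -
 interpret nl: nonlinearity f K p q \<mu> by (rule N)
 \<comment> \<open>The four thresholds serve, in order, the shape of the bump, the weight in the
   Sobolev inequality, the radial energy bound, and the final contradiction.\<close>
 define \<alpha>0 where "\<alpha>0 = max 8 (max ((real k2 - 1) * (p1 - 2) / 2) (max (2 * (real DIM('a) - 1) * \<mu>) (level_const q \<mu> / (1 / 2 - 1 / q) + 1)))"
 have q2: "0 < 1 / 2 - 1 / q" using nl.q by (simp add: field_simps)
 have "EX u :: 'a => real. weak_solution (ball 0 1) \<alpha> f u & ~radial_on (ball 0 1) u & (AE x in lebesgue_on (ball 0 1). u x >= 0)"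
  if "\<alpha> >= \<alpha>0" for \<alpha>
 proof -
  have \<alpha>: "8 <= \<alpha>" "(real k2 - 1) * (p1 - 2) / 2 <= \<alpha>" "2 * (real DIM('a) - 1) * \<mu> <= \<alpha>" "level_const q \<mu> / (1 / 2 - 1 / q) < \<alpha>"
   using that by (auto simp: \<alpha>0_def)
  interpret h: henon B1 B2 f K p q \<mu> \<alpha> p1 by unfold_locales (use p1 \<alpha> in auto)
  have M: "h.I (%x. t * bump \<alpha> x) <= (SUP t\<in>{0..}. h.I (%x. t * bump \<alpha> x))" if "0 <= t" for t
   by (rule cSUP_upper[OF _ h.bump_level_bounded[OF \<alpha>(1)]]) (use that in simp)
  obtain c R where c: "0 < c" "c <= (SUP t\<in>{0..}. h.I (%x. t * bump \<alpha> x))"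
   and PS: "!!\<epsilon>. \<epsilon> > 0 ==> EX u:XS. dnorm u <= R & abs (h.I u - c) <= \<epsilon> & (ALL \<phi>:XS. dnorm \<phi> <= 1 --> abs (h.dI u \<phi>) <= \<epsilon>)"
   by (rule h.PS_sequence_exists[OF bump_XS[OF \<alpha>(1)] h.dnorm_bump_pos[OF \<alpha>(1)] M], assumption) (rule that; assumption)
  have "EX U u g. ps_limit B1 B2 f K p q \<mu> \<alpha> p1 U u g R c" by (rule h.ps_limit_exists) (rule PS)
  then obtain U u g where "ps_limit B1 B2 f K p q \<mu> \<alpha> p1 U u g R c" by (elim exE)
  then interpret l: ps_limit B1 B2 f K p q \<mu> \<alpha> p1 U u g R c .
  have "~radial_on (ball 0 1) u"
  proof
   assume "radial_on (ball 0 1) u"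
   from l.radial_level[OF this c \<alpha>(1,3)] have "\<alpha> <= level_const q \<mu> / (1 / 2 - 1 / q)"
    by (simp only: pos_le_divide_eq[OF q2] mult.commute)
   then show False using \<alpha>(4) by simp
  qed
  moreover have "AE x in lebesgue_on (ball 0 1). u x >= 0"
  proof -
   have "AE x in lebesgue. u x >= 0" using l.u_nonneg by (rule AE_completion)
   then show ?thesis by (subst AE_restrict_space_iff) (auto elim: eventually_mono)
  qed
  ultimately show ?thesis using l.u_weak_solution by blast
 qed
 moreover have "\<alpha>0 > 0" by (simp add: \<alpha>0_def)
 ultimately show ?thesis by blast
qed

lemma locally_Hoelder_isCont:
 assumes "locally_Hoelder f" shows "isCont f z"
proof -
 obtain \<delta> \<gamma> C where h: "\<delta> > 0" "0 < \<gamma>" "ALL x:ball z \<delta>. ALL y:ball z \<delta>. abs (f x - f y) <= C * abs (x - y) powr \<gamma>"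
  using assms unfolding locally_Hoelder_def by blast
 have "((%x. f x - f z) \<longlongrightarrow> 0) (at z)"
 proof (rule Lim_null_comparison)
  have "\<forall>\<^sub>F x in at z. x : ball z \<delta>" by (rule eventually_at_in_open'[OF open_ball]) (use h(1) in simp)
  then show "\<forall>\<^sub>F x in at z. norm (f x - f z) <= C * abs (x - z) powr \<gamma>"
   by eventually_elim (use h in auto)
  have "((%x. abs (x - z) powr \<gamma>) \<longlongrightarrow> abs (z - z) powr \<gamma>) (at z)"
   using h(2) by (intro tendsto_powr' tendsto_rabs tendsto_diff tendsto_const tendsto_ident_at) auto
  from tendsto_mult[OF tendsto_const[of C] this] show "((%x. C * abs (x - z) powr \<gamma>) \<longlongrightarrow> 0) (at z)" using h(2) by simp
 qed
 then show ?thesis unfolding isCont_def by (simp only: LIM_zero_iff)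
qed

text \<open>Both cases of the definition are 2 (l + 1) / (l - 1), the critical Sobolev exponent in
  dimension l + 1. This is the form in which the exponent enters the weighted Sobolev
  inequality.\<close>

lemma p_star_exponent:
 assumes "4 <= n" shows "(real (l_of n) - 1) * (p_star n - 2) = 4"
proof -
 have "(real (l_of n) - 1) * (p_star n - 2) = 4" if "even n"
 proof -
  have "real n > 2" using assms by simp
  then show ?thesis using that by (simp add: l_of_def p_star_def real_of_nat_div field_simps)
 qed
 moreover have "(real (l_of n) - 1) * (p_star n - 2) = 4" if "odd n"
 proof -
  have "real (n div 2) > 0" using assms by simp
  then show ?thesis using that by (simp add: l_of_def p_star_def field_simps)
 qed
 ultimately show ?thesis by blast
qed

theorem theorem2:
  fixes f :: "real \<Rightarrow> real"
    and \<Omega> :: "(real ^ 'n) set"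
  assumes n: "CARD('n) \<ge> 4"
    and \<Omega>: "\<Omega> = ball 0 1"
    and f1: "locally_Hoelder f"
      "\<forall>z>0. f z \<ge> 0"
      "f \<in> o[at 0](\<lambda>z. z)"
      "filterlim (\<lambda>z. f z / z) at_top at_top"
      "\<forall>z\<le>0. f z = 0"
    and f2: "\<exists>C>0. \<exists>p. 2 < p \<and> p < p_star CARD('n) \<and>
      (\<forall>z. \<bar>f z\<bar> \<le> C * (1 + \<bar>z\<bar>) powr (p - 1))"
    and f3: "\<exists>q>2. \<forall>t. q * primitive f t \<le> t * f t"
    and f4: "\<exists>\<mu>1>2. \<exists>\<mu>2>2. \<exists>g :: real \<Rightarrow> real.
      (\<forall>t\<in>{0..1}. \<forall>v\<ge>0. f (t * v) \<ge> t powr (\<mu>1 - 1) * f v) \<and>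
      (\<forall>t\<ge>1. \<forall>v\<ge>0. f (t * v) \<ge> t powr (\<mu>2 - 1) * g v) \<and>
      (\<forall>v. g v \<ge> 0) \<and> continuous_on UNIV g \<and> g 0 = 0 \<and>
      4 * ((\<mu>1 - \<mu>2) / ((\<mu>1 - 2) * (\<mu>2 - 2))) < real CARD('n) - real (l_of CARD('n))"
  shows "\<exists>\<alpha>\<^sub>0>0. \<forall>\<alpha>\<ge>\<alpha>\<^sub>0. \<exists>u :: real ^ 'n \<Rightarrow> real.
    weak_solution \<Omega> \<alpha> f u \<and> \<not> radial_on \<Omega> u \<and> (AE x in lebesgue_on \<Omega>. u x \<ge> 0)"
proof -
 obtain C p where p: "2 < p" "p < p_star CARD('n)" "!!z. abs (f z) <= C * (1 + abs z) powr (p - 1)" using f2 by auto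
 obtain q where q: "q > 2" "!!t. q * primitive f t <= t * f t" using f3 by auto
 obtain \<mu> where \<mu>: "\<mu> > 2" "ALL t:{0..1}. ALL v>=0. f (t * v) >= t powr (\<mu> - 1) * f v" using f4 by blast
 have N: "nonlinearity f C p q \<mu>"
 proof
  show "continuous_on UNIV f" by (intro continuous_at_imp_continuous_on ballI locally_Hoelder_isCont f1(1))
  show nn: "0 <= f z" for z using f1(2,5) by (cases "z > 0") auto
  show "f z = 0" if "z <= 0" for z using that f1(5) by blast
  show "EX \<eta>>0. ALL z. abs z <= \<eta> --> abs (f z) <= \<delta> * abs z" if \<delta>: "\<delta> > 0" for \<delta>
  proof -
   have "\<forall>\<^sub>F z in at 0. abs (f z) <= \<delta> * abs z" using landau_o.smallD[OF f1(3) \<delta>] by simp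
   then obtain d where d: "d > 0" "!!z. z ~= 0 ==> abs z < d ==> abs (f z) <= \<delta> * abs z" by (auto simp: eventually_at dist_real_def)
   have "abs (f z) <= \<delta> * abs z" if "abs z <= d / 2" for z using d that f1(5) by (cases "z = 0") auto
   then show ?thesis using d(1) by (intro exI[of _ "d / 2"]) auto
  qed
  have "\<forall>\<^sub>F x in at_top. f x / x > 0" using f1(4) by (simp add: filterlim_at_top_dense)
  then obtain z where z: "!!x. x >= z ==> f x / x > 0" by (auto simp: eventually_at_top_linorder)
  have "f x > 0" if "x >= max z 1" for x using z[of x] that by (simp add: zero_less_divide_iff)
  then show "EX z>0. ALL x>=z. f x > 0" by (intro exI[of _ "max z 1"]) auto
  show "2 < p" "abs (f z) <= C * (1 + abs z) powr (p - 1)" "2 < q" "q * primitive f z <= z * f z" "2 < \<mu>" for z by (rule p q \<mu>)+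
  show "t powr (\<mu> - 1) * f v <= f (t * v)" if "0 <= t" "t <= 1" "0 <= v" for t v using \<mu>(2) that by simp
 qed
 have card: "card (Basis :: (real ^ 'n) set) = CARD('n)" by (metis DIM_cart DIM_real mult.right_neutral)
 \<comment> \<open>For n >= 4 the smaller block has dimension at least 2, as Hardy's inequality on
   its radius demands.\<close>
 have l: "l_of CARD('n) <= CARD('n)" "2 <= CARD('n) - l_of CARD('n)" "CARD('n) - l_of CARD('n) <= l_of CARD('n)"
  using n unfolding l_of_def by presburger+
 obtain B1 :: "(real ^ 'n) set" where B1: "B1 \<subseteq> Basis" "card B1 = l_of CARD('n)"
  using obtain_subset_with_card_n[of "l_of CARD('n)" "Basis :: (real ^ 'n) set"] l(1) card by metis
 have B2: "card (Basis - B1) = CARD('n) - l_of CARD('n)" using B1 card finite_subset[OF B1(1)] by (simp add: card_Diff_subset)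
 interpret bp: block_pair B1 "Basis - B1" by unfold_locales (use B1 B2 l in auto)
 \<comment> \<open>The midpoint leaves room on both sides: above \<open>p\<close> for the
   compactness of the nonlinear term, below the critical exponent for the Sobolev
   inequality.\<close>
 define p1 where "p1 = (p + p_star CARD('n)) / 2"
 have p1: "p < p1" "p1 < p_star CARD('n)" using p by (auto simp: p1_def)
 have "(real (card B1) - 1) * (p1 - 2) < (real (card B1) - 1) * (p_star CARD('n) - 2)"
  using p1 l B1 by (intro mult_strict_left_mono) auto
 then have "(real (card B1) - 1) * (p1 - 2) < 4" unfolding B1(2) p_star_exponent[OF n] .
 from bp.nonradial_solutions[OF N p1(1) this] show ?thesis unfolding \<Omega> .
qed

end
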